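(* Let $F$ be a real field. Let $q$ be a form over $F$ of dimension at least two and let $\pi$ be a form over $F$ similar to a Pfister form, such that $\pi\otimes q$ is anisotropic over $F$. Let $P$ be an ordering of $F$ such that $\pi$ is definite at $P$ and $q$ is indefinite at $P$. Then $|\mathrm{sgn}_P(q)|\leq\dim q-2i_1(q)$. Moreover, if $|\mathrm{sgn}_P(q)|=\dim q-2i_1(q)$, then $i_1(\pi\otimes q)=(\dim\pi)\,i_1(q)$.
   Context: "Form" means regular (nondegenerate) quadratic form of finite dimension. Forms $p,q$ over $F$ are similar if $p\simeq aq$ for some $a\in F^\times$. An $n$-fold Pfister form is a form isometric to $\langle 1,a_1\rangle\otimes\cdots\otimes\langle 1,a_n\rangle$ with $a_i\in F^\times$ (the $0$-fold Pfister form is $\langle 1\rangle$). An ordering of $F$ is a set $P\subset F^\times$ with $P\cup -P=F^\times$ and $x+y,xy\in P$ for all $x,y\in P$; $F$ is real if it has an ordering. The signature $\mathrm{sgn}_P(q)$ is the number of coefficients in a diagonalisation of $q$ lying in $P$ minus the number not lying in $P$. A form $q$ is indefinite at $P$ if $|\mathrm{sgn}_P(q)|<\dim q$, and definite at $P$ if $|\mathrm{sgn}_P(q)|=\dim q$. The Witt index $i(q)$ is defined by $q\simeq q_{\mathrm{an}}\perp i(q)\times\langle 1,-1\rangle$ with $q_{\mathrm{an}}$ anisotropic. For an anisotropic form $q$ of dimension $n\geq 2$, $F(q)$ is the quotient field of $F[X_1,\ldots,X_n]/(q(X_1,\ldots,X_n))$, and the first Witt index is $i_1(q)=i(q_{F(q)})$,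 the Witt index of $q$ viewed over $F(q)$. *)

theory Defs
  imports
    "HOL-Algebra.QuotRing"
    "HOL-Algebra.Indexed_Polynomials"
    "Jordan_Normal_Form.Matrix"
begin

text \<open>
  Fields are fields in the sense of HOL-Algebra, because the function field of a form depends on
  the form.  The types of vectors and matrices are used only as containers with a dimension; the
  arithmetic is always that of the carrier-based ring \<open>R\<close>.

  Only fields of characteristic different from 2 matter (real fields and their extensions), so a
  quadratic form of dimension \<open>n\<close> is given by its symmetric Gram matrix \<open>A\<close> and is the map
  \<open>v \<mapsto> b\<^sub>A(v, v)\<close>.  In particular, the diagonal form with entries \<open>a\<^sub>i\<close> has the diagonal Gram matrix
  with these entries, and the Gram matrix of a tensor product is the Kronecker product.
\<close>


section \<open>Quadratic forms\<close>

definition vecs :: "('a, 'b) ring_scheme \<Rightarrow> nat \<Rightarrow> 'a vec set" where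
  "vecs R n = {v \<in> carrier_vec n. \<forall>i<n. v $ i \<in> carrier R}"

definition mats :: "('a, 'b) ring_scheme \<Rightarrow> nat \<Rightarrow> nat \<Rightarrow> 'a mat set" where
  "mats R m n = {A \<in> carrier_mat m n. \<forall>i<m. \<forall>j<n. A $$ (i, j) \<in> carrier R}"

definition zvec :: "('a, 'b) ring_scheme \<Rightarrow> nat \<Rightarrow> 'a vec" where
  "zvec R n = vec n (\<lambda>_. \<zero>\<^bsub>R\<^esub>)"

definition apply_mat :: "('a, 'b) ring_scheme \<Rightarrow> 'a mat \<Rightarrow> 'a vec \<Rightarrow> 'a vec" where
  "apply_mat R T v =
     vec (dim_row T) (\<lambda>i. \<Oplus>\<^bsub>R\<^esub>j\<in>{..<dim_col T}. T $$ (i, j) \<otimes>\<^bsub>R\<^esub> v $ j)"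

abbreviation qdim :: "'a mat \<Rightarrow> nat" where
  "qdim A \<equiv> dim_row A"

definition bform :: "('a, 'b) ring_scheme \<Rightarrow> 'a mat \<Rightarrow> 'a vec \<Rightarrow> 'a vec \<Rightarrow> 'a" where
  "bform R A v w =
     (\<Oplus>\<^bsub>R\<^esub>i\<in>{..<qdim A}. \<Oplus>\<^bsub>R\<^esub>j\<in>{..<qdim A}. A $$ (i, j) \<otimes>\<^bsub>R\<^esub> v $ i \<otimes>\<^bsub>R\<^esub> w $ j)"

definition qeval :: "('a, 'b) ring_scheme \<Rightarrow> 'a mat \<Rightarrow> 'a vec \<Rightarrow> 'a" where
  "qeval R A v = bform R A v v"

definition quad_form :: "('a, 'b) ring_scheme \<Rightarrow> 'a mat \<Rightarrow> bool" where
  "quad_form R A \<longleftrightarrow>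
     A \<in> mats R (qdim A) (qdim A) \<and>
     (\<forall>i<qdim A. \<forall>j<qdim A. A $$ (i, j) = A $$ (j, i)) \<and>
     (\<forall>v\<in>vecs R (qdim A). (\<forall>w\<in>vecs R (qdim A). bform R A v w = \<zero>\<^bsub>R\<^esub>) \<longrightarrow> v = zvec R (qdim A))"

definition isometric :: "('a, 'b) ring_scheme \<Rightarrow> 'a mat \<Rightarrow> 'a mat \<Rightarrow> bool" where
  "isometric R A B \<longleftrightarrow>
     qdim A = qdim B \<and>
     (\<exists>T\<in>mats R (qdim A) (qdim A).
        bij_betw (apply_mat R T) (vecs R (qdim A)) (vecs R (qdim A)) \<and>
        (\<forall>v\<in>vecs R (qdim A). qeval R B (apply_mat R T v) = qeval R A v))"

definition anisotropic :: "('a, 'b) ring_scheme \<Rightarrow> 'a mat \<Rightarrow> bool" where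
  "anisotropic R A \<longleftrightarrow>
     (\<forall>v\<in>vecs R (qdim A). qeval R A v = \<zero>\<^bsub>R\<^esub> \<longrightarrow> v = zvec R (qdim A))"

definition diag_form :: "('a, 'b) ring_scheme \<Rightarrow> 'a list \<Rightarrow> 'a mat" where
  "diag_form R as =
     mat (length as) (length as) (\<lambda>(i, j). if i = j then as ! i else \<zero>\<^bsub>R\<^esub>)"

definition scale_form :: "('a, 'b) ring_scheme \<Rightarrow> 'a \<Rightarrow> 'a mat \<Rightarrow> 'a mat" where
  "scale_form R a A = map_mat (\<lambda>x. a \<otimes>\<^bsub>R\<^esub> x) A"

definition orth_sum :: "('a, 'b) ring_scheme \<Rightarrow> 'a mat \<Rightarrow> 'a mat \<Rightarrow> 'a mat" where
  "orth_sum R A B =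
     mat (qdim A + qdim B) (qdim A + qdim B)
       (\<lambda>(i, j).
          if i < qdim A \<and> j < qdim A then A $$ (i, j)
          else if qdim A \<le> i \<and> qdim A \<le> j then B $$ (i - qdim A, j - qdim A)
          else \<zero>\<^bsub>R\<^esub>)"

definition tensor_form :: "('a, 'b) ring_scheme \<Rightarrow> 'a mat \<Rightarrow> 'a mat \<Rightarrow> 'a mat" where
  "tensor_form R A B =
     mat (qdim A * qdim B) (qdim A * qdim B)
       (\<lambda>(i, j). A $$ (i div qdim B, j div qdim B) \<otimes>\<^bsub>R\<^esub> B $$ (i mod qdim B, j mod qdim B))"

definition similar_form :: "('a, 'b) ring_scheme \<Rightarrow> 'a mat \<Rightarrow> 'a mat \<Rightarrow> bool" where
  "similar_form R A B \<longleftrightarrow>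
     (\<exists>a\<in>carrier R - {\<zero>\<^bsub>R\<^esub>}. isometric R A (scale_form R a B))"

definition pfister_form :: "('a, 'b) ring_scheme \<Rightarrow> nat \<Rightarrow> 'a mat \<Rightarrow> bool" where
  "pfister_form R n A \<longleftrightarrow>
     quad_form R A \<and>
     (\<exists>as. length as = n \<and> set as \<subseteq> carrier R - {\<zero>\<^bsub>R\<^esub>} \<and>
        isometric R A
          (foldr (\<lambda>a B. tensor_form R (diag_form R [\<one>\<^bsub>R\<^esub>, a]) B) as (diag_form R [\<one>\<^bsub>R\<^esub>])))"

definition hyperbolic_form :: "('a, 'b) ring_scheme \<Rightarrow> nat \<Rightarrow> 'a mat" where
  "hyperbolic_form R m = (orth_sum R (diag_form R [\<one>\<^bsub>R\<^esub>, \<ominus>\<^bsub>R\<^esub> \<one>\<^bsub>R\<^esub>]) ^^ m) (diag_form R [])"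

definition witt_index :: "('a, 'b) ring_scheme \<Rightarrow> 'a mat \<Rightarrow> nat" where
  "witt_index R A =
     (THE m. \<exists>B. quad_form R B \<and> anisotropic R B \<and>
        isometric R A (orth_sum R B (hyperbolic_form R m)))"


section \<open>Orderings and signatures\<close>

definition field_ordering :: "('a, 'b) ring_scheme \<Rightarrow> 'a set \<Rightarrow> bool" where
  "field_ordering R P \<longleftrightarrow>
     P \<subseteq> carrier R - {\<zero>\<^bsub>R\<^esub>} \<and>
     P \<union> {\<ominus>\<^bsub>R\<^esub> x | x. x \<in> P} = carrier R - {\<zero>\<^bsub>R\<^esub>} \<and>
     (\<forall>x\<in>P. \<forall>y\<in>P. x \<oplus>\<^bsub>R\<^esub> y \<in> P \<and> x \<otimes>\<^bsub>R\<^esub> y \<in> P)"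

definition real_field :: "('a, 'b) ring_scheme \<Rightarrow> bool" where
  "real_field R \<longleftrightarrow> field R \<and> (\<exists>P. field_ordering R P)"

text \<open>By Sylvester's law of inertia the value does not depend on the diagonalisation.\<close>

definition signature :: "('a, 'b) ring_scheme \<Rightarrow> 'a set \<Rightarrow> 'a mat \<Rightarrow> int" where
  "signature R P A =
     (THE s. \<exists>as. set as \<subseteq> carrier R - {\<zero>\<^bsub>R\<^esub>} \<and> isometric R A (diag_form R as) \<and>
        s = int (length (filter (\<lambda>a. a \<in> P) as)) - int (length (filter (\<lambda>a. a \<notin> P) as)))"

definition indefinite_at :: "('a, 'b) ring_scheme \<Rightarrow> 'a set \<Rightarrow> 'a mat \<Rightarrow> bool" where
  "indefinite_at R P A \<longleftrightarrow> \<bar>signature R P A\<bar> < int (qdim A)"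

definition definite_at :: "('a, 'b) ring_scheme \<Rightarrow> 'a set \<Rightarrow> 'a mat \<Rightarrow> bool" where
  "definite_at R P A \<longleftrightarrow> \<bar>signature R P A\<bar> = int (qdim A)"


section \<open>Quotient fields of integral domains\<close>

definition frac_rel :: "('a, 'b) ring_scheme \<Rightarrow> (('a \<times> 'a) \<times> ('a \<times> 'a)) set" where
  "frac_rel D =
     {((a, b), (c, d)) | a b c d.
        a \<in> carrier D \<and> b \<in> carrier D - {\<zero>\<^bsub>D\<^esub>} \<and> c \<in> carrier D \<and> d \<in> carrier D - {\<zero>\<^bsub>D\<^esub>} \<and>
        a \<otimes>\<^bsub>D\<^esub> d = c \<otimes>\<^bsub>D\<^esub> b}"

definition mk_frac :: "('a, 'b) ring_scheme \<Rightarrow> 'a \<Rightarrow> 'a \<Rightarrow> ('a \<times> 'a) set" where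
  "mk_frac D a b = frac_rel D `` {(a, b)}"

definition quotient_field :: "('a, 'b) ring_scheme \<Rightarrow> ('a \<times> 'a) set ring" where
  "quotient_field D =
     \<lparr> carrier = (carrier D \<times> (carrier D - {\<zero>\<^bsub>D\<^esub>})) // frac_rel D,
       monoid.mult = (\<lambda>u v. \<Union>(a, b)\<in>u. \<Union>(c, d)\<in>v. mk_frac D (a \<otimes>\<^bsub>D\<^esub> c) (b \<otimes>\<^bsub>D\<^esub> d)),
       one = mk_frac D \<one>\<^bsub>D\<^esub> \<one>\<^bsub>D\<^esub>,
       zero = mk_frac D \<zero>\<^bsub>D\<^esub> \<one>\<^bsub>D\<^esub>,
       add = (\<lambda>u v. \<Union>(a, b)\<in>u. \<Union>(c, d)\<in>v.
                mk_frac D (a \<otimes>\<^bsub>D\<^esub> d \<oplus>\<^bsub>D\<^esub> c \<otimes>\<^bsub>D\<^esub> b) (b \<otimes>\<^bsub>D\<^esub> d)) \<rparr>"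


section \<open>The function field of a form\<close>

text \<open>
  A monomial in the variables \<open>X\<^sub>i\<close> is a multiset of indices, as in the library's indexed
  polynomials; the library provides these without their product, which is the convolution below.
  The variables \<open>X\<^sub>1, \<dots>, X\<^sub>n\<close> are indexed by \<open>{..<n}\<close>.
\<close>

definition mpoly_ring :: "('a, 'b) ring_scheme \<Rightarrow> 'c set \<Rightarrow> ('c multiset \<Rightarrow> 'a) ring" where
  "mpoly_ring R I =
     \<lparr> carrier = ring.indexed_pset R I (carrier R),
       monoid.mult = (\<lambda>f g m. \<Oplus>\<^bsub>R\<^esub>k\<in>{k. k \<subseteq># m}. f k \<otimes>\<^bsub>R\<^esub> g (m - k)),
       one = ring.indexed_const R \<one>\<^bsub>R\<^esub>,
       zero = ring.indexed_const R \<zero>\<^bsub>R\<^esub>,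
       add = ring.indexed_padd R \<rparr>"

definition form_poly :: "('a, 'b) ring_scheme \<Rightarrow> 'a mat \<Rightarrow> nat multiset \<Rightarrow> 'a" where
  "form_poly R A =
     qeval (mpoly_ring R {..<qdim A}) (map_mat (ring.indexed_const R) A)
       (vec (qdim A) (ring.indexed_var R))"

definition form_coord_ring :: "('a, 'b) ring_scheme \<Rightarrow> 'a mat \<Rightarrow> (nat multiset \<Rightarrow> 'a) set ring" where
  "form_coord_ring R A =
     mpoly_ring R {..<qdim A} Quot (Idl\<^bsub>mpoly_ring R {..<qdim A}\<^esub> {form_poly R A})"

definition function_field ::
    "('a, 'b) ring_scheme \<Rightarrow> 'a mat \<Rightarrow>
     ((nat multiset \<Rightarrow> 'a) set \<times> (nat multiset \<Rightarrow> 'a) set) set ring" where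
  "function_field R A = quotient_field (form_coord_ring R A)"

definition function_field_embed ::
    "('a, 'b) ring_scheme \<Rightarrow> 'a mat \<Rightarrow> 'a \<Rightarrow>
     ((nat multiset \<Rightarrow> 'a) set \<times> (nat multiset \<Rightarrow> 'a) set) set" where
  "function_field_embed R A a =
     mk_frac (form_coord_ring R A)
       ((Idl\<^bsub>mpoly_ring R {..<qdim A}\<^esub> {form_poly R A})
          +>\<^bsub>mpoly_ring R {..<qdim A}\<^esub> ring.indexed_const R a)
       \<one>\<^bsub>form_coord_ring R A\<^esub>"

definition first_witt_index :: "('a, 'b) ring_scheme \<Rightarrow> 'a mat \<Rightarrow> nat" where
  "first_witt_index R A =
     witt_index (function_field R A) (map_mat (function_field_embed R A) A)"

end

theory Submission
  imports Defs
begin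

text \<open>
  Write \<open>i = i\<^sub>1(q)\<close>. Totally isotropic subspaces of \<open>q\<close> over \<open>F(q)\<close> specialise: if \<open>M/F\<close> is any
  extension over which \<open>q\<close> is isotropic, one reduces an echelon basis of an \<open>i\<close>-dimensional totally
  isotropic subspace at an \<open>M\<close>-rational point of the quadric avoiding the denominators, so the Witt index
  of \<open>q\<close> over \<open>M\<close> is at least \<open>i\<close>. By induction on the number of slots, for every bilinear Pfister form
  \<open>\<rho>\<close> of dimension \<open>2\<^sup>k\<close>, if \<open>\<rho> \<otimes> q\<close> becomes isotropic over \<open>M\<close>, then its Witt index there is at
  least \<open>2\<^sup>k i\<close>: if \<open>\<phi> \<perp> b\<phi>\<close> is isotropic and \<open>\<phi>\<close> is not, then \<open>\<phi>\<close> becomes isotropic over a quadratic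
  extension in which \<open>T\<^sup>2 = \<sigma>T + b\<close>, and a totally isotropic subspace over that extension is one of
  \<open>\<phi> \<perp> b\<phi>\<close> over \<open>M\<close> of twice the dimension.

  If \<open>q\<close> is indefinite at \<open>P\<close> with diagonal entries \<open>d\<^sub>i > 0 > d\<^sub>j\<close>, then \<open>\<langle>1, c\<rangle> \<otimes> q\<close> with
  \<open>c = -d\<^sub>i d\<^sub>j > 0\<close> is isotropic, so its Witt index is at least \<open>2i\<close>; by inertia \<open>i\<close> is at most the
  number of positive and the number of negative entries of \<open>q\<close>. The same bound for \<open>\<pi> \<otimes> q\<close> and the
  lower bound over \<open>F(\<pi> \<otimes> q)\<close> meet when \<open>|sgn\<^sub>P(q)| = dim q - 2i\<close>.
\<close>

text \<open>Inertia bounds totally isotropic subspaces of forms over F, but \<open>q\<close> and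
  \<open>\<pi> \<otimes> q\<close> are anisotropic there and the first Witt index lives over a
  function field. The binary factor \<open>\<langle>1, c\<rangle>\<close> bridges this: it makes the
  form isotropic over F itself, and as c is positive it doubles the number of entries of each sign
  just as it doubles the isotropic dimension, so the factor 2 cancels. The harder step is to find an
  M-rational point of the quadric at which a given denominator is nonzero. For fixed values of the
  other coordinates the equation is quadratic in the first one, so a suitable point exists over an
  extension of M of degree at most two. The isotropic vector over M then gives a polynomial
  parametrisation of the quadric; a polynomial that is nonzero at a parameter in the extension
  vanishes at only finitely many parameters, so some parameter in the infinite field M works. Points
  over such quadratic extensions of F also show that the form polynomial generates a prime
  ideal.\<close>

section \<open>Vectors, linear maps and linear functionals over a carrier-based ring\<close>

definition vadd :: "('a, 'b) ring_scheme \<Rightarrow> 'a vec \<Rightarrow> 'a vec \<Rightarrow> 'a vec" where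
  "vadd R u v = vec (dim_vec u) (\<lambda>i. u $ i \<oplus>\<^bsub>R\<^esub> v $ i)"

definition vscale :: "('a, 'b) ring_scheme \<Rightarrow> 'a \<Rightarrow> 'a vec \<Rightarrow> 'a vec" where
  "vscale R c v = vec (dim_vec v) (\<lambda>i. c \<otimes>\<^bsub>R\<^esub> v $ i)"

definition uvec :: "('a, 'b) ring_scheme \<Rightarrow> nat \<Rightarrow> nat \<Rightarrow> 'a vec" where
  "uvec R n j = vec n (\<lambda>i. if i = j then \<one>\<^bsub>R\<^esub> else \<zero>\<^bsub>R\<^esub>)"

definition linmap :: "('a, 'b) ring_scheme \<Rightarrow> nat \<Rightarrow> nat \<Rightarrow> ('a vec \<Rightarrow> 'a vec) \<Rightarrow> bool" where
  "linmap R m n f \<longleftrightarrow>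
     (\<forall>v\<in>vecs R m. f v \<in> vecs R n) \<and>
     (\<forall>u\<in>vecs R m. \<forall>v\<in>vecs R m. f (vadd R u v) = vadd R (f u) (f v)) \<and>
     (\<forall>c\<in>carrier R. \<forall>v\<in>vecs R m. f (vscale R c v) = vscale R c (f v))"

definition linfun :: "('a, 'b) ring_scheme \<Rightarrow> nat \<Rightarrow> ('a vec \<Rightarrow> 'a) \<Rightarrow> bool" where
  "linfun R m f \<longleftrightarrow>
     (\<forall>v\<in>vecs R m. f v \<in> carrier R) \<and>
     (\<forall>u\<in>vecs R m. \<forall>v\<in>vecs R m. f (vadd R u v) = f u \<oplus>\<^bsub>R\<^esub> f v) \<and>
     (\<forall>c\<in>carrier R. \<forall>v\<in>vecs R m. f (vscale R c v) = c \<otimes>\<^bsub>R\<^esub> f v)"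

text \<open>Subspaces occur throughout as images of such parametrisations, never as sets;
  \<open>m\<close> is the dimension of the image. Over a field the kernel condition is ordinary
  injectivity (\<open>linemb_inj\<close>).\<close>

definition linemb :: "('a, 'b) ring_scheme \<Rightarrow> nat \<Rightarrow> nat \<Rightarrow> ('a vec \<Rightarrow> 'a vec) \<Rightarrow> bool" where
  "linemb R m n f \<longleftrightarrow> linmap R m n f \<and> (\<forall>v\<in>vecs R m. f v = zvec R n \<longrightarrow> v = zvec R m)"

lemma vecs_index: "v \<in> vecs R n \<Longrightarrow> i < n \<Longrightarrow> v $ i \<in> carrier R"
  by (simp add: vecs_def)

lemma vecs_dim: "v \<in> vecs R n \<Longrightarrow> dim_vec v = n"
  by (simp add: vecs_def)

lemma vecs_vecI: "(\<And>i. i < n \<Longrightarrow> f i \<in> carrier R) \<Longrightarrow> vec n f \<in> vecs R n"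
  by (simp add: vecs_def)

lemma mats_index: "T \<in> mats R m n \<Longrightarrow> i < m \<Longrightarrow> j < n \<Longrightarrow> T $$ (i, j) \<in> carrier R"
  by (simp add: mats_def)

lemma mats_dim: "T \<in> mats R m n \<Longrightarrow> dim_row T = m" "T \<in> mats R m n \<Longrightarrow> dim_col T = n"
  by (auto simp: mats_def)

lemma mats_matI:
  "(\<And>i j. i < m \<Longrightarrow> j < n \<Longrightarrow> f (i, j) \<in> carrier R) \<Longrightarrow> mat m n f \<in> mats R m n"
  by (simp add: mats_def)

lemma mats_col: "T \<in> mats R m n \<Longrightarrow> j < n \<Longrightarrow> col T j \<in> vecs R m"
  by (auto simp: mats_def vecs_def)

declare vecs_index [simp] vecs_dim [simp] mats_index [simp] mats_col [simp]

lemma vecs_eqI: "u \<in> vecs R n \<Longrightarrow> v \<in> vecs R n \<Longrightarrow> (\<And>i. i < n \<Longrightarrow> u $ i = v $ i) \<Longrightarrow> u = v"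
  by (intro eq_vecI) (simp_all add: vecs_dim)

lemma zvec_index [simp]: "i < n \<Longrightarrow> zvec R n $ i = \<zero>\<^bsub>R\<^esub>"
  by (simp add: zvec_def)

lemma uvec_index [simp]: "i < n \<Longrightarrow> uvec R n j $ i = (if i = j then \<one>\<^bsub>R\<^esub> else \<zero>\<^bsub>R\<^esub>)"
  by (simp add: uvec_def)

lemma zvec_dim [simp]: "dim_vec (zvec R n) = n"
  by (simp add: zvec_def)

lemma uvec_dim [simp]: "dim_vec (uvec R n j) = n"
  by (simp add: uvec_def)

lemma vadd_dim [simp]: "dim_vec (vadd R u v) = dim_vec u"
  by (simp add: vadd_def)

lemma vscale_dim [simp]: "dim_vec (vscale R c v) = dim_vec v"
  by (simp add: vscale_def)

lemma vadd_idx [simp]: "i < dim_vec u \<Longrightarrow> vadd R u v $ i = u $ i \<oplus>\<^bsub>R\<^esub> v $ i"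
  by (simp add: vadd_def)

lemma vscale_idx [simp]: "i < dim_vec v \<Longrightarrow> vscale R c v $ i = c \<otimes>\<^bsub>R\<^esub> v $ i"
  by (simp add: vscale_def)

lemma vadd_index: "u \<in> vecs R n \<Longrightarrow> i < n \<Longrightarrow> vadd R u v $ i = u $ i \<oplus>\<^bsub>R\<^esub> v $ i"
  by (simp add: vecs_dim)

lemma vscale_index: "v \<in> vecs R n \<Longrightarrow> i < n \<Longrightarrow> vscale R c v $ i = c \<otimes>\<^bsub>R\<^esub> v $ i"
  by (simp add: vecs_dim)

lemma apply_mat_index [simp]:
  "T \<in> mats R m n \<Longrightarrow> i < m \<Longrightarrow>
   apply_mat R T v $ i = (\<Oplus>\<^bsub>R\<^esub>j\<in>{..<n}. T $$ (i, j) \<otimes>\<^bsub>R\<^esub> v $ j)"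
  by (simp add: apply_mat_def mats_dim)

lemma linmap_closed: "linmap R m n f \<Longrightarrow> v \<in> vecs R m \<Longrightarrow> f v \<in> vecs R n"
  by (simp add: linmap_def)

lemma linmap_add:
  "linmap R m n f \<Longrightarrow> u \<in> vecs R m \<Longrightarrow> v \<in> vecs R m \<Longrightarrow> f (vadd R u v) = vadd R (f u) (f v)"
  by (simp add: linmap_def)

lemma linmap_scale:
  "linmap R m n f \<Longrightarrow> c \<in> carrier R \<Longrightarrow> v \<in> vecs R m \<Longrightarrow> f (vscale R c v) = vscale R c (f v)"
  by (simp add: linmap_def)

lemma linfun_closed: "linfun R m f \<Longrightarrow> v \<in> vecs R m \<Longrightarrow> f v \<in> carrier R"
  by (simp add: linfun_def)

lemma linfun_add:
  "linfun R m f \<Longrightarrow> u \<in> vecs R m \<Longrightarrow> v \<in> vecs R m \<Longrightarrow> f (vadd R u v) = f u \<oplus>\<^bsub>R\<^esub> f v"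
  by (simp add: linfun_def)

lemma linfun_scale:
  "linfun R m f \<Longrightarrow> c \<in> carrier R \<Longrightarrow> v \<in> vecs R m \<Longrightarrow> f (vscale R c v) = c \<otimes>\<^bsub>R\<^esub> f v"
  by (simp add: linfun_def)

lemma linmap_comp: "linmap R m n f \<Longrightarrow> linmap R k m g \<Longrightarrow> linmap R k n (\<lambda>v. f (g v))"
  by (simp add: linmap_def)

lemma linfun_comp: "linfun R m f \<Longrightarrow> linmap R k m g \<Longrightarrow> linfun R k (\<lambda>v. f (g v))"
  by (simp add: linmap_def linfun_def)

lemma linemb_linmap: "linemb R m n f \<Longrightarrow> linmap R m n f"
  by (simp add: linemb_def)

lemma linemb_comp: "linemb R m n f \<Longrightarrow> linemb R k m g \<Longrightarrow> linemb R k n (\<lambda>v. f (g v))"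
  unfolding linemb_def using linmap_comp linmap_closed by metis

lemma linfun_index: "linmap R m n f \<Longrightarrow> i < n \<Longrightarrow> linfun R m (\<lambda>v. f v $ i)"
  unfolding linfun_def linmap_def by (metis vadd_index vecs_index vscale_index)

context ring
begin

lemma zvec_vecs [simp]: "zvec R n \<in> vecs R n"
  unfolding zvec_def by (rule vecs_vecI) simp

lemma uvec_vecs [simp]: "uvec R n j \<in> vecs R n"
  unfolding uvec_def by (rule vecs_vecI) simp

lemma vadd_vecs [simp]: "u \<in> vecs R n \<Longrightarrow> v \<in> vecs R n \<Longrightarrow> vadd R u v \<in> vecs R n"
  unfolding vadd_def by (simp add: vecs_vecI)

lemma vscale_vecs [simp]: "c \<in> carrier R \<Longrightarrow> v \<in> vecs R n \<Longrightarrow> vscale R c v \<in> vecs R n"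
  unfolding vscale_def by (simp add: vecs_vecI)

lemma vscale_zero [simp]: "v \<in> vecs R n \<Longrightarrow> vscale R \<zero> v = zvec R n"
  by (rule vecs_eqI[of _ R n]) auto

lemma vscale_one [simp]: "v \<in> vecs R n \<Longrightarrow> vscale R \<one> v = v"
  by (rule vecs_eqI[of _ R n]) auto

lemma vscale_zvec [simp]: "c \<in> carrier R \<Longrightarrow> vscale R c (zvec R n) = zvec R n"
  by (rule vecs_eqI[of _ R n]) auto

lemma vscale_vscale:
  "a \<in> carrier R \<Longrightarrow> b \<in> carrier R \<Longrightarrow> v \<in> vecs R n \<Longrightarrow> vscale R a (vscale R b v) = vscale R (a \<otimes> b) v"
  by (rule vecs_eqI[of _ R n]) (auto simp: m_assoc)

lemma vadd_zero [simp]: "v \<in> vecs R n \<Longrightarrow> vadd R (zvec R n) v = v" "v \<in> vecs R n \<Longrightarrow> vadd R v (zvec R n) = v"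
  by (auto intro!: vecs_eqI[of _ R n])

lemma vec_nonzero_index: "v \<in> vecs R n \<Longrightarrow> v \<noteq> zvec R n \<Longrightarrow> \<exists>i<n. v $ i \<noteq> \<zero>"
  using vecs_eqI[of v R n "zvec R n"] by fastforce

lemma linmap_zero: "linmap R m n f \<Longrightarrow> f (zvec R m) = zvec R n"
  using linmap_scale[of R m n f \<zero> "zvec R m"] linmap_closed[of R m n f "zvec R m"] by simp

lemma linfun_zero: "linfun R m f \<Longrightarrow> f (zvec R m) = \<zero>"
  using linfun_scale[of R m f \<zero> "zvec R m"] linfun_closed[of R m f "zvec R m"] by simp

lemma linfun_expand:
  assumes f: "linfun R n f" and v: "v \<in> vecs R n"
  shows "f v = (\<Oplus>j\<in>{..<n}. v $ j \<otimes> f (uvec R n j))"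
proof -
  have cl: "f (uvec R n j) \<in> carrier R" for j
    using f by (simp add: linfun_closed)
  have "f (vec n (\<lambda>i. if i < k then v $ i else \<zero>)) = (\<Oplus>j\<in>{..<k}. v $ j \<otimes> f (uvec R n j))"
    if "k \<le> n" for k
    using that
  proof (induction k)
    case 0
    then show ?case using linfun_zero[OF f] by (simp add: zvec_def)
  next
    case (Suc k)
    have eq: "vec n (\<lambda>i. if i < Suc k then v $ i else \<zero>) =
      vadd R (vscale R (v $ k) (uvec R n k)) (vec n (\<lambda>i. if i < k then v $ i else \<zero>))"
      using v Suc.prems by (intro vecs_eqI[of _ R n] vecs_vecI vadd_vecs vscale_vecs) (auto simp: less_Suc_eq)
    have "f (vec n (\<lambda>i. if i < Suc k then v $ i else \<zero>)) =
      v $ k \<otimes> f (uvec R n k) \<oplus> (\<Oplus>j\<in>{..<k}. v $ j \<otimes> f (uvec R n j))"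
      unfolding eq using v Suc
      by (subst linfun_add[OF f]) (auto simp: linfun_scale[OF f] intro!: vecs_vecI)
    then show ?case
      using v Suc.prems cl by (simp add: lessThan_Suc finsum_insert Pi_def)
  qed
  from this[of n] have "f (vec n (\<lambda>i. if i < n then v $ i else \<zero>)) = (\<Oplus>j\<in>{..<n}. v $ j \<otimes> f (uvec R n j))"
    by simp
  moreover have "vec n (\<lambda>i. if i < n then v $ i else \<zero>) = v"
    using v by (auto intro!: eq_vecI)
  ultimately show ?thesis by simp
qed

lemma finsum_delta:
  assumes "finite I" "\<And>i. i \<in> I \<Longrightarrow> f i \<in> carrier R"
  shows "(\<Oplus>i\<in>I. if i = j then f i else \<zero>) = (if j \<in> I then f j else \<zero>)"
proof (cases "j \<in> I")
  case True
  then show ?thesis using add.finprod_singleton_swap[of j I f] assms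
    by (auto simp: Pi_def)
next
  case False
  then have "(\<Oplus>i\<in>I. if i = j then f i else \<zero>) = (\<Oplus>i\<in>I. \<zero>)"
    by (intro finsum_cong') auto
  then show ?thesis using False by (simp add: finsum_zero)
qed

end

context cring
begin

lemma apply_mat_vecs [simp]: "T \<in> mats R m n \<Longrightarrow> v \<in> vecs R n \<Longrightarrow> apply_mat R T v \<in> vecs R m"
  unfolding apply_mat_def by (auto simp: mats_dim intro!: finsum_closed vecs_vecI)

lemma linmap_apply_mat:
  assumes T: "T \<in> mats R m n"
  shows "linmap R n m (apply_mat R T)"
  unfolding linmap_def
proof (intro conjI ballI)
  fix v assume v: "v \<in> vecs R n"
  then show "apply_mat R T v \<in> vecs R m" using T by simp
  fix u assume u: "u \<in> vecs R n"
  show "apply_mat R T (vadd R v u) = vadd R (apply_mat R T v) (apply_mat R T u)"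
  proof (rule vecs_eqI[of _ R m])
    fix i assume i: "i < m"
    have "(\<Oplus>j\<in>{..<n}. T $$ (i, j) \<otimes> vadd R v u $ j) =
      (\<Oplus>j\<in>{..<n}. T $$ (i, j) \<otimes> v $ j \<oplus> T $$ (i, j) \<otimes> u $ j)"
      using T u v i by (intro finsum_cong') (auto simp: r_distr)
    also have "\<dots> = (\<Oplus>j\<in>{..<n}. T $$ (i, j) \<otimes> v $ j) \<oplus> (\<Oplus>j\<in>{..<n}. T $$ (i, j) \<otimes> u $ j)"
      using T u v i by (intro finsum_addf) auto
    finally show "apply_mat R T (vadd R v u) $ i = vadd R (apply_mat R T v) (apply_mat R T u) $ i"
      using T u v i by (simp add: vadd_index[of _ R m])
  qed (use T u v in auto)
next
  fix c v assume c: "c \<in> carrier R" and v: "v \<in> vecs R n"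
  show "apply_mat R T (vscale R c v) = vscale R c (apply_mat R T v)"
  proof (rule vecs_eqI[of _ R m])
    fix i assume i: "i < m"
    have "(\<Oplus>j\<in>{..<n}. T $$ (i, j) \<otimes> vscale R c v $ j) =
      (\<Oplus>j\<in>{..<n}. c \<otimes> (T $$ (i, j) \<otimes> v $ j))"
      using T c v i by (intro finsum_cong') (auto simp: m_lcomm)
    also have "\<dots> = c \<otimes> (\<Oplus>j\<in>{..<n}. T $$ (i, j) \<otimes> v $ j)"
      using T c v i by (intro finsum_rdistr[symmetric]) auto
    finally show "apply_mat R T (vscale R c v) $ i = vscale R c (apply_mat R T v) $ i"
      using T c v i by (simp add: vscale_index[of _ R m])
  qed (use T c v in auto)
qed

lemma apply_mat_uvec:
  assumes "T \<in> mats R m n" "j < n"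
  shows "apply_mat R T (uvec R n j) = col T j"
proof (rule vecs_eqI[of _ R m])
  fix i assume i: "i < m"
  have "(\<Oplus>k\<in>{..<n}. T $$ (i, k) \<otimes> uvec R n j $ k) = (\<Oplus>k\<in>{..<n}. if k = j then T $$ (i, k) else \<zero>)"
    using assms i by (intro finsum_cong') auto
  also have "\<dots> = T $$ (i, j)"
    using assms i by (subst finsum_delta) auto
  finally show "apply_mat R T (uvec R n j) $ i = col T j $ i"
    using assms i by (simp add: mats_dim)
qed (use assms in auto)

lemma linfun_apply_mat:
  assumes f: "linfun R m f" and T: "T \<in> mats R m n" and v: "v \<in> vecs R n"
  shows "f (apply_mat R T v) = (\<Oplus>j\<in>{..<n}. v $ j \<otimes> f (col T j))"
proof -
  have "f (apply_mat R T v) = (\<Oplus>j\<in>{..<n}. v $ j \<otimes> f (apply_mat R T (uvec R n j)))"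
    by (rule linfun_expand[OF linfun_comp[OF f linmap_apply_mat[OF T]] v])
  also have "\<dots> = (\<Oplus>j\<in>{..<n}. v $ j \<otimes> f (col T j))"
    using v T f by (intro finsum_cong') (auto simp: apply_mat_uvec linfun_closed)
  finally show ?thesis .
qed

lemma linmap_matrix:
  assumes f: "linmap R n m f"
  shows "\<exists>T\<in>mats R m n. (\<forall>j<n. col T j = f (uvec R n j)) \<and> (\<forall>v\<in>vecs R n. apply_mat R T v = f v)"
proof -
  define T where "T = mat m n (\<lambda>(i, j). f (uvec R n j) $ i)"
  have cl: "f (uvec R n j) \<in> vecs R m" for j using f by (simp add: linmap_closed)
  have T: "T \<in> mats R m n"
    unfolding T_def using cl by (intro mats_matI) (auto intro!: vecs_index)
  have "apply_mat R T v = f v" if v: "v \<in> vecs R n" for v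
  proof (rule vecs_eqI[of _ R m])
    fix i assume i: "i < m"
    have "f v $ i = (\<Oplus>j\<in>{..<n}. v $ j \<otimes> f (uvec R n j) $ i)"
      by (rule linfun_expand[OF linfun_index[OF f i] v])
    also have "\<dots> = (\<Oplus>j\<in>{..<n}. T $$ (i, j) \<otimes> v $ j)"
      using v i cl by (intro finsum_cong') (auto simp: T_def m_comm vecs_index[OF cl] intro!: vecs_index[OF cl])
    finally show "apply_mat R T v $ i = f v $ i" using T i v by simp
  qed (use T v f in \<open>auto simp: linmap_closed\<close>)
  moreover have "col T j = f (uvec R n j)" if "j < n" for j
    using that cl[of j] by (intro eq_vecI) (auto simp: T_def)
  ultimately show ?thesis using T by blast
qed

end

text \<open>Parametrises the hyperplane on which the coordinate \<open>p\<close> vanishes.\<close>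

definition vinsert :: "('a, 'b) ring_scheme \<Rightarrow> nat \<Rightarrow> 'a vec \<Rightarrow> 'a vec" where
  "vinsert R p v = vec (Suc (dim_vec v)) (\<lambda>i. if i < p then v $ i else if i = p then \<zero>\<^bsub>R\<^esub> else v $ (i - 1))"

context ring
begin

lemma linemb_vinsert: "p \<le> d \<Longrightarrow> linemb R d (Suc d) (vinsert R p)"
proof -
  assume p: "p \<le> d"
  have cl: "vinsert R p v \<in> vecs R (Suc d)" if "v \<in> vecs R d" for v
    using that p unfolding vinsert_def vecs_dim[OF that] by (intro vecs_vecI) auto
  have ix: "vinsert R p v $ i = (if i < p then v $ i else if i = p then \<zero> else v $ (i - 1))"
    if "v \<in> vecs R d" "i < Suc d" for v i
    using that by (simp add: vinsert_def)
  have "linmap R d (Suc d) (vinsert R p)"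
    unfolding linmap_def using cl p
    by (auto intro!: vecs_eqI[of _ R "Suc d"] simp: ix vadd_index[of _ R "Suc d"] vscale_index[of _ R "Suc d"])
  moreover have "v = zvec R d" if v: "v \<in> vecs R d" and z: "vinsert R p v = zvec R (Suc d)" for v
  proof (rule vecs_eqI[of _ R d])
    fix i assume i: "i < d"
    show "v $ i = zvec R d $ i"
      using ix[OF v, of i] ix[OF v, of "Suc i"] i z by (cases "i < p") auto
  qed (use v in auto)
  ultimately show ?thesis by (simp add: linemb_def)
qed

lemma linmap_take:
  assumes "m \<le> n"
  shows "linmap R n m (\<lambda>v. vec m (\<lambda>i. v $ i))"
  unfolding linmap_def
proof (intro conjI ballI)
  fix v assume v: "v \<in> vecs R n"
  then show "vec m (($) v) \<in> vecs R m" using assms by (intro vecs_vecI) auto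
  fix u assume u: "u \<in> vecs R n"
  show "vec m (($) (vadd R v u)) = vadd R (vec m (($) v)) (vec m (($) u))"
    using u v assms by (intro eq_vecI) auto
next
  fix c v assume "v \<in> vecs R n"
  then show "vec m (($) (vscale R c v)) = vscale R c (vec m (($) v))"
    using assms by (intro eq_vecI) auto
qed

lemma vinsert_index: "v \<in> vecs R d \<Longrightarrow> p \<le> d \<Longrightarrow> vinsert R p v $ p = \<zero>"
  by (simp add: vinsert_def)

end

section \<open>Kernels and dimension counts over a field\<close>

context field
begin

text \<open>If \<open>f w\<close> and the coordinate \<open>w $ p\<close> are nonzero, then
  projecting along \<open>w\<close> sends the hyperplane \<open>v $ p = 0\<close> into the kernel of
  \<open>f\<close>. This projection is injective because \<open>w\<close> lies outside that
  hyperplane.\<close>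

lemma linfun_kernel:
  assumes f: "linfun R (Suc d) f"
  shows "\<exists>g. linemb R d (Suc d) g \<and> (\<forall>v\<in>vecs R d. f (g v) = \<zero>)"
proof (cases "\<forall>v\<in>vecs R (Suc d). f v = \<zero>")
  case True
  then show ?thesis using linemb_vinsert[of 0 d]
    by (intro exI[of _ "vinsert R 0"]) (auto simp: linemb_def linmap_def)
next
  case False
  then obtain w where w: "w \<in> vecs R (Suc d)" "f w \<noteq> \<zero>" by auto
  then have "w \<noteq> zvec R (Suc d)" using linfun_zero[OF f] by auto
  then obtain p where p: "p < Suc d" "w $ p \<noteq> \<zero>" using vec_nonzero_index w by blast
  have E: "linemb R d (Suc d) (vinsert R p)" using p linemb_vinsert[of p d] by simp
  note L = linemb_linmap[OF E]
  have iv: "inv (f w) \<in> carrier R" "inv (f w) \<otimes> f w = \<one>"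
    using w linfun_closed[OF f, of w] field_Units by auto
  define t where "t v = \<ominus> (f (vinsert R p v) \<otimes> inv (f w))" for v
  define g where "g v = vadd R (vinsert R p v) (vscale R (t v) w)" for v
  have fcl: "f (vinsert R p v) \<in> carrier R" if "v \<in> vecs R d" for v
    using that f L by (simp add: linfun_closed linmap_closed)
  have tcl: "t v \<in> carrier R" if "v \<in> vecs R d" for v
    using that fcl iv by (simp add: t_def)
  have tadd: "t (vadd R u v) = t u \<oplus> t v" if "u \<in> vecs R d" "v \<in> vecs R d" for u v
    using that fcl[of u] fcl[of v] iv unfolding t_def
    by (simp add: linmap_add[OF L] linfun_add[OF f] linmap_closed[OF L] l_distr minus_add)
  have tsc: "t (vscale R c v) = c \<otimes> t v" if "c \<in> carrier R" "v \<in> vecs R d" for c v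
    using that fcl[of v] iv unfolding t_def
    by (simp add: linmap_scale[OF L] linfun_scale[OF f] linmap_closed[OF L] m_assoc r_minus)
  have lin: "linmap R d (Suc d) g"
    unfolding linmap_def
  proof (intro conjI ballI)
    fix v assume v: "v \<in> vecs R d"
    then show "g v \<in> vecs R (Suc d)"
      using w tcl[OF v] by (simp add: g_def linmap_closed[OF L])
    fix u assume u: "u \<in> vecs R d"
    show "g (vadd R v u) = vadd R (g v) (g u)"
      using u v w tcl[OF v] tcl[OF u] linmap_closed[OF L v] linmap_closed[OF L u]
      unfolding g_def tadd[OF v u] linmap_add[OF L v u]
      by (intro vecs_eqI[of _ R "Suc d"])
         (auto simp: l_distr vadd_index[of _ R "Suc d"] vscale_index[of _ R "Suc d"] a_ac)
  next
    fix c v assume c: "c \<in> carrier R" and v: "v \<in> vecs R d"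
    show "g (vscale R c v) = vscale R c (g v)"
      using c v w tcl[OF v] linmap_closed[OF L v]
      unfolding g_def tsc[OF c v] linmap_scale[OF L c v]
      by (intro vecs_eqI[of _ R "Suc d"])
         (auto simp: r_distr m_assoc vadd_index[of _ R "Suc d"] vscale_index[of _ R "Suc d"])
  qed
  moreover have "f (g v) = \<zero>" if v: "v \<in> vecs R d" for v
  proof -
    have "f (g v) = f (vinsert R p v) \<oplus> t v \<otimes> f w"
      using w tcl[OF v] linmap_closed[OF L v] by (simp add: g_def linfun_add[OF f] linfun_scale[OF f])
    also have "t v \<otimes> f w = \<ominus> f (vinsert R p v)"
      using fcl[OF v] iv w linfun_closed[OF f, of w] by (simp add: t_def l_minus m_assoc)
    finally show ?thesis using fcl[OF v] by (simp add: r_neg)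
  qed
  moreover have "v = zvec R d" if v: "v \<in> vecs R d" and z: "g v = zvec R (Suc d)" for v
  proof -
    have "g v $ p = t v \<otimes> w $ p"
      using v p w tcl[OF v] linmap_closed[OF L v]
      by (simp add: g_def vadd_index[of _ R "Suc d"] vscale_index[of _ R "Suc d"] vinsert_index[of v d p])
    then have "t v \<otimes> w $ p = \<zero>" using z p by simp
    then have "t v = \<zero>" using p w tcl[OF v] integral[of "t v" "w $ p"] by auto
    then have "g v = vinsert R p v"
      unfolding g_def using w linmap_closed[OF L v] by simp
    then show ?thesis using E v z by (simp add: linemb_def)
  qed
  ultimately show ?thesis by (auto simp: linemb_def)
qed

text \<open>Elimination: the last equation costs the source one dimension by
  \<open>linfun_kernel\<close>, and the remaining equations are solved by induction.\<close>

lemma linmap_kernel: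
  assumes "linmap R n m f" "m < n"
  shows "\<exists>v\<in>vecs R n. v \<noteq> zvec R n \<and> f v = zvec R m"
  using assms
proof (induction m arbitrary: n f)
  case 0
  have "uvec R n 0 \<noteq> zvec R n"
  proof
    assume "uvec R n 0 = zvec R n"
    then have "uvec R n 0 $ 0 = zvec R n $ 0" by simp
    then show False using 0 by simp
  qed
  moreover have "f (uvec R n 0) = zvec R 0"
    using linmap_closed[OF 0(1), of "uvec R n 0"] by (intro vecs_eqI[of _ R 0]) auto
  ultimately show ?case by (intro bexI[of _ "uvec R n 0"]) auto
next
  case (Suc m)
  then obtain k where k: "n = Suc k" by (cases n) auto
  obtain g where g: "linemb R k n g" "\<forall>v\<in>vecs R k. f (g v) $ m = \<zero>"
    using linfun_kernel[of k "\<lambda>v. f v $ m"] linfun_index[OF Suc.prems(1), of m] k by auto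
  have fg: "linmap R k (Suc m) (\<lambda>v. f (g v))"
    using linmap_comp[OF Suc.prems(1) linemb_linmap[OF g(1)]] .
  have cl: "f (g v) \<in> vecs R (Suc m)" if "v \<in> vecs R k" for v
    using linmap_closed[OF fg that] .
  have tr: "linmap R k m (\<lambda>v. vec m (\<lambda>i. f (g v) $ i))"
    using linmap_comp[OF linmap_take[of m "Suc m"] fg] by simp
  obtain v where v: "v \<in> vecs R k" "v \<noteq> zvec R k" "vec m (\<lambda>i. f (g v) $ i) = zvec R m"
    using Suc.IH[OF tr] Suc.prems k by auto
  have "f (g v) = zvec R (Suc m)"
  proof (rule vecs_eqI[of _ R "Suc m"])
    fix i assume i: "i < Suc m"
    show "f (g v) $ i = zvec R (Suc m) $ i"
    proof (cases "i = m")
      case True then show ?thesis using g v by simp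
    next
      case False
      then have "f (g v) $ i = vec m (\<lambda>i. f (g v) $ i) $ i" using i by simp
      then show ?thesis using i False v(3) by simp
    qed
  qed (use v cl in auto)
  then show ?case using g v by (intro bexI[of _ "g v"]) (auto simp: linemb_def linmap_closed)
qed

text \<open>The n columns of \<open>f\<close> together with \<open>w\<close> are n + 1 vectors in
  dimension n, hence dependent. Injectivity of \<open>f\<close> forces the coefficient of
  \<open>w\<close> to be nonzero, so one can solve for \<open>w\<close>.\<close>

lemma linemb_surj:
  assumes f: "linemb R n n f" and w: "w \<in> vecs R n"
  shows "\<exists>v\<in>vecs R n. f v = w"
proof -
  note L = linemb_linmap[OF f]
  define tk where "tk v = vec n (\<lambda>i. v $ i)" for v :: "'a vec"
  have tk: "linmap R (Suc n) n tk"
    unfolding tk_def using linmap_take[of n "Suc n"] by simp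
  define h where "h v = vadd R (f (tk v)) (vscale R (v $ n) w)" for v
  have h: "linmap R (Suc n) n h"
    unfolding linmap_def
  proof (intro conjI ballI)
    fix v assume v: "v \<in> vecs R (Suc n)"
    then show "h v \<in> vecs R n" using w by (simp add: h_def linmap_closed[OF L] linmap_closed[OF tk])
    fix u assume u: "u \<in> vecs R (Suc n)"
    show "h (vadd R v u) = vadd R (h v) (h u)"
      using u v w linmap_closed[OF L linmap_closed[OF tk u]] linmap_closed[OF L linmap_closed[OF tk v]]
      unfolding h_def linmap_add[OF tk v u] linmap_add[OF L linmap_closed[OF tk v] linmap_closed[OF tk u]]
      by (intro vecs_eqI[of _ R "n"])
         (auto simp: l_distr vadd_index[of _ R "n"] vscale_index[of _ R "n"] vadd_index[of _ R "Suc n"] a_ac)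
  next
    fix c v assume c: "c \<in> carrier R" and v: "v \<in> vecs R (Suc n)"
    show "h (vscale R c v) = vscale R c (h v)"
      using c v w linmap_closed[OF L linmap_closed[OF tk v]]
      unfolding h_def linmap_scale[OF tk c v] linmap_scale[OF L c linmap_closed[OF tk v]]
      by (intro vecs_eqI[of _ R "n"])
         (auto simp: r_distr m_assoc vadd_index[of _ R "n"] vscale_index[of _ R "n"] vscale_index[of _ R "Suc n"])
  qed
  obtain v where v: "v \<in> vecs R (Suc n)" "v \<noteq> zvec R (Suc n)" "h v = zvec R n"
    using linmap_kernel[OF h] by auto
  have tv: "tk v \<in> vecs R n" using linmap_closed[OF tk v(1)] .
  have vn: "v $ n \<in> carrier R" using v by simp
  have nz: "v $ n \<noteq> \<zero>"
  proof
    assume 0: "v $ n = \<zero>"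
    then have "f (tk v) = zvec R n"
      using v(3) w linmap_closed[OF L tv] by (simp add: h_def)
    then have z: "tk v = zvec R n" using f tv by (simp add: linemb_def)
    have "v = zvec R (Suc n)"
    proof (rule vecs_eqI[of _ R "Suc n"])
      fix i assume i: "i < Suc n"
      show "v $ i = zvec R (Suc n) $ i"
      proof (cases "i = n")
        case False
        then have "v $ i = tk v $ i" using i by (simp add: tk_def)
        then show ?thesis using z i False by simp
      qed (simp add: 0)
    qed (use v in auto)
    then show False using v by simp
  qed
  then have iv: "inv (v $ n) \<in> carrier R" "inv (v $ n) \<otimes> v $ n = \<one>"
    using vn field_Units by auto
  define c where "c = \<ominus> (inv (v $ n))"
  have c: "c \<in> carrier R" using iv by (simp add: c_def)
  have "f (vscale R c (tk v)) = w"
  proof (rule vecs_eqI[of _ R n])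
    fix i assume i: "i < n"
    have ft: "f (tk v) \<in> vecs R n" using linmap_closed[OF L tv] .
    have "h v $ i = \<zero>" using v(3) i by simp
    then have s: "f (tk v) $ i \<oplus> v $ n \<otimes> w $ i = \<zero>" using w i ft unfolding h_def by (simp add: vadd_index[of _ R n] vscale_index[of _ R n])
    then have "f (tk v) $ i = \<ominus> (v $ n \<otimes> w $ i)" using ft w i vn by (simp add: sum_zero_eq_neg)
    then have "c \<otimes> f (tk v) $ i = (inv (v $ n) \<otimes> v $ n) \<otimes> w $ i"
      using iv vn w i by (simp add: c_def l_minus r_minus m_assoc[symmetric])
    also have "\<dots> = w $ i" using iv w i by simp
    finally show "f (vscale R c (tk v)) $ i = w $ i"
      using iv w i ft by (simp add: linmap_scale[OF L c tv] vscale_index[of _ R n])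
  qed (use w c tv linmap_closed[OF L] in auto)
  then show ?thesis using c tv by (intro bexI[of _ "vscale R c (tk v)"]) auto
qed

end

section \<open>Bilinear and quadratic forms, isometries, isotropic subspaces\<close>

definition gram :: "('a, 'b) ring_scheme \<Rightarrow> 'a mat \<Rightarrow> 'a mat \<Rightarrow> 'a mat" where
  "gram R A T = mat (dim_col T) (dim_col T) (\<lambda>(j, k). bform R A (col T j) (col T k))"

definition sym_mat :: "('a, 'b) ring_scheme \<Rightarrow> 'a mat \<Rightarrow> bool" where
  "sym_mat R A \<longleftrightarrow> A \<in> mats R (qdim A) (qdim A) \<and> (\<forall>i<qdim A. \<forall>j<qdim A. A $$ (i, j) = A $$ (j, i))"

text \<open>Isometry through an injective linear map, which composes more easily than a bijective
  matrix. Over a field it agrees with \<open>isometric\<close> (\<open>isometric_wiso\<close>,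
  \<open>wiso_isometric\<close>).\<close>

definition wiso :: "('a, 'b) ring_scheme \<Rightarrow> 'a mat \<Rightarrow> 'a mat \<Rightarrow> bool" where
  "wiso R A B \<longleftrightarrow> qdim A = qdim B \<and>
     (\<exists>f. linemb R (qdim A) (qdim A) f \<and> (\<forall>v\<in>vecs R (qdim A). qeval R B (f v) = qeval R A v))"

text \<open>Existence of a totally isotropic subspace of dimension \<open>d\<close>. Only values of
  the quadratic form are required to vanish; in characteristic different from 2 the bilinear form
  then vanishes as well (\<open>bform_polar\<close>).\<close>

definition ti :: "('a, 'b) ring_scheme \<Rightarrow> 'a mat \<Rightarrow> nat \<Rightarrow> bool" where
  "ti R A d \<longleftrightarrow> (\<exists>f. linemb R d (qdim A) f \<and> (\<forall>v\<in>vecs R d. qeval R A (f v) = \<zero>\<^bsub>R\<^esub>))"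

text \<open>An orthogonal family of anisotropic vectors. Comparing each vector with the later ones
  is enough for symmetric \<open>A\<close>.\<close>

definition orthl :: "('a, 'b) ring_scheme \<Rightarrow> 'a mat \<Rightarrow> 'a vec list \<Rightarrow> bool" where
  "orthl R A vs \<longleftrightarrow> sorted_wrt (\<lambda>u v. bform R A u v = \<zero>\<^bsub>R\<^esub>) vs \<and>
     (\<forall>v\<in>set vs. v \<in> vecs R (qdim A) \<and> qeval R A v \<noteq> \<zero>\<^bsub>R\<^esub>)"

lemma quad_form_sym: "quad_form R A \<Longrightarrow> sym_mat R A"
  by (simp add: quad_form_def sym_mat_def)

lemma sym_mat_mats: "sym_mat R A \<Longrightarrow> A \<in> mats R (qdim A) (qdim A)"
  by (simp add: sym_mat_def)

lemma wiso_dim: "wiso R A B \<Longrightarrow> qdim A = qdim B"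
  by (simp add: wiso_def)

lemma wiso_trans: "wiso R A B \<Longrightarrow> wiso R B C \<Longrightarrow> wiso R A C"
proof -
  assume "wiso R A B" "wiso R B C"
  then obtain f g where f: "linemb R (qdim A) (qdim A) f" "\<forall>v\<in>vecs R (qdim A). qeval R B (f v) = qeval R A v"
    and g: "linemb R (qdim A) (qdim A) g" "\<forall>v\<in>vecs R (qdim A). qeval R C (g v) = qeval R B v"
    and d: "qdim A = qdim C"
    by (auto simp: wiso_def)
  have "\<forall>v\<in>vecs R (qdim A). qeval R C (g (f v)) = qeval R A v"
    using f g linmap_closed[OF linemb_linmap[OF f(1)]] by simp
  then show "wiso R A C"
    unfolding wiso_def using linemb_comp[OF g(1) f(1)] d by blast
qed

lemma linemb_id: "linemb R n n (\<lambda>v. v)"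
  by (simp add: linemb_def linmap_def)

lemma ti_wiso: "ti R A d \<Longrightarrow> wiso R A B \<Longrightarrow> ti R B d"
proof -
  assume "ti R A d" "wiso R A B"
  then obtain f g where f: "linemb R d (qdim A) f" "\<forall>v\<in>vecs R d. qeval R A (f v) = \<zero>\<^bsub>R\<^esub>"
    and g: "linemb R (qdim A) (qdim A) g" "\<forall>v\<in>vecs R (qdim A). qeval R B (g v) = qeval R A v"
    and d: "qdim A = qdim B"
    by (auto simp: wiso_def ti_def)
  have "\<forall>v\<in>vecs R d. qeval R B (g (f v)) = \<zero>\<^bsub>R\<^esub>"
    using f g linmap_closed[OF linemb_linmap[OF f(1)]] by simp
  then show "ti R B d"
    unfolding ti_def using linemb_comp[OF g(1) f(1)] d by auto
qed

lemma mat_map_mats: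
  "A \<in> mats R m n \<Longrightarrow> (\<And>x. x \<in> carrier R \<Longrightarrow> f x \<in> carrier S) \<Longrightarrow> map_mat f A \<in> mats S m n"
proof -
  assume A: "A \<in> mats R m n" and f: "\<And>x. x \<in> carrier R \<Longrightarrow> f x \<in> carrier S"
  show "map_mat f A \<in> mats S m n"
    unfolding mats_def using mats_dim[OF A] mats_index[OF A] f
    by (intro CollectI conjI carrier_matI allI impI) simp_all
qed

definition vdrop :: "nat \<Rightarrow> nat \<Rightarrow> 'a vec \<Rightarrow> 'a vec" where
  "vdrop m n v = vec n (\<lambda>i. v $ (m + i))"

lemma diag_dim [simp]: "qdim (diag_form R as) = length as"
  by (simp add: diag_form_def)

lemma orth_sum_dim [simp]: "qdim (orth_sum R A B) = qdim A + qdim B"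
  by (simp add: orth_sum_def)

context cring
begin

lemma linfun_sum:
  assumes "\<And>i. i < n \<Longrightarrow> c i \<in> carrier R"
  shows "linfun R n (\<lambda>v. \<Oplus>i\<in>{..<n}. c i \<otimes> v $ i)"
  unfolding linfun_def
proof (intro conjI ballI)
  fix v assume v: "v \<in> vecs R n"
  then show "(\<Oplus>i\<in>{..<n}. c i \<otimes> v $ i) \<in> carrier R" using assms by (intro finsum_closed) auto
  fix u assume u: "u \<in> vecs R n"
  have "(\<Oplus>i\<in>{..<n}. c i \<otimes> vadd R v u $ i) = (\<Oplus>i\<in>{..<n}. c i \<otimes> v $ i \<oplus> c i \<otimes> u $ i)"
    using u v assms by (intro finsum_cong') (auto simp: r_distr)
  also have "\<dots> = (\<Oplus>i\<in>{..<n}. c i \<otimes> v $ i) \<oplus> (\<Oplus>i\<in>{..<n}. c i \<otimes> u $ i)"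
    using u v assms by (intro finsum_addf) auto
  finally show "(\<Oplus>i\<in>{..<n}. c i \<otimes> vadd R v u $ i) = (\<Oplus>i\<in>{..<n}. c i \<otimes> v $ i) \<oplus> (\<Oplus>i\<in>{..<n}. c i \<otimes> u $ i)" .
next
  fix a v assume a: "a \<in> carrier R" and v: "v \<in> vecs R n"
  have "(\<Oplus>i\<in>{..<n}. c i \<otimes> vscale R a v $ i) = (\<Oplus>i\<in>{..<n}. a \<otimes> (c i \<otimes> v $ i))"
    using a v assms by (intro finsum_cong') (auto simp: m_lcomm)
  also have "\<dots> = a \<otimes> (\<Oplus>i\<in>{..<n}. c i \<otimes> v $ i)"
    using a v assms by (intro finsum_rdistr[symmetric]) auto
  finally show "(\<Oplus>i\<in>{..<n}. c i \<otimes> vscale R a v $ i) = a \<otimes> (\<Oplus>i\<in>{..<n}. c i \<otimes> v $ i)" .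
qed

lemma bform_eq:
  assumes "A \<in> mats R n n" "v \<in> vecs R n" "w \<in> vecs R n"
  shows "bform R A v w = (\<Oplus>i\<in>{..<n}. v $ i \<otimes> apply_mat R A w $ i)"
proof -
  have "(\<Oplus>j\<in>{..<n}. A $$ (i, j) \<otimes> v $ i \<otimes> w $ j) = v $ i \<otimes> apply_mat R A w $ i" if i: "i < n" for i
  proof -
    have "(\<Oplus>j\<in>{..<n}. A $$ (i, j) \<otimes> v $ i \<otimes> w $ j) = (\<Oplus>j\<in>{..<n}. v $ i \<otimes> (A $$ (i, j) \<otimes> w $ j))"
      using assms i by (intro finsum_cong') (auto simp: m_ac)
    also have "\<dots> = v $ i \<otimes> (\<Oplus>j\<in>{..<n}. A $$ (i, j) \<otimes> w $ j)"
      using assms i by (intro finsum_rdistr[symmetric]) auto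
    finally show ?thesis using assms i by simp
  qed
  then show ?thesis
    using assms vecs_index[OF apply_mat_vecs[OF assms(1,3)]]
    unfolding bform_def mats_dim(1)[OF assms(1)] by (intro finsum_cong') (auto simp del: apply_mat_index)
qed

lemma linfun_bform_right:
  assumes "A \<in> mats R n n" "v \<in> vecs R n"
  shows "linfun R n (\<lambda>w. bform R A v w)"
proof -
  have "linfun R n (\<lambda>w. \<Oplus>i\<in>{..<n}. v $ i \<otimes> apply_mat R A w $ i)"
    using linfun_comp[OF linfun_sum[of n "\<lambda>i. v $ i"] linmap_apply_mat[OF assms(1)]] assms by simp
  then show ?thesis using bform_eq[OF assms] unfolding linfun_def by simp
qed

lemma linfun_bform_left:
  assumes "A \<in> mats R n n" "w \<in> vecs R n"
  shows "linfun R n (\<lambda>v. bform R A v w)"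
proof -
  note aw = apply_mat_vecs[OF assms]
  have "linfun R n (\<lambda>v. \<Oplus>i\<in>{..<n}. apply_mat R A w $ i \<otimes> v $ i)"
    using aw by (intro linfun_sum) (auto simp del: apply_mat_index)
  moreover have "bform R A v w = (\<Oplus>i\<in>{..<n}. apply_mat R A w $ i \<otimes> v $ i)" if v: "v \<in> vecs R n" for v
    unfolding bform_eq[OF assms(1) v assms(2)] using v vecs_index[OF aw]
    by (intro finsum_cong') (auto simp: m_comm simp del: apply_mat_index)
  ultimately show ?thesis unfolding linfun_def by simp
qed

lemma bform_closed:
  "A \<in> mats R n n \<Longrightarrow> v \<in> vecs R n \<Longrightarrow> w \<in> vecs R n \<Longrightarrow> bform R A v w \<in> carrier R"
  using linfun_closed[OF linfun_bform_right] .

lemma qeval_closed: "A \<in> mats R n n \<Longrightarrow> v \<in> vecs R n \<Longrightarrow> qeval R A v \<in> carrier R"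
  unfolding qeval_def by (rule bform_closed)

lemma bform_sum:
  assumes "A \<in> mats R n n" "v \<in> vecs R n" "w \<in> vecs R n"
  shows "bform R A v w = (\<Oplus>j\<in>{..<n}. v $ j \<otimes> (\<Oplus>k\<in>{..<n}. w $ k \<otimes> A $$ (j, k)))"
proof -
  have "(\<Oplus>k\<in>{..<n}. w $ k \<otimes> A $$ (j, k)) = apply_mat R A w $ j" if "j < n" for j
    unfolding apply_mat_index[OF assms(1) that]
    by (rule finsum_cong') (use assms that in \<open>auto simp: m_comm\<close>)
  then show ?thesis
    unfolding bform_eq[OF assms] using assms(2) vecs_index[OF apply_mat_vecs[OF assms(1,3)]]
    by (intro finsum_cong') (auto simp del: apply_mat_index)
qed

lemma bform_commute:
  assumes A: "sym_mat R A" and v: "v \<in> vecs R (qdim A)" and w: "w \<in> vecs R (qdim A)"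
  shows "bform R A v w = bform R A w v"
proof -
  let ?n = "qdim A"
  have M: "A \<in> mats R ?n ?n" and sy: "\<And>i j. i < ?n \<Longrightarrow> j < ?n \<Longrightarrow> A $$ (i, j) = A $$ (j, i)"
    using A by (auto simp: sym_mat_def)
  have "bform R A v w = (\<Oplus>i\<in>{..<?n}. apply_mat R A w $ i \<otimes> v $ i)"
    unfolding bform_eq[OF M v w] using v vecs_index[OF apply_mat_vecs[OF M w]]
    by (intro finsum_cong') (auto simp: m_comm simp del: apply_mat_index)
  also have "\<dots> = bform R A w v"
  proof -
    have lf: "linfun R ?n (\<lambda>w. \<Oplus>i\<in>{..<?n}. v $ i \<otimes> apply_mat R A w $ i)"
      using linfun_comp[OF linfun_sum[of ?n "\<lambda>i. v $ i"] linmap_apply_mat[OF M]] v by simp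
    have co: "apply_mat R A (uvec R ?n j) $ i = A $$ (i, j)" if "i < ?n" "j < ?n" for i j
      unfolding apply_mat_uvec[OF M that(2)] using that mats_dim(2)[OF M] by simp
    have "(\<Oplus>i\<in>{..<?n}. apply_mat R A w $ i \<otimes> v $ i) = (\<Oplus>i\<in>{..<?n}. v $ i \<otimes> apply_mat R A w $ i)"
      using v vecs_index[OF apply_mat_vecs[OF M w]]
      by (intro finsum_cong') (auto simp: m_comm simp del: apply_mat_index)
    also have "\<dots> = (\<Oplus>j\<in>{..<?n}. w $ j \<otimes> (\<Oplus>i\<in>{..<?n}. v $ i \<otimes> apply_mat R A (uvec R ?n j) $ i))"
      by (rule linfun_expand[OF lf w])
    also have "\<dots> = (\<Oplus>j\<in>{..<?n}. w $ j \<otimes> (\<Oplus>i\<in>{..<?n}. v $ i \<otimes> A $$ (j, i)))"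
    proof (rule finsum_cong')
      fix j assume j: "j \<in> {..<?n}"
      have "(\<Oplus>i\<in>{..<?n}. v $ i \<otimes> apply_mat R A (uvec R ?n j) $ i) = (\<Oplus>i\<in>{..<?n}. v $ i \<otimes> A $$ (j, i))"
        using j v M sy by (intro finsum_cong') (auto simp: co simp del: apply_mat_index)
      then show "w $ j \<otimes> (\<Oplus>i\<in>{..<?n}. v $ i \<otimes> apply_mat R A (uvec R ?n j) $ i) =
        w $ j \<otimes> (\<Oplus>i\<in>{..<?n}. v $ i \<otimes> A $$ (j, i))" by simp
    qed (use M v w in \<open>auto intro!: m_closed finsum_closed\<close>)
    finally show ?thesis unfolding bform_sum[OF M w v] .
  qed
  finally show ?thesis .
qed

lemma gram_mats: "A \<in> mats R n n \<Longrightarrow> T \<in> mats R n m \<Longrightarrow> gram R A T \<in> mats R m m"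
  unfolding gram_def by (auto simp: mats_dim intro!: mats_matI bform_closed)

lemma bform_gram:
  assumes A: "A \<in> mats R n n" and T: "T \<in> mats R n m" and v: "v \<in> vecs R m" and w: "w \<in> vecs R m"
  shows "bform R A (apply_mat R T v) (apply_mat R T w) = bform R (gram R A T) v w"
proof -
  have cT: "\<And>j. j < m \<Longrightarrow> col T j \<in> vecs R n" using T by simp
  have "bform R A (apply_mat R T v) (apply_mat R T w) = (\<Oplus>j\<in>{..<m}. v $ j \<otimes> bform R A (col T j) (apply_mat R T w))"
    by (rule linfun_apply_mat[OF linfun_bform_left[OF A apply_mat_vecs[OF T w]] T v])
  also have "\<dots> = (\<Oplus>j\<in>{..<m}. v $ j \<otimes> (\<Oplus>k\<in>{..<m}. w $ k \<otimes> gram R A T $$ (j, k)))"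
  proof (rule finsum_cong')
    fix j assume j: "j \<in> {..<m}"
    have "bform R A (col T j) (apply_mat R T w) = (\<Oplus>k\<in>{..<m}. w $ k \<otimes> bform R A (col T j) (col T k))"
      using j by (intro linfun_apply_mat[OF linfun_bform_right[OF A cT] T w]) simp
    also have "\<dots> = (\<Oplus>k\<in>{..<m}. w $ k \<otimes> gram R A T $$ (j, k))"
      using j w A cT by (intro finsum_cong') (auto simp: gram_def mats_dim[OF T] intro!: m_closed bform_closed[OF A])
    finally show "v $ j \<otimes> bform R A (col T j) (apply_mat R T w) = v $ j \<otimes> (\<Oplus>k\<in>{..<m}. w $ k \<otimes> gram R A T $$ (j, k))"
      by simp
  qed (use v w gram_mats[OF A T] in \<open>auto intro!: m_closed finsum_closed\<close>)
  also have "\<dots> = bform R (gram R A T) v w"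
    by (rule bform_sum[OF gram_mats[OF A T] v w, symmetric])
  finally show ?thesis .
qed

lemma bform_add_left:
  "A \<in> mats R n n \<Longrightarrow> u \<in> vecs R n \<Longrightarrow> v \<in> vecs R n \<Longrightarrow> w \<in> vecs R n \<Longrightarrow>
   bform R A (vadd R u v) w = bform R A u w \<oplus> bform R A v w"
  using linfun_add[OF linfun_bform_left] by blast

lemma bform_add_right:
  "A \<in> mats R n n \<Longrightarrow> u \<in> vecs R n \<Longrightarrow> v \<in> vecs R n \<Longrightarrow> w \<in> vecs R n \<Longrightarrow>
   bform R A w (vadd R u v) = bform R A w u \<oplus> bform R A w v"
  using linfun_add[OF linfun_bform_right] by blast

lemma bform_scale_left:
  "A \<in> mats R n n \<Longrightarrow> c \<in> carrier R \<Longrightarrow> v \<in> vecs R n \<Longrightarrow> w \<in> vecs R n \<Longrightarrow>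
   bform R A (vscale R c v) w = c \<otimes> bform R A v w"
  using linfun_scale[OF linfun_bform_left] by blast

lemma bform_scale_right:
  "A \<in> mats R n n \<Longrightarrow> c \<in> carrier R \<Longrightarrow> v \<in> vecs R n \<Longrightarrow> w \<in> vecs R n \<Longrightarrow>
   bform R A w (vscale R c v) = c \<otimes> bform R A w v"
  using linfun_scale[OF linfun_bform_right] by blast

lemma qeval_zvec: "A \<in> mats R n n \<Longrightarrow> qeval R A (zvec R n) = \<zero>"
  unfolding qeval_def using linfun_zero[OF linfun_bform_left, of A n "zvec R n"] by simp

lemma qeval_scale:
  assumes "A \<in> mats R n n" "c \<in> carrier R" "v \<in> vecs R n"
  shows "qeval R A (vscale R c v) = c \<otimes> c \<otimes> qeval R A v"
  using assms bform_closed[OF assms(1,3,3)] unfolding qeval_def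
  by (simp add: bform_scale_left[of A n] bform_scale_right[of A n] m_assoc)

lemma qeval_add:
  assumes A: "sym_mat R A" and u: "u \<in> vecs R (qdim A)" and v: "v \<in> vecs R (qdim A)"
  shows "qeval R A (vadd R u v) = qeval R A u \<oplus> qeval R A v \<oplus> (bform R A u v \<oplus> bform R A u v)"
proof -
  note M = sym_mat_mats[OF A]
  have "qeval R A (vadd R u v) = (bform R A u u \<oplus> bform R A v u) \<oplus> (bform R A u v \<oplus> bform R A v v)"
    using u v unfolding qeval_def
    by (simp add: bform_add_left[OF M] bform_add_right[OF M])
  also have "bform R A v u = bform R A u v" by (rule bform_commute[OF A v u])
  finally show ?thesis
    using bform_closed[OF M u v] bform_closed[OF M u u] bform_closed[OF M v v]
    unfolding qeval_def by (simp add: a_assoc a_comm[of "bform R A v v"])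
qed

lemma diag_mats: "set as \<subseteq> carrier R \<Longrightarrow> diag_form R as \<in> mats R (length as) (length as)"
  unfolding diag_form_def by (rule mats_matI) (auto simp: subset_iff)

lemma diag_sym: "set as \<subseteq> carrier R \<Longrightarrow> sym_mat R (diag_form R as)"
  using diag_mats by (auto simp: sym_mat_def diag_form_def)

lemma bform_diag:
  assumes as: "set as \<subseteq> carrier R" and v: "v \<in> vecs R (length as)" and w: "w \<in> vecs R (length as)"
  shows "bform R (diag_form R as) v w = (\<Oplus>i\<in>{..<length as}. as ! i \<otimes> v $ i \<otimes> w $ i)"
proof -
  have a: "as ! i \<in> carrier R" if "i < length as" for i using as that by (auto simp: subset_iff)
  have "(\<Oplus>j\<in>{..<length as}. diag_form R as $$ (i, j) \<otimes> v $ i \<otimes> w $ j) = as ! i \<otimes> v $ i \<otimes> w $ i"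
    if i: "i < length as" for i
  proof -
    have "(\<Oplus>j\<in>{..<length as}. diag_form R as $$ (i, j) \<otimes> v $ i \<otimes> w $ j) =
      (\<Oplus>j\<in>{..<length as}. if j = i then as ! i \<otimes> v $ i \<otimes> w $ j else \<zero>)"
      using i a v w by (intro finsum_cong') (auto simp: diag_form_def)
    also have "\<dots> = as ! i \<otimes> v $ i \<otimes> w $ i"
      using i a v w by (subst finsum_delta) auto
    finally show ?thesis .
  qed
  then show ?thesis unfolding bform_def diag_dim using a v w by (intro finsum_cong') auto
qed

lemma qeval_diag:
  assumes "set as \<subseteq> carrier R" "v \<in> vecs R (length as)"
  shows "qeval R (diag_form R as) v = (\<Oplus>i\<in>{..<length as}. as ! i \<otimes> v $ i \<otimes> v $ i)"
  unfolding qeval_def by (rule bform_diag[OF assms assms(2)])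

lemma bform_diag_uvec:
  assumes as: "set as \<subseteq> carrier R" and v: "v \<in> vecs R (length as)" and i: "i < length as"
  shows "bform R (diag_form R as) v (uvec R (length as) i) = as ! i \<otimes> v $ i"
proof -
  have a: "as ! i \<in> carrier R" if "i < length as" for i using as that by (auto simp: subset_iff)
  have "(\<Oplus>j\<in>{..<length as}. as ! j \<otimes> v $ j \<otimes> uvec R (length as) i $ j) =
    (\<Oplus>j\<in>{..<length as}. if j = i then as ! j \<otimes> v $ j else \<zero>)"
    using a v by (intro finsum_cong') auto
  also have "\<dots> = as ! i \<otimes> v $ i" using a v i by (subst finsum_delta) auto
  finally show ?thesis using bform_diag[OF as v, of "uvec R (length as) i"] by simp
qed

lemma finsum_lessThan_add:
  fixes m n :: nat
  assumes "\<And>i. i < m + n \<Longrightarrow> f i \<in> carrier R"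
  shows "(\<Oplus>i\<in>{..<m + n}. f i) = (\<Oplus>i\<in>{..<m}. f i) \<oplus> (\<Oplus>i\<in>{..<n}. f (m + i))"
proof -
  have "(\<Oplus>i\<in>{..<m + k}. f i) = (\<Oplus>i\<in>{..<m}. f i) \<oplus> (\<Oplus>i\<in>{..<k}. f (m + i))" if "k \<le> n" for k
    using that
proof (induction k)
  case 0
  then show ?case using assms by (simp add: finsum_closed Pi_def)
next
  case (Suc k)
  then show ?case using assms
    by (simp add: lessThan_Suc finsum_insert finsum_closed Pi_def a_ac)
qed
  then show ?thesis by simp
qed

lemma vdrop_vecs [simp]: "v \<in> vecs R (m + n) \<Longrightarrow> vdrop m n v \<in> vecs R n"
  unfolding vdrop_def by (rule vecs_vecI) simp

lemma vtake_vecs [simp]: "v \<in> vecs R n \<Longrightarrow> m \<le> n \<Longrightarrow> vec m (($) v) \<in> vecs R m"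
  by (rule vecs_vecI) simp

lemma vdrop_linmap: "linmap R (m + n) n (vdrop m n)"
  unfolding linmap_def
  using vdrop_vecs by (auto intro!: eq_vecI) (auto simp: vdrop_def)

lemma append_vecs [simp]: "u \<in> vecs R m \<Longrightarrow> v \<in> vecs R n \<Longrightarrow> u @\<^sub>v v \<in> vecs R (m + n)"
  unfolding append_vec_def Let_def by (auto intro!: vecs_vecI)

lemma append_index: "u \<in> vecs R m \<Longrightarrow> v \<in> vecs R n \<Longrightarrow> i < m + n \<Longrightarrow> (u @\<^sub>v v) $ i = (if i < m then u $ i else v $ (i - m))"
  by (simp add: append_vec_def)

lemma take_append [simp]: "u \<in> vecs R m \<Longrightarrow> v \<in> vecs R n \<Longrightarrow> vec m (($) (u @\<^sub>v v)) = u"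
  by (intro eq_vecI) (auto simp: append_index)

lemma drop_append [simp]: "u \<in> vecs R m \<Longrightarrow> v \<in> vecs R n \<Longrightarrow> vdrop m n (u @\<^sub>v v) = v"
  unfolding vdrop_def by (intro eq_vecI) (auto simp: append_index)

lemma append_zero_iff:
  assumes "u \<in> vecs R m" "v \<in> vecs R n"
  shows "u @\<^sub>v v = zvec R (m + n) \<longleftrightarrow> u = zvec R m \<and> v = zvec R n"
proof
  assume z: "u @\<^sub>v v = zvec R (m + n)"
  have "vec m (($) (u @\<^sub>v v)) = zvec R m" unfolding z by (intro eq_vecI) auto
  moreover have "vdrop m n (u @\<^sub>v v) = zvec R n" unfolding z vdrop_def by (intro eq_vecI) auto
  ultimately show "u = zvec R m \<and> v = zvec R n" using assms by simp
next
  assume "u = zvec R m \<and> v = zvec R n"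
  then show "u @\<^sub>v v = zvec R (m + n)" by (intro eq_vecI) auto
qed

lemma append_take_drop: "v \<in> vecs R (m + n) \<Longrightarrow> vec m (($) v) @\<^sub>v vdrop m n v = v"
  by (intro eq_vecI) (auto simp: vdrop_def)

lemma linmap_append:
  assumes f: "linmap R k m f" and g: "linmap R k n g"
  shows "linmap R k (m + n) (\<lambda>v. f v @\<^sub>v g v)"
  unfolding linmap_def
proof (intro conjI ballI)
  fix v assume v: "v \<in> vecs R k"
  note fv = linmap_closed[OF f v] and gv = linmap_closed[OF g v]
  then show "f v @\<^sub>v g v \<in> vecs R (m + n)" by simp
  fix u assume u: "u \<in> vecs R k"
  note fu = linmap_closed[OF f u] and gu = linmap_closed[OF g u]
  show "f (vadd R v u) @\<^sub>v g (vadd R v u) = vadd R (f v @\<^sub>v g v) (f u @\<^sub>v g u)"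
    unfolding linmap_add[OF f v u] linmap_add[OF g v u]
    using fu fv gu gv by (intro eq_vecI) auto
next
  fix c v assume c: "c \<in> carrier R" and v: "v \<in> vecs R k"
  note fv = linmap_closed[OF f v] and gv = linmap_closed[OF g v]
  show "f (vscale R c v) @\<^sub>v g (vscale R c v) = vscale R c (f v @\<^sub>v g v)"
    unfolding linmap_scale[OF f c v] linmap_scale[OF g c v]
    using fv gv by (intro eq_vecI) auto
qed

lemma orth_sum_mats:
  "A \<in> mats R m m \<Longrightarrow> B \<in> mats R n n \<Longrightarrow> orth_sum R A B \<in> mats R (m + n) (m + n)"
  unfolding orth_sum_def by (auto simp: mats_dim intro!: mats_matI)

lemma bform_orth_sum:
  assumes A: "A \<in> mats R m m" and B: "B \<in> mats R n n"
    and v: "v \<in> vecs R (m + n)" and w: "w \<in> vecs R (m + n)"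
  shows "bform R (orth_sum R A B) v w =
    bform R A (vec m (($) v)) (vec m (($) w)) \<oplus> bform R B (vdrop m n v) (vdrop m n w)"
proof -
  note O = orth_sum_mats[OF A B]
  note d = mats_dim[OF A] mats_dim[OF B]
  let ?t = "\<lambda>i j. orth_sum R A B $$ (i, j) \<otimes> v $ i \<otimes> w $ j"
  have cl: "?t i j \<in> carrier R" if "i < m + n" "j < m + n" for i j using O v w that by auto
  have fz: "(\<Oplus>j\<in>I. f j) = \<zero>" if "\<And>j. j \<in> I \<Longrightarrow> f j = \<zero>" for f and I :: "nat set"
  proof -
    have "(\<Oplus>j\<in>I. f j) = (\<Oplus>j\<in>I. \<zero>)" by (rule finsum_cong') (use that in auto)
    then show ?thesis by (simp add: finsum_zero)
  qed
  have row1: "(\<Oplus>j\<in>{..<m + n}. ?t i j) = (\<Oplus>j\<in>{..<m}. A $$ (i, j) \<otimes> v $ i \<otimes> w $ j)" if i: "i < m" for i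
  proof -
    have "(\<Oplus>j\<in>{..<m + n}. ?t i j) = (\<Oplus>j\<in>{..<m}. ?t i j) \<oplus> (\<Oplus>j\<in>{..<n}. ?t i (m + j))"
      using i cl by (intro finsum_lessThan_add) auto
    also have "(\<Oplus>j\<in>{..<n}. ?t i (m + j)) = \<zero>"
      using i v w by (intro fz) (auto simp: orth_sum_def d)
    also have "(\<Oplus>j\<in>{..<m}. ?t i j) = (\<Oplus>j\<in>{..<m}. A $$ (i, j) \<otimes> v $ i \<otimes> w $ j)"
      using i v w A by (intro finsum_cong') (auto simp: orth_sum_def d)
    finally show ?thesis using i v w A by (simp add: finsum_closed Pi_def)
  qed
  have row2: "(\<Oplus>j\<in>{..<m + n}. ?t (m + i) j) = (\<Oplus>j\<in>{..<n}. B $$ (i, j) \<otimes> v $ (m + i) \<otimes> w $ (m + j))" if i: "i < n" for i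
  proof -
    have "(\<Oplus>j\<in>{..<m + n}. ?t (m + i) j) = (\<Oplus>j\<in>{..<m}. ?t (m + i) j) \<oplus> (\<Oplus>j\<in>{..<n}. ?t (m + i) (m + j))"
      using i cl by (intro finsum_lessThan_add) auto
    also have "(\<Oplus>j\<in>{..<m}. ?t (m + i) j) = \<zero>"
      using i v w by (intro fz) (auto simp: orth_sum_def d)
    also have "(\<Oplus>j\<in>{..<n}. ?t (m + i) (m + j)) = (\<Oplus>j\<in>{..<n}. B $$ (i, j) \<otimes> v $ (m + i) \<otimes> w $ (m + j))"
      using i v w B by (intro finsum_cong') (auto simp: orth_sum_def d)
    finally show ?thesis using i v w B by (simp add: finsum_closed Pi_def)
  qed
  have "bform R (orth_sum R A B) v w =
    (\<Oplus>i\<in>{..<m}. \<Oplus>j\<in>{..<m + n}. ?t i j) \<oplus> (\<Oplus>i\<in>{..<n}. \<Oplus>j\<in>{..<m + n}. ?t (m + i) j)"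
    unfolding bform_def orth_sum_dim d
    using cl by (intro finsum_lessThan_add finsum_closed) auto
  also have "(\<Oplus>i\<in>{..<m}. \<Oplus>j\<in>{..<m + n}. ?t i j) = bform R A (vec m (($) v)) (vec m (($) w))"
    unfolding bform_def d
  proof (rule finsum_cong')
    fix i assume i: "i \<in> {..<m}"
    then have im: "i < m" by simp
    show "(\<Oplus>j\<in>{..<m + n}. ?t i j) = (\<Oplus>j\<in>{..<m}. A $$ (i, j) \<otimes> vec m (($) v) $ i \<otimes> vec m (($) w) $ j)"
      unfolding row1[OF im] using im v w A by (intro finsum_cong') auto
  qed (use A v w in \<open>auto intro!: finsum_closed\<close>)
  also have "(\<Oplus>i\<in>{..<n}. \<Oplus>j\<in>{..<m + n}. ?t (m + i) j) = bform R B (vdrop m n v) (vdrop m n w)"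
    unfolding bform_def d
  proof (rule finsum_cong')
    fix i assume i: "i \<in> {..<n}"
    then have im: "i < n" by simp
    show "(\<Oplus>j\<in>{..<m + n}. ?t (m + i) j) = (\<Oplus>j\<in>{..<n}. B $$ (i, j) \<otimes> vdrop m n v $ i \<otimes> vdrop m n w $ j)"
      unfolding row2[OF im] using im v w B by (intro finsum_cong') (auto simp: vdrop_def)
  qed (use B v w in \<open>auto simp: vdrop_def intro!: finsum_closed\<close>)
  finally show ?thesis .
qed

lemma qeval_orth_sum:
  assumes "A \<in> mats R m m" "B \<in> mats R n n" "v \<in> vecs R (m + n)"
  shows "qeval R (orth_sum R A B) v = qeval R A (vec m (($) v)) \<oplus> qeval R B (vdrop m n v)"
  unfolding qeval_def by (rule bform_orth_sum[OF assms assms(3)])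

lemma diag_append: "diag_form R (as @ bs) = orth_sum R (diag_form R as) (diag_form R bs)"
  by (intro eq_matI) (auto simp: diag_form_def orth_sum_def nth_append)

lemma wiso_orth_sum:
  assumes "wiso R A B" "A \<in> mats R (qdim A) (qdim A)" "B \<in> mats R (qdim B) (qdim B)" "C \<in> mats R (qdim C) (qdim C)"
  shows "wiso R (orth_sum R A C) (orth_sum R B C)"
proof -
  let ?m = "qdim A" and ?n = "qdim C"
  have d: "qdim B = ?m" and B: "B \<in> mats R ?m ?m" using assms by (auto simp: wiso_def)
  obtain f where f: "linemb R ?m ?m f" "\<forall>v\<in>vecs R ?m. qeval R B (f v) = qeval R A v"
    using assms by (auto simp: wiso_def)
  note L = linemb_linmap[OF f(1)]
  define g where "g v = f (vec ?m (($) v)) @\<^sub>v vdrop ?m ?n v" for v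
  have t: "linmap R (?m + ?n) ?m (\<lambda>v. vec ?m (($) v))" by (rule linmap_take) simp
  have gl: "linmap R (?m + ?n) (?m + ?n) g"
    unfolding g_def by (rule linmap_append[OF linmap_comp[OF L t] vdrop_linmap])
  have parts: "vec ?m (($) (g v)) = f (vec ?m (($) v)) \<and> vdrop ?m ?n (g v) = vdrop ?m ?n v \<and> f (vec ?m (($) v)) \<in> vecs R ?m"
    if v: "v \<in> vecs R (?m + ?n)" for v
    using linmap_closed[OF L linmap_closed[OF t v]] v take_append[of _ ?m _ ?n] drop_append[of _ ?m _ ?n] vdrop_vecs[OF v]
    unfolding g_def by blast
  have "v = zvec R (?m + ?n)" if v: "v \<in> vecs R (?m + ?n)" and z: "g v = zvec R (?m + ?n)" for v
  proof -
    have tv: "vec ?m (($) v) \<in> vecs R ?m" using linmap_closed[OF t v] .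
    have "f (vec ?m (($) v)) = zvec R ?m" "vdrop ?m ?n v = zvec R ?n"
      using z append_zero_iff[of "f (vec ?m (($) v))" ?m "vdrop ?m ?n v" ?n] parts[OF v] v unfolding g_def by auto
    then have "vec ?m (($) v) = zvec R ?m" "vdrop ?m ?n v = zvec R ?n"
      using f(1) tv by (auto simp: linemb_def)
    then show ?thesis using append_take_drop[OF v] append_zero_iff[of "zvec R ?m" ?m "zvec R ?n" ?n] by simp
  qed
  then have "linemb R (?m + ?n) (?m + ?n) g" using gl by (simp add: linemb_def)
  moreover have "qeval R (orth_sum R B C) (g v) = qeval R (orth_sum R A C) v" if v: "v \<in> vecs R (?m + ?n)" for v
    using parts[OF v] f(2) linmap_closed[OF t v]
    by (simp add: qeval_orth_sum[OF B assms(4) linmap_closed[OF gl v]] qeval_orth_sum[OF assms(2,4) v])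
  ultimately show ?thesis by (auto simp: wiso_def d)
qed

lemma isometric_wiso: 
  assumes "isometric R A B" shows "wiso R A B"
proof -
  obtain T where T: "qdim A = qdim B" "T \<in> mats R (qdim A) (qdim A)"
    "bij_betw (apply_mat R T) (vecs R (qdim A)) (vecs R (qdim A))"
    "\<forall>v\<in>vecs R (qdim A). qeval R B (apply_mat R T v) = qeval R A v"
    using assms by (auto simp: isometric_def)
  have L: "linmap R (qdim A) (qdim A) (apply_mat R T)" using linmap_apply_mat[OF T(2)] .
  have "v = zvec R (qdim A)" if "v \<in> vecs R (qdim A)" "apply_mat R T v = zvec R (qdim A)" for v
    using bij_betw_imp_inj_on[OF T(3)] linmap_zero[OF L] that zvec_vecs unfolding inj_on_def by metis
  then show ?thesis using T L by (auto simp: wiso_def linemb_def)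
qed

end

section \<open>Isometries over a field and echelon bases\<close>

context field
begin

lemma linmap_neg: "linmap R m n f \<Longrightarrow> u \<in> vecs R m \<Longrightarrow> v \<in> vecs R m \<Longrightarrow> f u = f v \<Longrightarrow>
  f (vadd R u (vscale R (\<ominus> \<one>) v)) = zvec R n"
proof -
  assume f: "linmap R m n f" and u: "u \<in> vecs R m" and v: "v \<in> vecs R m" and e: "f u = f v"
  have "f (vadd R u (vscale R (\<ominus> \<one>) v)) = vadd R (f v) (vscale R (\<ominus> \<one>) (f v))"
    using u v e by (simp add: linmap_add[OF f] linmap_scale[OF f])
  also have "\<dots> = zvec R n"
    using linmap_closed[OF f v] by (intro vecs_eqI[of _ R n]) (auto simp: l_minus r_neg)
  finally show ?thesis .
qed

lemma linemb_inj:
  assumes f: "linemb R m n f" shows "inj_on f (vecs R m)"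
proof (rule inj_onI)
  fix u v assume u: "u \<in> vecs R m" and v: "v \<in> vecs R m" and e: "f u = f v"
  have "vadd R u (vscale R (\<ominus> \<one>) v) = zvec R m"
    using linmap_neg[OF linemb_linmap[OF f] u v e] f u v by (simp add: linemb_def)
  then have "(vadd R u (vscale R (\<ominus> \<one>) v)) $ i = \<zero>" if "i < m" for i using that by simp
  then have "u $ i = v $ i" if "i < m" for i
    using that u v r_right_minus_eq[of "u $ i" "v $ i"] by (auto simp: l_minus a_minus_def)
  then show "u = v" using u v by (intro vecs_eqI[of u R m])
qed

lemma linemb_bij: "linemb R n n f \<Longrightarrow> bij_betw f (vecs R n) (vecs R n)"
  using linemb_inj[of n n f] linemb_surj[of n f] linmap_closed[OF linemb_linmap, of R n n f]
  unfolding bij_betw_def by auto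

lemma wiso_isometric:
  assumes "wiso R A B" shows "isometric R A B"
proof -
  let ?n = "qdim A"
  obtain f where f: "linemb R ?n ?n f" "\<forall>v\<in>vecs R ?n. qeval R B (f v) = qeval R A v" "?n = qdim B"
    using assms by (auto simp: wiso_def)
  obtain T where T: "T \<in> mats R ?n ?n" "\<forall>v\<in>vecs R ?n. apply_mat R T v = f v"
    using linmap_matrix[OF linemb_linmap[OF f(1)]] by auto
  have "bij_betw (apply_mat R T) (vecs R ?n) (vecs R ?n)"
    using linemb_bij[OF f(1)] T(2) bij_betw_cong[of "vecs R ?n" "apply_mat R T" f] by simp
  then show ?thesis using T f by (auto simp: isometric_def)
qed

lemma linemb_inverse:
  assumes f: "linemb R n n f"
  shows "\<exists>g. linemb R n n g \<and> (\<forall>v\<in>vecs R n. f (g v) = v)"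
proof -
  define g where "g = inv_into (vecs R n) f"
  note L = linemb_linmap[OF f] and I = linemb_inj[OF f]
  have im: "f ` vecs R n = vecs R n" using linemb_bij[OF f] by (simp add: bij_betw_def)
  have g: "g v \<in> vecs R n" "f (g v) = v" if "v \<in> vecs R n" for v
    using that im inv_into_into[of v f "vecs R n"] f_inv_into_f[of v f "vecs R n"] by (auto simp: g_def)
  have gf: "g (f v) = v" if "v \<in> vecs R n" for v
    using I that by (simp add: g_def)
  have "g (vadd R u v) = vadd R (g u) (g v)" if "u \<in> vecs R n" "v \<in> vecs R n" for u v
    using gf[of "vadd R (g u) (g v)"] linmap_add[OF L, of "g u" "g v"] g that by simp
  moreover have "g (vscale R c v) = vscale R c (g v)" if "c \<in> carrier R" "v \<in> vecs R n" for c v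
    using gf[of "vscale R c (g v)"] linmap_scale[OF L, of c "g v"] g that by simp
  ultimately have "linmap R n n g" using g by (simp add: linmap_def)
  moreover have "v = zvec R n" if "v \<in> vecs R n" "g v = zvec R n" for v
    using g(2)[OF that(1)] that(2) linmap_zero[OF L] by simp
  ultimately show ?thesis using g by (auto simp: linemb_def)
qed

lemma wiso_sym:
  assumes "wiso R A B" shows "wiso R B A"
proof -
  let ?n = "qdim A"
  obtain f where f: "linemb R ?n ?n f" "\<forall>v\<in>vecs R ?n. qeval R B (f v) = qeval R A v" "?n = qdim B"
    using assms by (auto simp: wiso_def)
  obtain g where g: "linemb R ?n ?n g" "\<forall>v\<in>vecs R ?n. f (g v) = v"
    using linemb_inverse[OF f(1)] by auto
  have "qeval R A (g v) = qeval R B v" if "v \<in> vecs R ?n" for v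
    using f(2) g that linmap_closed[OF linemb_linmap[OF g(1)] that] by metis
  then show ?thesis using g f(3) by (auto simp: wiso_def)
qed

lemma wiso_anisotropic:
  assumes "wiso R A B" "anisotropic R B" shows "anisotropic R A"
  using assms unfolding wiso_def anisotropic_def linemb_def
  by (metis linmap_closed)

text \<open>Reduced echelon form: after a change of parameters the coordinates at the pivots
  \<open>p\<close> form the identity matrix. In \<open>ti_specialize\<close> this block is what
  keeps a basis independent after specialisation.\<close>

lemma linemb_echelon:
  assumes "linemb R d n f"
  shows "\<exists>g p. linmap R d d g \<and> (\<forall>j<d. p j < n) \<and> (\<forall>v\<in>vecs R d. \<forall>j<d. f (g v) $ p j = v $ j)"
  using assms
proof (induction d arbitrary: f)
  case 0
  then show ?case using linemb_id[of R 0] by (auto simp: linemb_def)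
next
  case (Suc d)
  note L = linemb_linmap[OF Suc.prems]
  have nz: "uvec R (Suc d) 0 \<noteq> zvec R (Suc d)"
  proof
    assume "uvec R (Suc d) 0 = zvec R (Suc d)"
    then have "uvec R (Suc d) 0 $ 0 = zvec R (Suc d) $ 0" by simp
    then show False by simp
  qed
  let ?w = "f (uvec R (Suc d) 0)"
  have w: "?w \<in> vecs R n" using linmap_closed[OF L] by simp
  have "?w \<noteq> zvec R n" using Suc.prems nz by (auto simp: linemb_def)
  then obtain p0 where p0: "p0 < n" "?w $ p0 \<noteq> \<zero>" using vec_nonzero_index[OF w] by blast
  have iv: "inv (?w $ p0) \<in> carrier R" "inv (?w $ p0) \<otimes> ?w $ p0 = \<one>"
    using p0 w field_Units by auto
  define x where "x = vscale R (inv (?w $ p0)) (uvec R (Suc d) 0)"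
  have x: "x \<in> vecs R (Suc d)" using iv by (simp add: x_def)
  have fx: "f x \<in> vecs R n" using linmap_closed[OF L x] .
  have fx1: "f x $ p0 = \<one>" using iv p0 w by (simp add: x_def linmap_scale[OF L])
  obtain h where h: "linemb R d (Suc d) h" "\<forall>v\<in>vecs R d. f (h v) $ p0 = \<zero>"
    using linfun_kernel[OF linfun_index[OF L p0(1)]] by auto
  note hL = linemb_linmap[OF h(1)]
  obtain g p where g: "linmap R d d g" "\<forall>j<d. p j < n" "\<forall>v\<in>vecs R d. \<forall>j<d. f (h (g v)) $ p j = v $ j"
    using Suc.IH[OF linemb_comp[OF Suc.prems h(1)]] by auto
  \<comment> \<open>The new basis vector \<open>x\<close> has the entry 1 at the new pivot
    \<open>p0\<close>, where all vectors coming through \<open>h\<close> vanish. Its entries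
    \<open>t\<close> at the old pivots are cleared by subtracting \<open>v $ d\<close> times
    \<open>t\<close> from the remaining parameters.\<close>
  define t where "t = vec d (\<lambda>k. f x $ p k)"
  have t: "t \<in> vecs R d" unfolding t_def using g(2) fx by (auto intro!: vecs_vecI)
  define r where "r v = vadd R (vec d (($) v)) (vscale R (\<ominus> (v $ d)) t)" for v
  have tk: "linmap R (Suc d) d (\<lambda>v. vec d (($) v))" by (rule linmap_take) simp
  have r: "linmap R (Suc d) d r"
    unfolding linmap_def r_def using t
    by (auto intro!: eq_vecI vadd_vecs vscale_vecs vtake_vecs
        simp: minus_add l_distr a_ac r_distr m_assoc r_minus l_minus) 
  define G where "G v = vadd R (h (g (r v))) (vscale R (v $ d) x)" for v
  have hgr: "linmap R (Suc d) (Suc d) (\<lambda>v. h (g (r v)))"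
    using linmap_comp[OF hL linmap_comp[OF g(1) r]] .
  have cl: "h (g (r v)) \<in> vecs R (Suc d)" if "v \<in> vecs R (Suc d)" for v
    using linmap_closed[OF hgr that] .
  have GL: "linmap R (Suc d) (Suc d) G"
    unfolding linmap_def
  proof (intro conjI ballI)
    fix v assume v: "v \<in> vecs R (Suc d)"
    then show "G v \<in> vecs R (Suc d)" using x cl by (simp add: G_def)
    fix u assume u: "u \<in> vecs R (Suc d)"
    show "G (vadd R v u) = vadd R (G v) (G u)"
      unfolding G_def linmap_add[OF hgr v u] using u v x cl[OF u] cl[OF v]
      by (intro vecs_eqI[of _ R "Suc d"]) (auto simp: l_distr a_ac)
  next
    fix c v assume c: "c \<in> carrier R" and v: "v \<in> vecs R (Suc d)"
    show "G (vscale R c v) = vscale R c (G v)"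
      unfolding G_def linmap_scale[OF hgr c v] using c v x cl[OF v]
      by (intro vecs_eqI[of _ R "Suc d"]) (auto simp: r_distr m_assoc)
  qed
  have "f (G v) $ (p(d := p0)) j = v $ j" if v: "v \<in> vecs R (Suc d)" and j: "j < Suc d" for v j
  proof -
    note hv = cl[OF v]
    note fh = linmap_closed[OF L hv]
    have rv: "r v \<in> vecs R d" using linmap_closed[OF r v] .
    have ix: "f (G v) $ k = f (h (g (r v))) $ k \<oplus> v $ d \<otimes> f x $ k" if "k < n" for k
      using v x hv fh fx that by (simp add: G_def linmap_add[OF L] linmap_scale[OF L])
    show ?thesis
    proof (cases "j = d")
      case True
      then show ?thesis
        using ix[OF p0(1)] h(2) linmap_closed[OF g(1) rv] fx1 v by simp
    next
      case False
      then have jd: "j < d" using j by simp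
      have "f (G v) $ p j = r v $ j \<oplus> v $ d \<otimes> f x $ p j"
        using ix[of "p j"] g(2,3) rv jd by simp
      also have "r v $ j = v $ j \<oplus> \<ominus> (v $ d) \<otimes> f x $ p j"
        using jd v t by (simp add: r_def t_def)
      also have "v $ j \<oplus> \<ominus> (v $ d) \<otimes> f x $ p j \<oplus> v $ d \<otimes> f x $ p j = v $ j"
        using jd v fx g(2) by (simp add: l_minus a_assoc l_neg)
      finally show ?thesis using False by simp
    qed
  qed
  then show ?case using GL g(2) p0(1)
    by (intro exI[of _ G] exI[of _ "p(d := p0)"]) auto
qed

end

section \<open>Orthogonal bases and the Witt decomposition\<close>

text \<open>Real fields and their extension fields satisfy this (\<open>real_inf_field\<close>,
  \<open>inf_field_homI\<close>). That 2 is nonzero gives polarisation and diagonalisation; infinity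
  of the field gives points where a nonzero polynomial does not vanish.\<close>

locale inf_field = field R for R (structure) +
  assumes two: "\<one> \<oplus> \<one> \<noteq> \<zero>" and infinite_carrier: "infinite (carrier R)"

text \<open>The diagonal of \<open>hyperbolic_form\<close> (see
  \<open>hyperbolic_form_eq\<close>).\<close>

definition alt :: "('a, 'b) ring_scheme \<Rightarrow> nat \<Rightarrow> 'a list" where
  "alt R m = concat (replicate m [\<one>\<^bsub>R\<^esub>, \<ominus>\<^bsub>R\<^esub> \<one>\<^bsub>R\<^esub>])"

lemma alt_0 [simp]: "alt R 0 = []"
  by (simp add: alt_def)

lemma alt_Suc: "alt R (Suc m) = [\<one>\<^bsub>R\<^esub>, \<ominus>\<^bsub>R\<^esub> \<one>\<^bsub>R\<^esub>] @ alt R m"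
  by (simp add: alt_def)

lemma alt_Suc': "alt R (Suc m) = alt R m @ [\<one>\<^bsub>R\<^esub>, \<ominus>\<^bsub>R\<^esub> \<one>\<^bsub>R\<^esub>]"
  by (induction m) (simp_all add: alt_Suc)

lemma length_alt [simp]: "length (alt R m) = 2 * m"
  by (induction m) (simp_all add: alt_Suc)

lemma linmap_vec:
  assumes "\<And>i. i < k \<Longrightarrow> linfun R n (\<phi> i)"
  shows "linmap R n k (\<lambda>v. vec k (\<lambda>i. \<phi> i v))"
  unfolding linmap_def
  using linfun_closed[OF assms] linfun_add[OF assms] linfun_scale[OF assms]
  by (auto intro!: vecs_vecI eq_vecI)

context cring
begin

lemma hyperbolic_form_eq: "hyperbolic_form R m = diag_form R (alt R m)"
  by (induction m) (simp_all add: hyperbolic_form_def alt_Suc diag_append[symmetric])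

lemma finsum_lessThan_mult:
  fixes m n :: nat
  assumes "\<And>a b. a < m \<Longrightarrow> b < n \<Longrightarrow> g a b \<in> carrier R"
  shows "(\<Oplus>i\<in>{..<m * n}. g (i div n) (i mod n)) = (\<Oplus>a\<in>{..<m}. \<Oplus>b\<in>{..<n}. g a b)"
proof -
  have "(\<Oplus>i\<in>{..<k * n}. g (i div n) (i mod n)) = (\<Oplus>a\<in>{..<k}. \<Oplus>b\<in>{..<n}. g a b)" if "k \<le> m" for k
    using that
  proof (induction k)
    case 0
    then show ?case by simp
  next
    case (Suc k)
    have cl: "g (i div n) (i mod n) \<in> carrier R" if "i < k * n + n" for i
    proof -
      have "i < Suc k * n" using that by simp
      then have "i div n < Suc k" by (rule less_mult_imp_div_less)
      moreover have "n > 0" using that by (cases n) auto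
      ultimately show ?thesis using Suc.prems assms by simp
    qed
    have "(\<Oplus>i\<in>{..<Suc k * n}. g (i div n) (i mod n)) = (\<Oplus>i\<in>{..<k * n + n}. g (i div n) (i mod n))"
      by (simp add: add.commute)
    also have "\<dots> = (\<Oplus>i\<in>{..<k * n}. g (i div n) (i mod n)) \<oplus> (\<Oplus>b\<in>{..<n}. g ((k * n + b) div n) ((k * n + b) mod n))"
      by (rule finsum_lessThan_add[OF cl])
    also have "(\<Oplus>b\<in>{..<n}. g ((k * n + b) div n) ((k * n + b) mod n)) = (\<Oplus>b\<in>{..<n}. g k b)"
      using assms Suc.prems by (intro finsum_cong') auto
    finally show ?case using Suc assms
      by (simp add: lessThan_Suc finsum_insert finsum_closed Pi_def a_comm)
  qed
  then show ?thesis by simp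
qed

lemma finsum_product:
  assumes "finite I" "finite J" "\<And>i. i \<in> I \<Longrightarrow> x i \<in> carrier R" "\<And>j. j \<in> J \<Longrightarrow> y j \<in> carrier R"
  shows "(\<Oplus>i\<in>I. \<Oplus>j\<in>J. x i \<otimes> y j) = (\<Oplus>i\<in>I. x i) \<otimes> (\<Oplus>j\<in>J. y j)"
proof -
  have Y: "(\<Oplus>j\<in>J. y j) \<in> carrier R" using assms by (intro finsum_closed) auto
  have "(\<Oplus>j\<in>J. x i \<otimes> y j) = x i \<otimes> (\<Oplus>j\<in>J. y j)" if "i \<in> I" for i
    using assms that by (intro finsum_rdistr[symmetric]) auto
  then have "(\<Oplus>i\<in>I. \<Oplus>j\<in>J. x i \<otimes> y j) = (\<Oplus>i\<in>I. x i \<otimes> (\<Oplus>j\<in>J. y j))"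
    using assms Y by (intro finsum_cong') auto
  also have "\<dots> = (\<Oplus>i\<in>I. x i) \<otimes> (\<Oplus>j\<in>J. y j)"
    using assms Y by (intro finsum_ldistr[symmetric]) auto
  finally show ?thesis .
qed

end

text \<open>The pure tensor of \<open>s\<close> and \<open>t\<close>, with the index convention of
  \<open>tensor_form\<close>.\<close>

definition tv :: "('a, 'b) ring_scheme \<Rightarrow> 'a vec \<Rightarrow> 'a vec \<Rightarrow> 'a vec" where
  "tv R s t = vec (dim_vec s * dim_vec t) (\<lambda>i. s $ (i div dim_vec t) \<otimes>\<^bsub>R\<^esub> t $ (i mod dim_vec t))"

text \<open>The diagonal of a tensor product of two diagonal forms (see
  \<open>tensor_diag\<close>).\<close>

definition tens :: "('a, 'b) ring_scheme \<Rightarrow> 'a list \<Rightarrow> 'a list \<Rightarrow> 'a list" where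
  "tens R as bs = concat (map (\<lambda>a. map (\<lambda>b. a \<otimes>\<^bsub>R\<^esub> b) bs) as)"

lemma tens_Nil [simp]: "tens R [] bs = []"
  by (simp add: tens_def)

lemma tens_Cons [simp]: "tens R (a # as) bs = map (\<lambda>b. a \<otimes>\<^bsub>R\<^esub> b) bs @ tens R as bs"
  by (simp add: tens_def)

lemma tens_append: "tens R (as @ as') bs = tens R as bs @ tens R as' bs"
  by (induction as) auto

lemma length_tens [simp]: "length (tens R as bs) = length as * length bs"
  by (induction as) auto

lemma tensor_dim [simp]: "qdim (tensor_form R A B) = qdim A * qdim B"
  by (simp add: tensor_form_def)

context cring
begin

lemma index_div_mod:
  fixes i m n :: nat
  assumes "i < m * n" shows "i div n < m" "i mod n < n"
  using assms by (simp add: less_mult_imp_div_less, metis gr_zeroI mod_less_divisor mult_0_right not_less_zero)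

lemma tv_vecs: "s \<in> vecs R m \<Longrightarrow> t \<in> vecs R n \<Longrightarrow> tv R s t \<in> vecs R (m * n)"
  unfolding tv_def using index_div_mod by (auto intro!: vecs_vecI)

lemma tensor_sym: "sym_mat R A \<Longrightarrow> sym_mat R B \<Longrightarrow> sym_mat R (tensor_form R A B)"
  unfolding sym_mat_def tensor_dim
  unfolding tensor_form_def using index_div_mod
  by (auto intro!: mats_matI)

lemma bform_tensor:
  assumes A: "A \<in> mats R m m" and B: "B \<in> mats R n n"
    and s: "s \<in> vecs R m" "s' \<in> vecs R m" and t: "t \<in> vecs R n" "t' \<in> vecs R n"
  shows "bform R (tensor_form R A B) (tv R s t) (tv R s' t') = bform R A s s' \<otimes> bform R B t t'"
proof -
  note d = mats_dim[OF A] mats_dim[OF B] vecs_dim[OF s(1)] vecs_dim[OF s(2)] vecs_dim[OF t(1)] vecs_dim[OF t(2)]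
  define x where "x a c = A $$ (a, c) \<otimes> s $ a \<otimes> s' $ c" for a c
  define y where "y b e = B $$ (b, e) \<otimes> t $ b \<otimes> t' $ e" for b e
  have x: "x a c \<in> carrier R" if "a < m" "c < m" for a c using that A s by (simp add: x_def)
  have y: "y a c \<in> carrier R" if "a < n" "c < n" for a c using that B t by (simp add: y_def)
  have Xc: "(\<Oplus>c\<in>{..<m}. x a c) \<in> carrier R" if "a < m" for a using that x by (intro finsum_closed) auto
  have Yc: "(\<Oplus>e\<in>{..<n}. y b e) \<in> carrier R" if "b < n" for b using that y by (intro finsum_closed) auto
  have "bform R (tensor_form R A B) (tv R s t) (tv R s' t') =
    (\<Oplus>i\<in>{..<m * n}. (\<Oplus>c\<in>{..<m}. x (i div n) c) \<otimes> (\<Oplus>e\<in>{..<n}. y (i mod n) e))"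
    unfolding bform_def tensor_dim d
  proof (rule finsum_cong')
    fix i assume "i \<in> {..<m * n}"
    then have i: "i < m * n" "i div n < m" "i mod n < n" using index_div_mod[of i m n] by auto
    have "(\<Oplus>j\<in>{..<m * n}. tensor_form R A B $$ (i, j) \<otimes> tv R s t $ i \<otimes> tv R s' t' $ j) =
      (\<Oplus>j\<in>{..<m * n}. x (i div n) (j div n) \<otimes> y (i mod n) (j mod n))"
    proof (rule finsum_cong')
      fix j assume "j \<in> {..<m * n}"
      then have j: "j < m * n" "j div n < m" "j mod n < n" using index_div_mod[of j m n] by auto
      show "tensor_form R A B $$ (i, j) \<otimes> tv R s t $ i \<otimes> tv R s' t' $ j =
        x (i div n) (j div n) \<otimes> y (i mod n) (j mod n)"
        using i j A B s t by (simp add: tensor_form_def tv_def d x_def y_def m_ac)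
    qed (use i x y index_div_mod in auto)
    also have "\<dots> = (\<Oplus>c\<in>{..<m}. \<Oplus>e\<in>{..<n}. x (i div n) c \<otimes> y (i mod n) e)"
      using i x y by (intro finsum_lessThan_mult) auto
    also have "\<dots> = (\<Oplus>c\<in>{..<m}. x (i div n) c) \<otimes> (\<Oplus>e\<in>{..<n}. y (i mod n) e)"
      using i x y by (intro finsum_product) auto
    finally show "(\<Oplus>j\<in>{..<m * n}. tensor_form R A B $$ (i, j) \<otimes> tv R s t $ i \<otimes> tv R s' t' $ j) =
      (\<Oplus>c\<in>{..<m}. x (i div n) c) \<otimes> (\<Oplus>e\<in>{..<n}. y (i mod n) e)" .
  qed (use Xc Yc index_div_mod in auto)
  also have "\<dots> = (\<Oplus>a\<in>{..<m}. \<Oplus>b\<in>{..<n}. (\<Oplus>c\<in>{..<m}. x a c) \<otimes> (\<Oplus>e\<in>{..<n}. y b e))"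
    using Xc Yc by (intro finsum_lessThan_mult) auto
  also have "\<dots> = (\<Oplus>a\<in>{..<m}. \<Oplus>c\<in>{..<m}. x a c) \<otimes> (\<Oplus>b\<in>{..<n}. \<Oplus>e\<in>{..<n}. y b e)"
    using Xc Yc by (intro finsum_product) auto
  finally show ?thesis by (simp add: bform_def d x_def y_def)
qed

end

context inf_field
begin

lemma double_zero: "x \<in> carrier R \<Longrightarrow> x \<oplus> x = \<zero> \<Longrightarrow> x = \<zero>"
proof -
  assume x: "x \<in> carrier R" and d: "x \<oplus> x = \<zero>"
  have "(\<one> \<oplus> \<one>) \<otimes> x = \<zero>" using x d by (simp add: l_distr)
  then show "x = \<zero>" using x two integral[of "\<one> \<oplus> \<one>" x] by auto
qed

text \<open>Polarisation: 2 b(u, v) = q(u + v) - q(u) - q(v), and 2 is nonzero.\<close>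

lemma bform_polar:
  assumes A: "sym_mat R A" and u: "u \<in> vecs R (qdim A)" and v: "v \<in> vecs R (qdim A)"
    and "qeval R A u = \<zero>" "qeval R A v = \<zero>" "qeval R A (vadd R u v) = \<zero>"
  shows "bform R A u v = \<zero>"
proof -
  have c: "bform R A u v \<in> carrier R" using bform_closed[OF sym_mat_mats[OF A] u v] .
  have "\<zero> \<oplus> \<zero> \<oplus> (bform R A u v \<oplus> bform R A u v) = \<zero>"
    using qeval_add[OF A u v] unfolding assms(4-6) by (rule sym)
  then have "bform R A u v \<oplus> bform R A u v = \<zero>" using c by simp
  then show ?thesis by (rule double_zero[OF c])
qed

text \<open>The vectors become the columns of a matrix whose Gram matrix is diagonal. Pairing a
  combination with one column reads off a coefficient times a nonzero value, so the columns are
  independent.\<close>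

lemma orthl_embed:
  assumes A: "sym_mat R A" and vs: "orthl R A vs"
  shows "\<exists>f. linemb R (length vs) (qdim A) f \<and>
    (\<forall>v\<in>vecs R (length vs). qeval R A (f v) = qeval R (diag_form R (map (qeval R A) vs)) v) \<and>
    (\<forall>v\<in>vecs R (length vs). \<forall>w\<in>vecs R (length vs).
       bform R A (f v) (f w) = bform R (diag_form R (map (qeval R A) vs)) v w)"
proof -
  let ?n = "qdim A" and ?k = "length vs" and ?D = "diag_form R (map (qeval R A) vs)"
  note M = sym_mat_mats[OF A]
  have vi: "vs ! j \<in> vecs R ?n" "qeval R A (vs ! j) \<noteq> \<zero>" if "j < ?k" for j
    using vs that by (auto simp: orthl_def)
  have o: "bform R A (vs ! i) (vs ! j) = \<zero>" if "i < j" "j < ?k" for i j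
    using vs that by (auto simp: orthl_def sorted_wrt_iff_nth_less)
  define T where "T = mat ?n ?k (\<lambda>(i, j). vs ! j $ i)"
  have T: "T \<in> mats R ?n ?k" unfolding T_def by (rule mats_matI) (use vecs_index[OF vi(1)] in simp)
  have cT: "col T j = vs ! j" if "j < ?k" for j
    using that vi[OF that] by (intro eq_vecI) (auto simp: T_def)
  have "gram R A T = ?D"
  proof (rule eq_matI)
    fix i j assume "i < dim_row ?D" "j < dim_col ?D"
    then have ij: "i < ?k" "j < ?k" by (auto simp: diag_form_def)
    then have "bform R A (vs ! i) (vs ! j) = (if i = j then qeval R A (vs ! i) else \<zero>)"
      using o[of i j] o[of j i] bform_commute[OF A vi(1)[OF ij(1)] vi(1)[OF ij(2)]]
      by (cases i j rule: linorder_cases) (auto simp: qeval_def)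
    then show "gram R A T $$ (i, j) = ?D $$ (i, j)"
      using ij mats_dim[OF T] by (simp add: gram_def cT diag_form_def)
  qed (use mats_dim[OF T] in \<open>auto simp: gram_def diag_form_def\<close>)
  then have G: "bform R A (apply_mat R T v) (apply_mat R T w) = bform R ?D v w"
    if "v \<in> vecs R ?k" "w \<in> vecs R ?k" for v w
    using bform_gram[OF M T that] by simp
  have sD: "set (map (qeval R A) vs) \<subseteq> carrier R"
    using vs qeval_closed[OF M] by (auto simp: orthl_def)
  have "v = zvec R ?k" if v: "v \<in> vecs R ?k" and z: "apply_mat R T v = zvec R ?n" for v
  proof (rule vecs_eqI[of _ R ?k])
    fix j assume j: "j < ?k"
    have "qeval R A (vs ! j) \<otimes> v $ j = bform R ?D v (uvec R ?k j)"
      using bform_diag_uvec[OF sD, of v j] v j by simp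
    also have "\<dots> = bform R A (zvec R ?n) (apply_mat R T (uvec R ?k j))"
      using G[OF v, of "uvec R ?k j"] z by simp
    also have "\<dots> = \<zero>"
      using linfun_zero[OF linfun_bform_left[OF M]] apply_mat_vecs[OF T, of "uvec R ?k j"] by simp
    finally have "qeval R A (vs ! j) \<otimes> v $ j = \<zero>" .
    then show "v $ j = zvec R ?k $ j"
      using vi[OF j] j v integral[of "qeval R A (vs ! j)" "v $ j"] qeval_closed[OF M vi(1)[OF j]] by auto
  qed (use v in auto)
  then show ?thesis using linmap_apply_mat[OF T] G
    by (intro exI[of _ "apply_mat R T"]) (auto simp: linemb_def qeval_def)
qed

lemma linemb_le: "linemb R m n f \<Longrightarrow> m \<le> n"
  using linmap_kernel[of m n f] by (auto simp: linemb_def not_less[symmetric])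

lemma orthl_length: "sym_mat R A \<Longrightarrow> orthl R A vs \<Longrightarrow> length vs \<le> qdim A"
  using orthl_embed linemb_le by blast

lemma orthl_wiso:
  assumes "sym_mat R A" "orthl R A vs" "length vs = qdim A"
  shows "wiso R (diag_form R (map (qeval R A) vs)) A"
  using orthl_embed[OF assms(1,2)] assms(3) unfolding wiso_def by auto

text \<open>Gram-Schmidt: \<open>w'\<close> is the part of \<open>w\<close> orthogonal to
  \<open>vs\<close>. The difference lies in the span of \<open>vs\<close>, so vectors orthogonal to
  \<open>vs\<close> do not see it.\<close>

lemma orth_proj:
  assumes A: "sym_mat R A" and vs: "orthl R A vs" and w: "w \<in> vecs R (qdim A)"
  shows "\<exists>w'\<in>vecs R (qdim A). (\<forall>v\<in>set vs. bform R A v w' = \<zero>) \<and>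
    (\<forall>u\<in>vecs R (qdim A). (\<forall>v\<in>set vs. bform R A v u = \<zero>) \<longrightarrow> bform R A u w' = bform R A u w)"
  using vs
proof (induction vs)
  case Nil
  then show ?case using w by auto
next
  case (Cons v vs)
  let ?n = "qdim A"
  note M = sym_mat_mats[OF A]
  have v: "v \<in> vecs R ?n" "qeval R A v \<noteq> \<zero>" and vs: "orthl R A vs"
    and vo: "\<And>x. x \<in> set vs \<Longrightarrow> x \<in> vecs R ?n \<and> bform R A v x = \<zero>"
    using Cons.prems by (auto simp: orthl_def)
  obtain w' where w': "w' \<in> vecs R ?n" "\<forall>v\<in>set vs. bform R A v w' = \<zero>"
    "\<forall>u\<in>vecs R ?n. (\<forall>v\<in>set vs. bform R A v u = \<zero>) \<longrightarrow> bform R A u w' = bform R A u w"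
    using Cons.IH[OF vs] by auto
  have qv: "qeval R A v \<in> carrier R" using qeval_closed[OF M v(1)] .
  then have iv: "inv (qeval R A v) \<in> carrier R" "inv (qeval R A v) \<otimes> qeval R A v = \<one>"
    using v field_Units by auto
  have bw: "bform R A v w' \<in> carrier R" using bform_closed[OF M v(1) w'(1)] .
  define c where "c = \<ominus> (bform R A v w' \<otimes> inv (qeval R A v))"
  have c: "c \<in> carrier R" using bw iv by (simp add: c_def)
  define z where "z = vadd R w' (vscale R c v)"
  have z: "z \<in> vecs R ?n" using v w' c by (simp add: z_def)
  have bz: "bform R A u z = bform R A u w' \<oplus> c \<otimes> bform R A u v" if "u \<in> vecs R ?n" for u
    using that v w' c by (simp add: z_def bform_add_right[OF M] bform_scale_right[OF M])
  have "bform R A v z = bform R A v w' \<oplus> c \<otimes> qeval R A v"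
    using bz[OF v(1)] by (simp add: qeval_def)
  also have "c \<otimes> qeval R A v = \<ominus> bform R A v w'"
    using iv bw qv by (simp add: c_def l_minus m_assoc)
  finally have "bform R A v z = \<zero>" using bw by (simp add: r_neg)
  moreover have "bform R A x z = \<zero>" if "x \<in> set vs" for x
  proof -
    have "bform R A x v = \<zero>" using vo[OF that] bform_commute[OF A v(1), of x] by simp
    then show ?thesis using vo[OF that] w'(2) that bz[of x] c by simp
  qed
  moreover have "bform R A u z = bform R A u w"
    if u: "u \<in> vecs R ?n" "\<forall>x\<in>set (v # vs). bform R A x u = \<zero>" for u
  proof -
    have "bform R A u v = \<zero>" using bform_commute[OF A u(1) v(1)] u(2) by simp
    then show ?thesis using bz[OF u(1)] w'(3) u c bform_closed[OF M u(1) w] by simp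
  qed
  ultimately show ?case using z by (intro bexI[of _ z]) auto
qed

text \<open>If no vector could be added, every vector orthogonal to \<open>vs\<close> would be
  isotropic, and by polarisation the bilinear form would vanish on that complement. A nonzero
  \<open>u\<close> in it, which exists by a dimension count, would then be orthogonal to every
  \<open>w\<close>, because b(u, w) = b(u, w') for the projection \<open>w'\<close>. This
  contradicts regularity.\<close>

lemma orth_extend_step:
  assumes A: "quad_form R A" and vs: "orthl R A vs" and k: "length vs < qdim A"
  shows "\<exists>u. orthl R A (u # vs)"
proof (rule ccontr)
  let ?n = "qdim A"
  assume no: "\<not> ?thesis"
  note S = quad_form_sym[OF A]
  note M = sym_mat_mats[OF S]
  have vi: "v \<in> vecs R ?n" if "v \<in> set vs" for v using vs that by (auto simp: orthl_def)
  have q0: "qeval R A x = \<zero>" if x: "x \<in> vecs R ?n" "\<forall>v\<in>set vs. bform R A v x = \<zero>" for x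
  proof (rule ccontr)
    assume "qeval R A x \<noteq> \<zero>"
    then have "orthl R A (x # vs)"
      using vs x vi bform_commute[OF S x(1)] by (auto simp: orthl_def)
    then show False using no by auto
  qed
  have lm: "linmap R ?n (length vs) (\<lambda>v. vec (length vs) (\<lambda>i. bform R A (vs ! i) v))"
    using vi by (intro linmap_vec linfun_bform_right[OF M]) auto
  obtain u where u: "u \<in> vecs R ?n" "u \<noteq> zvec R ?n"
    "vec (length vs) (\<lambda>i. bform R A (vs ! i) u) = zvec R (length vs)"
    using linmap_kernel[OF lm k] by auto
  have uo: "\<forall>v\<in>set vs. bform R A v u = \<zero>"
  proof
    fix v assume "v \<in> set vs"
    then obtain i where i: "i < length vs" "v = vs ! i" by (auto simp: in_set_conv_nth)
    have "vec (length vs) (\<lambda>i. bform R A (vs ! i) u) $ i = zvec R (length vs) $ i" using u(3) by simp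
    then show "bform R A v u = \<zero>" using i by simp
  qed
  obtain w where w: "w \<in> vecs R ?n" "bform R A u w \<noteq> \<zero>"
    using A u unfolding quad_form_def by blast
  obtain w' where w': "w' \<in> vecs R ?n" "\<forall>v\<in>set vs. bform R A v w' = \<zero>" "bform R A u w' = bform R A u w"
    using orth_proj[OF S vs w(1)] u(1) uo by blast
  have "bform R A v (vadd R u w') = \<zero>" if "v \<in> set vs" for v
    using bform_add_right[OF M u(1) w'(1) vi[OF that]] uo w'(2) that by simp
  then have "bform R A u w' = \<zero>"
    using bform_polar[OF S u(1) w'(1)] q0 u(1) uo w' by simp
  then show False using w w' by simp
qed

lemma orth_extend:
  assumes A: "quad_form R A" and vs: "orthl R A vs"
  shows "\<exists>us. orthl R A (us @ vs) \<and> length (us @ vs) = qdim A"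
proof -
  have "\<exists>us. orthl R A (us @ vs) \<and> length (us @ vs) = length vs + j" if "length vs + j \<le> qdim A" for j
    using that
  proof (induction j)
    case 0
    then show ?case using vs by (intro exI[of _ "[]"]) auto
  next
    case (Suc j)
    then obtain us where us: "orthl R A (us @ vs)" "length (us @ vs) = length vs + j" by auto
    then obtain u where "orthl R A (u # us @ vs)" using orth_extend_step[OF A us(1)] Suc.prems by auto
    then show ?case using us by (intro exI[of _ "u # us"]) auto
  qed
  from this[of "qdim A - length vs"] show ?thesis
    using orthl_length[OF quad_form_sym[OF A] vs] by simp
qed

lemma diagonalisation:
  assumes A: "quad_form R A"
  shows "\<exists>vs. orthl R A vs \<and> length vs = qdim A"
  using orth_extend[OF A, of "[]"] by (auto simp: orthl_def)

lemma orthl_diag_carrier: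
  assumes "sym_mat R A" "orthl R A vs"
  shows "set (map (qeval R A) vs) \<subseteq> carrier R - {\<zero>}"
  using assms qeval_closed[OF sym_mat_mats[OF assms(1)]] by (auto simp: orthl_def)

lemma quad_form_diag:
  assumes as: "set as \<subseteq> carrier R - {\<zero>}"
  shows "quad_form R (diag_form R as)"
proof -
  have ac: "set as \<subseteq> carrier R" using as by auto
  have "v = zvec R (length as)" if v: "v \<in> vecs R (length as)"
    and z: "\<forall>w\<in>vecs R (length as). bform R (diag_form R as) v w = \<zero>" for v
  proof (rule vecs_eqI[of _ R "length as"])
    fix i assume i: "i < length as"
    have "as ! i \<otimes> v $ i = \<zero>" using z bform_diag_uvec[OF ac v i] by simp
    moreover have "as ! i \<in> carrier R - {\<zero>}" using as i by (meson nth_mem subsetD)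
    ultimately show "v $ i = zvec R (length as) $ i" using i v integral[of "as ! i" "v $ i"] by auto
  qed (use v in auto)
  then show ?thesis using diag_sym[OF ac] by (auto simp: quad_form_def sym_mat_def)
qed

text \<open>Regularity is visible on a full orthogonal family; in \<open>hom_wiso\<close> this
  carries regularity to extension fields.\<close>

lemma orthl_quad_form:
  assumes S: "sym_mat R A" and vs: "orthl R A vs" "length vs = qdim A"
  shows "quad_form R A"
proof -
  let ?n = "qdim A" and ?D = "diag_form R (map (qeval R A) vs)"
  obtain f where f: "linemb R ?n ?n f" "\<forall>v\<in>vecs R ?n. \<forall>w\<in>vecs R ?n. bform R A (f v) (f w) = bform R ?D v w"
    using orthl_embed[OF S vs(1)] vs(2) by auto
  have D: "quad_form R ?D" by (rule quad_form_diag[OF orthl_diag_carrier[OF S vs(1)]])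
  have "v = zvec R ?n" if v: "v \<in> vecs R ?n" and z: "\<forall>w\<in>vecs R ?n. bform R A v w = \<zero>" for v
  proof -
    obtain c where c: "c \<in> vecs R ?n" "f c = v" using linemb_surj[OF f(1) v] by auto
    have "bform R ?D c w = \<zero>" if w: "w \<in> vecs R ?n" for w
      using bspec[OF bspec[OF f(2) c(1)] w] z linmap_closed[OF linemb_linmap[OF f(1)] w] c(2) by metis
    then have "c = zvec R ?n" using D c(1) vs(2) unfolding quad_form_def by simp
    then show ?thesis using c(2) linmap_zero[OF linemb_linmap[OF f(1)]] by simp
  qed
  then show ?thesis using S unfolding quad_form_def sym_mat_def by blast
qed

lemma anisotropic_quad_form:
  assumes "sym_mat R A" "anisotropic R A" shows "quad_form R A"
  using assms unfolding quad_form_def sym_mat_def anisotropic_def qeval_def by blast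

text \<open>An isotropic vector \<open>x\<close> and a vector \<open>w\<close> with \<open>b(x, w) = 1/2\<close> span the hyperbolic plane; replacing
  \<open>w\<close> by \<open>f = w - q(w) x\<close> makes it isotropic, and \<open>x \<plusminus> f\<close> have the values \<open>\<plusminus>1\<close>.\<close>

lemma hyperbolic_pair:
  assumes S: "sym_mat R A" and x: "x \<in> vecs R (qdim A)" and qx: "qeval R A x = \<zero>"
    and y: "y \<in> vecs R (qdim A)" "bform R A x y \<noteq> \<zero>"
  shows "\<exists>h k. orthl R A [h, k] \<and> qeval R A h = \<one> \<and> qeval R A k = \<ominus> \<one>"
proof -
  let ?n = "qdim A"
  note M = sym_mat_mats[OF S]
  have bxy: "bform R A x y \<in> carrier R" using bform_closed[OF M x y(1)] .
  have i2: "inv (\<one> \<oplus> \<one>) \<in> carrier R" "inv (\<one> \<oplus> \<one>) \<oplus> inv (\<one> \<oplus> \<one>) = \<one>"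
  proof -
    show c: "inv (\<one> \<oplus> \<one>) \<in> carrier R" using two field_Units by auto
    have "inv (\<one> \<oplus> \<one>) \<otimes> (\<one> \<oplus> \<one>) = \<one>" using two field_Units by auto
    then show "inv (\<one> \<oplus> \<one>) \<oplus> inv (\<one> \<oplus> \<one>) = \<one>" using c by (simp add: r_distr)
  qed
  define h2 where "h2 = inv (\<one> \<oplus> \<one>)"
  have h2: "h2 \<in> carrier R" "h2 \<oplus> h2 = \<one>" using i2 by (auto simp: h2_def)
  have iv: "inv (bform R A x y) \<in> carrier R" "inv (bform R A x y) \<otimes> bform R A x y = \<one>"
    using bxy y field_Units by auto
  define w where "w = vscale R (h2 \<otimes> inv (bform R A x y)) y"
  have w: "w \<in> vecs R ?n" using h2 iv y by (simp add: w_def)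
  have bxw: "bform R A x w = h2"
    using h2 iv y x bxy by (simp add: w_def bform_scale_right[OF M] m_assoc)
  define c where "c = \<ominus> qeval R A w"
  have qw: "qeval R A w \<in> carrier R" using qeval_closed[OF M w] .
  then have c: "c \<in> carrier R" by (simp add: c_def)
  define f where "f = vadd R w (vscale R c x)"
  have f: "f \<in> vecs R ?n" using w c x by (simp add: f_def)
  have bxx: "bform R A x x = \<zero>" using qx by (simp add: qeval_def)
  have bwx: "bform R A w x = h2" using bform_commute[OF S w x] bxw by simp
  have bxf: "bform R A x f = h2"
    using w x c h2 by (simp add: f_def bform_add_right[OF M] bform_scale_right[OF M] bxx bxw)
  have qf: "qeval R A f = \<zero>"
  proof -
    have cx: "vscale R c x \<in> vecs R ?n" using c x by simp
    have "qeval R A f = qeval R A w \<oplus> qeval R A (vscale R c x) \<oplus> (bform R A w (vscale R c x) \<oplus> bform R A w (vscale R c x))"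
      unfolding f_def by (rule qeval_add[OF S w cx])
    also have "qeval R A (vscale R c x) = \<zero>" using qeval_scale[OF M c x] qx c by simp
    also have "bform R A w (vscale R c x) = c \<otimes> h2"
      using bform_scale_right[OF M c x w] bwx by simp
    also have "c \<otimes> h2 \<oplus> c \<otimes> h2 = c" using r_distr[of h2 h2 c] h2 c by simp
    finally show ?thesis using qw by (simp add: c_def r_neg)
  qed
  define h k where "h = vadd R x f" and "k = vadd R x (vscale R (\<ominus> \<one>) f)"
  have mf: "vscale R (\<ominus> \<one>) f \<in> vecs R ?n" using f by simp
  have qmf: "qeval R A (vscale R (\<ominus> \<one>) f) = \<zero>" using qeval_scale[OF M, of "\<ominus> \<one>" f] f qf by simp
  have bxmf: "bform R A x (vscale R (\<ominus> \<one>) f) = \<ominus> h2"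
    using bform_scale_right[OF M _ f x, of "\<ominus> \<one>"] bxf h2 by (simp add: l_minus)
  have hk: "h \<in> vecs R ?n" "k \<in> vecs R ?n" using x f mf by (auto simp: h_def k_def)
  have qh: "qeval R A h = \<one>" unfolding h_def using qeval_add[OF S x f] qx qf bxf h2 by simp
  have qk: "qeval R A k = \<ominus> \<one>"
    unfolding k_def using qeval_add[OF S x mf] qx qmf bxmf h2 minus_add[of h2 h2] by simp
  have "bform R A h k = bform R A x x \<oplus> bform R A f x \<oplus> (bform R A x (vscale R (\<ominus> \<one>) f) \<oplus> bform R A f (vscale R (\<ominus> \<one>) f))"
    unfolding h_def k_def using x f mf
    by (simp add: bform_add_left[OF M] bform_add_right[OF M])
  also have "bform R A f x = h2" using bform_commute[OF S f x] bxf by simp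
  also have "bform R A f (vscale R (\<ominus> \<one>) f) = \<zero>"
    using bform_scale_right[OF M _ f f, of "\<ominus> \<one>"] qf by (simp add: qeval_def)
  finally have "bform R A h k = \<zero>" using bxx bxmf h2 by (simp add: r_neg)
  moreover have "\<ominus> \<one> \<noteq> \<zero>" using one_not_zero by (metis minus_minus minus_zero one_closed)
  ultimately have "orthl R A [h, k]" using hk qh qk by (simp add: orthl_def)
  then show ?thesis using qh qk by blast
qed

text \<open>Regularity supplies a vector that is not orthogonal to the isotropic one. The resulting
  pair with values 1 and -1 is then completed to an orthogonal basis of the whole space.\<close>

lemma split_hyperbolic:
  assumes A: "quad_form R A" and n: "\<not> anisotropic R A"
  shows "\<exists>cs. set cs \<subseteq> carrier R - {\<zero>} \<and> length cs + 2 = qdim A \<and> wiso R A (diag_form R (cs @ [\<one>, \<ominus> \<one>]))"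
proof -
  note S = quad_form_sym[OF A]
  obtain x where x: "x \<in> vecs R (qdim A)" "qeval R A x = \<zero>" "x \<noteq> zvec R (qdim A)"
    using n by (auto simp: anisotropic_def)
  obtain y where y: "y \<in> vecs R (qdim A)" "bform R A x y \<noteq> \<zero>"
    using A x unfolding quad_form_def by blast
  obtain h k where hk: "orthl R A [h, k]" "qeval R A h = \<one>" "qeval R A k = \<ominus> \<one>"
    using hyperbolic_pair[OF S x(1,2) y] by auto
  obtain us where us: "orthl R A (us @ [h, k])" "length (us @ [h, k]) = qdim A"
    using orth_extend[OF A hk(1)] by auto
  have "wiso R A (diag_form R (map (qeval R A) us @ [\<one>, \<ominus> \<one>]))"
    using wiso_sym[OF orthl_wiso[OF S us]] hk by simp
  moreover have "set (map (qeval R A) us) \<subseteq> carrier R - {\<zero>}"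
    using orthl_diag_carrier[OF S us(1)] by auto
  ultimately show ?thesis using us by (intro exI[of _ "map (qeval R A) us"]) auto
qed

lemma alt_carrier: "set (alt R m) \<subseteq> carrier R - {\<zero>}"
proof -
  have "\<ominus> \<one> \<noteq> \<zero>" using one_not_zero by (metis minus_minus minus_zero one_closed)
  then show ?thesis by (induction m) (auto simp: alt_Suc)
qed

lemma wiso_diag_append:
  assumes "wiso R (diag_form R as) (diag_form R bs)"
    "set as \<subseteq> carrier R" "set bs \<subseteq> carrier R" "set cs \<subseteq> carrier R"
  shows "wiso R (diag_form R (as @ cs)) (diag_form R (bs @ cs))"
  unfolding diag_append using wiso_orth_sum[OF assms(1)] assms diag_mats by simp

lemma witt_decomposition:
  assumes A: "quad_form R A"
  shows "\<exists>bs m. set bs \<subseteq> carrier R - {\<zero>} \<and> anisotropic R (diag_form R bs) \<and> wiso R A (diag_form R (bs @ alt R m))"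
  using A
proof (induction "qdim A" arbitrary: A rule: less_induct)
  case less
  note S = quad_form_sym[OF less.prems]
  show ?case
  proof (cases "anisotropic R A")
    case True
    obtain vs where vs: "orthl R A vs" "length vs = qdim A" using diagonalisation[OF less.prems] by auto
    have W: "wiso R (diag_form R (map (qeval R A) vs)) A" by (rule orthl_wiso[OF S vs])
    then show ?thesis
      using wiso_anisotropic[OF W True] wiso_sym[OF W] orthl_diag_carrier[OF S vs(1)]
      by (intro exI[of _ "map (qeval R A) vs"] exI[of _ 0]) auto
  next
    case False
    obtain cs where cs: "set cs \<subseteq> carrier R - {\<zero>}" "length cs + 2 = qdim A"
      "wiso R A (diag_form R (cs @ [\<one>, \<ominus> \<one>]))"
      using split_hyperbolic[OF less.prems False] by auto
    obtain bs m where bs: "set bs \<subseteq> carrier R - {\<zero>}" "anisotropic R (diag_form R bs)"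
      "wiso R (diag_form R cs) (diag_form R (bs @ alt R m))"
      using less.hyps[of "diag_form R cs"] quad_form_diag[OF cs(1)] cs(2) by auto
    have "wiso R (diag_form R (cs @ [\<one>, \<ominus> \<one>])) (diag_form R ((bs @ alt R m) @ [\<one>, \<ominus> \<one>]))"
      using bs cs alt_carrier[of m] by (intro wiso_diag_append) auto
    then have "wiso R A (diag_form R (bs @ alt R (Suc m)))"
      using wiso_trans[OF cs(3)] by (simp add: alt_Suc')
    then show ?thesis using bs by blast
  qed
qed

end

section \<open>Orderings as pairs of cones\<close>

text \<open>A common abstraction of the positive and of the negative elements of an ordering, so
  that one inertia argument serves both signs. Negative elements are not closed under products;
  closure under multiplication by nonzero squares is what survives.\<close>

definition cone :: "('a, 'b) ring_scheme \<Rightarrow> 'a set \<Rightarrow> bool" where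
  "cone R S \<longleftrightarrow> S \<subseteq> carrier R - {\<zero>\<^bsub>R\<^esub>} \<and> (\<forall>x\<in>S. \<forall>y\<in>S. x \<oplus>\<^bsub>R\<^esub> y \<in> S) \<and>
     (\<forall>c\<in>carrier R - {\<zero>\<^bsub>R\<^esub>}. \<forall>x\<in>S. x \<otimes>\<^bsub>R\<^esub> c \<otimes>\<^bsub>R\<^esub> c \<in> S)"

definition cone_pair :: "('a, 'b) ring_scheme \<Rightarrow> 'a set \<Rightarrow> 'a set \<Rightarrow> bool" where
  "cone_pair R S S' \<longleftrightarrow> cone R S \<and> cone R S' \<and> S \<union> S' = carrier R - {\<zero>\<^bsub>R\<^esub>} \<and> S \<inter> S' = {}"

lemma (in field) field_ordering_facts:
  assumes P: "field_ordering R P"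
  shows "cone_pair R P {x \<in> carrier R. \<ominus> x \<in> P}" "\<one> \<in> P"
proof -
  have sub: "P \<subseteq> carrier R - {\<zero>}" and un: "P \<union> {\<ominus> x | x. x \<in> P} = carrier R - {\<zero>}"
    and cl: "\<And>x y. x \<in> P \<Longrightarrow> y \<in> P \<Longrightarrow> x \<oplus> y \<in> P \<and> x \<otimes> y \<in> P"
    using P by (auto simp: field_ordering_def)
  have carr: "\<And>x. x \<in> P \<Longrightarrow> x \<in> carrier R" using sub by auto
  have cases: "x \<in> P \<or> \<ominus> x \<in> P" if "x \<in> carrier R" "x \<noteq> \<zero>" for x
  proof -
    have "x \<in> P \<union> {\<ominus> x | x. x \<in> P}" using that un by auto
    then show ?thesis using carr by auto
  qed
  have sq: "c \<otimes> c \<in> P" if "c \<in> carrier R" "c \<noteq> \<zero>" for c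
  proof (cases "c \<in> P")
    case True then show ?thesis using cl by blast
  next
    case False
    then have "(\<ominus> c) \<otimes> (\<ominus> c) \<in> P" using cases[OF that] cl by blast
    then show ?thesis using that by (simp add: l_minus r_minus)
  qed
  then show "\<one> \<in> P" using one_not_zero sq[of \<one>] by simp
  have cP: "cone R P" unfolding cone_def using sub cl sq carr by (auto simp: m_assoc)
  have "cone R {x \<in> carrier R. \<ominus> x \<in> P}"
    unfolding cone_def
  proof (intro conjI ballI)
    show "{x \<in> carrier R. \<ominus> x \<in> P} \<subseteq> carrier R - {\<zero>}" using sub by auto
    fix x y assume "x \<in> {x \<in> carrier R. \<ominus> x \<in> P}" "y \<in> {x \<in> carrier R. \<ominus> x \<in> P}"
    then show "x \<oplus> y \<in> {x \<in> carrier R. \<ominus> x \<in> P}" using cl by (simp add: minus_add)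
  next
    fix c x assume c: "c \<in> carrier R - {\<zero>}" and x: "x \<in> {x \<in> carrier R. \<ominus> x \<in> P}"
    then have "(\<ominus> x) \<otimes> (c \<otimes> c) \<in> P" using cl sq by simp
    then show "x \<otimes> c \<otimes> c \<in> {x \<in> carrier R. \<ominus> x \<in> P}" using c x by (simp add: l_minus m_assoc)
  qed
  moreover have "P \<inter> {x \<in> carrier R. \<ominus> x \<in> P} = {}"
  proof -
    have False if "x \<in> P" "\<ominus> x \<in> P" for x
      using cl[OF that] sub carr[OF that(1)] by (auto simp: r_neg)
    then show ?thesis by auto
  qed
  moreover have "P \<union> {x \<in> carrier R. \<ominus> x \<in> P} = carrier R - {\<zero>}"
    using sub cases by auto
  ultimately show "cone_pair R P {x \<in> carrier R. \<ominus> x \<in> P}" using cP by (simp add: cone_pair_def)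
qed

text \<open>The positive multiples of 1 are positive, hence nonzero, and therefore pairwise
  distinct.\<close>

lemma (in field) real_inf_field:
  assumes P: "field_ordering R P"
  shows "inf_field R"
proof -
  have sub: "P \<subseteq> carrier R - {\<zero>}" and cl: "\<And>x y. x \<in> P \<Longrightarrow> y \<in> P \<Longrightarrow> x \<oplus> y \<in> P \<and> x \<otimes> y \<in> P"
    using P by (auto simp: field_ordering_def)
  note one = field_ordering_facts(2)[OF P]
  have nP: "[Suc k] \<cdot> \<one> \<in> P" for k
    by (induction k) (use one cl in auto)
  have inj: "inj (\<lambda>k::nat. [k] \<cdot> \<one>)"
  proof (rule linorder_injI)
    fix j k :: nat assume "j < k"
    then obtain i where k: "k = j + Suc i" using less_imp_Suc_add by auto
    show "[j] \<cdot> \<one> \<noteq> [k] \<cdot> \<one>"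
    proof
      assume e: "[j] \<cdot> \<one> = [k] \<cdot> \<one>"
      have "[k] \<cdot> \<one> = [j] \<cdot> \<one> \<oplus> [Suc i] \<cdot> \<one>" unfolding k by (rule add.nat_pow_mult[symmetric]) simp
      then have "[Suc i] \<cdot> \<one> = \<zero>" using e add.l_cancel_one' by (metis add.nat_pow_closed one_closed)
      then show False using nP[of i] sub by auto
    qed
  qed
  have "infinite (range (\<lambda>k::nat. [k] \<cdot> \<one>))" using inj finite_imageD infinite_UNIV_nat by blast
  moreover have "range (\<lambda>k::nat. [k] \<cdot> \<one>) \<subseteq> carrier R" by auto
  ultimately have "infinite (carrier R)" using finite_subset by blast
  moreover have "\<one> \<oplus> \<one> \<noteq> \<zero>" using cl[OF one one] sub by auto
  ultimately show ?thesis using field_axioms by (simp add: inf_field_def inf_field_axioms_def)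
qed

section \<open>The Witt index as the largest dimension of a totally isotropic subspace\<close>

context inf_field
begin

lemma ti_zero: "A \<in> mats R (qdim A) (qdim A) \<Longrightarrow> ti R A 0"
  unfolding ti_def linemb_def linmap_def
  by (intro exI[of _ "\<lambda>_. zvec R (qdim A)"]) (auto simp: qeval_zvec intro!: eq_vecI)

lemma ti_anisotropic:
  assumes "anisotropic R A" "ti R A d" shows "d = 0"
proof (rule ccontr)
  assume "d \<noteq> 0"
  obtain f where f: "linemb R d (qdim A) f" "\<forall>v\<in>vecs R d. qeval R A (f v) = \<zero>"
    using assms by (auto simp: ti_def)
  have "f (uvec R d 0) = zvec R (qdim A)"
    using assms(1) f linmap_closed[OF linemb_linmap[OF f(1)]] by (simp add: anisotropic_def)
  then have "uvec R d 0 = zvec R d" using f by (simp add: linemb_def)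
  then have "uvec R d 0 $ 0 = zvec R d $ 0" by simp
  then show False using \<open>d \<noteq> 0\<close> by simp
qed

lemma ti_mono:
  assumes "ti R A d" "e \<le> d" shows "ti R A e"
  using assms(2,1)
proof (induction rule: inc_induct)
  case base
  then show ?case .
next
  case (step k)
  then obtain f where f: "linemb R (Suc k) (qdim A) f" "\<forall>v\<in>vecs R (Suc k). qeval R A (f v) = \<zero>"
    by (auto simp: ti_def)
  have L: "linemb R k (Suc k) (vinsert R k)" by (rule linemb_vinsert) simp
  have "\<forall>v\<in>vecs R k. qeval R A (f (vinsert R k v)) = \<zero>"
    using f(2) linmap_closed[OF linemb_linmap[OF L]] by simp
  then show ?case using linemb_comp[OF f(1) L] unfolding ti_def by blast
qed

lemma qeval_diag_hyp:
  assumes cs: "set cs \<subseteq> carrier R" and v: "v \<in> vecs R (length cs + 2)"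
  shows "qeval R (diag_form R (cs @ [\<one>, \<ominus> \<one>])) v =
    qeval R (diag_form R cs) (vec (length cs) (($) v)) \<oplus>
    (v $ length cs \<otimes> v $ length cs \<ominus> v $ Suc (length cs) \<otimes> v $ Suc (length cs))"
proof -
  let ?n = "length cs"
  have D: "diag_form R [\<one>, \<ominus> \<one>] \<in> mats R 2 2" using diag_mats[of "[\<one>, \<ominus> \<one>]"] by (simp add: numeral_2_eq_2)
  have w: "vdrop ?n 2 v \<in> vecs R (length [\<one>, \<ominus> \<one>])" using vdrop_vecs[OF v] by (simp add: numeral_2_eq_2)
  have i: "vdrop ?n 2 v $ 0 = v $ ?n" "vdrop ?n 2 v $ Suc 0 = v $ Suc ?n" by (auto simp: vdrop_def)
  have c: "v $ ?n \<in> carrier R" "v $ Suc ?n \<in> carrier R" using v by auto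
  have "qeval R (diag_form R [\<one>, \<ominus> \<one>]) (vdrop ?n 2 v) =
    (\<Oplus>i\<in>{..<Suc (Suc 0)}. [\<one>, \<ominus> \<one>] ! i \<otimes> vdrop ?n 2 v $ i \<otimes> vdrop ?n 2 v $ i)"
    using qeval_diag[OF _ w] by simp
  also have "\<dots> = v $ ?n \<otimes> v $ ?n \<ominus> v $ Suc ?n \<otimes> v $ Suc ?n"
    using c by (simp add: lessThan_Suc finsum_insert i Pi_def a_minus_def l_minus a_comm)
  finally show ?thesis
    using qeval_orth_sum[OF diag_mats[OF cs] D v] by (simp add: diag_append)
qed

text \<open>The added direction is the isotropic vector of the hyperbolic plane whose two
  coordinates are equal.\<close>

lemma ti_extend_hyp:
  assumes cs: "set cs \<subseteq> carrier R" and t: "ti R (diag_form R cs) d"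
  shows "ti R (diag_form R (cs @ [\<one>, \<ominus> \<one>])) (Suc d)"
proof -
  let ?n = "length cs"
  obtain f where f: "linemb R d ?n f" "\<forall>v\<in>vecs R d. qeval R (diag_form R cs) (f v) = \<zero>"
    using t by (auto simp: ti_def)
  note L = linemb_linmap[OF f(1)]
  define g where "g v = f (vec d (($) v)) @\<^sub>v vec 2 (\<lambda>_. v $ d)" for v
  have t: "linmap R (Suc d) d (\<lambda>v. vec d (($) v))" by (rule linmap_take) simp
  have l2: "linmap R (Suc d) 2 (\<lambda>v. vec 2 (\<lambda>_. v $ d))"
    unfolding linmap_def by (auto intro!: vecs_vecI eq_vecI)
  have gl: "linmap R (Suc d) (?n + 2) g"
    unfolding g_def by (rule linmap_append[OF linmap_comp[OF L t] l2])
  have pt: "vec ?n (($) (g v)) = f (vec d (($) v))" "g v $ ?n = v $ d" "g v $ Suc ?n = v $ d"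
    if v: "v \<in> vecs R (Suc d)" for v
  proof -
    have fv: "f (vec d (($) v)) \<in> vecs R ?n" using linmap_closed[OF linmap_comp[OF L t] v] .
    show "vec ?n (($) (g v)) = f (vec d (($) v))"
      unfolding g_def using take_append[OF fv linmap_closed[OF l2 v]] .
    show "g v $ ?n = v $ d" "g v $ Suc ?n = v $ d"
      unfolding g_def using append_index[OF fv linmap_closed[OF l2 v]] by auto
  qed
  have q0: "qeval R (diag_form R (cs @ [\<one>, \<ominus> \<one>])) (g v) = \<zero>" if v: "v \<in> vecs R (Suc d)" for v
  proof -
    have "v $ d \<in> carrier R" using v by simp
    then show ?thesis
      using qeval_diag_hyp[OF cs linmap_closed[OF gl v]] f(2) linmap_closed[OF t v] unfolding pt[OF v]
      by (simp add: a_minus_def r_neg)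
  qed
  have "v = zvec R (Suc d)" if v: "v \<in> vecs R (Suc d)" and z: "g v = zvec R (?n + 2)" for v
  proof -
    have "f (vec d (($) v)) = vec ?n (($) (zvec R (?n + 2)))" using pt(1)[OF v] z by simp
    also have "\<dots> = zvec R ?n" by (intro eq_vecI) auto
    finally have "f (vec d (($) v)) = zvec R ?n" .
    then have tz: "vec d (($) v) = zvec R d" using f(1) linmap_closed[OF t v] by (simp add: linemb_def)
    have "v $ d = \<zero>" using pt(2)[OF v] z by simp
    moreover have "v $ i = \<zero>" if "i < d" for i
    proof -
      have "vec d (($) v) $ i = zvec R d $ i" using tz by simp
      then show ?thesis using that by simp
    qed
    ultimately show ?thesis using v by (intro vecs_eqI[of _ R "Suc d"]) (auto simp: less_Suc_eq)
  qed
  then have "linemb R (Suc d) (?n + 2) g" using gl by (simp add: linemb_def)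
  then show ?thesis using q0 by (auto simp: ti_def numeral_2_eq_2)
qed

text \<open>If \<open>e\<close> spans an isotropic line of the hyperbolic plane, the projection from \<open>e\<^sup>\<bottom>\<close> to \<open>e\<^sup>\<bottom>/\<langle>e\<rangle>\<close>
  preserves values; a totally isotropic space loses at most one dimension, either by intersecting
  with \<open>e\<^sup>\<bottom>\<close> or, when it contains \<open>e\<close> (hence lies in \<open>e\<^sup>\<bottom>\<close>), by projecting.\<close>

lemma ti_reduce_hyp:
  assumes cs: "set cs \<subseteq> carrier R" and t: "ti R (diag_form R (cs @ [\<one>, \<ominus> \<one>])) (Suc d)"
  shows "ti R (diag_form R cs) d"
proof -
  let ?n = "length cs" and ?D = "diag_form R (cs @ [\<one>, \<ominus> \<one>])"
  have len: "length (cs @ [\<one>, \<ominus> \<one>]) = ?n + 2" by simp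
  have csD: "set (cs @ [\<one>, \<ominus> \<one>]) \<subseteq> carrier R" using cs by auto
  have S: "sym_mat R ?D" and M: "?D \<in> mats R (?n + 2) (?n + 2)"
    using diag_sym[OF csD] diag_mats[OF csD] by auto
  obtain f where f: "linemb R (Suc d) (?n + 2) f" "\<forall>v\<in>vecs R (Suc d). qeval R ?D (f v) = \<zero>"
    using t by (auto simp: ti_def numeral_2_eq_2)
  note L = linemb_linmap[OF f(1)]
  define e where "e = vadd R (uvec R (?n + 2) ?n) (uvec R (?n + 2) (Suc ?n))"
  have e: "e \<in> vecs R (?n + 2)" by (simp add: e_def)
  have ei: "e $ i = (if i < ?n then \<zero> else \<one>)" if "i < ?n + 2" for i
    using that by (auto simp: e_def)
  have be: "bform R ?D v e = v $ ?n \<ominus> v $ Suc ?n" if v: "v \<in> vecs R (?n + 2)" for v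
  proof -
    have v': "v \<in> vecs R (length (cs @ [\<one>, \<ominus> \<one>]))" using v by simp
    have "bform R ?D v (uvec R (?n + 2) ?n) = v $ ?n"
      using bform_diag_uvec[OF csD v', of ?n] v by (simp add: nth_append)
    moreover have "bform R ?D v (uvec R (?n + 2) (Suc ?n)) = \<ominus> v $ Suc ?n"
      using bform_diag_uvec[OF csD v', of "Suc ?n"] v by (simp add: nth_append l_minus)
    ultimately show ?thesis
      using bform_add_right[OF M _ _ v, of "uvec R (?n + 2) ?n" "uvec R (?n + 2) (Suc ?n)"]
      by (simp add: e_def a_minus_def)
  qed
  \<comment> \<open>Both cases below supply a \<open>d\<close>-dimensional subspace that is
    orthogonal to \<open>e\<close> (its two hyperbolic coordinates agree) and meets the line of
    \<open>e\<close> only in zero. On such a subspace the projection to the coordinates of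
    \<open>cs\<close> is injective and preserves values.\<close>
  have main: "ti R (diag_form R cs) d"
    if g: "linemb R d (Suc d) g" and eq: "\<And>v. v \<in> vecs R d \<Longrightarrow> f (g v) $ ?n = f (g v) $ Suc ?n"
      and ne: "\<And>v a. v \<in> vecs R d \<Longrightarrow> a \<in> carrier R \<Longrightarrow> f (g v) = vscale R a e \<Longrightarrow> a = \<zero>" for g
  proof -
    have fg: "linemb R d (?n + 2) (\<lambda>v. f (g v))" using linemb_comp[OF f(1) g] .
    note FL = linemb_linmap[OF fg]
    have t: "linmap R (?n + 2) ?n (\<lambda>v. vec ?n (($) v))" by (rule linmap_take) simp
    have hl: "linmap R d ?n (\<lambda>v. vec ?n (($) (f (g v))))" using linmap_comp[OF t FL] .
    have q0: "qeval R (diag_form R cs) (vec ?n (($) (f (g v)))) = \<zero>" if v: "v \<in> vecs R d" for v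
    proof -
      have gv: "g v \<in> vecs R (Suc d)" using linmap_closed[OF linemb_linmap[OF g] v] .
      have fv: "f (g v) \<in> vecs R (?n + 2)" using linmap_closed[OF FL v] .
      have c: "f (g v) $ Suc ?n \<in> carrier R" using fv by simp
      have q: "qeval R (diag_form R cs) (vec ?n (($) (f (g v)))) \<in> carrier R"
        using qeval_closed[OF diag_mats[OF cs] linmap_closed[OF hl v]] .
      have "\<zero> = qeval R ?D (f (g v))" using f(2) gv by simp
      also have "\<dots> = qeval R (diag_form R cs) (vec ?n (($) (f (g v))))"
        unfolding qeval_diag_hyp[OF cs fv] eq[OF v] using c q by (simp add: a_minus_def r_neg)
      finally show ?thesis by simp
    qed
    have "v = zvec R d" if v: "v \<in> vecs R d" and z: "vec ?n (($) (f (g v))) = zvec R ?n" for v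
    proof -
      have fv: "f (g v) \<in> vecs R (?n + 2)" using linmap_closed[OF FL v] .
      let ?a = "f (g v) $ Suc ?n"
      have a: "?a \<in> carrier R" using fv by simp
      have fe: "f (g v) = vscale R ?a e"
      proof (rule vecs_eqI[OF fv])
        fix i assume i: "i < ?n + 2"
        show "f (g v) $ i = vscale R ?a e $ i"
        proof (cases "i < ?n")
          case True
          have "vec ?n (($) (f (g v))) $ i = zvec R ?n $ i" using z by simp
          then show ?thesis using True i e ei[of i] a by simp
        next
          case False
          then have "i = ?n \<or> i = Suc ?n" using i by auto
          then show ?thesis using e ei[of i] a eq[OF v] by auto
        qed
      qed (use a e in simp)
      then have "?a = \<zero>" using ne[OF v a] by simp
      then have "f (g v) = zvec R (?n + 2)" using fe e by simp
      then show ?thesis using fg v by (simp add: linemb_def)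
    qed
    then show ?thesis using hl q0 unfolding ti_def linemb_def by auto
  qed
  have diff: "f v $ ?n = f v $ Suc ?n" if "v \<in> vecs R (Suc d)" "bform R ?D (f v) e = \<zero>" for v
  proof -
    have fv: "f v \<in> vecs R (?n + 2)" using linmap_closed[OF L that(1)] .
    then have "f v $ ?n \<in> carrier R" "f v $ Suc ?n \<in> carrier R" by auto
    then show ?thesis using be[OF fv] that(2) r_right_minus_eq by metis
  qed
  show ?thesis
  proof (cases "\<exists>c0\<in>vecs R (Suc d). f c0 = e")
    case True
    then obtain c0 where c0: "c0 \<in> vecs R (Suc d)" "f c0 = e" by auto
    have "c0 \<noteq> zvec R (Suc d)"
    proof
      assume "c0 = zvec R (Suc d)"
      then have "e = zvec R (?n + 2)" using c0(2) linmap_zero[OF L] by metis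
      then have "e $ ?n = \<zero>" by simp
      then show False using ei[of ?n] by simp
    qed
    \<comment> \<open>The vectors with coordinate \<open>p\<close> zero form a hyperplane of the
      parameter space that does not contain \<open>c0\<close>, so its image avoids
      \<open>e\<close>.\<close>
    then obtain p where p: "p < Suc d" "c0 $ p \<noteq> \<zero>" using vec_nonzero_index[OF c0(1)] by auto
    have lid: "linfun R (Suc d) (\<lambda>v. v $ p)"
      using linfun_index[OF linemb_linmap[OF linemb_id] p(1)] .
    obtain g where g: "linemb R d (Suc d) g" "\<forall>v\<in>vecs R d. g v $ p = \<zero>"
      using linfun_kernel[OF lid] by auto
    have gc: "g v \<in> vecs R (Suc d)" if "v \<in> vecs R d" for v
      using linmap_closed[OF linemb_linmap[OF g(1)] that] .
    show ?thesis
    proof (rule main[OF g(1)])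
      fix v assume v: "v \<in> vecs R d"
      have "qeval R ?D (vadd R (f (g v)) e) = \<zero>"
        using f(2) gc[OF v] c0 linmap_add[OF L gc[OF v] c0(1)] by (metis vadd_vecs)
      moreover have "qeval R ?D e = \<zero>" "qeval R ?D (f (g v)) = \<zero>"
        using f(2) c0 gc[OF v] by auto
      ultimately have "bform R ?D (f (g v)) e = \<zero>"
        using bform_polar[OF S, of "f (g v)" e] e linmap_closed[OF L gc[OF v]] by simp
      then show "f (g v) $ ?n = f (g v) $ Suc ?n" using diff gc[OF v] by simp
    next
      fix v a assume v: "v \<in> vecs R d" and a: "a \<in> carrier R" and fe: "f (g v) = vscale R a e"
      have "f (g v) = f (vscale R a c0)" using fe c0 a by (simp add: linmap_scale[OF L])
      then have "g v = vscale R a c0"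
        using linemb_inj[OF f(1)] gc[OF v] a c0 by (simp add: inj_on_eq_iff)
      then have "a \<otimes> c0 $ p = \<zero>" using g(2) v p c0 by (metis vscale_index)
      then show "a = \<zero>" using p a c0 integral[of a "c0 $ p"] by auto
    qed
  next
    case False
    have lb: "linfun R (Suc d) (\<lambda>v. bform R ?D (f v) e)"
      using linfun_comp[OF linfun_bform_left[OF M e] L] .
    obtain g where g: "linemb R d (Suc d) g" "\<forall>v\<in>vecs R d. bform R ?D (f (g v)) e = \<zero>"
      using linfun_kernel[OF lb] by auto
    have gc: "g v \<in> vecs R (Suc d)" if "v \<in> vecs R d" for v
      using linmap_closed[OF linemb_linmap[OF g(1)] that] .
    show ?thesis
    proof (rule main[OF g(1)])
      fix v assume v: "v \<in> vecs R d"
      then show "f (g v) $ ?n = f (g v) $ Suc ?n" using diff g(2) gc by simp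
    next
      fix v a assume v: "v \<in> vecs R d" and a: "a \<in> carrier R" and fe: "f (g v) = vscale R a e"
      show "a = \<zero>"
      proof (rule ccontr)
        assume "a \<noteq> \<zero>"
        then have iv: "inv a \<in> carrier R" "inv a \<otimes> a = \<one>" using a field_Units by auto
        have "f (vscale R (inv a) (g v)) = e"
          using iv a e gc[OF v] fe by (simp add: linmap_scale[OF L] vscale_vscale[of _ _ e "?n + 2"])
        then show False using False iv gc[OF v] by auto
      qed
    qed
  qed
qed

lemma ti_alt:
  assumes bs: "set bs \<subseteq> carrier R" "anisotropic R (diag_form R bs)"
  shows "ti R (diag_form R (bs @ alt R m)) d \<longleftrightarrow> d \<le> m"
proof (induction m arbitrary: d)
  case 0
  have "ti R (diag_form R bs) 0" using ti_zero diag_mats[OF bs(1)] by simp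
  then show ?case using ti_anisotropic[OF bs(2)] by auto
next
  case (Suc m)
  have c: "set (bs @ alt R m) \<subseteq> carrier R" using bs alt_carrier[of m] by auto
  have c': "set (bs @ alt R (Suc m)) \<subseteq> carrier R" using bs alt_carrier[of "Suc m"] by auto
  have e: "bs @ alt R (Suc m) = (bs @ alt R m) @ [\<one>, \<ominus> \<one>]" by (simp add: alt_Suc')
  show ?case
  proof (cases d)
    case 0
    then show ?thesis using ti_zero[of "diag_form R (bs @ alt R (Suc m))"] diag_mats[OF c'] by simp
  next
    case (Suc k)
    then show ?thesis
      using ti_reduce_hyp[OF c, of k] ti_extend_hyp[OF c, of k] Suc.IH[of k] unfolding e by auto
  qed
qed

text \<open>By \<open>ti_alt\<close> the dimensions of totally isotropic subspaces are exactly those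
  up to \<open>m\<close>, for every decomposition with \<open>m\<close> hyperbolic planes. They
  depend on the form alone, so \<open>m\<close> is unique and the definite description denotes
  it.\<close>

lemma witt_index_props:
  assumes A: "quad_form R A"
  shows "ti R A d \<longleftrightarrow> d \<le> witt_index R A" "2 * witt_index R A \<le> qdim A"
proof -
  note M = sym_mat_mats[OF quad_form_sym[OF A]]
  have tiff: "ti R A d \<longleftrightarrow> d \<le> m"
    if B: "quad_form R B" "anisotropic R B" "isometric R A (orth_sum R B (hyperbolic_form R m))" for B m d
  proof -
    note SB = quad_form_sym[OF B(1)]
    obtain vs where vs: "orthl R B vs" "length vs = qdim B" using diagonalisation[OF B(1)] by auto
    define bs where "bs = map (qeval R B) vs"
    have W: "wiso R (diag_form R bs) B" unfolding bs_def by (rule orthl_wiso[OF SB vs])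
    have bs: "set bs \<subseteq> carrier R" using orthl_diag_carrier[OF SB vs(1)] by (auto simp: bs_def)
    have al: "set (alt R m) \<subseteq> carrier R" using alt_carrier by auto
    have "wiso R (orth_sum R B (diag_form R (alt R m))) (orth_sum R (diag_form R bs) (diag_form R (alt R m)))"
      using wiso_orth_sum[OF wiso_sym[OF W] sym_mat_mats[OF SB]] diag_mats[OF bs] diag_mats[OF al] by simp
    then have W2: "wiso R A (diag_form R (bs @ alt R m))"
      using wiso_trans[OF isometric_wiso[OF B(3)]] by (simp add: hyperbolic_form_eq diag_append)
    have "anisotropic R (diag_form R bs)" using wiso_anisotropic[OF W B(2)] .
    then show ?thesis
      using ti_alt[OF bs] ti_wiso[OF _ W2] ti_wiso[OF _ wiso_sym[OF W2]] by blast
  qed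
  obtain bs m where bs: "set bs \<subseteq> carrier R - {\<zero>}" "anisotropic R (diag_form R bs)"
    "wiso R A (diag_form R (bs @ alt R m))"
    using witt_decomposition[OF A] by auto
  have ex: "quad_form R (diag_form R bs) \<and> anisotropic R (diag_form R bs) \<and>
    isometric R A (orth_sum R (diag_form R bs) (hyperbolic_form R m))"
    using bs wiso_isometric quad_form_diag[OF bs(1)] by (simp add: hyperbolic_form_eq diag_append)
  have "witt_index R A = m"
    unfolding witt_index_def
  proof (rule the_equality)
    fix k assume "\<exists>B. quad_form R B \<and> anisotropic R B \<and> isometric R A (orth_sum R B (hyperbolic_form R k))"
    then have "ti R A d \<longleftrightarrow> d \<le> k" for d using tiff by blast
    moreover have "ti R A d \<longleftrightarrow> d \<le> m" for d using tiff ex by blast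
    ultimately show "k = m" by (metis order_antisym order_refl)
  qed (use ex in blast)
  then show "ti R A d \<longleftrightarrow> d \<le> witt_index R A" "2 * witt_index R A \<le> qdim A"
    using tiff ex wiso_dim[OF bs(3)] by auto
qed

section \<open>Inertia and signatures\<close>

lemma cone_sum:
  assumes S: "cone R S" and "finite I" "\<And>i. i \<in> I \<Longrightarrow> t i \<in> insert \<zero> S"
  shows "(\<Oplus>i\<in>I. t i) \<in> insert \<zero> S \<and> ((\<exists>i\<in>I. t i \<noteq> \<zero>) \<longrightarrow> (\<Oplus>i\<in>I. t i) \<in> S)"
  using assms(2,3)
proof (induction I)
  case empty
  then show ?case by simp
next
  case (insert i I)
  have sub: "S \<subseteq> carrier R" and add: "\<And>x y. x \<in> S \<Longrightarrow> y \<in> S \<Longrightarrow> x \<oplus> y \<in> S"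
    using S by (auto simp: cone_def)
  have tc: "t j \<in> carrier R" if "j \<in> insert i I" for j using insert.prems[OF that] sub by auto
  have e: "(\<Oplus>i\<in>insert i I. t i) = t i \<oplus> (\<Oplus>i\<in>I. t i)"
    using insert.hyps tc by (intro finsum_insert) auto
  have IH: "(\<Oplus>i\<in>I. t i) \<in> insert \<zero> S" "(\<exists>i\<in>I. t i \<noteq> \<zero>) \<Longrightarrow> (\<Oplus>i\<in>I. t i) \<in> S"
    using insert by auto
  then have sc: "(\<Oplus>i\<in>I. t i) \<in> carrier R" using sub by auto
  have ti: "t i \<in> insert \<zero> S" using insert.prems by auto
  show ?case
  proof (cases "t i = \<zero>")
    case True
    then show ?thesis using e IH sc by auto
  next
    case False
    then have tS: "t i \<in> S" using ti by auto
    then have "t i \<oplus> (\<Oplus>i\<in>I. t i) \<in> S"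
      using IH(1) add tc[of i] by (cases "(\<Oplus>i\<in>I. t i) = \<zero>") auto
    then show ?thesis using e by simp
  qed
qed

lemma diag_cone:
  assumes S: "cone R S" and as: "set as \<subseteq> carrier R" and v: "v \<in> vecs R (length as)" "v \<noteq> zvec R (length as)"
    and pos: "\<And>i. i < length as \<Longrightarrow> v $ i \<noteq> \<zero> \<Longrightarrow> as ! i \<in> S"
  shows "qeval R (diag_form R as) v \<in> S"
proof -
  have a: "as ! i \<in> carrier R" if "i < length as" for i using as that by (meson nth_mem subsetD)
  have t: "as ! i \<otimes> v $ i \<otimes> v $ i \<in> S" if "i < length as" "v $ i \<noteq> \<zero>" for i
    using S pos[OF that] that v by (auto simp: cone_def)
  have t0: "as ! i \<otimes> v $ i \<otimes> v $ i = \<zero>" if "i < length as" "v $ i = \<zero>" for i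
    using that a by simp
  have nz: "\<zero> \<notin> S" using S by (auto simp: cone_def)
  obtain i where i: "i < length as" "v $ i \<noteq> \<zero>" using vec_nonzero_index[OF v] by auto
  have "(\<Oplus>i\<in>{..<length as}. as ! i \<otimes> v $ i \<otimes> v $ i) \<in> S"
  proof -
    have "as ! j \<otimes> v $ j \<otimes> v $ j \<in> insert \<zero> S" if "j \<in> {..<length as}" for j
      using t[of j] t0[of j] that by (cases "v $ j = \<zero>") auto
    moreover have "as ! i \<otimes> v $ i \<otimes> v $ i \<noteq> \<zero>" using t[OF i] nz by auto
    ultimately show ?thesis
      using cone_sum[OF S finite_lessThan, of "length as" "\<lambda>i. as ! i \<otimes> v $ i \<otimes> v $ i"] i(1) by blast
  qed
  then show ?thesis using qeval_diag[OF as v(1)] by simp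
qed

lemma filter_index:
  "length (filter (\<lambda>i. Q (as ! i)) [0..<length as]) = length (filter Q as)"
proof -
  have "filter Q as = filter Q (map ((!) as) [0..<length as])" by (simp only: map_nth)
  also have "\<dots> = map ((!) as) (filter (\<lambda>i. Q (as ! i)) [0..<length as])"
    by (simp add: filter_map o_def)
  finally show ?thesis by simp
qed

text \<open>If \<open>d\<close> exceeded the number of entries outside \<open>S\<close>, some
  nonzero parameter would have an image whose coordinates vanish at all those entries. The value of
  the form there is a nonempty sum of elements of \<open>S\<close> times squares, hence in
  \<open>S\<close>.\<close>

lemma inertia_bound:
  assumes S: "cone R S" and as: "set as \<subseteq> carrier R - {\<zero>}" and f: "linemb R d (length as) f"
    and n: "\<And>v. v \<in> vecs R d \<Longrightarrow> v \<noteq> zvec R d \<Longrightarrow> qeval R (diag_form R as) (f v) \<notin> S"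
  shows "d \<le> length (filter (\<lambda>a. a \<notin> S) as)"
proof (rule ccontr)
  assume ng: "\<not> ?thesis"
  define js where "js = filter (\<lambda>i. as ! i \<notin> S) [0..<length as]"
  have js: "length js = length (filter (\<lambda>a. a \<notin> S) as)"
    unfolding js_def by (rule filter_index)
  then have lt: "length js < d" using ng by simp
  have jn: "js ! k < length as" if "k < length js" for k
    using nth_mem[OF that] by (simp add: js_def)
  note L = linemb_linmap[OF f]
  have lm: "linmap R d (length js) (\<lambda>v. vec (length js) (\<lambda>k. f v $ (js ! k)))"
    by (intro linmap_vec linfun_index[OF L] jn)
  obtain v where v: "v \<in> vecs R d" "v \<noteq> zvec R d" "vec (length js) (\<lambda>k. f v $ (js ! k)) = zvec R (length js)"
    using linmap_kernel[OF lm lt] by auto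
  have fv: "f v \<in> vecs R (length as)" using linmap_closed[OF L v(1)] .
  have nz: "f v \<noteq> zvec R (length as)" using f v by (auto simp: linemb_def)
  have "as ! i \<in> S" if i: "i < length as" "f v $ i \<noteq> \<zero>" for i
  proof (rule ccontr)
    assume "as ! i \<notin> S"
    then have "i \<in> set js" using i by (simp add: js_def)
    then obtain k where k: "k < length js" "js ! k = i" by (auto simp: in_set_conv_nth)
    have "vec (length js) (\<lambda>k. f v $ (js ! k)) $ k = zvec R (length js) $ k" using v(3) by simp
    then show False using k i by simp
  qed
  then have "qeval R (diag_form R as) (f v) \<in> S"
    using diag_cone[OF S _ fv nz] as by auto
  then show False using n v by simp
qed

lemma ti_inertia:
  assumes S: "cone R S" and as: "set as \<subseteq> carrier R - {\<zero>}" and t: "ti R (diag_form R as) d"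
  shows "d \<le> length (filter (\<lambda>a. a \<notin> S) as)"
proof -
  obtain f where f: "linemb R d (length as) f" "\<forall>v\<in>vecs R d. qeval R (diag_form R as) (f v) = \<zero>"
    using t by (auto simp: ti_def)
  show ?thesis using S f by (intro inertia_bound[OF S as f(1)]) (auto simp: cone_def)
qed

text \<open>The unit vectors belonging to the entries of \<open>as\<close> outside \<open>S\<close>
  span a subspace on which all nonzero vectors have values in \<open>S'\<close>. The isometry
  carries it to the second form, where \<open>inertia_bound\<close> limits its dimension.\<close>

lemma sylvester_le:
  assumes S: "cone_pair R S S'" and as: "set as \<subseteq> carrier R - {\<zero>}" and bs: "set bs \<subseteq> carrier R - {\<zero>}"
    and W: "wiso R (diag_form R as) (diag_form R bs)"
  shows "length (filter (\<lambda>a. a \<notin> S) as) \<le> length (filter (\<lambda>a. a \<notin> S) bs)"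
proof -
  let ?n = "length as" and ?D = "diag_form R as"
  have ac: "set as \<subseteq> carrier R" using as by auto
  have cS: "cone R S" "cone R S'" and un: "S \<union> S' = carrier R - {\<zero>}" and dj: "S \<inter> S' = {}"
    using S by (auto simp: cone_pair_def)
  define js where "js = filter (\<lambda>i. as ! i \<notin> S) [0..<?n]"
  have js: "length js = length (filter (\<lambda>a. a \<notin> S) as)"
    unfolding js_def by (rule filter_index)
  define us where "us = map (uvec R ?n) js"
  have bu: "bform R ?D (uvec R ?n i) (uvec R ?n j) = (if i = j then as ! j else \<zero>)" if "j < ?n" for i j
  proof -
    have "as ! j \<in> carrier R" using ac nth_mem[OF that] by (rule subsetD)
    then show ?thesis using bform_diag_uvec[OF ac _ that, of "uvec R ?n i"] that by auto
  qed
  have jn: "i < ?n \<and> as ! i \<in> S'" if "i \<in> set js" for i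
  proof -
    have i: "i < ?n" "as ! i \<notin> S" using that by (auto simp: js_def)
    then have "as ! i \<in> carrier R - {\<zero>}" using as nth_mem by blast
    then show ?thesis using i un by blast
  qed
  have d: "distinct js" by (simp add: js_def)
  have o: "orthl R ?D us"
    unfolding orthl_def us_def
  proof (intro conjI ballI)
    show "sorted_wrt (\<lambda>u v. bform R ?D u v = \<zero>) (map (uvec R ?n) js)"
      using d jn bu by (auto simp: sorted_wrt_iff_nth_less nth_eq_iff_index_eq)
    fix v assume "v \<in> set (map (uvec R ?n) js)"
    then obtain j where j: "j \<in> set js" "v = uvec R ?n j" by auto
    then show "v \<in> vecs R (qdim ?D)" by simp
    have "as ! j \<noteq> \<zero>" using jn[OF j(1)] cS by (auto simp: cone_def)
    then show "qeval R ?D v \<noteq> \<zero>" using bu[of j j] jn[OF j(1)] j by (simp add: qeval_def)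
  qed
  define cs where "cs = map (qeval R ?D) us"
  have "qeval R ?D (uvec R ?n j) \<in> S'" if "j \<in> set js" for j
    using bu[of j j] jn[OF that] by (simp add: qeval_def)
  then have cS': "set cs \<subseteq> S'" by (auto simp: cs_def us_def)
  have lc: "length cs = length js" by (simp add: cs_def us_def)
  obtain f where f: "linemb R (length cs) ?n f" "\<forall>v\<in>vecs R (length cs). qeval R ?D (f v) = qeval R (diag_form R cs) v"
    using orthl_embed[OF diag_sym[OF ac] o] by (auto simp: cs_def)
  obtain h where h: "linemb R ?n ?n h" "\<forall>v\<in>vecs R ?n. qeval R (diag_form R bs) (h v) = qeval R ?D v"
    using W unfolding wiso_def diag_dim by blast
  have lb: "length bs = ?n" using wiso_dim[OF W] by simp
  have hf: "linemb R (length cs) (length bs) (\<lambda>v. h (f v))" using linemb_comp[OF h(1) f(1)] lb by simp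
  have "length cs \<le> length (filter (\<lambda>a. a \<notin> S) bs)"
  proof (rule inertia_bound[OF cS(1) bs hf])
    fix v assume v: "v \<in> vecs R (length cs)" "v \<noteq> zvec R (length cs)"
    have "qeval R (diag_form R cs) v \<in> S'"
      using cS' cS by (intro diag_cone[OF cS(2) _ v]) (auto simp: cone_def subset_iff)
    moreover have "qeval R (diag_form R bs) (h (f v)) = qeval R (diag_form R cs) v"
      using f(2) h(2) v linmap_closed[OF linemb_linmap[OF f(1)] v(1)] by simp
    ultimately show "qeval R (diag_form R bs) (h (f v)) \<notin> S" using dj by auto
  qed
  then show ?thesis using lc js by simp
qed

text \<open>Two diagonalisations of \<open>A\<close> are isometric, so \<open>sylvester_le\<close>
  in both directions equates their counts; this is the uniqueness that the definite description
  needs.\<close>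

lemma signature_diag:
  assumes P: "field_ordering R P" and as: "set as \<subseteq> carrier R - {\<zero>}" and W: "wiso R A (diag_form R as)"
  shows "signature R P A = int (length (filter (\<lambda>a. a \<in> P) as)) - int (length (filter (\<lambda>a. a \<notin> P) as))"
proof -
  note S = field_ordering_facts(1)[OF P]
  have "s = int (length (filter (\<lambda>a. a \<in> P) as)) - int (length (filter (\<lambda>a. a \<notin> P) as))"
    if bs: "set bs \<subseteq> carrier R - {\<zero>}" "isometric R A (diag_form R bs)"
      "s = int (length (filter (\<lambda>a. a \<in> P) bs)) - int (length (filter (\<lambda>a. a \<notin> P) bs))" for s bs
  proof -
    have W2: "wiso R (diag_form R as) (diag_form R bs)"
      using wiso_trans[OF wiso_sym[OF W] isometric_wiso[OF bs(2)]] .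
    have l: "length as = length bs" using wiso_dim[OF W2] by simp
    have "length (filter (\<lambda>a. a \<notin> P) as) = length (filter (\<lambda>a. a \<notin> P) bs)"
      using sylvester_le[OF S as bs(1) W2] sylvester_le[OF S bs(1) as wiso_sym[OF W2]] by simp
    then show ?thesis using bs(3) l sum_length_filter_compl[of "\<lambda>a. a \<in> P" as] sum_length_filter_compl[of "\<lambda>a. a \<in> P" bs]
      by linarith
  qed
  then show ?thesis unfolding signature_def
    by (intro the_equality) (use as W wiso_isometric in blast)+
qed

lemma orthl_tensor:
  assumes A: "sym_mat R A" and B: "sym_mat R B" and ss: "orthl R A ss" and ts: "orthl R B ts"
  shows "orthl R (tensor_form R A B) (concat (map (\<lambda>s. map (tv R s) ts) ss)) \<and>
    map (qeval R (tensor_form R A B)) (concat (map (\<lambda>s. map (tv R s) ts) ss)) = tens R (map (qeval R A) ss) (map (qeval R B) ts)"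
  using ss
proof (induction ss)
  case Nil
  then show ?case by (simp add: orthl_def)
next
  case (Cons s ss)
  note MA = sym_mat_mats[OF A] and MB = sym_mat_mats[OF B]
  let ?T = "tensor_form R A B"
  have s: "s \<in> vecs R (qdim A)" "qeval R A s \<noteq> \<zero>" and ss: "orthl R A ss"
    and so: "\<And>x. x \<in> set ss \<Longrightarrow> x \<in> vecs R (qdim A) \<and> bform R A s x = \<zero>"
    using Cons.prems by (auto simp: orthl_def)
  have t: "\<And>x. x \<in> set ts \<Longrightarrow> x \<in> vecs R (qdim B) \<and> qeval R B x \<noteq> \<zero>" using ts by (auto simp: orthl_def)
  have b: "bform R ?T (tv R x y) (tv R x' y') = bform R A x x' \<otimes> bform R B y y'"
    if "x \<in> set (s # ss)" "x' \<in> set (s # ss)" "y \<in> set ts" "y' \<in> set ts" for x x' y y'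
    using that s so t by (intro bform_tensor[OF MA MB]) auto
  have q: "qeval R ?T (tv R s y) = qeval R A s \<otimes> qeval R B y" if "y \<in> set ts" for y
    using b[of s s y y] that by (simp add: qeval_def)
  have nz: "qeval R ?T (tv R s y) \<noteq> \<zero>" if "y \<in> set ts" for y
    unfolding q[OF that] using s t[OF that] integral qeval_closed[OF MA s(1)] qeval_closed[OF MB] by blast
  have c: "bform R B y y' \<in> carrier R" "bform R A s s \<in> carrier R" if "y \<in> set ts" "y' \<in> set ts" for y y'
    using that t s bform_closed[OF MB] bform_closed[OF MA] by auto
  have h: "sorted_wrt (\<lambda>u v. bform R ?T u v = \<zero>) (map (tv R s) ts)"
    unfolding sorted_wrt_map
    using ts b c unfolding orthl_def by (auto intro: sorted_wrt_mono_rel[rotated])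
  have cross: "bform R ?T u v = \<zero>" if uv: "u \<in> set (map (tv R s) ts)" "v \<in> set (concat (map (\<lambda>s. map (tv R s) ts) ss))" for u v
  proof -
    obtain y where "y \<in> set ts" "u = tv R s y" using uv(1) by auto
    moreover obtain x y' where "x \<in> set ss" "y' \<in> set ts" "v = tv R x y'" using uv(2) by auto
    ultimately obtain y x y' where "y \<in> set ts" "u = tv R s y" "x \<in> set ss" "y' \<in> set ts" "v = tv R x y'" by blast
    then show ?thesis using b[of s x y y'] so[of x] c by auto
  qed
  have tvv: "tv R s y \<in> vecs R (qdim ?T)" if "y \<in> set ts" for y
    using tv_vecs[OF s(1)] t[OF that] by simp
  have IH: "orthl R ?T (concat (map (\<lambda>s. map (tv R s) ts) ss))"
    "map (qeval R ?T) (concat (map (\<lambda>s. map (tv R s) ts) ss)) = tens R (map (qeval R A) ss) (map (qeval R B) ts)"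
    using Cons.IH[OF ss] by auto
  have "orthl R ?T (concat (map (\<lambda>s. map (tv R s) ts) (s # ss)))"
    using IH(1) h cross nz tvv unfolding orthl_def by (auto simp: sorted_wrt_append)
  then show ?case using IH(2) q by simp
qed

end

section \<open>Base change along field homomorphisms\<close>

locale inf_field_hom = ring_hom_cring R S h + R?: inf_field R + S?: inf_field S
  for R (structure) and S (structure) and h

context ring_hom_cring
begin

lemma map_vec_vecs [simp]: "v \<in> vecs R n \<Longrightarrow> map_vec h v \<in> vecs S n"
  unfolding map_vec_def by (auto intro!: vecs_vecI)

lemma map_mat_mats [simp]: "A \<in> mats R m n \<Longrightarrow> map_mat h A \<in> mats S m n"
  by (rule mat_map_mats) (auto intro: hom_closed)

lemma hom_bform:
  assumes A: "A \<in> mats R n n" and v: "v \<in> vecs R n" and w: "w \<in> vecs R n"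
  shows "h (bform R A v w) = bform S (map_mat h A) (map_vec h v) (map_vec h w)"
proof -
  note d = mats_dim[OF A] vecs_dim[OF v] vecs_dim[OF w]
  have "h (\<Oplus>j\<in>{..<n}. A $$ (i, j) \<otimes> v $ i \<otimes> w $ j) =
    (\<Oplus>\<^bsub>S\<^esub>j\<in>{..<n}. map_mat h A $$ (i, j) \<otimes>\<^bsub>S\<^esub> map_vec h v $ i \<otimes>\<^bsub>S\<^esub> map_vec h w $ j)" if i: "i < n" for i
  proof -
    have "h (\<Oplus>j\<in>{..<n}. A $$ (i, j) \<otimes> v $ i \<otimes> w $ j) = (\<Oplus>\<^bsub>S\<^esub>j\<in>{..<n}. h (A $$ (i, j) \<otimes> v $ i \<otimes> w $ j))"
      using i A v w by (subst hom_finsum) (auto simp: o_def)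
    also have "\<dots> = (\<Oplus>\<^bsub>S\<^esub>j\<in>{..<n}. map_mat h A $$ (i, j) \<otimes>\<^bsub>S\<^esub> map_vec h v $ i \<otimes>\<^bsub>S\<^esub> map_vec h w $ j)"
      using i A v w d by (intro S.finsum_cong') auto
    finally show ?thesis .
  qed
  moreover have "h (\<Oplus>i\<in>{..<n}. \<Oplus>j\<in>{..<n}. A $$ (i, j) \<otimes> v $ i \<otimes> w $ j) =
    (\<Oplus>\<^bsub>S\<^esub>i\<in>{..<n}. h (\<Oplus>j\<in>{..<n}. A $$ (i, j) \<otimes> v $ i \<otimes> w $ j))"
    using A v w by (subst hom_finsum) (auto simp: o_def intro!: R.finsum_closed)
  ultimately show ?thesis
    unfolding bform_def index_map_mat(2) d(1)
    using A v w d by (auto intro!: S.finsum_cong' S.finsum_closed)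
qed

lemma hom_qeval:
  assumes "A \<in> mats R n n" "v \<in> vecs R n"
  shows "h (qeval R A v) = qeval S (map_mat h A) (map_vec h v)"
  unfolding qeval_def by (rule hom_bform[OF assms assms(2)])

lemma hom_sym_mat: "sym_mat R A \<Longrightarrow> sym_mat S (map_mat h A)"
  using map_mat_mats[OF sym_mat_mats] mats_dim by (fastforce simp: sym_mat_def)

end

lemma (in ring_hom_cring) field_hom_zero_iff:
  assumes "field R" "field S" "x \<in> carrier R"
  shows "h x = \<zero>\<^bsub>S\<^esub> \<longleftrightarrow> x = \<zero>"
proof
  interpret R: field R by fact
  interpret S: field S by fact
  assume z: "h x = \<zero>\<^bsub>S\<^esub>"
  show "x = \<zero>"
  proof (rule ccontr)
    assume "x \<noteq> \<zero>"
    then have iv: "inv x \<in> carrier R" "inv x \<otimes> x = \<one>" using assms R.field_Units by auto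
    then have "h (inv x) \<otimes>\<^bsub>S\<^esub> h x = \<one>\<^bsub>S\<^esub>" using assms(3) hom_mult[of "inv x" x] by simp
    then show False using z iv by simp
  qed
qed simp

text \<open>A homomorphism of fields is injective, so infinity and 2 being nonzero pass to the
  target.\<close>

lemma inf_field_homI:
  assumes R: "inf_field R" and S: "field S" and h: "h \<in> Ring.ring_hom R S"
  shows "inf_field_hom R S h"
proof -
  interpret R: inf_field R by fact
  interpret S: field S by fact
  interpret ring_hom_cring R S h
    by unfold_locales (rule h)
  note zi = field_hom_zero_iff[OF R.field_axioms S]
  have "inj_on h (carrier R)"
  proof (rule inj_onI)
    fix x y assume xy: "x \<in> carrier R" "y \<in> carrier R" "h x = h y"
    then have "h (x \<ominus>\<^bsub>R\<^esub> y) = \<zero>\<^bsub>S\<^esub>" by (simp add: a_minus_def S.r_neg)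
    then have "x \<ominus>\<^bsub>R\<^esub> y = \<zero>\<^bsub>R\<^esub>" using zi[of "x \<ominus>\<^bsub>R\<^esub> y"] xy by blast
    then show "x = y" using xy R.r_right_minus_eq by blast
  qed
  then have "infinite (h ` carrier R)" using R.infinite_carrier finite_imageD by blast
  moreover have "h ` carrier R \<subseteq> carrier S" by auto
  ultimately have "infinite (carrier S)" using finite_subset by blast
  moreover have "\<one>\<^bsub>S\<^esub> \<oplus>\<^bsub>S\<^esub> \<one>\<^bsub>S\<^esub> \<noteq> \<zero>\<^bsub>S\<^esub>"
    using zi[of "\<one>\<^bsub>R\<^esub> \<oplus>\<^bsub>R\<^esub> \<one>\<^bsub>R\<^esub>"] R.two by simp
  ultimately have "inf_field S" using S by (simp add: inf_field_def inf_field_axioms_def)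
  then interpret S: inf_field S .
  show ?thesis by unfold_locales
qed

context inf_field_hom
begin

lemma hom_zero_iff: "x \<in> carrier R \<Longrightarrow> h x = \<zero>\<^bsub>S\<^esub> \<longleftrightarrow> x = \<zero>"
  by (rule field_hom_zero_iff[OF R.field_axioms S.field_axioms])

lemma hom_orthl:
  assumes A: "sym_mat R A" and vs: "orthl R A vs"
  shows "orthl S (map_mat h A) (map (map_vec h) vs)"
    "map (qeval S (map_mat h A)) (map (map_vec h) vs) = map h (map (qeval R A) vs)"
proof -
  note M = sym_mat_mats[OF A]
  have v: "v \<in> vecs R (qdim A)" "qeval R A v \<noteq> \<zero>" if "v \<in> set vs" for v using vs that by (auto simp: orthl_def)
  have q: "qeval S (map_mat h A) (map_vec h v) = h (qeval R A v)" if "v \<in> set vs" for v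
    using hom_qeval[OF M v(1)[OF that]] by simp
  then show "map (qeval S (map_mat h A)) (map (map_vec h) vs) = map h (map (qeval R A) vs)" by simp
  have b: "bform S (map_mat h A) (map_vec h u) (map_vec h v) = h (bform R A u v)" if "u \<in> set vs" "v \<in> set vs" for u v
    using hom_bform[OF M v(1)[OF that(1)] v(1)[OF that(2)]] by simp
  have "sorted_wrt (\<lambda>u v. bform S (map_mat h A) (map_vec h u) (map_vec h v) = \<zero>\<^bsub>S\<^esub>) vs"
    using vs b unfolding orthl_def sorted_wrt_iff_nth_less by simp
  moreover have "qeval S (map_mat h A) (map_vec h v) \<noteq> \<zero>\<^bsub>S\<^esub>" if "v \<in> set vs" for v
    using q[OF that] hom_zero_iff[OF R.qeval_closed[OF M v(1)[OF that]]] v(2)[OF that] by simp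
  ultimately show "orthl S (map_mat h A) (map (map_vec h) vs)"
    using v(1) unfolding orthl_def sorted_wrt_map by auto
qed

text \<open>Base change is controlled through one orthogonal basis over \<open>R\<close>: an
  injective homomorphism preserves both its orthogonality and the nonvanishing of its
  values.\<close>

lemma hom_wiso:
  assumes A: "sym_mat R A" and vs: "orthl R A vs" "length vs = qdim A"
  shows "wiso S (diag_form S (map h (map (qeval R A) vs))) (map_mat h A)" "quad_form S (map_mat h A)"
proof -
  note O = hom_orthl[OF A vs(1)]
  have l: "length (map (map_vec h) vs) = qdim (map_mat h A)" using vs(2) by simp
  show "wiso S (diag_form S (map h (map (qeval R A) vs))) (map_mat h A)"
    using S.orthl_wiso[OF hom_sym_mat[OF A] O(1) l] unfolding O(2) .
  show "quad_form S (map_mat h A)" by (rule S.orthl_quad_form[OF hom_sym_mat[OF A] O(1) l])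
qed

end

section \<open>Quadratic extensions\<close>

text \<open>The quadratic extension \<open>R[T]/(T\<^sup>2 - \<sigma>T - \<beta>)\<close> is put on the type of \<open>R\<close> itself, through a
  bijection of the (infinite) type with its square, so that extensions can be iterated in an
  induction.\<close>

definition enc :: "'a \<times> 'a \<Rightarrow> 'a" where
  "enc = (SOME f. bij f)"

definition qc :: "'a \<Rightarrow> 'a \<Rightarrow> 'a" where
  "qc a b = enc (a, b)"

definition qre :: "'a \<Rightarrow> 'a" where
  "qre z = fst (inv_into UNIV enc z)"

definition qim :: "'a \<Rightarrow> 'a" where
  "qim z = snd (inv_into UNIV enc z)"

definition quad_ext :: "('a, 'b) ring_scheme \<Rightarrow> 'a \<Rightarrow> 'a \<Rightarrow> ('a, 'b) ring_scheme" where
  "quad_ext R \<sigma> \<beta> = R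
     \<lparr> carrier := {z. qre z \<in> carrier R \<and> qim z \<in> carrier R},
       monoid.mult := (\<lambda>z w. qc
         (qre z \<otimes>\<^bsub>R\<^esub> qre w \<oplus>\<^bsub>R\<^esub> \<beta> \<otimes>\<^bsub>R\<^esub> (qim z \<otimes>\<^bsub>R\<^esub> qim w))
         (qre z \<otimes>\<^bsub>R\<^esub> qim w \<oplus>\<^bsub>R\<^esub> qim z \<otimes>\<^bsub>R\<^esub> qre w \<oplus>\<^bsub>R\<^esub> \<sigma> \<otimes>\<^bsub>R\<^esub> (qim z \<otimes>\<^bsub>R\<^esub> qim w))),
       one := qc \<one>\<^bsub>R\<^esub> \<zero>\<^bsub>R\<^esub>,
       zero := qc \<zero>\<^bsub>R\<^esub> \<zero>\<^bsub>R\<^esub>,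
       add := (\<lambda>z w. qc (qre z \<oplus>\<^bsub>R\<^esub> qre w) (qim z \<oplus>\<^bsub>R\<^esub> qim w)) \<rparr>"

definition qemb :: "('a, 'b) ring_scheme \<Rightarrow> 'a \<Rightarrow> 'a" where
  "qemb R a = qc a \<zero>\<^bsub>R\<^esub>"

text \<open>For the quadratic polynomial \<open>T^2 - \<sigma> T - \<beta>\<close>, having no root
  is the same as being irreducible.\<close>

definition irred :: "('a, 'b) ring_scheme \<Rightarrow> 'a \<Rightarrow> 'a \<Rightarrow> bool" where
  "irred R \<sigma> \<beta> \<longleftrightarrow> (\<forall>t\<in>carrier R. t \<otimes>\<^bsub>R\<^esub> t \<noteq> \<sigma> \<otimes>\<^bsub>R\<^esub> t \<oplus>\<^bsub>R\<^esub> \<beta>)"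

lemma bij_enc:
  assumes "infinite (UNIV :: 'a set)"
  shows "bij (enc :: 'a \<times> 'a \<Rightarrow> 'a)"
proof -
  have "\<exists>f :: 'a \<times> 'a \<Rightarrow> 'a. bij f"
    using card_of_Times_same_infinite[OF assms] card_of_ordIso[of "UNIV \<times> UNIV :: ('a \<times> 'a) set" "UNIV :: 'a set"]
    by auto
  then show ?thesis unfolding enc_def by (rule someI_ex)
qed

context inf_field
begin

lemma bij_enc': "bij (enc :: 'a \<times> 'a \<Rightarrow> 'a)"
  by (rule bij_enc) (metis infinite_carrier finite_subset subset_UNIV)

lemma qre_qc [simp]: "qre (qc (a::'a) b) = a"
  using bij_enc' by (simp add: qre_def qc_def bij_is_inj)

lemma qim_qc [simp]: "qim (qc (a::'a) b) = b"
  using bij_enc' by (simp add: qim_def qc_def bij_is_inj)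

lemma qc_eta [simp]: "qc (qre z) (qim z) = (z::'a)"
  using bij_enc' by (simp add: qre_def qim_def qc_def bij_is_surj surj_f_inv_f)

lemma qc_eq_iff: "z = (w::'a) \<longleftrightarrow> qre z = qre w \<and> qim z = qim w"
  by (metis qc_eta)

context
  fixes \<sigma> \<beta> E
  assumes \<sigma>: "\<sigma> \<in> carrier R" and \<beta>: "\<beta> \<in> carrier R"
    and E_def: "E = quad_ext R \<sigma> \<beta>"
begin

lemma E_carrier [simp]: "z \<in> carrier E \<longleftrightarrow> qre z \<in> carrier R \<and> qim z \<in> carrier R"
  by (simp add: E_def quad_ext_def)

lemma E_mult [simp]:
  "qre (z \<otimes>\<^bsub>E\<^esub> w) = qre z \<otimes> qre w \<oplus> \<beta> \<otimes> (qim z \<otimes> qim w)"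
  "qim (z \<otimes>\<^bsub>E\<^esub> w) = qre z \<otimes> qim w \<oplus> qim z \<otimes> qre w \<oplus> \<sigma> \<otimes> (qim z \<otimes> qim w)"
  by (simp_all add: E_def quad_ext_def)

lemma E_add [simp]:
  "qre (z \<oplus>\<^bsub>E\<^esub> w) = qre z \<oplus> qre w" "qim (z \<oplus>\<^bsub>E\<^esub> w) = qim z \<oplus> qim w"
  by (simp_all add: E_def quad_ext_def)

lemma E_one [simp]: "qre \<one>\<^bsub>E\<^esub> = \<one>" "qim \<one>\<^bsub>E\<^esub> = \<zero>"
  by (simp_all add: E_def quad_ext_def)

lemma E_zero [simp]: "qre \<zero>\<^bsub>E\<^esub> = \<zero>" "qim \<zero>\<^bsub>E\<^esub> = \<zero>"
  by (simp_all add: E_def quad_ext_def)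

lemma E_cring: "cring E"
proof (rule cringI)
  show "abelian_group E"
  proof (rule abelian_groupI)
    fix x assume x: "x \<in> carrier E"
    show "\<exists>y\<in>carrier E. y \<oplus>\<^bsub>E\<^esub> x = \<zero>\<^bsub>E\<^esub>"
      using x by (intro bexI[of _ "qc (\<ominus> qre x) (\<ominus> qim x)"]) (auto simp: qc_eq_iff l_neg)
  qed (auto simp: qc_eq_iff a_ac)
  show "comm_monoid E"
  proof (rule comm_monoidI)
    fix x y z assume "x \<in> carrier E" "y \<in> carrier E" "z \<in> carrier E"
    then have c: "qre x \<in> carrier R" "qim x \<in> carrier R" "qre y \<in> carrier R" "qim y \<in> carrier R"
      "qre z \<in> carrier R" "qim z \<in> carrier R" by auto
    show "x \<otimes>\<^bsub>E\<^esub> y \<otimes>\<^bsub>E\<^esub> z = x \<otimes>\<^bsub>E\<^esub> (y \<otimes>\<^bsub>E\<^esub> z)"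
      unfolding qc_eq_iff[of "x \<otimes>\<^bsub>E\<^esub> y \<otimes>\<^bsub>E\<^esub> z"] E_mult
      using c \<sigma> \<beta> by algebra
    show "x \<otimes>\<^bsub>E\<^esub> y = y \<otimes>\<^bsub>E\<^esub> x"
      unfolding qc_eq_iff[of "x \<otimes>\<^bsub>E\<^esub> y"] E_mult
      using c \<sigma> \<beta> by algebra
  qed (use \<sigma> \<beta> in \<open>auto simp: qc_eq_iff\<close>)
  fix x y z assume "x \<in> carrier E" "y \<in> carrier E" "z \<in> carrier E"
  then have c: "qre x \<in> carrier R" "qim x \<in> carrier R" "qre y \<in> carrier R" "qim y \<in> carrier R"
    "qre z \<in> carrier R" "qim z \<in> carrier R" by auto
  show "(x \<oplus>\<^bsub>E\<^esub> y) \<otimes>\<^bsub>E\<^esub> z = x \<otimes>\<^bsub>E\<^esub> z \<oplus>\<^bsub>E\<^esub> y \<otimes>\<^bsub>E\<^esub> z"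
    unfolding qc_eq_iff[of "(x \<oplus>\<^bsub>E\<^esub> y) \<otimes>\<^bsub>E\<^esub> z"] E_mult E_add
    using c \<sigma> \<beta> by algebra
qed

lemma qemb_hom: "qemb R \<in> Ring.ring_hom R E"
  by (rule ring_hom_memI) (use \<sigma> \<beta> in \<open>auto simp: qemb_def qc_eq_iff\<close>)

lemma qemb_simps [simp]: "qre (qemb R a) = a" "qim (qemb R a) = \<zero>"
  by (auto simp: qemb_def)

text \<open>The norm of \<open>a + bT\<close> is \<open>a\<^sup>2 + \<sigma>ab - \<beta>b\<^sup>2\<close>; for \<open>b \<noteq> 0\<close> it vanishes only if \<open>-a/b\<close> is a root.\<close>

lemma norm_nonzero:
  assumes irr: "irred R \<sigma> \<beta>" and a: "a \<in> carrier R" and b: "b \<in> carrier R" and nz: "\<not> (a = \<zero> \<and> b = \<zero>)"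
  shows "a \<otimes> a \<oplus> \<sigma> \<otimes> (a \<otimes> b) \<ominus> \<beta> \<otimes> (b \<otimes> b) \<noteq> \<zero>"
proof
  assume z: "a \<otimes> a \<oplus> \<sigma> \<otimes> (a \<otimes> b) \<ominus> \<beta> \<otimes> (b \<otimes> b) = \<zero>"
  show False
  proof (cases "b = \<zero>")
    case True
    then have "a \<otimes> a = \<zero>" using z a \<sigma> \<beta> by (simp add: a_minus_def)
    then show False using True nz a integral by blast
  next
    case False
    then obtain c where c: "c \<in> carrier R" "c \<otimes> b = \<one>" using b field_Units by (metis Diff_iff Units_inv_closed Units_l_inv singletonD)
    define t where "t = \<ominus> (a \<otimes> c)"
    have t: "t \<in> carrier R" using a c by (simp add: t_def)
    \<comment> \<open>The products \<open>c \<otimes> b\<close> are left unevaluated so that this is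
      a polynomial identity; setting them to 1 afterwards removes the second summand.\<close>
    have "t \<otimes> t \<ominus> (\<sigma> \<otimes> t \<oplus> \<beta> \<otimes> ((c \<otimes> b) \<otimes> (c \<otimes> b))) = (c \<otimes> c) \<otimes> (a \<otimes> a \<oplus> \<sigma> \<otimes> (a \<otimes> b) \<ominus> \<beta> \<otimes> (b \<otimes> b))
       \<oplus> (\<sigma> \<otimes> a \<otimes> c) \<otimes> (\<one> \<ominus> c \<otimes> b)"
      unfolding t_def using a b c(1) \<sigma> \<beta> by algebra
    then have "t \<otimes> t \<ominus> (\<sigma> \<otimes> t \<oplus> \<beta>) = \<zero>"
      unfolding z c(2) using a c \<sigma> \<beta> t by (simp add: a_minus_def r_neg)
    then have "t \<otimes> t = \<sigma> \<otimes> t \<oplus> \<beta>" using t \<sigma> \<beta> by simp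
    then show False using irr t by (simp add: irred_def)
  qed
qed

lemma E_field:
  assumes irr: "irred R \<sigma> \<beta>"
  shows "field E"
proof (rule cring.cring_fieldI2[OF E_cring])
  show "\<zero>\<^bsub>E\<^esub> \<noteq> \<one>\<^bsub>E\<^esub>" by (simp add: qc_eq_iff[of "\<zero>\<^bsub>E\<^esub>"])
  fix z assume z: "z \<in> carrier E" "z \<noteq> \<zero>\<^bsub>E\<^esub>"
  define a b where "a = qre z" and "b = qim z"
  have ab: "a \<in> carrier R" "b \<in> carrier R" "\<not> (a = \<zero> \<and> b = \<zero>)"
    using z by (auto simp: a_def b_def qc_eq_iff[of z])
  define N where "N = a \<otimes> a \<oplus> \<sigma> \<otimes> (a \<otimes> b) \<ominus> \<beta> \<otimes> (b \<otimes> b)"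
  have N: "N \<in> carrier R" "N \<noteq> \<zero>" using norm_nonzero[OF irr ab] ab \<sigma> \<beta> by (auto simp: N_def)
  then obtain c where c: "c \<in> carrier R" "c \<otimes> N = \<one>"
    using field_Units by (metis Diff_iff Units_inv_closed Units_l_inv singletonD)
  \<comment> \<open>The conjugate divided by the norm: the second root is \<sigma> - T, so a + bT
    has the conjugate a + \<sigma>b - bT.\<close>
  define w where "w = qc ((a \<oplus> \<sigma> \<otimes> b) \<otimes> c) (\<ominus> (b \<otimes> c))"
  have w: "w \<in> carrier E" using ab c \<sigma> by (simp add: w_def)
  have "qre (z \<otimes>\<^bsub>E\<^esub> w) = c \<otimes> N"
    unfolding E_mult w_def qre_qc qim_qc a_def[symmetric] b_def[symmetric] N_def
    using ab c(1) \<sigma> \<beta> by algebra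
  moreover have "qim (z \<otimes>\<^bsub>E\<^esub> w) = \<zero>"
    unfolding E_mult w_def qre_qc qim_qc a_def[symmetric] b_def[symmetric]
    using ab c(1) \<sigma> \<beta> by algebra
  ultimately have "z \<otimes>\<^bsub>E\<^esub> w = \<one>\<^bsub>E\<^esub>" using c by (simp add: qc_eq_iff[of "z \<otimes>\<^bsub>E\<^esub> w"])
  then show "\<exists>w\<in>carrier E. z \<otimes>\<^bsub>E\<^esub> w = \<one>\<^bsub>E\<^esub>" using w by blast
qed

lemma E_inf_field_hom: "irred R \<sigma> \<beta> \<Longrightarrow> inf_field_hom R E (qemb R)"
  by (rule inf_field_homI[OF inf_field_axioms E_field qemb_hom])

lemma qre_finsum:
  assumes "finite I" "\<And>i. i \<in> I \<Longrightarrow> f i \<in> carrier E"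
  shows "qre (\<Oplus>\<^bsub>E\<^esub>i\<in>I. f i) = (\<Oplus>i\<in>I. qre (f i)) \<and> qim (\<Oplus>\<^bsub>E\<^esub>i\<in>I. f i) = (\<Oplus>i\<in>I. qim (f i))"
proof -
  interpret E: cring E by (rule E_cring)
  show ?thesis using assms
  proof (induction I)
    case empty
    then show ?case by simp
  next
    case (insert i I)
    have "(\<Oplus>\<^bsub>E\<^esub>i\<in>insert i I. f i) = f i \<oplus>\<^bsub>E\<^esub> (\<Oplus>\<^bsub>E\<^esub>i\<in>I. f i)"
      using insert by (intro E.finsum_insert) auto
    moreover have "(\<Oplus>i\<in>insert i I. qre (f i)) = qre (f i) \<oplus> (\<Oplus>i\<in>I. qre (f i))"
      "(\<Oplus>i\<in>insert i I. qim (f i)) = qim (f i) \<oplus> (\<Oplus>i\<in>I. qim (f i))"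
      using insert by (auto intro!: finsum_insert)
    ultimately show ?case using insert by simp
  qed
qed

text \<open>Expand q(u + Tv) = q(u) + 2 b(u, v) T + q(v) T^2 and substitute T^2 = \<sigma>T +
  \<beta>; the two equations are the coefficients of 1 and T.\<close>

lemma qeval_quad_ext:
  assumes l: "set l \<subseteq> carrier R" and w: "w \<in> vecs E (length l)"
  defines "u \<equiv> map_vec qre w" and "v \<equiv> map_vec qim w"
  shows "u \<in> vecs R (length l)" "v \<in> vecs R (length l)"
    "qre (qeval E (diag_form E (map (qemb R) l)) w) = qeval R (diag_form R l) u \<oplus> \<beta> \<otimes> qeval R (diag_form R l) v"
    "qim (qeval E (diag_form E (map (qemb R) l)) w) =
       bform R (diag_form R l) u v \<oplus> bform R (diag_form R l) u v \<oplus> \<sigma> \<otimes> qeval R (diag_form R l) v"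
proof -
  interpret E: cring E by (rule E_cring)
  let ?n = "length l"
  note dw = vecs_dim[OF w]
  have wi: "qre (w $ i) \<in> carrier R" "qim (w $ i) \<in> carrier R" if "i < ?n" for i
    using vecs_index[OF w that] by simp_all
  have li: "l ! i \<in> carrier R" if "i < ?n" for i using l nth_mem[OF that] by blast
  show u: "u \<in> vecs R ?n" and v: "v \<in> vecs R ?n"
    unfolding u_def v_def map_vec_def dw using wi by (auto intro!: vecs_vecI)
  have ui: "u $ i = qre (w $ i)" "v $ i = qim (w $ i)" if "i < ?n" for i
    using that dw by (auto simp: u_def v_def)
  have lE: "set (map (qemb R) l) \<subseteq> carrier E" using l by auto
  have tc: "qemb R (l ! i) \<otimes>\<^bsub>E\<^esub> w $ i \<otimes>\<^bsub>E\<^esub> w $ i \<in> carrier E" if "i < ?n" for i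
    using vecs_index[OF w that] li[OF that] by (intro E.m_closed) auto
  have "qeval E (diag_form E (map (qemb R) l)) w = (\<Oplus>\<^bsub>E\<^esub>i\<in>{..<?n}. map (qemb R) l ! i \<otimes>\<^bsub>E\<^esub> w $ i \<otimes>\<^bsub>E\<^esub> w $ i)"
    using E.qeval_diag[OF lE, of w] w by simp
  also have "\<dots> = (\<Oplus>\<^bsub>E\<^esub>i\<in>{..<?n}. qemb R (l ! i) \<otimes>\<^bsub>E\<^esub> w $ i \<otimes>\<^bsub>E\<^esub> w $ i)"
    by (rule E.finsum_cong') (use tc in auto)
  finally have q: "qeval E (diag_form E (map (qemb R) l)) w = (\<Oplus>\<^bsub>E\<^esub>i\<in>{..<?n}. qemb R (l ! i) \<otimes>\<^bsub>E\<^esub> w $ i \<otimes>\<^bsub>E\<^esub> w $ i)" .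
  have re: "qre (qemb R (l ! i) \<otimes>\<^bsub>E\<^esub> w $ i \<otimes>\<^bsub>E\<^esub> w $ i) = l ! i \<otimes> u $ i \<otimes> u $ i \<oplus> \<beta> \<otimes> (l ! i \<otimes> v $ i \<otimes> v $ i)"
    if "i < ?n" for i
    unfolding E_mult qemb_simps ui[OF that]
    using wi[OF that] li[OF that] \<sigma> \<beta> by algebra
  have im: "qim (qemb R (l ! i) \<otimes>\<^bsub>E\<^esub> w $ i \<otimes>\<^bsub>E\<^esub> w $ i) =
      l ! i \<otimes> u $ i \<otimes> v $ i \<oplus> l ! i \<otimes> u $ i \<otimes> v $ i \<oplus> \<sigma> \<otimes> (l ! i \<otimes> v $ i \<otimes> v $ i)"
    if "i < ?n" for i
    unfolding E_mult qemb_simps ui[OF that]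
    using wi[OF that] li[OF that] \<sigma> \<beta> by algebra
  have F: "qre (\<Oplus>\<^bsub>E\<^esub>i\<in>{..<?n}. qemb R (l ! i) \<otimes>\<^bsub>E\<^esub> w $ i \<otimes>\<^bsub>E\<^esub> w $ i) =
      (\<Oplus>i\<in>{..<?n}. qre (qemb R (l ! i) \<otimes>\<^bsub>E\<^esub> w $ i \<otimes>\<^bsub>E\<^esub> w $ i)) \<and>
    qim (\<Oplus>\<^bsub>E\<^esub>i\<in>{..<?n}. qemb R (l ! i) \<otimes>\<^bsub>E\<^esub> w $ i \<otimes>\<^bsub>E\<^esub> w $ i) =
      (\<Oplus>i\<in>{..<?n}. qim (qemb R (l ! i) \<otimes>\<^bsub>E\<^esub> w $ i \<otimes>\<^bsub>E\<^esub> w $ i))"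
    using tc lessThan_iff by (intro qre_finsum finite_lessThan) blast
  have fs: "(\<Oplus>i\<in>{..<?n}. x i \<oplus> c \<otimes> y i) = (\<Oplus>i\<in>{..<?n}. x i) \<oplus> c \<otimes> (\<Oplus>i\<in>{..<?n}. y i)"
    if "c \<in> carrier R" "\<And>i. i < ?n \<Longrightarrow> x i \<in> carrier R" "\<And>i. i < ?n \<Longrightarrow> y i \<in> carrier R" for x y c
    using that by (subst finsum_rdistr) (auto intro!: finsum_addf)
  have "qre (qeval E (diag_form E (map (qemb R) l)) w) = (\<Oplus>i\<in>{..<?n}. l ! i \<otimes> u $ i \<otimes> u $ i \<oplus> \<beta> \<otimes> (l ! i \<otimes> v $ i \<otimes> v $ i))"
    unfolding q conjunct1[OF F]
    by (rule finsum_cong') (use re li u v \<beta> in \<open>auto simp del: E_mult\<close>)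
  also have "\<dots> = (\<Oplus>i\<in>{..<?n}. l ! i \<otimes> u $ i \<otimes> u $ i) \<oplus> \<beta> \<otimes> (\<Oplus>i\<in>{..<?n}. l ! i \<otimes> v $ i \<otimes> v $ i)"
    using li u v \<beta> by (intro fs) auto
  finally show "qre (qeval E (diag_form E (map (qemb R) l)) w) = qeval R (diag_form R l) u \<oplus> \<beta> \<otimes> qeval R (diag_form R l) v"
    unfolding qeval_diag[OF l u] qeval_diag[OF l v] .
  have "qim (qeval E (diag_form E (map (qemb R) l)) w) =
    (\<Oplus>i\<in>{..<?n}. (l ! i \<otimes> u $ i \<otimes> v $ i \<oplus> l ! i \<otimes> u $ i \<otimes> v $ i) \<oplus> \<sigma> \<otimes> (l ! i \<otimes> v $ i \<otimes> v $ i))"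
    unfolding q conjunct2[OF F]
    by (rule finsum_cong') (use im li u v \<sigma> in \<open>auto simp del: E_mult\<close>)
  also have "\<dots> = (\<Oplus>i\<in>{..<?n}. l ! i \<otimes> u $ i \<otimes> v $ i \<oplus> l ! i \<otimes> u $ i \<otimes> v $ i) \<oplus> \<sigma> \<otimes> (\<Oplus>i\<in>{..<?n}. l ! i \<otimes> v $ i \<otimes> v $ i)"
    using li u v \<sigma> by (intro fs) auto
  also have "(\<Oplus>i\<in>{..<?n}. l ! i \<otimes> u $ i \<otimes> v $ i \<oplus> l ! i \<otimes> u $ i \<otimes> v $ i) =
    (\<Oplus>i\<in>{..<?n}. l ! i \<otimes> u $ i \<otimes> v $ i) \<oplus> (\<Oplus>i\<in>{..<?n}. l ! i \<otimes> u $ i \<otimes> v $ i)"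
    using li u v by (intro finsum_addf) auto
  finally show "qim (qeval E (diag_form E (map (qemb R) l)) w) =
       bform R (diag_form R l) u v \<oplus> bform R (diag_form R l) u v \<oplus> \<sigma> \<otimes> qeval R (diag_form R l) v"
    unfolding qeval_diag[OF l v] bform_diag[OF l u v] .
qed

end

declare E_carrier [simp del] E_mult [simp del] E_add [simp del] E_one [simp del] E_zero [simp del]
  qemb_simps [simp del]

end

section \<open>Isotropy of \<open>\<phi> \<bottom> b\<phi>\<close> and of \<open>\<phi>\<close> over
  quadratic extensions\<close>

lemma linembD: "linemb R m n f \<Longrightarrow> v \<in> vecs R m \<Longrightarrow> f v = zvec R n \<Longrightarrow> v = zvec R m"
  by (simp add: linemb_def)

context inf_field
begin

lemma qc_eqI: "qre z = qre w \<Longrightarrow> qim z = qim w \<Longrightarrow> z = (w::'a)"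
  using qc_eq_iff by blast

lemma linmap_vscale:
  assumes t: "t \<in> carrier R"
  shows "linmap R n n (vscale R t)"
  unfolding linmap_def
proof (intro conjI ballI)
  fix v assume v: "v \<in> vecs R n"
  then show "vscale R t v \<in> vecs R n" using t by simp
  fix u assume u: "u \<in> vecs R n"
  show "vscale R t (vadd R v u) = vadd R (vscale R t v) (vscale R t u)"
    using u v t by (intro eq_vecI) (simp_all add: r_distr)
next
  fix c v assume c: "c \<in> carrier R" and v: "v \<in> vecs R n"
  show "vscale R t (vscale R c v) = vscale R c (vscale R t v)"
    unfolding vscale_vscale[OF t c v] vscale_vscale[OF c t v] using m_comm[OF t c] by simp
qed

lemma qeval_diag_scale:
  assumes l: "set l \<subseteq> carrier R" and b: "b \<in> carrier R" and v: "v \<in> vecs R (length l)"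
  shows "qeval R (diag_form R (map (\<lambda>a. b \<otimes> a) l)) v = b \<otimes> qeval R (diag_form R l) v"
proof -
  have li: "l ! i \<in> carrier R" if "i < length l" for i using l nth_mem[OF that] by blast
  have bl: "set (map (\<lambda>a. b \<otimes> a) l) \<subseteq> carrier R" using l b by auto
  have "qeval R (diag_form R (map (\<lambda>a. b \<otimes> a) l)) v =
    (\<Oplus>i\<in>{..<length l}. map (\<lambda>a. b \<otimes> a) l ! i \<otimes> v $ i \<otimes> v $ i)"
    using qeval_diag[OF bl, of v] v by simp
  also have "\<dots> = (\<Oplus>i\<in>{..<length l}. b \<otimes> (l ! i \<otimes> v $ i \<otimes> v $ i))"
  proof (rule finsum_cong')
    fix i assume "i \<in> {..<length l}"
    then have i: "i < length l" by simp
    note c = li[OF i] vecs_index[OF v i]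
    show "map (\<lambda>a. b \<otimes> a) l ! i \<otimes> v $ i \<otimes> v $ i = b \<otimes> (l ! i \<otimes> v $ i \<otimes> v $ i)"
      using i c b by (simp add: m_assoc)
  qed (use li b v in auto)
  also have "\<dots> = b \<otimes> (\<Oplus>i\<in>{..<length l}. l ! i \<otimes> v $ i \<otimes> v $ i)"
    using li b v by (intro finsum_rdistr[symmetric]) auto
  finally show ?thesis using qeval_diag[OF l v] by simp
qed

lemma qeval_diag_double:
  assumes l: "set l \<subseteq> carrier R" and b: "b \<in> carrier R" and v: "v \<in> vecs R (length l + length l)"
  shows "qeval R (diag_form R (l @ map (\<lambda>a. b \<otimes> a) l)) v =
    qeval R (diag_form R l) (vec (length l) (($) v)) \<oplus> b \<otimes> qeval R (diag_form R l) (vdrop (length l) (length l) v)"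
proof -
  have bl: "set (map (\<lambda>a. b \<otimes> a) l) \<subseteq> carrier R" using l b by auto
  have M: "diag_form R (map (\<lambda>a. b \<otimes> a) l) \<in> mats R (length l) (length l)"
    using diag_mats[OF bl] by simp
  show ?thesis
    unfolding diag_append qeval_orth_sum[OF diag_mats[OF l] M v]
    using qeval_diag_scale[OF l b vdrop_vecs[OF v]] by simp
qed

lemma ti_double:
  assumes l: "set l \<subseteq> carrier R" and b: "b \<in> carrier R" and t: "ti R (diag_form R l) d"
  shows "ti R (diag_form R (l @ map (\<lambda>a. b \<otimes> a) l)) (2 * d)"
proof -
  let ?n = "length l"
  obtain f where f: "linemb R d ?n f" "\<forall>v\<in>vecs R d. qeval R (diag_form R l) (f v) = \<zero>"
    using t by (auto simp: ti_def)
  note L = linemb_linmap[OF f(1)]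
  define g where "g v = f (vec d (($) v)) @\<^sub>v f (vdrop d d v)" for v
  have t: "linmap R (d + d) d (\<lambda>v. vec d (($) v))" by (rule linmap_take) simp
  have gl: "linmap R (d + d) (?n + ?n) g"
    unfolding g_def by (rule linmap_append[OF linmap_comp[OF L t] linmap_comp[OF L vdrop_linmap]])
  have c: "f (vec d (($) v)) \<in> vecs R ?n" "f (vdrop d d v) \<in> vecs R ?n"
    "vec d (($) v) \<in> vecs R d" "vdrop d d v \<in> vecs R d" if v: "v \<in> vecs R (d + d)" for v
    using linmap_closed[OF L linmap_closed[OF t v]] linmap_closed[OF L vdrop_vecs[OF v]]
      linmap_closed[OF t v] vdrop_vecs[OF v] by auto
  have "qeval R (diag_form R (l @ map (\<lambda>a. b \<otimes> a) l)) (g v) = \<zero>" if v: "v \<in> vecs R (d + d)" for v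
    unfolding qeval_diag_double[OF l b linmap_closed[OF gl v]]
    using f(2) c[OF v] take_append[OF c(1,2)[OF v]] drop_append[OF c(1,2)[OF v]] b by (simp add: g_def)
  moreover have "v = zvec R (d + d)" if v: "v \<in> vecs R (d + d)" and z: "g v = zvec R (?n + ?n)" for v
  proof -
    have "f (vec d (($) v)) = zvec R ?n" "f (vdrop d d v) = zvec R ?n"
      using z append_zero_iff[OF c(1,2)[OF v]] by (auto simp: g_def)
    then have "vec d (($) v) = zvec R d" "vdrop d d v = zvec R d"
      using linembD[OF f(1)] c[OF v] by blast+
    then show ?thesis using append_take_drop[OF v] append_zero_iff[of "zvec R d" d "zvec R d" d] by simp
  qed
  ultimately show ?thesis using gl unfolding ti_def linemb_def by (auto simp: mult_2)
qed

text \<open>If \<open>b = -t\<^sup>2\<close>, the graph of multiplication by \<open>t\<close> is totally isotropic.\<close>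

lemma ti_graph:
  assumes l: "set l \<subseteq> carrier R" and b: "b \<in> carrier R" and t: "t \<in> carrier R" "t \<otimes> t \<oplus> b = \<zero>"
  shows "ti R (diag_form R (l @ map (\<lambda>a. b \<otimes> a) l)) (length l)"
proof -
  let ?n = "length l"
  define g where "g v = vscale R t v @\<^sub>v v" for v
  note s = linmap_vscale[OF t(1), of ?n]
  have gl: "linmap R ?n (?n + ?n) g"
    unfolding g_def by (rule linmap_append[OF s linemb_linmap[OF linemb_id]])
  have c: "vscale R t v \<in> vecs R ?n" if v: "v \<in> vecs R ?n" for v using linmap_closed[OF s v] .
  have "qeval R (diag_form R (l @ map (\<lambda>a. b \<otimes> a) l)) (g v) = \<zero>" if v: "v \<in> vecs R ?n" for v
  proof -
    have q: "qeval R (diag_form R l) v \<in> carrier R" using qeval_closed[OF diag_mats[OF l] v] .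
    have "qeval R (diag_form R (l @ map (\<lambda>a. b \<otimes> a) l)) (g v) =
      qeval R (diag_form R l) (vscale R t v) \<oplus> b \<otimes> qeval R (diag_form R l) v"
      unfolding qeval_diag_double[OF l b linmap_closed[OF gl v]]
      using take_append[OF c[OF v] v] drop_append[OF c[OF v] v] by (simp add: g_def)
    also have "\<dots> = (t \<otimes> t \<oplus> b) \<otimes> qeval R (diag_form R l) v"
      unfolding qeval_scale[OF diag_mats[OF l] t(1) v] using q t(1) b by (simp add: l_distr)
    finally show ?thesis using t(2) q by simp
  qed
  moreover have "v = zvec R ?n" if v: "v \<in> vecs R ?n" and z: "g v = zvec R (?n + ?n)" for v
    using z append_zero_iff[OF c[OF v] v] by (simp add: g_def)
  ultimately show ?thesis using gl unfolding ti_def linemb_def by auto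
qed

text \<open>With \<open>E = R[T]/(T\<^sup>2 - \<sigma>T - b)\<close> and the \<open>R\<close>-linear map \<open>s: E \<rightarrow> R\<close> with \<open>s(1) = 1\<close> and \<open>s(T) = 0\<close>,
  the form \<open>\<langle>1, b\<rangle> \<otimes> q\<close> is the transfer of \<open>q\<^sub>E\<close> along \<open>s\<close>.\<close>

lemma ti_transfer:
  assumes l: "set l \<subseteq> carrier R" and b: "b \<in> carrier R" and \<sigma>: "\<sigma> \<in> carrier R"
    and E: "E = quad_ext R \<sigma> b" and t: "ti E (diag_form E (map (qemb R) l)) d"
  shows "ti R (diag_form R (l @ map (\<lambda>a. b \<otimes> a) l)) (2 * d)"
proof -
  let ?n = "length l"
  note Es = E_carrier[OF \<sigma> b E] E_mult[OF \<sigma> b E] E_add[OF \<sigma> b E] E_zero[OF \<sigma> b E]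
    qemb_simps[OF \<sigma> b E]
  interpret E: cring E by (rule E_cring[OF \<sigma> b E])
  obtain f where f: "linemb E d ?n f" "\<forall>v\<in>vecs E d. qeval E (diag_form E (map (qemb R) l)) (f v) = \<zero>\<^bsub>E\<^esub>"
    using t by (auto simp: ti_def)
  note L = linemb_linmap[OF f(1)]
  \<comment> \<open>\<open>\<phi>\<close> and \<open>\<psi>\<close> are the identifications of R^2d
    with E^d and of E^n with R^2n. Conjugating \<open>f\<close> by them gives an
    \<open>R\<close>-linear injection, and the component of the E-value at 1 is the value of the
    doubled form.\<close>
  define \<phi> where "\<phi> v = vec d (\<lambda>j. qc (v $ j) (v $ (d + j)))" for v :: "'a vec"
  define \<psi> where "\<psi> w = map_vec qre w @\<^sub>v map_vec qim w" for w :: "'a vec"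
  have \<phi>c: "\<phi> v \<in> vecs E d" if "v \<in> vecs R (d + d)" for v
    unfolding \<phi>_def using that by (intro vecs_vecI) (auto simp: Es)
  have \<phi>a: "\<phi> (vadd R u v) = vadd E (\<phi> u) (\<phi> v)" if "u \<in> vecs R (d + d)" "v \<in> vecs R (d + d)" for u v
  proof (rule eq_vecI)
    fix j assume "j < dim_vec (vadd E (\<phi> u) (\<phi> v))"
    then have j: "j < d" by (simp add: \<phi>_def)
    show "\<phi> (vadd R u v) $ j = vadd E (\<phi> u) (\<phi> v) $ j"
      by (rule qc_eqI) (use that j in \<open>simp_all add: \<phi>_def Es\<close>)
  qed (simp add: \<phi>_def)
  have \<phi>s: "\<phi> (vscale R c v) = vscale E (qemb R c) (\<phi> v)" if "c \<in> carrier R" "v \<in> vecs R (d + d)" for c v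
  proof (rule eq_vecI)
    fix j assume "j < dim_vec (vscale E (qemb R c) (\<phi> v))"
    then have j: "j < d" by (simp add: \<phi>_def)
    then have vj: "v $ j \<in> carrier R" "v $ (d + j) \<in> carrier R" using that by auto
    show "\<phi> (vscale R c v) $ j = vscale E (qemb R c) (\<phi> v) $ j"
      by (rule qc_eqI) (use vj that b \<sigma> j in \<open>simp_all add: \<phi>_def Es\<close>)
  qed (simp add: \<phi>_def)
  have uv: "map_vec qre w \<in> vecs R k" "map_vec qim w \<in> vecs R k" if w: "w \<in> vecs E k" for w k
    unfolding map_vec_def vecs_dim[OF w] using vecs_index[OF w] by (auto intro!: vecs_vecI simp: Es)
  have \<psi>c: "\<psi> w \<in> vecs R (k + k)" if "w \<in> vecs E k" for w k
    unfolding \<psi>_def using uv[OF that] by simp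
  have \<psi>a: "\<psi> (vadd E u w) = vadd R (\<psi> u) (\<psi> w)" if "u \<in> vecs E k" "w \<in> vecs E k" for u w k
    using that by (intro eq_vecI) (auto simp: \<psi>_def Es)
  have \<psi>s: "\<psi> (vscale E (qemb R c) w) = vscale R c (\<psi> w)" if c: "c \<in> carrier R" and w: "w \<in> vecs E k" for c w k
  proof -
    have wi: "qre (w $ i) \<in> carrier R" "qim (w $ i) \<in> carrier R" if "i < k" for i
      using vecs_index[OF w that] by (simp_all add: Es)
    show ?thesis
      using w c b \<sigma> wi by (intro eq_vecI) (auto simp: \<psi>_def Es)
  qed
  define g where "g v = \<psi> (f (\<phi> v))" for v
  have gl: "linmap R (d + d) (?n + ?n) g"
    unfolding linmap_def g_def
  proof (intro conjI ballI)
    fix v assume v: "v \<in> vecs R (d + d)"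
    show "\<psi> (f (\<phi> v)) \<in> vecs R (?n + ?n)" using \<psi>c linmap_closed[OF L \<phi>c[OF v]] .
    fix u assume u: "u \<in> vecs R (d + d)"
    show "\<psi> (f (\<phi> (vadd R v u))) = vadd R (\<psi> (f (\<phi> v))) (\<psi> (f (\<phi> u)))"
      unfolding \<phi>a[OF v u] linmap_add[OF L \<phi>c[OF v] \<phi>c[OF u]]
      by (rule \<psi>a[OF linmap_closed[OF L \<phi>c[OF v]] linmap_closed[OF L \<phi>c[OF u]]])
  next
    fix c v assume c: "c \<in> carrier R" and v: "v \<in> vecs R (d + d)"
    have cE: "qemb R c \<in> carrier E" using c by (simp add: Es)
    show "\<psi> (f (\<phi> (vscale R c v))) = vscale R c (\<psi> (f (\<phi> v)))"
      unfolding \<phi>s[OF c v] linmap_scale[OF L cE \<phi>c[OF v]]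
      by (rule \<psi>s[OF c linmap_closed[OF L \<phi>c[OF v]]])
  qed
  have q0: "qeval R (diag_form R (l @ map (\<lambda>a. b \<otimes> a) l)) (g v) = \<zero>" if v: "v \<in> vecs R (d + d)" for v
  proof -
    have fv: "f (\<phi> v) \<in> vecs E ?n" using linmap_closed[OF L \<phi>c[OF v]] .
    have "qeval R (diag_form R (l @ map (\<lambda>a. b \<otimes> a) l)) (g v) =
      qre (qeval E (diag_form E (map (qemb R) l)) (f (\<phi> v)))"
      unfolding qeval_diag_double[OF l b linmap_closed[OF gl v]] qeval_quad_ext(3)[OF \<sigma> b E l fv]
      using take_append[OF uv[OF fv]] drop_append[OF uv[OF fv]] by (simp add: g_def \<psi>_def)
    also have "\<dots> = \<zero>" using f(2) \<phi>c[OF v] by (simp add: Es)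
    finally show ?thesis .
  qed
  have "v = zvec R (d + d)" if v: "v \<in> vecs R (d + d)" and z: "g v = zvec R (?n + ?n)" for v
  proof -
    have fv: "f (\<phi> v) \<in> vecs E ?n" using linmap_closed[OF L \<phi>c[OF v]] .
    have z2: "map_vec qre (f (\<phi> v)) = zvec R ?n" "map_vec qim (f (\<phi> v)) = zvec R ?n"
      using z append_zero_iff[OF uv[OF fv]] by (auto simp: g_def \<psi>_def)
    have "f (\<phi> v) = zvec E ?n"
    proof (rule vecs_eqI[OF fv])
      fix i assume i: "i < ?n"
      have "map_vec qre (f (\<phi> v)) $ i = \<zero>" "map_vec qim (f (\<phi> v)) $ i = \<zero>" unfolding z2 using i by auto
      then show "f (\<phi> v) $ i = zvec E ?n $ i" using i vecs_dim[OF fv] by (simp add: qc_eq_iff[of "f (\<phi> v) $ i"] Es)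
    qed simp
    then have p0: "\<phi> v = zvec E d" using f(1) \<phi>c[OF v] by (simp add: linemb_def)
    show ?thesis
    proof (rule vecs_eqI[OF v])
      fix i assume i: "i < d + d"
      show "v $ i = zvec R (d + d) $ i"
      proof (cases "i < d")
        case True
        have "\<phi> v $ i = zvec E d $ i" using p0 by simp
        then show ?thesis using True by (simp add: \<phi>_def qc_eq_iff[of "qc _ _"] Es)
      next
        case False
        have "\<phi> v $ (i - d) = zvec E d $ (i - d)" "d + (i - d) = i" using p0 False by simp_all
        then show ?thesis using False i by (simp add: \<phi>_def qc_eq_iff[of "qc _ _"] Es)
      qed
    qed simp
  qed
  then show ?thesis using gl q0 unfolding ti_def linemb_def by (auto simp: mult_2)
qed

text \<open>Write the isotropic vector as (y, z), so that q(y) + b q(z) = 0 with q(z) nonzero, and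
  let B be the bilinear form of q. The value of q at y + Tz is q(y) + 2B(y, z)T + q(z)T^2. The
  choice \<sigma> = -2B(y, z)/q(z) makes it vanish as soon as T^2 = \<sigma>T + b. If this equation
  has a root t in the field itself, anisotropy gives y = -tz, and then q(y) = t^2 q(z) yields t^2 +
  b = 0.\<close>

lemma double_isotropic:
  assumes l: "set l \<subseteq> carrier R" and b: "b \<in> carrier R"
    and an: "anisotropic R (diag_form R l)" and iso: "\<not> anisotropic R (diag_form R (l @ map (\<lambda>a. b \<otimes> a) l))"
  shows "(\<exists>t\<in>carrier R. t \<otimes> t \<oplus> b = \<zero>) \<or>
    (\<exists>\<sigma>\<in>carrier R. irred R \<sigma> b \<and>
       \<not> anisotropic (quad_ext R \<sigma> b) (diag_form (quad_ext R \<sigma> b) (map (qemb R) l)))"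
proof -
  let ?n = "length l" and ?D = "diag_form R l"
  note M = diag_mats[OF l] and S = diag_sym[OF l]
  obtain x where x: "x \<in> vecs R (?n + ?n)" "qeval R (diag_form R (l @ map (\<lambda>a. b \<otimes> a) l)) x = \<zero>" "x \<noteq> zvec R (?n + ?n)"
    using iso by (auto simp: anisotropic_def)
  define y z where "y = vec ?n (($) x)" and "z = vdrop ?n ?n x"
  have y: "y \<in> vecs R ?n" and z: "z \<in> vecs R ?n" using x(1) by (auto simp: y_def z_def)
  have yz: "\<not> (y = zvec R ?n \<and> z = zvec R ?n)"
    using append_take_drop[OF x(1)] append_zero_iff[OF y z] x(3) by (auto simp: y_def z_def)
  have qy: "qeval R ?D y \<in> carrier R" and qz: "qeval R ?D z \<in> carrier R" and byz: "bform R ?D y z \<in> carrier R"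
    by (rule qeval_closed[OF M y], rule qeval_closed[OF M z], rule bform_closed[OF M y z])
  have sum0: "qeval R ?D y \<oplus> b \<otimes> qeval R ?D z = \<zero>"
    using x(2) unfolding qeval_diag_double[OF l b x(1)] y_def z_def .
  have z0: "z \<noteq> zvec R ?n"
  proof
    assume "z = zvec R ?n"
    then have "qeval R ?D y = \<zero>" using sum0 qeval_zvec[OF M] b qy by simp
    then show False using an y yz \<open>z = zvec R ?n\<close> by (simp add: anisotropic_def)
  qed
  then have qz0: "qeval R ?D z \<noteq> \<zero>" using an z by (auto simp: anisotropic_def)
  then obtain c where c: "c \<in> carrier R" "c \<otimes> qeval R ?D z = \<one>"
    using qz field_Units by (metis Diff_iff Units_inv_closed Units_l_inv singletonD)
  define \<sigma> where "\<sigma> = \<ominus> ((bform R ?D y z \<oplus> bform R ?D y z) \<otimes> c)"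
  have \<sigma>: "\<sigma> \<in> carrier R" using byz c by (simp add: \<sigma>_def)
  have s0: "bform R ?D y z \<oplus> bform R ?D y z \<oplus> \<sigma> \<otimes> qeval R ?D z = \<zero>"
    using byz qz c by (simp add: \<sigma>_def l_minus m_assoc r_neg)
  show ?thesis
  proof (cases "irred R \<sigma> b")
    case False
    then obtain t where t: "t \<in> carrier R" "t \<otimes> t = \<sigma> \<otimes> t \<oplus> b" by (auto simp: irred_def)
    have tz: "vscale R t z \<in> vecs R ?n" using t z by simp
    have "qeval R ?D (vadd R y (vscale R t z)) =
      qeval R ?D y \<oplus> t \<otimes> t \<otimes> qeval R ?D z \<oplus> (t \<otimes> bform R ?D y z \<oplus> t \<otimes> bform R ?D y z)"
      using qeval_add[OF S] y tz qeval_scale[OF M t(1) z] bform_scale_right[OF M t(1) z y] by simp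
    also have "\<dots> = (qeval R ?D y \<oplus> b \<otimes> qeval R ?D z) \<oplus> t \<otimes> (bform R ?D y z \<oplus> bform R ?D y z \<oplus> \<sigma> \<otimes> qeval R ?D z)"
      unfolding t(2) using t(1) \<sigma> b qy qz byz by algebra
    also have "\<dots> = \<zero>" unfolding sum0 s0 using t by simp
    finally have "vadd R y (vscale R t z) = zvec R ?n"
      using an y tz by (simp add: anisotropic_def)
    then have e: "vadd R y (vscale R t z) $ i = \<zero>" if "i < ?n" for i using that by simp
    have "y = vscale R (\<ominus> t) z"
    proof (rule vecs_eqI[OF y])
      fix i assume i: "i < ?n"
      have "y $ i \<oplus> t \<otimes> z $ i = \<zero>" using e[OF i] i y z by simp
      then show "y $ i = vscale R (\<ominus> t) z $ i" using i y z t by (simp add: l_minus sum_zero_eq_neg)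
    qed (use z t in simp)
    then have "qeval R ?D y = t \<otimes> t \<otimes> qeval R ?D z"
      using qeval_scale[OF M _ z, of "\<ominus> t"] t(1) by (simp add: l_minus r_minus)
    then have "(t \<otimes> t \<oplus> b) \<otimes> qeval R ?D z = \<zero>" using sum0 t(1) b qz by (simp add: l_distr)
    then have "t \<otimes> t \<oplus> b = \<zero>" using qz qz0 t b integral by blast
    then show ?thesis using t by blast
  next
    case True
    let ?E = "quad_ext R \<sigma> b"
    note Es = E_carrier[OF \<sigma> b refl] E_zero[OF \<sigma> b refl]
    define w where "w = vec ?n (\<lambda>i. qc (y $ i) (z $ i))"
    have w: "w \<in> vecs ?E ?n" unfolding w_def using y z by (auto intro!: vecs_vecI simp: Es)
    have m: "map_vec qre w = y" "map_vec qim w = z" using y z by (auto simp: w_def intro!: eq_vecI)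
    have "qeval ?E (diag_form ?E (map (qemb R) l)) w = \<zero>\<^bsub>?E\<^esub>"
      using qeval_quad_ext(3,4)[OF \<sigma> b refl l w] unfolding m sum0 s0
      by (simp add: qc_eq_iff[of "qeval ?E _ _"] Es)
    moreover have "w \<noteq> zvec ?E ?n"
    proof
      assume w0: "w = zvec ?E ?n"
      have "z = zvec R ?n"
      proof (rule vecs_eqI[OF z])
        fix i assume i: "i < ?n"
        have "qim (w $ i) = \<zero>" unfolding w0 using i by (simp add: Es)
        then show "z $ i = zvec R ?n $ i" using i by (simp add: w_def)
      qed simp
      then show False using z0 by simp
    qed
    ultimately have "\<not> anisotropic ?E (diag_form ?E (map (qemb R) l))"
      using w by (auto simp: anisotropic_def)
    then show ?thesis using True \<sigma> by blast
  qed
qed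

end

section \<open>Multiples of Pfister forms\<close>

text \<open>The diagonal of the form with entries \<open>ds\<close>, tensored with one binary form
  <1, b> for each slot \<open>b\<close>.\<close>

primrec pf :: "('a, 'b) ring_scheme \<Rightarrow> 'a list \<Rightarrow> 'a list \<Rightarrow> 'a list" where
  "pf R [] ds = ds"
| "pf R (b # bs) ds = pf R bs ds @ map (\<lambda>a. b \<otimes>\<^bsub>R\<^esub> a) (pf R bs ds)"

lemma length_pf [simp]: "length (pf R bs ds) = 2 ^ length bs * length ds"
  by (induction bs) auto

lemma (in ring) pf_carrier: "set bs \<subseteq> carrier R \<Longrightarrow> set ds \<subseteq> carrier R \<Longrightarrow> set (pf R bs ds) \<subseteq> carrier R"
  by (induction bs) auto

lemma (in ring_hom_cring) map_pf:
  "set bs \<subseteq> carrier R \<Longrightarrow> set ds \<subseteq> carrier R \<Longrightarrow> map h (pf R bs ds) = pf S (map h bs) (map h ds)"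
proof (induction bs)
  case (Cons b bs)
  have "set (pf R bs ds) \<subseteq> carrier R" using R.pf_carrier Cons.prems by auto
  then have "map h (map (\<lambda>a. b \<otimes> a) (pf R bs ds)) = map (\<lambda>a. h b \<otimes>\<^bsub>S\<^esub> a) (map h (pf R bs ds))"
    using Cons.prems by (auto simp: subset_iff)
  moreover have "map h (pf R bs ds) = pf S (map h bs) (map h ds)" using Cons by simp
  ultimately show ?case by (simp del: map_map)
qed simp

text \<open>Descending along a tower of quadratic extensions: each Pfister slot that makes the form
  isotropic is traded for a quadratic extension over which the form without this slot is isotropic.\<close>

lemma pfister_ti:
  fixes F :: "('f, 'c) ring_scheme" and L :: "('a, 'b) ring_scheme"
  assumes F: "inf_field F" and ds: "set ds \<subseteq> carrier F" and i: "2 * i \<le> length ds"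
    and base: "\<And>(L :: ('a, 'b) ring_scheme) h. inf_field_hom F L h \<Longrightarrow>
      \<not> anisotropic L (diag_form L (map h ds)) \<Longrightarrow> ti L (diag_form L (map h ds)) i"
  shows "inf_field_hom F L h \<Longrightarrow> set bs \<subseteq> carrier L \<Longrightarrow>
    \<not> anisotropic L (diag_form L (pf L bs (map h ds))) \<Longrightarrow>
    ti L (diag_form L (pf L bs (map h ds))) (2 ^ length bs * i)"
proof (induction "length bs" arbitrary: bs L h)
  case 0
  then show ?case using base by simp
next
  case (Suc k bs' L h)
  then obtain b bs where bs': "bs' = b # bs" and k: "k = length bs" by (cases bs') auto
  note prems = Suc.prems[unfolded bs']
  \<comment> \<open>The field varies in the induction hypothesis, since the last case below applies
    it to a quadratic extension of \<open>L\<close>, which lives on the same type.\<close>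
  have IH: "ti L (diag_form L (pf L cs (map h ds))) (2 ^ length bs * i)"
    if "inf_field_hom F L h" "set cs \<subseteq> carrier L" "length cs = length bs"
      "\<not> anisotropic L (diag_form L (pf L cs (map h ds)))" for cs and L :: "('a, 'b) ring_scheme" and h
    using Suc.hyps(1)[of cs L h] that k by simp
  interpret H: inf_field_hom F L h by (rule prems(1))
  let ?l = "pf L bs (map h ds)"
  have b: "b \<in> carrier L" and bs: "set bs \<subseteq> carrier L" using prems(2) by auto
  have hds: "set (map h ds) \<subseteq> carrier L" using ds by auto
  have l: "set ?l \<subseteq> carrier L" using H.S.pf_carrier[OF bs hds] .
  have iso: "\<not> anisotropic L (diag_form L (?l @ map (\<lambda>a. b \<otimes>\<^bsub>L\<^esub> a) ?l))" using prems(3) by simp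
  have "ti L (diag_form L (pf L (b # bs) (map h ds))) (2 ^ length (b # bs) * i)"
  proof (cases "anisotropic L (diag_form L ?l)")
    case False
    then have "ti L (diag_form L ?l) (2 ^ length bs * i)"
      using IH[OF prems(1) bs] by simp
    then show ?thesis using H.S.ti_double[OF l b] by (simp add: mult.assoc)
  next
    case True
    consider t where "t \<in> carrier L" "t \<otimes>\<^bsub>L\<^esub> t \<oplus>\<^bsub>L\<^esub> b = \<zero>\<^bsub>L\<^esub>"
      | \<sigma> where "\<sigma> \<in> carrier L" "irred L \<sigma> b"
        "\<not> anisotropic (quad_ext L \<sigma> b) (diag_form (quad_ext L \<sigma> b) (map (qemb L) ?l))"
      using H.S.double_isotropic[OF l b True iso] by blast
    then show ?thesis
    proof cases
      case 1
      have "ti L (diag_form L (?l @ map (\<lambda>a. b \<otimes>\<^bsub>L\<^esub> a) ?l)) (length ?l)"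
        by (rule H.S.ti_graph[OF l b 1])
      \<comment> \<open>The graph is half of the doubled space. That this is large enough is the
        assumption \<open>2 * i \<le> length ds\<close>, multiplied by a power of 2.\<close>
      moreover have "2 ^ length (b # bs) * i \<le> length ?l" using i by simp
      ultimately show ?thesis using H.S.ti_mono by simp
    next
      case 2
      let ?E = "quad_ext L \<sigma> b"
      interpret K: inf_field_hom L ?E "qemb L" by (rule H.S.E_inf_field_hom[OF 2(1) b refl 2(2)])
      have "qemb L \<circ> h \<in> Ring.ring_hom F ?E" by (rule ring_hom_trans[OF H.homh K.homh])
      then have HE: "inf_field_hom F ?E (qemb L \<circ> h)"
        by (rule inf_field_homI[OF F K.S.field_axioms])
      let ?m = "pf ?E (map (qemb L) bs) (map (qemb L \<circ> h) ds)"
      have "map (qemb L) ?l = pf ?E (map (qemb L) bs) (map (qemb L) (map h ds))"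
        by (rule K.map_pf[OF bs hds])
      then have e: "map (qemb L) ?l = ?m" by (simp only: map_map)
      have bsE: "set (map (qemb L) bs) \<subseteq> carrier ?E" using bs by auto
      have "\<not> anisotropic ?E (diag_form ?E ?m)" using 2(3) by (simp only: e not_False_eq_True)
      then have "ti ?E (diag_form ?E ?m) (2 ^ length bs * i)"
        by (intro IH[OF HE bsE]) simp_all
      then have "ti ?E (diag_form ?E (map (qemb L) ?l)) (2 ^ length bs * i)"
        by (simp only: e)
      from H.S.ti_transfer[OF l b 2(1) refl this] show ?thesis by (simp add: mult.assoc)
    qed
  qed
  then show ?case by (simp only: bs')
qed

section \<open>Polynomials and evaluation\<close>

lemma finite_submsets: "finite {k. k \<subseteq># (m :: 'c multiset)}"
proof (induction m)
  case empty
  then show ?case by simp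
next
  case (add x m)
  have "{k. k \<subseteq># add_mset x m} \<subseteq> {k. k \<subseteq># m} \<union> add_mset x ` {k. k \<subseteq># m}"
  proof
    fix k assume k: "k \<in> {k. k \<subseteq># add_mset x m}"
    show "k \<in> {k. k \<subseteq># m} \<union> add_mset x ` {k. k \<subseteq># m}"
    proof (cases "x \<in># k")
      case True
      then obtain k' where "k = add_mset x k'" by (metis insert_DiffM)
      then show ?thesis using k by auto
    next
      case False
      then have "k - {#x#} = k" by (simp add: diff_single_trivial)
      then have "k \<subseteq># m" using k subset_eq_diff_conv[of k "{#x#}" m] by simp
      then show ?thesis by simp
    qed
  qed
  then show ?case using add finite_subset by blast
qed

text \<open>The product of \<open>mpoly_ring\<close>. It does not mention the set of variables, so
  polynomial rings in different sets of variables share their operations and inclusions between them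
  are homomorphisms.\<close>

definition pm :: "('a, 'b) ring_scheme \<Rightarrow> ('c multiset \<Rightarrow> 'a) \<Rightarrow> ('c multiset \<Rightarrow> 'a) \<Rightarrow> ('c multiset \<Rightarrow> 'a)" where
  "pm R f g = (\<lambda>m. \<Oplus>\<^bsub>R\<^esub>k\<in>{k. k \<subseteq># m}. f k \<otimes>\<^bsub>R\<^esub> g (m - k))"

definition psc :: "('a, 'b) ring_scheme \<Rightarrow> 'a \<Rightarrow> ('c multiset \<Rightarrow> 'a) \<Rightarrow> ('c multiset \<Rightarrow> 'a)" where
  "psc R a g = (\<lambda>m. a \<otimes>\<^bsub>R\<^esub> g m)"

definition mon :: "('a, 'b) ring_scheme \<Rightarrow> ('c \<Rightarrow> 'a) \<Rightarrow> 'c multiset \<Rightarrow> 'a" where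
  "mon R x m = (\<Otimes>\<^bsub>R\<^esub>i\<in>set_mset m. x i [^]\<^bsub>R\<^esub> count m i)"

text \<open>Evaluation at the point \<open>x\<close> with coefficients carried along
  \<open>h\<close>; the support of a polynomial is finite (\<open>pset_finite\<close>).\<close>

definition pev :: "('r, 'b) ring_scheme \<Rightarrow> ('s, 'd) ring_scheme \<Rightarrow> ('r \<Rightarrow> 's) \<Rightarrow> ('c \<Rightarrow> 's) \<Rightarrow> ('c multiset \<Rightarrow> 'r) \<Rightarrow> 's" where
  "pev R S h x f = (\<Oplus>\<^bsub>S\<^esub>m\<in>{m. f m \<noteq> \<zero>\<^bsub>R\<^esub>}. h (f m) \<otimes>\<^bsub>S\<^esub> mon S x m)"

context cring
begin

lemma pset_coeff: "f \<in> indexed_pset I (carrier R) \<Longrightarrow> f m \<in> carrier R"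
  using indexed_pset_in_carrier[of "carrier R" f I] carrier_coeffE by blast

lemma pset_cc: "f \<in> indexed_pset I (carrier R) \<Longrightarrow> carrier_coeff f"
  using indexed_pset_in_carrier[of "carrier R" f I] by blast

lemma pset_finite: "f \<in> indexed_pset I (carrier R) \<Longrightarrow> finite {m. f m \<noteq> \<zero>}"
proof (induction rule: indexed_pset.induct)
  case (indexed_const k)
  have "{m. indexed_const k m \<noteq> \<zero>} \<subseteq> {{#}}" by (auto simp: indexed_const_def)
  then show ?case using finite_subset by blast
next
  case (indexed_padd P Q)
  have "{m. indexed_padd P Q m \<noteq> \<zero>} \<subseteq> {m. P m \<noteq> \<zero>} \<union> {m. Q m \<noteq> \<zero>}"
    by (auto simp: indexed_padd_def)
  then show ?case using indexed_padd finite_subset finite_UnI by metis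
next
  case (indexed_pmult P i)
  have "{m. indexed_pmult P i m \<noteq> \<zero>} \<subseteq> add_mset i ` {m. P m \<noteq> \<zero>}"
  proof
    fix m assume "m \<in> {m. indexed_pmult P i m \<noteq> \<zero>}"
    then have "i \<in># m" "P (m - {#i#}) \<noteq> \<zero>" by (auto simp: indexed_pmult_def split: if_splits)
    then show "m \<in> add_mset i ` {m. P m \<noteq> \<zero>}" by (intro image_eqI[of _ _ "m - {#i#}"]) auto
  qed
  then show ?case using indexed_pmult finite_subset finite_imageI by metis
qed

lemma pset_scale:
  fixes f :: "'c multiset \<Rightarrow> 'a"
  shows "f \<in> indexed_pset I (carrier R) \<Longrightarrow> a \<in> carrier R \<Longrightarrow> psc R a f \<in> indexed_pset I (carrier R)"
proof (induction rule: indexed_pset.induct)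
  case (indexed_const k)
  then have "psc R a (indexed_const k :: 'c multiset \<Rightarrow> 'a) = indexed_const (a \<otimes> k)"
    by (auto simp: psc_def indexed_const_def)
  then show ?case using indexed_const by (simp add: indexed_pset.indexed_const)
next
  case (indexed_padd P Q)
  then have "psc R a (indexed_padd P Q) = indexed_padd (psc R a P) (psc R a Q)"
    using pset_coeff[OF indexed_padd(1)] pset_coeff[OF indexed_padd(2)] by (auto simp: psc_def indexed_padd_def r_distr)
  then show ?case using indexed_padd by (simp add: indexed_pset.indexed_padd)
next
  case (indexed_pmult P i)
  then have "psc R a (indexed_pmult P i) = indexed_pmult (psc R a P) i"
    by (auto simp: psc_def indexed_pmult_def)
  then show ?case using indexed_pmult by (simp add: indexed_pset.indexed_pmult)
qed

lemma pm_closed: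
  assumes "carrier_coeff f" "carrier_coeff g"
  shows "carrier_coeff (pm R f g)"
  unfolding pm_def carrier_coeff_def
  using carrier_coeffE[OF assms(1)] carrier_coeffE[OF assms(2)] by (auto intro!: finsum_closed)

lemma pm_const:
  assumes a: "a \<in> carrier R" and g0: "carrier_coeff g"
  shows "pm R (indexed_const a) g = psc R a g"
  supply g = carrier_coeffE[OF g0]
proof
  fix m :: "'c multiset"
  have "pm R (indexed_const a) g m = (\<Oplus>k\<in>{k. k \<subseteq># m}. if k = {#} then a \<otimes> g (m - k) else \<zero>)"
    unfolding pm_def by (rule finsum_cong') (use a g in \<open>auto simp: indexed_const_def\<close>)
  also have "\<dots> = a \<otimes> g m"
    using finsum_delta[OF finite_submsets, of m "\<lambda>k. a \<otimes> g (m - k)" "{#}"] a g by simp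
  finally show "pm R (indexed_const a) g m = psc R a g m" by (simp add: psc_def)
qed

lemma pm_padd:
  assumes fs: "carrier_coeff f" "carrier_coeff f'" "carrier_coeff g"
  shows "pm R (indexed_padd f f') g = indexed_padd (pm R f g) (pm R f' g)"
  supply assms = carrier_coeffE[OF fs(1)] carrier_coeffE[OF fs(2)] carrier_coeffE[OF fs(3)]
proof
  fix m
  have "pm R (indexed_padd f f') g m =
    (\<Oplus>k\<in>{k. k \<subseteq># m}. f k \<otimes> g (m - k) \<oplus> f' k \<otimes> g (m - k))"
    unfolding pm_def by (rule finsum_cong') (use assms in \<open>auto simp: indexed_padd_def l_distr\<close>)
  also have "\<dots> = indexed_padd (pm R f g) (pm R f' g) m"
    unfolding indexed_padd_def pm_def using assms by (intro finsum_addf) auto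
  finally show "pm R (indexed_padd f f') g m = indexed_padd (pm R f g) (pm R f' g) m" .
qed

lemma pm_pmult:
  assumes f0: "carrier_coeff f" and g0: "carrier_coeff g"
  shows "pm R (indexed_pmult f i) g = indexed_pmult (pm R f g) i"
  supply f = carrier_coeffE[OF f0]
  supply g = carrier_coeffE[OF g0]
proof
  fix m
  show "pm R (indexed_pmult f i) g m = indexed_pmult (pm R f g) i m"
  proof (cases "i \<in># m")
    case False
    have "pm R (indexed_pmult f i) g m = (\<Oplus>k\<in>{k. k \<subseteq># m}. \<zero>)"
      unfolding pm_def
      by (rule finsum_cong') (use False g in \<open>auto simp: indexed_pmult_def dest: mset_subset_eqD\<close>)
    then show ?thesis using False by (simp add: indexed_pmult_def finsum_zero)
  next
    case True
    then obtain m' where m: "m = add_mset i m'" by (metis insert_DiffM)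
    have inj: "inj_on (add_mset i) {k. k \<subseteq># m'}" by (auto simp: inj_on_def)
    have "pm R (indexed_pmult f i) g m = (\<Oplus>k\<in>add_mset i ` {k. k \<subseteq># m'}. indexed_pmult f i k \<otimes> g (m - k))"
      unfolding pm_def
    proof (rule add.finprod_mono_neutral_cong_right[OF finite_submsets])
      show "add_mset i ` {k. k \<subseteq># m'} \<subseteq> {k. k \<subseteq># m}" by (auto simp: m)
      fix k assume k: "k \<in> {k. k \<subseteq># m} - add_mset i ` {k. k \<subseteq># m'}"
      have "i \<notin># k"
      proof
        assume "i \<in># k"
        then obtain k' where "k = add_mset i k'" by (metis insert_DiffM)
        then show False using k m by auto
      qed
      then show "indexed_pmult f i k \<otimes> g (m - k) = \<zero>" using g by (simp add: indexed_pmult_def)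
    qed (use f g in \<open>auto simp: indexed_pmult_def\<close>)
    also have "\<dots> = (\<Oplus>k\<in>{k. k \<subseteq># m'}. indexed_pmult f i (add_mset i k) \<otimes> g (m - add_mset i k))"
      using f g inj by (intro finsum_reindex) (auto simp: indexed_pmult_def)
    also have "\<dots> = (\<Oplus>k\<in>{k. k \<subseteq># m'}. f k \<otimes> g (m' - k))"
      by (rule finsum_cong') (use f g in \<open>auto simp: indexed_pmult_def m\<close>)
    finally show ?thesis by (simp add: indexed_pmult_def pm_def m)
  qed
qed

lemma pm_commute:
  fixes f g :: "'c multiset \<Rightarrow> 'a"
  assumes f0: "carrier_coeff f" and g0: "carrier_coeff g"
  shows "pm R f g = pm R g f"
  supply f = carrier_coeffE[OF f0]
  supply g = carrier_coeffE[OF g0]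
proof
  fix m :: "'c multiset"
  have im: "(\<lambda>k. m - k) ` {k. k \<subseteq># m} = {k. k \<subseteq># m}"
  proof (intro equalityI subsetI)
    fix k assume "k \<in> {k. k \<subseteq># m}"
    then have "k = m - (m - k)" by (simp add: subset_mset.diff_add multiset_eq_iff subseteq_mset_def)
    then show "k \<in> (\<lambda>k. m - k) ` {k. k \<subseteq># m}" by (intro image_eqI[of _ _ "m - k"]) auto
  qed auto
  have mm: "m - (m - k) = k" if "k \<subseteq># m" for k
    using that by (simp add: multiset_eq_iff subseteq_mset_def)
  have inj: "inj_on (\<lambda>k. m - k) {k. k \<subseteq># m}"
    using mm by (metis (no_types, lifting) inj_onI mem_Collect_eq)
  have "pm R f g m = (\<Oplus>k\<in>(\<lambda>k. m - k) ` {k. k \<subseteq># m}. f k \<otimes> g (m - k))"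
    unfolding pm_def im ..
  also have "\<dots> = (\<Oplus>k\<in>{k. k \<subseteq># m}. f (m - k) \<otimes> g (m - (m - k)))"
    using f g inj by (intro finsum_reindex) auto
  also have "\<dots> = pm R g f m"
    unfolding pm_def by (rule finsum_cong') (use f g mm in \<open>auto simp: m_comm\<close>)
  finally show "pm R f g m = pm R g f m" .
qed

lemma pm_scale:
  assumes a: "a \<in> carrier R" and f0: "carrier_coeff f" and g0: "carrier_coeff g"
  shows "pm R (psc R a f) g = psc R a (pm R f g)"
  supply f = carrier_coeffE[OF f0]
  supply g = carrier_coeffE[OF g0]
proof
  fix m
  have "pm R (psc R a f) g m = (\<Oplus>k\<in>{k. k \<subseteq># m}. a \<otimes> (f k \<otimes> g (m - k)))"
    unfolding pm_def by (rule finsum_cong') (use a f g in \<open>auto simp: psc_def m_assoc\<close>)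
  also have "\<dots> = psc R a (pm R f g) m"
    unfolding pm_def psc_def using a f g by (intro finsum_rdistr[symmetric] finite_submsets) auto
  finally show "pm R (psc R a f) g m = psc R a (pm R f g) m" .
qed

lemma pm_pset:
  assumes f: "f \<in> indexed_pset I (carrier R)" and g: "g \<in> indexed_pset I (carrier R)"
  shows "pm R f g \<in> indexed_pset I (carrier R)"
  using f
proof (induction rule: indexed_pset.induct)
  case (indexed_const k)
  then show ?case using pm_const[OF indexed_const pset_cc[OF g]] pset_scale[OF g] by simp
next
  case (indexed_padd P Q)
  then show ?case
    using pm_padd[OF pset_cc[OF indexed_padd(1)] pset_cc[OF indexed_padd(2)] pset_cc[OF g]]
    by (simp add: indexed_pset.indexed_padd)
next
  case (indexed_pmult P i)
  then show ?case
    using pm_pmult[OF pset_cc[OF indexed_pmult(1)] pset_cc[OF g]]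
    by (simp add: indexed_pset.indexed_pmult)
qed

text \<open>Each way of building up the first factor commutes with \<open>pm\<close> in its first
  argument, so induction on \<open>f\<close> is enough.\<close>

lemma pm_assoc:
  assumes f: "f \<in> indexed_pset I (carrier R)" and g0: "carrier_coeff g" and k0: "carrier_coeff k"
  shows "pm R (pm R f g) k = pm R f (pm R g k)"
  using f
proof (induction rule: indexed_pset.induct)
  case (indexed_const a)
  then show ?case
    using pm_const[OF indexed_const g0] pm_const[OF indexed_const pm_closed[OF g0 k0]] pm_scale[OF indexed_const g0 k0] by simp
next
  case (indexed_padd P Q)
  note P = pset_cc[OF indexed_padd(1)] and Q = pset_cc[OF indexed_padd(2)]
  show ?case
    unfolding pm_padd[OF P Q g0] pm_padd[OF pm_closed[OF P g0] pm_closed[OF Q g0] k0] pm_padd[OF P Q pm_closed[OF g0 k0]]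
    using indexed_padd by simp
next
  case (indexed_pmult P i)
  note P = pset_cc[OF indexed_pmult(1)]
  show ?case
    unfolding pm_pmult[OF P g0] pm_pmult[OF pm_closed[OF P g0] k0] pm_pmult[OF P pm_closed[OF g0 k0]]
    using indexed_pmult by simp
qed

lemma mpoly_simps:
  "carrier (mpoly_ring R I) = indexed_pset I (carrier R)"
  "f \<otimes>\<^bsub>mpoly_ring R I\<^esub> g = pm R f g"
  "f \<oplus>\<^bsub>mpoly_ring R I\<^esub> g = indexed_padd f g"
  "\<one>\<^bsub>mpoly_ring R I\<^esub> = indexed_const \<one>"
  "\<zero>\<^bsub>mpoly_ring R I\<^esub> = indexed_const \<zero>"
  by (simp_all add: mpoly_ring_def pm_def)

lemma mpoly_cring: "cring (mpoly_ring R I)"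
proof (rule cringI)
  show "abelian_group (mpoly_ring R I)"
  proof (rule abelian_groupI, unfold mpoly_simps)
    fix f g k assume f: "f \<in> indexed_pset I (carrier R)" and g: "g \<in> indexed_pset I (carrier R)"
      and k: "k \<in> indexed_pset I (carrier R)"
    note c = pset_coeff[OF f] pset_coeff[OF g] pset_coeff[OF k]
    show "indexed_padd f g \<in> indexed_pset I (carrier R)" using f g by (rule indexed_pset.indexed_padd)
    show "indexed_padd (indexed_padd f g) k = indexed_padd f (indexed_padd g k)"
      "indexed_padd f g = indexed_padd g f"
      using c by (auto simp: indexed_padd_def a_ac)
    show "indexed_padd (indexed_const \<zero>) f = f" using c by (auto simp: indexed_padd_def indexed_const_def)
    show "\<exists>g\<in>indexed_pset I (carrier R). indexed_padd g f = indexed_const \<zero>"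
    proof (intro bexI[of _ "psc R (\<ominus> \<one>) f"] pset_scale[OF f])
      show "indexed_padd (psc R (\<ominus> \<one>) f) f = indexed_const \<zero>"
        using c by (auto simp: indexed_padd_def indexed_const_def psc_def l_minus l_neg)
    qed simp
  qed (auto intro: indexed_pset.indexed_const)
  show "comm_monoid (mpoly_ring R I)"
  proof (rule comm_monoidI, unfold mpoly_simps)
    fix f g k assume f: "f \<in> indexed_pset I (carrier R)" and g: "g \<in> indexed_pset I (carrier R)"
      and k: "k \<in> indexed_pset I (carrier R)"
    show "pm R f g \<in> indexed_pset I (carrier R)" by (rule pm_pset[OF f g])
    show "pm R (pm R f g) k = pm R f (pm R g k)" by (rule pm_assoc[OF f pset_cc[OF g] pset_cc[OF k]])
    show "pm R f g = pm R g f" by (rule pm_commute[OF pset_cc[OF f] pset_cc[OF g]])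
    show "pm R (indexed_const \<one>) f = f"
      using pm_const[OF _ pset_cc[OF f], of \<one>] pset_coeff[OF f] by (simp add: psc_def)
  qed (auto intro: indexed_pset.indexed_const)
  fix f g k assume "f \<in> carrier (mpoly_ring R I)" "g \<in> carrier (mpoly_ring R I)" "k \<in> carrier (mpoly_ring R I)"
  then show "(f \<oplus>\<^bsub>mpoly_ring R I\<^esub> g) \<otimes>\<^bsub>mpoly_ring R I\<^esub> k =
    f \<otimes>\<^bsub>mpoly_ring R I\<^esub> k \<oplus>\<^bsub>mpoly_ring R I\<^esub> g \<otimes>\<^bsub>mpoly_ring R I\<^esub> k"
    unfolding mpoly_simps using pm_padd[of f g k] pset_cc by blast
qed

lemma const_hom:
  fixes I :: "'c set"
  shows "indexed_const \<in> Ring.ring_hom R (mpoly_ring R I)"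
proof (rule ring_hom_memI, unfold mpoly_simps)
  fix x y assume x: "x \<in> carrier R" and y: "y \<in> carrier R"
  let ?y = "indexed_const y :: 'c multiset \<Rightarrow> 'a"
  show "indexed_const x \<in> indexed_pset I (carrier R)" using x by (simp add: indexed_pset.indexed_const)
  show "indexed_const (x \<oplus> y) = indexed_padd (indexed_const x) ?y"
    by (simp add: indexed_padd_const)
  have "carrier_coeff ?y" using y by (simp add: indexed_const_def carrier_coeff_def)
  moreover have "psc R x ?y = indexed_const (x \<otimes> y)"
    using x y by (auto simp: psc_def indexed_const_def)
  ultimately show "indexed_const (x \<otimes> y) = pm R (indexed_const x) ?y"
    using pm_const[OF x, of ?y] carrier_coeffE[of ?y] by simp
qed simp

lemma var_mult:
  assumes f: "carrier_coeff f"
  shows "pm R (indexed_var i) f = indexed_pmult f i"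
proof -
  have c: "carrier_coeff (indexed_const \<one>)" by (simp add: indexed_const_def carrier_coeff_def)
  have "pm R (indexed_const \<one>) f = f"
    using pm_const[OF _ f, of \<one>] carrier_coeffE[OF f] by (simp add: psc_def)
  then show ?thesis unfolding indexed_var_def pm_pmult[OF c f] by simp
qed

lemma var_pset: "i \<in> I \<Longrightarrow> indexed_var i \<in> indexed_pset I (carrier R)"
  unfolding indexed_var_def by (simp add: indexed_pset.indexed_pmult indexed_pset.indexed_const)

lemma mon_closed: "range x \<subseteq> carrier R \<Longrightarrow> mon R x m \<in> carrier R"
  unfolding mon_def by (intro finprod_closed) auto

lemma mon_empty [simp]: "mon R x {#} = \<one>"
  by (simp add: mon_def)

lemma mon_add_mset:
  assumes x0: "range x \<subseteq> carrier R"
  shows "mon R x (add_mset i m) = mon R x m \<otimes> x i"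
proof -
  note x = range_subsetD[OF x0]
  \<comment> \<open>The power of \<open>x i\<close> is split off even if \<open>i\<close> does not
    occur, with exponent 0, so that the two sides of the claim are treated alike.\<close>
  have split: "mon R x k = x i [^] count k i \<otimes> (\<Otimes>j\<in>set_mset k - {i}. x j [^] count k j)" for k
  proof (cases "i \<in># k")
    case True
    then have "set_mset k = insert i (set_mset k - {i})" by auto
    then have "mon R x k = (\<Otimes>j\<in>insert i (set_mset k - {i}). x j [^] count k j)"
      unfolding mon_def by simp
    also have "\<dots> = x i [^] count k i \<otimes> (\<Otimes>j\<in>set_mset k - {i}. x j [^] count k j)"
      using x by (intro finprod_insert) auto
    finally show ?thesis .
  next
    case False
    then have "set_mset k - {i} = set_mset k" "count k i = 0" by (auto simp: not_in_iff)
    then show ?thesis using x by (simp add: mon_def finprod_closed Pi_def)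
  qed
  have e: "(\<Otimes>j\<in>set_mset (add_mset i m) - {i}. x j [^] count (add_mset i m) j) = (\<Otimes>j\<in>set_mset m - {i}. x j [^] count m j)"
    using x by (intro finprod_cong') auto
  have c: "(\<Otimes>j\<in>set_mset m - {i}. x j [^] count m j) \<in> carrier R"
    using x by (intro finprod_closed) auto
  show ?thesis unfolding split[of m] split[of "add_mset i m"] e using x c by (simp add: m_ac)
qed

end

context ring_hom_cring
begin

lemma pev_superset:
  assumes f: "f \<in> R.indexed_pset I (carrier R)" and x0: "range x \<subseteq> carrier S"
    and A: "finite A" "{m. f m \<noteq> \<zero>} \<subseteq> A"
  shows "pev R S h x f = (\<Oplus>\<^bsub>S\<^esub>m\<in>A. h (f m) \<otimes>\<^bsub>S\<^esub> mon S x m)"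
  supply x = range_subsetD[OF x0]
  unfolding pev_def
  using R.pset_coeff[OF f] S.mon_closed[OF x0] A
  by (intro S.add.finprod_mono_neutral_cong_left) auto

lemma pev_closed:
  assumes f: "f \<in> R.indexed_pset I (carrier R)" and x0: "range x \<subseteq> carrier S"
  shows "pev R S h x f \<in> carrier S"
  supply x = range_subsetD[OF x0]
  unfolding pev_def using R.pset_coeff[OF f] S.mon_closed[OF x0] by (intro S.finsum_closed) auto

lemma pev_const:
  assumes a: "a \<in> carrier R" and x0: "range x \<subseteq> carrier S"
  shows "pev R S h x (R.indexed_const a) = h a"
proof -
  note x = range_subsetD[OF x0]
  have "pev R S h x (R.indexed_const a) = (\<Oplus>\<^bsub>S\<^esub>m\<in>{{#}}. h (R.indexed_const a m) \<otimes>\<^bsub>S\<^esub> mon S x m)"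
    using a x by (intro pev_superset[OF R.indexed_pset.indexed_const[where I = UNIV] x0])
      (auto simp: R.indexed_const_def split: if_splits)
  then show ?thesis using a by (simp add: R.indexed_const_def S.finsum_insert)
qed

lemma pev_padd:
  assumes f: "f \<in> R.indexed_pset I (carrier R)" and g: "g \<in> R.indexed_pset I (carrier R)" and x0: "range x \<subseteq> carrier S"
  shows "pev R S h x (R.indexed_padd f g) = pev R S h x f \<oplus>\<^bsub>S\<^esub> pev R S h x g"
proof -
  note x = range_subsetD[OF x0]
  let ?A = "{m. f m \<noteq> \<zero>} \<union> {m. g m \<noteq> \<zero>}"
  have A: "finite ?A" using R.pset_finite[OF f] R.pset_finite[OF g] by simp
  have fg: "{m. R.indexed_padd f g m \<noteq> \<zero>} \<subseteq> ?A" by (auto simp: R.indexed_padd_def)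
  note c = R.pset_coeff[OF f] R.pset_coeff[OF g] S.mon_closed[OF x0]
  have "pev R S h x (R.indexed_padd f g) = (\<Oplus>\<^bsub>S\<^esub>m\<in>?A. h (R.indexed_padd f g m) \<otimes>\<^bsub>S\<^esub> mon S x m)"
    by (rule pev_superset[OF R.indexed_pset.indexed_padd[OF f g] x0 A fg])
  also have "\<dots> = (\<Oplus>\<^bsub>S\<^esub>m\<in>?A. h (f m) \<otimes>\<^bsub>S\<^esub> mon S x m \<oplus>\<^bsub>S\<^esub> h (g m) \<otimes>\<^bsub>S\<^esub> mon S x m)"
    using c by (intro S.finsum_cong') (auto simp: R.indexed_padd_def S.l_distr)
  also have "\<dots> = (\<Oplus>\<^bsub>S\<^esub>m\<in>?A. h (f m) \<otimes>\<^bsub>S\<^esub> mon S x m) \<oplus>\<^bsub>S\<^esub> (\<Oplus>\<^bsub>S\<^esub>m\<in>?A. h (g m) \<otimes>\<^bsub>S\<^esub> mon S x m)"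
    using c by (intro S.finsum_addf) auto
  finally show ?thesis using pev_superset[OF f x0 A] pev_superset[OF g x0 A] by simp
qed

lemma pev_pmult:
  assumes f: "f \<in> R.indexed_pset I (carrier R)" and x0: "range x \<subseteq> carrier S" and i: "i \<in> I"
  shows "pev R S h x (R.indexed_pmult f i) = pev R S h x f \<otimes>\<^bsub>S\<^esub> x i"
proof -
  note x = range_subsetD[OF x0]
  let ?A = "{m. f m \<noteq> \<zero>}" and ?g = "R.indexed_pmult f i"
  have A: "finite ?A" using R.pset_finite[OF f] .
  note c = R.pset_coeff[OF f] S.mon_closed[OF x0]
  have g: "?g \<in> R.indexed_pset I (carrier R)" using R.indexed_pset.indexed_pmult[OF f i] .
  have sub: "{m. ?g m \<noteq> \<zero>} \<subseteq> add_mset i ` ?A"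
  proof
    fix m assume "m \<in> {m. ?g m \<noteq> \<zero>}"
    then have "i \<in># m" "f (m - {#i#}) \<noteq> \<zero>" by (auto simp: R.indexed_pmult_def split: if_splits)
    then show "m \<in> add_mset i ` ?A" by (intro image_eqI[of _ _ "m - {#i#}"]) auto
  qed
  have "pev R S h x ?g = (\<Oplus>\<^bsub>S\<^esub>m\<in>add_mset i ` ?A. h (?g m) \<otimes>\<^bsub>S\<^esub> mon S x m)"
    by (rule pev_superset[OF g x0 _ sub]) (use A in simp)
  also have "\<dots> = (\<Oplus>\<^bsub>S\<^esub>m\<in>?A. h (?g (add_mset i m)) \<otimes>\<^bsub>S\<^esub> mon S x (add_mset i m))"
    using c R.pset_coeff[OF g] by (intro S.finsum_reindex) (auto simp: inj_on_def)
  also have "\<dots> = (\<Oplus>\<^bsub>S\<^esub>m\<in>?A. (h (f m) \<otimes>\<^bsub>S\<^esub> mon S x m) \<otimes>\<^bsub>S\<^esub> x i)"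
    using c x by (intro S.finsum_cong') (auto simp: R.indexed_pmult_def S.mon_add_mset[OF x0] S.m_assoc)
  also have "\<dots> = (\<Oplus>\<^bsub>S\<^esub>m\<in>?A. h (f m) \<otimes>\<^bsub>S\<^esub> mon S x m) \<otimes>\<^bsub>S\<^esub> x i"
    using c x0 A by (intro S.finsum_ldistr[symmetric]) auto
  finally show ?thesis by (simp add: pev_def)
qed

lemma pev_psc:
  assumes f: "f \<in> R.indexed_pset I (carrier R)" and x0: "range x \<subseteq> carrier S" and a: "a \<in> carrier R"
  shows "pev R S h x (psc R a f) = h a \<otimes>\<^bsub>S\<^esub> pev R S h x f"
proof -
  note x = range_subsetD[OF x0]
  let ?A = "{m. f m \<noteq> \<zero>}"
  have A: "finite ?A" using R.pset_finite[OF f] .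
  note c = R.pset_coeff[OF f] S.mon_closed[OF x0]
  have "pev R S h x (psc R a f) = (\<Oplus>\<^bsub>S\<^esub>m\<in>?A. h (psc R a f m) \<otimes>\<^bsub>S\<^esub> mon S x m)"
    by (rule pev_superset[OF R.pset_scale[OF f a] x0 A]) (use a in \<open>auto simp: psc_def\<close>)
  also have "\<dots> = (\<Oplus>\<^bsub>S\<^esub>m\<in>?A. h a \<otimes>\<^bsub>S\<^esub> (h (f m) \<otimes>\<^bsub>S\<^esub> mon S x m))"
    using c a by (intro S.finsum_cong') (auto simp: psc_def S.m_assoc)
  also have "\<dots> = h a \<otimes>\<^bsub>S\<^esub> (\<Oplus>\<^bsub>S\<^esub>m\<in>?A. h (f m) \<otimes>\<^bsub>S\<^esub> mon S x m)"
    using c a A by (intro S.finsum_rdistr[symmetric]) auto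
  finally show ?thesis by (simp add: pev_def)
qed

lemma pev_pm:
  assumes f: "f \<in> R.indexed_pset I (carrier R)" and g: "g \<in> R.indexed_pset I (carrier R)" and x0: "range x \<subseteq> carrier S"
  shows "pev R S h x (pm R f g) = pev R S h x f \<otimes>\<^bsub>S\<^esub> pev R S h x g"
  using f
  supply x = range_subsetD[OF x0]
proof (induction rule: R.indexed_pset.induct)
  case (indexed_const k)
  then show ?case
    using R.pm_const[OF indexed_const R.pset_cc[OF g]] pev_psc[OF g x0] pev_const[OF _ x0] by simp
next
  case (indexed_padd P Q)
  note P = R.pset_cc[OF indexed_padd(1)] and Q = R.pset_cc[OF indexed_padd(2)]
  show ?case
    unfolding R.pm_padd[OF P Q R.pset_cc[OF g]]
    using pev_padd[OF R.pm_pset[OF indexed_padd(1) g] R.pm_pset[OF indexed_padd(2) g] x0]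
      pev_padd[OF indexed_padd(1,2) x0] indexed_padd(3,4)
      pev_closed[OF indexed_padd(1) x0] pev_closed[OF indexed_padd(2) x0] pev_closed[OF g x0]
    by (simp add: S.l_distr)
next
  case (indexed_pmult P i)
  note P = R.pset_cc[OF indexed_pmult(1)]
  show ?case
    unfolding R.pm_pmult[OF P R.pset_cc[OF g]]
    using pev_pmult[OF R.pm_pset[OF indexed_pmult(1) g] x0 indexed_pmult(2)]
      pev_pmult[OF indexed_pmult(1) x0 indexed_pmult(2)] indexed_pmult(3)
      pev_closed[OF indexed_pmult(1) x0] pev_closed[OF g x0] x
    by (simp add: S.m_ac)
qed

lemma pev_hom:
  assumes x0: "range x \<subseteq> carrier S"
  shows "pev R S h x \<in> Ring.ring_hom (mpoly_ring R I) S"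
  supply x = range_subsetD[OF x0]
proof (rule ring_hom_memI, unfold R.mpoly_simps)
  fix f g assume f: "f \<in> R.indexed_pset I (carrier R)" and g: "g \<in> R.indexed_pset I (carrier R)"
  show "pev R S h x f \<in> carrier S" by (rule pev_closed[OF f x0])
  show "pev R S h x (pm R f g) = pev R S h x f \<otimes>\<^bsub>S\<^esub> pev R S h x g" by (rule pev_pm[OF f g x0])
  show "pev R S h x (R.indexed_padd f g) = pev R S h x f \<oplus>\<^bsub>S\<^esub> pev R S h x g" by (rule pev_padd[OF f g x0])
qed (use pev_const[OF _ x0] in simp)

lemma pev_var:
  assumes x0: "range x \<subseteq> carrier S"
  shows "pev R S h x (R.indexed_var i) = x i"
proof -
  have "R.indexed_const \<one> \<in> R.indexed_pset UNIV (carrier R)" by (simp add: R.indexed_pset.indexed_const)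
  from pev_pmult[OF this x0] show ?thesis
    unfolding R.indexed_var_def using pev_const[OF _ x0, of \<one>] range_subsetD[OF x0] by simp
qed

lemma pev_cong:
  assumes "f \<in> R.indexed_pset I (carrier R)" "range x \<subseteq> carrier S" "range y \<subseteq> carrier S" "\<And>i. i \<in> I \<Longrightarrow> x i = y i"
  shows "pev R S h x f = pev R S h y f"
  using assms(1)
proof (induction rule: R.indexed_pset.induct)
  case (indexed_const k)
  then show ?case using pev_const[OF _ assms(2)] pev_const[OF _ assms(3)] by simp
next
  case (indexed_padd P Q)
  then show ?case using pev_padd[OF indexed_padd(1,2) assms(2)] pev_padd[OF indexed_padd(1,2) assms(3)] by simp
next
  case (indexed_pmult P i)
  then show ?case using pev_pmult[OF indexed_pmult(1) assms(2)] pev_pmult[OF indexed_pmult(1) assms(3)] assms(4) by simp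
qed

end

section \<open>Polynomial functions of one parameter and restriction to lines\<close>

text \<open>Horner evaluation, constant coefficient first.\<close>

primrec hor :: "('a, 'b) ring_scheme \<Rightarrow> 'a list \<Rightarrow> 'a \<Rightarrow> 'a" where
  "hor R [] s = \<zero>\<^bsub>R\<^esub>"
| "hor R (c # cs) s = hor R cs s \<otimes>\<^bsub>R\<^esub> s \<oplus>\<^bsub>R\<^esub> c"

definition upfun :: "('a, 'b) ring_scheme \<Rightarrow> ('a \<Rightarrow> 'a) \<Rightarrow> bool" where
  "upfun R g \<longleftrightarrow> (\<exists>cs. set cs \<subseteq> carrier R \<and> (\<forall>s\<in>carrier R. g s = hor R cs s))"

text \<open>The property of polynomial functions used for choosing points: restricted to the line
  through any \<open>u\<close> and \<open>v\<close> they become polynomials in the parameter. The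
  points lie over \<open>R\<close>, while the values and the coefficients may lie in
  \<open>S\<close>.\<close>

definition linepoly :: "('r, 'b) ring_scheme \<Rightarrow> ('s, 'd) ring_scheme \<Rightarrow> ('r \<Rightarrow> 's) \<Rightarrow> (('c \<Rightarrow> 'r) \<Rightarrow> 's) \<Rightarrow> bool" where
  "linepoly R S h g \<longleftrightarrow> (\<forall>u v. range u \<subseteq> carrier R \<longrightarrow> range v \<subseteq> carrier R \<longrightarrow>
     (\<exists>cs. set cs \<subseteq> carrier S \<and>
       (\<forall>s\<in>carrier R. g (\<lambda>i. u i \<oplus>\<^bsub>R\<^esub> s \<otimes>\<^bsub>R\<^esub> (v i \<ominus>\<^bsub>R\<^esub> u i)) = hor S cs (h s))))"

text \<open>A polynomial in the variable \<open>i\<close> whose coefficients are polynomials, in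
  Horner form.\<close>

primrec (in ring) mhor :: "('c multiset \<Rightarrow> 'a) list \<Rightarrow> 'c \<Rightarrow> 'c multiset \<Rightarrow> 'a" where
  "mhor [] i = indexed_const \<zero>"
| "mhor (P # Ps) i = indexed_padd (indexed_pmult (mhor Ps i) i) P"

context cring
begin

lemma hor_closed: "set cs \<subseteq> carrier R \<Longrightarrow> s \<in> carrier R \<Longrightarrow> hor R cs s \<in> carrier R"
  by (induction cs) auto

lemma upfun_hor: "set cs \<subseteq> carrier R \<Longrightarrow> upfun R (hor R cs)"
  unfolding upfun_def by auto

lemma upfun_closed: "upfun R g \<Longrightarrow> s \<in> carrier R \<Longrightarrow> g s \<in> carrier R"
  unfolding upfun_def using hor_closed by auto

lemma upfun_const: "a \<in> carrier R \<Longrightarrow> upfun R (\<lambda>_. a)"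
  unfolding upfun_def by (intro exI[of _ "[a]"]) auto

lemma upfun_id: "upfun R (\<lambda>s. s)"
  unfolding upfun_def by (intro exI[of _ "[\<zero>, \<one>]"]) auto

lemma hor_add:
  "set cs \<subseteq> carrier R \<Longrightarrow> set ds \<subseteq> carrier R \<Longrightarrow>
   \<exists>es. set es \<subseteq> carrier R \<and> (\<forall>s\<in>carrier R. hor R cs s \<oplus> hor R ds s = hor R es s)"
proof (induction cs arbitrary: ds)
  case Nil
  then show ?case using hor_closed by (intro exI[of _ ds]) auto
next
  case (Cons c cs)
  show ?case
  proof (cases ds)
    case Nil
    then show ?thesis using Cons.prems hor_closed[OF Cons.prems(1)] by (intro exI[of _ "c # cs"]) auto
  next
    case (Cons d ds')
    then obtain es where es: "set es \<subseteq> carrier R" "\<forall>s\<in>carrier R. hor R cs s \<oplus> hor R ds' s = hor R es s"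
      using Cons.IH[of ds'] Cons.prems by auto
    have "hor R (c # cs) s \<oplus> hor R ds s = hor R ((c \<oplus> d) # es) s" if s: "s \<in> carrier R" for s
    proof -
      have "hor R cs s \<in> carrier R" "hor R ds' s \<in> carrier R" "c \<in> carrier R" "d \<in> carrier R"
        using Cons Cons.prems hor_closed s by auto
      then show ?thesis using bspec[OF es(2) s, symmetric] s by (simp add: Cons l_distr a_ac)
    qed
    then show ?thesis using es Cons Cons.prems by (intro exI[of _ "(c \<oplus> d) # es"]) auto
  qed
qed

lemma upfun_add: "upfun R f \<Longrightarrow> upfun R g \<Longrightarrow> upfun R (\<lambda>s. f s \<oplus> g s)"
proof -
  assume "upfun R f" "upfun R g"
  then obtain cs ds where cs: "set cs \<subseteq> carrier R" "\<forall>s\<in>carrier R. f s = hor R cs s"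
    and ds: "set ds \<subseteq> carrier R" "\<forall>s\<in>carrier R. g s = hor R ds s" unfolding upfun_def by blast
  obtain es where es: "set es \<subseteq> carrier R" "\<forall>s\<in>carrier R. hor R cs s \<oplus> hor R ds s = hor R es s"
    using hor_add[OF cs(1) ds(1)] by blast
  have "\<forall>s\<in>carrier R. f s \<oplus> g s = hor R es s" using cs(2) ds(2) es(2) by simp
  then show "upfun R (\<lambda>s. f s \<oplus> g s)" unfolding upfun_def using es(1) by blast
qed

lemma upfun_scale:
  assumes a: "a \<in> carrier R" and g: "upfun R g" shows "upfun R (\<lambda>s. a \<otimes> g s)"
proof -
  obtain cs where cs: "set cs \<subseteq> carrier R" "\<forall>s\<in>carrier R. g s = hor R cs s" using g by (auto simp: upfun_def)
  have "a \<otimes> hor R cs s = hor R (map (\<lambda>c. a \<otimes> c) cs) s" if s: "s \<in> carrier R" for s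
    using cs(1)
  proof (induction cs)
    case Nil
    then show ?case using a by simp
  next
    case (Cons c cs)
    then have IH: "a \<otimes> hor R cs s = hor R (map (\<lambda>c. a \<otimes> c) cs) s" and c: "c \<in> carrier R" "hor R cs s \<in> carrier R"
      using hor_closed s by auto
    show ?case using IH[symmetric] c a s by (simp add: r_distr m_assoc)
  qed
  moreover have "set (map (\<lambda>c. a \<otimes> c) cs) \<subseteq> carrier R" using cs(1) a by auto
  ultimately show ?thesis unfolding upfun_def using cs(2) by metis
qed

lemma upfun_shift: "upfun R g \<Longrightarrow> upfun R (\<lambda>s. g s \<otimes> s)"
proof -
  assume "upfun R g"
  then obtain cs where cs: "set cs \<subseteq> carrier R" "\<forall>s\<in>carrier R. g s = hor R cs s" by (auto simp: upfun_def)
  then show "upfun R (\<lambda>s. g s \<otimes> s)"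
    unfolding upfun_def using hor_closed[OF cs(1)] by (intro exI[of _ "\<zero> # cs"]) auto
qed

lemma upfun_cong: "upfun R f \<Longrightarrow> (\<And>s. s \<in> carrier R \<Longrightarrow> f s = g s) \<Longrightarrow> upfun R g"
proof -
  assume "upfun R f" and e: "\<And>s. s \<in> carrier R \<Longrightarrow> f s = g s"
  then obtain cs where cs: "set cs \<subseteq> carrier R" "\<forall>s\<in>carrier R. f s = hor R cs s" unfolding upfun_def by blast
  have "g s = hor R cs s" if "s \<in> carrier R" for s using bspec[OF cs(2) that] e[OF that] by simp
  then show "upfun R g" unfolding upfun_def using cs(1) by blast
qed

lemma upfun_mult:
  assumes f: "upfun R f" and g: "upfun R g" shows "upfun R (\<lambda>s. f s \<otimes> g s)"
proof -
  obtain cs where cs: "set cs \<subseteq> carrier R" "\<forall>s\<in>carrier R. f s = hor R cs s" using f by (auto simp: upfun_def)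
  have "upfun R (\<lambda>s. hor R cs s \<otimes> g s)"
    using cs(1)
  proof (induction cs)
    case Nil
    show ?case by (rule upfun_cong[OF upfun_const[OF zero_closed]]) (use upfun_closed[OF g] in simp)
  next
    case (Cons c cs)
    then have IH: "upfun R (\<lambda>s. hor R cs s \<otimes> g s)" and c: "c \<in> carrier R" and cs: "set cs \<subseteq> carrier R" by auto
    show ?case
      by (rule upfun_cong[OF upfun_add[OF upfun_shift[OF IH] upfun_scale[OF c g]]])
        (use c hor_closed[OF cs] upfun_closed[OF g] in \<open>simp add: l_distr r_distr m_ac\<close>)
  qed
  then show ?thesis by (rule upfun_cong) (use cs(2) in simp)
qed

end

context field
begin

text \<open>Synthetic division by s - r: the coefficients of the quotient are the intermediate
  values of the Horner scheme at \<open>r\<close>.\<close>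

lemma hor_factor:
  assumes r: "r \<in> carrier R"
  shows "set cs \<subseteq> carrier R \<Longrightarrow> cs \<noteq> [] \<Longrightarrow> \<exists>ds. set ds \<subseteq> carrier R \<and> length ds < length cs \<and>
    (\<forall>s\<in>carrier R. hor R cs s = (s \<ominus> r) \<otimes> hor R ds s \<oplus> hor R cs r)"
proof (induction cs)
  case Nil
  then show ?case by simp
next
  case (Cons c cs)
  show ?case
  proof (cases "cs = []")
    case True
    then show ?thesis using Cons.prems r by (intro exI[of _ "[]"]) auto
  next
    case False
    then obtain ds where ds: "set ds \<subseteq> carrier R" "length ds < length cs"
      "\<forall>s\<in>carrier R. hor R cs s = (s \<ominus> r) \<otimes> hor R ds s \<oplus> hor R cs r"
      using Cons by auto
    have hr: "hor R cs r \<in> carrier R" using hor_closed Cons.prems r by auto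
    have c: "c \<in> carrier R" using Cons.prems by simp
    have "hor R (c # cs) s = (s \<ominus> r) \<otimes> hor R (hor R cs r # ds) s \<oplus> hor R (c # cs) r" if s: "s \<in> carrier R" for s
    proof -
      have hd: "hor R ds s \<in> carrier R" using hor_closed ds(1) s by auto
      have "hor R (c # cs) s = ((s \<ominus> r) \<otimes> hor R ds s \<oplus> hor R cs r) \<otimes> s \<oplus> c" using bspec[OF ds(3) s] by simp
      also have "\<dots> = (s \<ominus> r) \<otimes> (hor R ds s \<otimes> s \<oplus> hor R cs r) \<oplus> (hor R cs r \<otimes> r \<oplus> c)"
        using s r hd hr c by algebra
      finally show ?thesis by simp
    qed
    then show ?thesis using ds hr by (intro exI[of _ "hor R cs r # ds"]) auto
  qed
qed

text \<open>Splitting off the factor of one zero shortens the list and leaves the other, still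
  infinitely many, zeros to the quotient.\<close>

lemma hor_vanish:
  assumes "set cs \<subseteq> carrier R" "Z \<subseteq> carrier R" "infinite Z" "\<And>s. s \<in> Z \<Longrightarrow> hor R cs s = \<zero>" "s \<in> carrier R"
  shows "hor R cs s = \<zero>"
  using assms
proof (induction "length cs" arbitrary: cs Z rule: less_induct)
  case less
  show ?case
  proof (cases "cs = []")
    case False
    obtain r where r: "r \<in> Z" using less.prems(3) by (metis finite.emptyI equals0I)
    then have rc: "r \<in> carrier R" using less.prems(2) by auto
    obtain ds where ds: "set ds \<subseteq> carrier R" "length ds < length cs"
      "\<forall>s\<in>carrier R. hor R cs s = (s \<ominus> r) \<otimes> hor R ds s \<oplus> hor R cs r"
      using hor_factor[OF rc less.prems(1) False] by auto
    have hr: "hor R cs r = \<zero>" using less.prems(4)[OF r] .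
    have e: "hor R cs s = (s \<ominus> r) \<otimes> hor R ds s" if "s \<in> carrier R" for s
      using bspec[OF ds(3) that] hr hor_closed[OF ds(1) that] that rc by simp
    have "hor R ds s = \<zero>" if s: "s \<in> Z - {r}" for s
    proof -
      have sc: "s \<in> carrier R" using s less.prems(2) by auto
      have "(s \<ominus> r) \<otimes> hor R ds s = \<zero>" using e[OF sc] less.prems(4) s by auto
      moreover have "s \<ominus> r \<noteq> \<zero>" using s sc rc by auto
      ultimately show ?thesis using integral[of "s \<ominus> r" "hor R ds s"] hor_closed[OF ds(1) sc] sc rc by auto
    qed
    then have "hor R ds s = \<zero>"
      using less.hyps[OF ds(2,1), of "Z - {r}"] less.prems by auto
    then show ?thesis using e[OF less.prems(5)] less.prems(5) rc by simp
  qed simp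
qed

lemma upfun_zeros_finite:
  assumes "upfun R g" "s \<in> carrier R" "g s \<noteq> \<zero>"
  shows "finite {s \<in> carrier R. g s = \<zero>}"
proof (rule ccontr)
  assume inf: "infinite {s \<in> carrier R. g s = \<zero>}"
  obtain cs where cs: "set cs \<subseteq> carrier R" "\<forall>s\<in>carrier R. g s = hor R cs s" using assms by (auto simp: upfun_def)
  have "hor R cs s = \<zero>" by (rule hor_vanish[OF cs(1) _ inf _ assms(2)]) (use cs in auto)
  then show False using assms cs by auto
qed

end

context inf_field
begin

text \<open>The value at 0 is the constant coefficient. The remaining polynomial times s vanishes
  everywhere, so it has all nonzero elements as zeros, which is enough in an infinite field.\<close>

lemma hor_coeffs_zero:
  "set cs \<subseteq> carrier R \<Longrightarrow> (\<And>s. s \<in> carrier R \<Longrightarrow> hor R cs s = \<zero>) \<Longrightarrow> set cs \<subseteq> {\<zero>}"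
proof (induction cs)
  case Nil
  then show ?case by simp
next
  case (Cons c cs)
  have cs: "set cs \<subseteq> carrier R" and c: "c \<in> carrier R" using Cons.prems by auto
  have c0: "c = \<zero>" using Cons.prems(2)[of \<zero>] hor_closed[OF cs, of \<zero>] c by simp
  have z: "hor R cs s = \<zero>" if s: "s \<in> carrier R - {\<zero>}" for s
  proof -
    have h: "hor R cs s \<in> carrier R" using hor_closed[OF cs] s by auto
    have "hor R cs s \<otimes> s = \<zero>" using Cons.prems(2)[of s] s c0 h by simp
    then show ?thesis using integral[OF _ h, of s] s by auto
  qed
  have "infinite (carrier R - {\<zero>})" using infinite_carrier by simp
  then have "hor R cs s = \<zero>" if "s \<in> carrier R" for s
    using hor_vanish[OF cs _ _ z that] by blast
  then show ?case using Cons.IH[OF cs] c0 by auto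
qed

lemma pset_mono: "f \<in> indexed_pset I (carrier R) \<Longrightarrow> I \<subseteq> K \<Longrightarrow> f \<in> indexed_pset K (carrier R)"
  by (induction rule: indexed_pset.induct) (auto intro: indexed_pset.intros)

lemma pset_zero: "indexed_const \<zero> \<in> indexed_pset I (carrier R)"
  by (simp add: indexed_pset.indexed_const)

lemma horner_pset:
  fixes I :: "'c set"
  assumes "set Ps \<subseteq> indexed_pset I (carrier R)"
  shows "mhor Ps i \<in> indexed_pset (insert i I) (carrier R)"
  using assms
proof (induction Ps)
  case Nil
  show ?case unfolding mhor.simps(1) by (rule pset_zero)
next
  case (Cons P Ps)
  have "P \<in> indexed_pset I (carrier R) \<and> set Ps \<subseteq> indexed_pset I (carrier R)"
    using Cons.prems unfolding set_simps insert_subset .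
  note c = conjunct1[OF this] conjunct2[OF this]
  note P = pset_mono[OF c(1) subset_insertI] and Q = Cons.IH[OF c(2)]
  show ?case unfolding mhor.simps(2)
    by (rule indexed_pset.indexed_padd[OF indexed_pset.indexed_pmult[OF Q insertI1] P])
qed

lemma horner_add:
  fixes I :: "'c set"
  shows "set Ps \<subseteq> indexed_pset I (carrier R) \<Longrightarrow> set Qs \<subseteq> indexed_pset I (carrier R) \<Longrightarrow>
   \<exists>Rs. set Rs \<subseteq> indexed_pset I (carrier R) \<and>
     indexed_padd (mhor Ps i) (mhor Qs i) = mhor Rs i"
proof (induction Ps arbitrary: Qs)
  case Nil
  have "carrier_coeff (mhor Qs i)" using horner_pset[OF Nil(2)] pset_cc by blast
  then have "indexed_padd (mhor [] i) (mhor Qs i) = mhor Qs i"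
    using indexed_padd_zero(2)[of "mhor Qs i"] by simp
  then show ?case using Nil by blast
next
  case (Cons P Ps)
  show ?case
  proof (cases Qs)
    case Nil
    have "carrier_coeff (mhor (P # Ps) i)" using horner_pset[OF Cons.prems(1)] pset_cc by blast
    then have "indexed_padd (mhor (P # Ps) i) (mhor Qs i) = mhor (P # Ps) i"
      unfolding Nil using indexed_padd_zero(1)[of "mhor (P # Ps) i"]
      by simp
    then show ?thesis using Cons.prems by blast
  next
    case (Cons Q Qs')
    note QC = this
    obtain Rs where Rs: "set Rs \<subseteq> indexed_pset I (carrier R)"
      "indexed_padd (mhor Ps i) (mhor Qs' i) = mhor Rs i"
      using Cons.IH[of Qs'] Cons.prems QC by auto
    have P: "P \<in> indexed_pset I (carrier R)" and Q: "Q \<in> indexed_pset I (carrier R)"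
      and Ps: "set Ps \<subseteq> indexed_pset I (carrier R)" and Qs: "set Qs' \<subseteq> indexed_pset I (carrier R)"
      using Cons.prems QC by auto
    let ?p = "mhor Ps i" and ?q = "mhor Qs' i"
    have c: "P m \<in> carrier R" "Q m \<in> carrier R" "?p m \<in> carrier R" "?q m \<in> carrier R" for m
      using pset_coeff[OF P] pset_coeff[OF Q] pset_coeff[OF horner_pset[OF Ps]] pset_coeff[OF horner_pset[OF Qs]] by auto
    have "indexed_padd (indexed_padd (indexed_pmult ?p i) P) (indexed_padd (indexed_pmult ?q i) Q) =
      indexed_padd (indexed_pmult (indexed_padd ?p ?q) i) (indexed_padd P Q)"
      using c by (auto simp: indexed_padd_def indexed_pmult_def a_ac)
    then have "indexed_padd (mhor (P # Ps) i) (mhor Qs i) = mhor (indexed_padd P Q # Rs) i"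
      using Rs(2) QC by simp
    moreover have "set (indexed_padd P Q # Rs) \<subseteq> indexed_pset I (carrier R)"
      using Rs(1) P Q by (auto intro: indexed_pset.indexed_padd)
    ultimately show ?thesis by blast
  qed
qed

lemma horner_pmult:
  fixes I :: "'c set"
  assumes "set Ps \<subseteq> indexed_pset I (carrier R)" "j \<noteq> i"
  shows "indexed_pmult (mhor Ps i) j = mhor (map (\<lambda>P. indexed_pmult P j) Ps) i"
  using assms(1)
proof (induction Ps)
  case Nil
  have "indexed_pmult (indexed_const \<zero>) j = indexed_const \<zero>"
    by (rule ext) (simp add: indexed_pmult_def indexed_const_def)
  then show ?case unfolding mhor.simps list.map .
next
  case (Cons P Ps)
  have Ps: "set Ps \<subseteq> indexed_pset I (carrier R)" using Cons.prems unfolding set_simps insert_subset by blast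
  have neq_mem: "j \<in># m - {#i#} \<longleftrightarrow> j \<in># m" "i \<in># m - {#j#} \<longleftrightarrow> i \<in># m" for m
    using assms(2) by (auto simp: in_diff_count)
  have c: "P m \<in> carrier R" for m
    using Cons.prems pset_coeff unfolding set_simps insert_subset by blast
  have e: "indexed_pmult (indexed_padd (indexed_pmult p i) P) j m =
    indexed_padd (indexed_pmult (indexed_pmult p j) i) (indexed_pmult P j) m" for m and p :: "'c multiset \<Rightarrow> 'a"
    unfolding indexed_padd_def indexed_pmult_def neq_mem using c by (simp add: add_mset_commute)
  show ?case unfolding mhor.simps list.map Cons.IH[OF Ps, symmetric]
    by (rule ext, rule e)
qed

lemma horner_exists:
  fixes I :: "'c set"
  assumes "f \<in> indexed_pset (insert i I) (carrier R)"
  shows "\<exists>Ps. set Ps \<subseteq> indexed_pset I (carrier R) \<and> f = mhor Ps i"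
  using assms
proof (induction rule: indexed_pset.induct)
  case (indexed_const k)
  have "indexed_const k = mhor [indexed_const k :: 'c multiset \<Rightarrow> 'a] i"
    unfolding mhor.simps
    by (rule ext) (use indexed_const in \<open>simp add: indexed_pmult_def indexed_padd_def indexed_const_def\<close>)
  moreover have "set [indexed_const k :: 'c multiset \<Rightarrow> 'a] \<subseteq> indexed_pset I (carrier R)"
    using indexed_pset.indexed_const[OF indexed_const] by simp
  ultimately show ?case by blast
next
  case (indexed_padd P Q)
  obtain Ps Qs where "set Ps \<subseteq> indexed_pset I (carrier R)" "P = mhor Ps i"
    "set Qs \<subseteq> indexed_pset I (carrier R)" "Q = mhor Qs i" using indexed_padd.IH by blast
  then show ?case using horner_add[of Ps I Qs i] by blast
next
  case (indexed_pmult P j)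
  obtain Ps where Ps: "set Ps \<subseteq> indexed_pset I (carrier R)" "P = mhor Ps i" using indexed_pmult.IH by blast
  show ?case
  proof (cases "j = i")
    case True
    have c: "P m \<in> carrier R" for m using pset_coeff[OF horner_pset[OF Ps(1)]] Ps(2) by blast
    have "indexed_pmult P i = mhor (indexed_const \<zero> # Ps) i"
      unfolding mhor.simps Ps(2)[symmetric]
      by (rule ext) (use c in \<open>simp add: indexed_pmult_def indexed_padd_def indexed_const_def\<close>)
    moreover have "set (indexed_const \<zero> # Ps) \<subseteq> indexed_pset I (carrier R)"
      using Ps(1) pset_zero by simp
    ultimately show ?thesis using True by blast
  next
    case False
    then have j: "j \<in> I" using indexed_pmult.hyps by blast
    have "set (map (\<lambda>P. indexed_pmult P j) Ps) \<subseteq> indexed_pset I (carrier R)"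
      unfolding set_map by (rule image_subsetI, rule indexed_pset.indexed_pmult[OF subsetD[OF Ps(1)] j])
    then show ?thesis using horner_pmult[OF Ps(1) False] unfolding Ps(2) by blast
  qed
qed

lemma id_hom: "ring_hom_cring R R (\<lambda>x. x)"
proof (rule ring_hom_cring.intro[OF is_cring is_cring], rule ring_hom_cring_axioms.intro)
  show "(\<lambda>x. x) \<in> Ring.ring_hom R R" by (rule ring_hom_memI) simp_all
qed

text \<open>Induction on the variables, with \<open>f\<close> regarded as a polynomial in
  \<open>i\<close>. For fixed values of the other variables all its coefficients are zero, because
  it vanishes for every value of \<open>i\<close>; by induction the coefficients are then zero as
  polynomials.\<close>

lemma poly_vanish:
  fixes f :: "'c multiset \<Rightarrow> 'a"
  assumes "finite I" "f \<in> indexed_pset I (carrier R)" "\<And>x. range x \<subseteq> carrier R \<Longrightarrow> pev R R (\<lambda>x. x) x f = \<zero>"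
  shows "f = indexed_const \<zero>"
  using assms
proof (induction I arbitrary: f)
  case empty
  have "\<exists>a\<in>carrier R. f = indexed_const a" using empty(1)
    by (induction rule: indexed_pset.induct) (auto simp: indexed_padd_const)
  then obtain a where a: "a \<in> carrier R" "f = indexed_const a" by auto
  have "pev R R (\<lambda>x. x) (\<lambda>_. \<zero>) f = a" unfolding a(2) by (rule ring_hom_cring.pev_const[OF id_hom a(1)]) auto
  then have "a = \<zero>" using empty(2)[of "\<lambda>_. \<zero>"] by auto
  then show ?case using a by simp
next
  case (insert i I)
  obtain Ps where Ps: "set Ps \<subseteq> indexed_pset I (carrier R)" "f = mhor Ps i"
    using horner_exists[OF insert.prems(1)] by auto
  have ev: "pev R R (\<lambda>x. x) x (mhor Ps i) = hor R (map (pev R R (\<lambda>x. x) x) Ps) (x i)"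
    if x: "range x \<subseteq> carrier R" and P: "set Ps \<subseteq> indexed_pset I (carrier R)" for x Ps
    using P
  proof (induction Ps)
    case Nil
    then show ?case using ring_hom_cring.pev_const[OF id_hom zero_closed x] by simp
  next
    case (Cons P Ps)
    let ?K = "insert i I"
    have p: "mhor Ps i \<in> indexed_pset ?K (carrier R)" using horner_pset Cons.prems by auto
    have P: "P \<in> indexed_pset ?K (carrier R)" using Cons.prems pset_mono[of P I ?K] by auto
    have "pev R R (\<lambda>x. x) x (indexed_padd (indexed_pmult (mhor Ps i) i) P) =
      pev R R (\<lambda>x. x) x (mhor Ps i) \<otimes> x i \<oplus> pev R R (\<lambda>x. x) x P"
      using ring_hom_cring.pev_padd[OF id_hom indexed_pset.indexed_pmult[OF p, of i] P x] ring_hom_cring.pev_pmult[OF id_hom p x, of i] by simp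
    then show ?case using Cons by simp
  qed
  have pz: "P = indexed_const \<zero>" if P: "P \<in> set Ps" for P
  proof (rule insert.IH)
    show PI: "P \<in> indexed_pset I (carrier R)" using P Ps by auto
    fix y :: "'c \<Rightarrow> 'a" assume y: "range y \<subseteq> carrier R"
    have "hor R (map (pev R R (\<lambda>x. x) y) Ps) s = \<zero>" if s: "s \<in> carrier R" for s
    proof -
      have x: "range (y(i := s)) \<subseteq> carrier R" using y s by auto
      have "pev R R (\<lambda>x. x) (y(i := s)) T = pev R R (\<lambda>x. x) y T" if T: "T \<in> set Ps" for T
      proof (rule ring_hom_cring.pev_cong[OF id_hom _ x y])
        show "T \<in> indexed_pset I (carrier R)" using T Ps(1) by blast
        fix k assume "k \<in> I"
        then show "(y(i := s)) k = y k" using insert.hyps(2) by auto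
      qed
      then have m: "map (pev R R (\<lambda>x. x) (y(i := s))) Ps = map (pev R R (\<lambda>x. x) y) Ps"
        by (rule map_cong[OF refl])
      show ?thesis using insert.prems(2)[OF x] unfolding Ps(2) ev[OF x Ps(1)] m by simp
    qed
    moreover have "set (map (pev R R (\<lambda>x. x) y) Ps) \<subseteq> carrier R"
      using ring_hom_cring.pev_closed[OF id_hom _ y] Ps(1) by auto
    ultimately have "set (map (pev R R (\<lambda>x. x) y) Ps) \<subseteq> {\<zero>}" by (rule hor_coeffs_zero[rotated])
    then show "pev R R (\<lambda>x. x) y P = \<zero>" using P by auto
  qed
  have "mhor Ps i = indexed_const \<zero>" if "set Ps \<subseteq> {indexed_const \<zero>}" for Ps :: "('c multiset \<Rightarrow> 'a) list"
    using that by (induction Ps) (simp_all add: indexed_padd_const)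
  then have "mhor Ps i = indexed_const \<zero>" using pz by blast
  then show ?case using Ps(2) by simp
qed

end

context inf_field_hom
begin

lemma linepolyI:
  assumes "\<And>u v. range u \<subseteq> carrier R \<Longrightarrow> range v \<subseteq> carrier R \<Longrightarrow>
    \<exists>cs. set cs \<subseteq> carrier S \<and> (\<forall>s\<in>carrier R. g (\<lambda>i. u i \<oplus> s \<otimes> (v i \<ominus> u i)) = hor S cs (h s))"
  shows "linepoly R S h g"
  unfolding linepoly_def by (intro allI impI assms)

lemma linepolyD:
  assumes g: "linepoly R S h g" and u: "range u \<subseteq> carrier R" and v: "range v \<subseteq> carrier R"
  shows "\<exists>cs. set cs \<subseteq> carrier S \<and> (\<forall>s\<in>carrier R. g (\<lambda>i. u i \<oplus> s \<otimes> (v i \<ominus> u i)) = hor S cs (h s))"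
  by (rule mp[OF mp[OF spec[OF spec[OF g[unfolded linepoly_def], of u], of v] u] v])

lemma upfun_list:
  assumes G: "upfun S G" and t: "\<And>s. s \<in> carrier R \<Longrightarrow> t s = G (h s)"
  shows "\<exists>cs. set cs \<subseteq> carrier S \<and> (\<forall>s\<in>carrier R. t s = hor S cs (h s))"
proof -
  obtain cs where cs: "set cs \<subseteq> carrier S" "\<forall>s\<in>carrier S. G s = hor S cs s"
    using G unfolding upfun_def by (elim exE conjE)
  have "t s = hor S cs (h s)" if "s \<in> carrier R" for s
    unfolding t[OF that] by (rule bspec[OF cs(2) hom_closed[OF that]])
  then show ?thesis using cs(1) by (intro exI[of _ cs] conjI ballI)
qed

lemma linepoly_const:
  assumes a: "a \<in> carrier S" shows "linepoly R S h (\<lambda>_. a)"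
  by (rule linepolyI, rule upfun_list[OF S.upfun_const[OF a]], rule refl)

lemma linepoly_coord: "linepoly R S h (\<lambda>y. h (y i))"
proof (rule linepolyI)
  fix u v :: "'e \<Rightarrow> 'a" assume "range u \<subseteq> carrier R" "range v \<subseteq> carrier R"
  then have uv: "u i \<in> carrier R" "v i \<in> carrier R" by blast+
  then have c: "h (u i) \<in> carrier S" "h (v i \<ominus> u i) \<in> carrier S" by simp_all
  have U: "upfun S (\<lambda>s. h (u i) \<oplus>\<^bsub>S\<^esub> s \<otimes>\<^bsub>S\<^esub> h (v i \<ominus> u i))"
    by (rule S.upfun_add[OF S.upfun_const[OF c(1)] S.upfun_mult[OF S.upfun_id S.upfun_const[OF c(2)]]])
  show "\<exists>cs. set cs \<subseteq> carrier S \<and> (\<forall>s\<in>carrier R. h (u i \<oplus> s \<otimes> (v i \<ominus> u i)) = hor S cs (h s))"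
    by (rule upfun_list[OF U]) (use uv in simp)
qed

lemma linepoly_add:
  assumes "linepoly R S h f" "linepoly R S h g" shows "linepoly R S h (\<lambda>y. f y \<oplus>\<^bsub>S\<^esub> g y)"
proof (rule linepolyI)
  fix u v :: "'e \<Rightarrow> 'a" assume uv: "range u \<subseteq> carrier R" "range v \<subseteq> carrier R"
  obtain cs where cs: "set cs \<subseteq> carrier S" "\<forall>s\<in>carrier R. f (\<lambda>i. u i \<oplus> s \<otimes> (v i \<ominus> u i)) = hor S cs (h s)"
    using linepolyD[OF assms(1) uv] by auto
  obtain ds where ds: "set ds \<subseteq> carrier S" "\<forall>s\<in>carrier R. g (\<lambda>i. u i \<oplus> s \<otimes> (v i \<ominus> u i)) = hor S ds (h s)"
    using linepolyD[OF assms(2) uv] by auto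
  have U: "upfun S (\<lambda>s. hor S cs s \<oplus>\<^bsub>S\<^esub> hor S ds s)"
    by (rule S.upfun_add[OF S.upfun_hor[OF cs(1)] S.upfun_hor[OF ds(1)]])
  show "\<exists>es. set es \<subseteq> carrier S \<and> (\<forall>s\<in>carrier R. f (\<lambda>i. u i \<oplus> s \<otimes> (v i \<ominus> u i)) \<oplus>\<^bsub>S\<^esub> g (\<lambda>i. u i \<oplus> s \<otimes> (v i \<ominus> u i)) = hor S es (h s))"
    by (rule upfun_list[OF U]) (use cs(2) ds(2) in simp)
qed

lemma linepoly_mult:
  assumes "linepoly R S h f" "linepoly R S h g" shows "linepoly R S h (\<lambda>y. f y \<otimes>\<^bsub>S\<^esub> g y)"
proof (rule linepolyI)
  fix u v :: "'e \<Rightarrow> 'a" assume uv: "range u \<subseteq> carrier R" "range v \<subseteq> carrier R"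
  obtain cs where cs: "set cs \<subseteq> carrier S" "\<forall>s\<in>carrier R. f (\<lambda>i. u i \<oplus> s \<otimes> (v i \<ominus> u i)) = hor S cs (h s)"
    using linepolyD[OF assms(1) uv] by auto
  obtain ds where ds: "set ds \<subseteq> carrier S" "\<forall>s\<in>carrier R. g (\<lambda>i. u i \<oplus> s \<otimes> (v i \<ominus> u i)) = hor S ds (h s)"
    using linepolyD[OF assms(2) uv] by auto
  have U: "upfun S (\<lambda>s. hor S cs s \<otimes>\<^bsub>S\<^esub> hor S ds s)"
    by (rule S.upfun_mult[OF S.upfun_hor[OF cs(1)] S.upfun_hor[OF ds(1)]])
  show "\<exists>es. set es \<subseteq> carrier S \<and> (\<forall>s\<in>carrier R. f (\<lambda>i. u i \<oplus> s \<otimes> (v i \<ominus> u i)) \<otimes>\<^bsub>S\<^esub> g (\<lambda>i. u i \<oplus> s \<otimes> (v i \<ominus> u i)) = hor S es (h s))"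
    by (rule upfun_list[OF U]) (use cs(2) ds(2) in simp)
qed

lemma linepoly_cong:
  assumes f: "linepoly R S h f" and e: "\<And>y. range y \<subseteq> carrier R \<Longrightarrow> f y = g y"
  shows "linepoly R S h g"
proof (rule linepolyI)
  fix u v :: "'e \<Rightarrow> 'a" assume uv: "range u \<subseteq> carrier R" "range v \<subseteq> carrier R"
  obtain cs where cs: "set cs \<subseteq> carrier S" "\<forall>s\<in>carrier R. f (\<lambda>i. u i \<oplus> s \<otimes> (v i \<ominus> u i)) = hor S cs (h s)"
    using linepolyD[OF f uv] by auto
  have "g (\<lambda>i. u i \<oplus> s \<otimes> (v i \<ominus> u i)) = hor S cs (h s)" if s: "s \<in> carrier R" for s
  proof -
    have ui: "u i \<in> carrier R" "v i \<in> carrier R" for i using uv by blast+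
    have "range (\<lambda>i. u i \<oplus> s \<otimes> (v i \<ominus> u i)) \<subseteq> carrier R"
      by (rule image_subsetI) (use ui s in simp)
    from e[OF this] show ?thesis using bspec[OF cs(2) s] by simp
  qed
  then show "\<exists>cs. set cs \<subseteq> carrier S \<and> (\<forall>s\<in>carrier R. g (\<lambda>i. u i \<oplus> s \<otimes> (v i \<ominus> u i)) = hor S cs (h s))"
    using cs(1) by blast
qed

lemma linepoly_pev:
  assumes "f \<in> R.indexed_pset I (carrier R)"
  shows "linepoly R S h (\<lambda>y. h (pev R R (\<lambda>x. x) y f))"
  using assms
proof (induction rule: R.indexed_pset.induct)
  case (indexed_const k)
  have "h k = h (pev R R (\<lambda>x. x) y (R.indexed_const k))" if y: "range y \<subseteq> carrier R" for y
    using ring_hom_cring.pev_const[OF R.id_hom indexed_const y] by simp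
  moreover have "h k \<in> carrier S" using indexed_const by simp
  ultimately show ?case by (rule linepoly_cong[OF linepoly_const, rotated])
next
  case (indexed_padd P Q)
  have "h (pev R R (\<lambda>x. x) y P) \<oplus>\<^bsub>S\<^esub> h (pev R R (\<lambda>x. x) y Q) = h (pev R R (\<lambda>x. x) y (R.indexed_padd P Q))"
    if y: "range y \<subseteq> carrier R" for y
    unfolding ring_hom_cring.pev_padd[OF R.id_hom indexed_padd(1,2) y]
    using ring_hom_cring.pev_closed[OF R.id_hom indexed_padd(1) y] ring_hom_cring.pev_closed[OF R.id_hom indexed_padd(2) y] by simp
  then show ?case by (rule linepoly_cong[OF linepoly_add[OF indexed_padd(3,4)]])
next
  case (indexed_pmult P i)
  have "h (pev R R (\<lambda>x. x) y P) \<otimes>\<^bsub>S\<^esub> h (y i) = h (pev R R (\<lambda>x. x) y (R.indexed_pmult P i))"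
    if y: "range y \<subseteq> carrier R" for y
  proof -
    have "y i \<in> carrier R" using y by blast
    then show ?thesis
      unfolding ring_hom_cring.pev_pmult[OF R.id_hom indexed_pmult(1) y indexed_pmult(2)]
      using ring_hom_cring.pev_closed[OF R.id_hom indexed_pmult(1) y] by simp
  qed
  then show ?case by (rule linepoly_cong[OF linepoly_mult[OF indexed_pmult(3) linepoly_coord]])
qed

text \<open>Almost all points of the line through \<open>u\<close> and \<open>v\<close> will do.\<close>

lemma linepoly_common:
  assumes f: "linepoly R S h f" and g: "linepoly R S h g"
    and u: "range u \<subseteq> carrier R" "f u \<noteq> \<zero>\<^bsub>S\<^esub>" and v: "range v \<subseteq> carrier R" "g v \<noteq> \<zero>\<^bsub>S\<^esub>"
  shows "\<exists>y. range y \<subseteq> carrier R \<and> f y \<noteq> \<zero>\<^bsub>S\<^esub> \<and> g y \<noteq> \<zero>\<^bsub>S\<^esub>"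
proof -
  define L where "L s = (\<lambda>i. u i \<oplus> s \<otimes> (v i \<ominus> u i))" for s
  have uv: "u i \<in> carrier R" "v i \<in> carrier R" for i using u(1) v(1) by blast+
  have L: "range (L s) \<subseteq> carrier R" if "s \<in> carrier R" for s
    unfolding L_def by (rule image_subsetI) (use uv that in simp)
  have L0: "L \<zero> = u"
    unfolding L_def by (rule ext) (use uv in simp)
  have L1: "L \<one> = v"
    unfolding L_def
  proof (rule ext)
    fix i
    have "u i \<oplus> \<one> \<otimes> (v i \<ominus> u i) = v i" using uv[of i] by algebra
    then show "u i \<oplus> \<one> \<otimes> (v i \<ominus> u i) = v i" .
  qed
  obtain cs where cs: "set cs \<subseteq> carrier S" "\<forall>s\<in>carrier R. f (L s) = hor S cs (h s)"
    using linepolyD[OF f u(1) v(1), folded L_def] by auto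
  obtain ds where ds: "set ds \<subseteq> carrier S" "\<forall>s\<in>carrier R. g (L s) = hor S ds (h s)"
    using linepolyD[OF g u(1) v(1), folded L_def] by auto
  \<comment> \<open>On the line \<open>L\<close>, the function \<open>f\<close> is nonzero at the
    parameter 0 and \<open>g\<close> at the parameter 1, so each has finitely many zeros
    there.\<close>
  have fG: "finite {s \<in> carrier S. hor S cs s = \<zero>\<^bsub>S\<^esub>}"
  proof (rule S.upfun_zeros_finite[OF S.upfun_hor[OF cs(1)]])
    show "h \<zero> \<in> carrier S" by simp
    show "hor S cs (h \<zero>) \<noteq> \<zero>\<^bsub>S\<^esub>" using bspec[OF cs(2) R.zero_closed] u(2) unfolding L0 by metis
  qed
  have fK: "finite {s \<in> carrier S. hor S ds s = \<zero>\<^bsub>S\<^esub>}"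
  proof (rule S.upfun_zeros_finite[OF S.upfun_hor[OF ds(1)]])
    show "h \<one> \<in> carrier S" by simp
    show "hor S ds (h \<one>) \<noteq> \<zero>\<^bsub>S\<^esub>" using bspec[OF ds(2) R.one_closed] v(2) unfolding L1 by metis
  qed
  have "inj_on h (carrier R)"
  proof (rule inj_onI)
    fix x y assume xy: "x \<in> carrier R" "y \<in> carrier R" "h x = h y"
    then have "h (x \<ominus> y) = \<zero>\<^bsub>S\<^esub>" by (simp add: a_minus_def S.r_neg)
    then show "x = y" using hom_zero_iff[of "x \<ominus> y"] xy by simp
  qed
  then have "infinite (h ` carrier R)" using R.infinite_carrier finite_imageD by blast
  then have "infinite (h ` carrier R - ({s \<in> carrier S. hor S cs s = \<zero>\<^bsub>S\<^esub>} \<union> {s \<in> carrier S. hor S ds s = \<zero>\<^bsub>S\<^esub>}))"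
    using fG fK by (intro Diff_infinite_finite finite_UnI)
  then obtain t where "t \<in> h ` carrier R - ({s \<in> carrier S. hor S cs s = \<zero>\<^bsub>S\<^esub>} \<union> {s \<in> carrier S. hor S ds s = \<zero>\<^bsub>S\<^esub>})"
    using infinite_imp_nonempty by blast
  then obtain s where s: "s \<in> carrier R" "hor S cs (h s) \<noteq> \<zero>\<^bsub>S\<^esub>" "hor S ds (h s) \<noteq> \<zero>\<^bsub>S\<^esub>" by auto
  have "f (L s) \<noteq> \<zero>\<^bsub>S\<^esub>" "g (L s) \<noteq> \<zero>\<^bsub>S\<^esub>" using bspec[OF cs(2) s(1)] bspec[OF ds(2) s(1)] s by simp_all
  then show ?thesis using L[OF s(1)] by blast
qed

end

section \<open>Quotient fields\<close>

context domain
begin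

lemma frac_equiv: "equiv (carrier R \<times> (carrier R - {\<zero>})) (frac_rel R)"
proof (rule equivI)
  show "frac_rel R \<subseteq> (carrier R \<times> (carrier R - {\<zero>})) \<times> (carrier R \<times> (carrier R - {\<zero>}))"
    by (auto simp: frac_rel_def)
  show "refl_on (carrier R \<times> (carrier R - {\<zero>})) (frac_rel R)"
    by (auto simp: refl_on_def frac_rel_def)
  show "sym (frac_rel R)" by (auto simp: sym_def frac_rel_def)
  show "trans (frac_rel R)"
  proof (rule transI)
    fix p q r assume "(p, q) \<in> frac_rel R" "(q, r) \<in> frac_rel R"
    then obtain a b c d e f where p: "p = (a, b)" "q = (c, d)" "r = (e, f)"
      and c: "a \<in> carrier R" "b \<in> carrier R - {\<zero>}" "c \<in> carrier R" "d \<in> carrier R - {\<zero>}"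
        "e \<in> carrier R" "f \<in> carrier R - {\<zero>}"
      and e1: "a \<otimes> d = c \<otimes> b" and e2: "c \<otimes> f = e \<otimes> d"
      by (auto simp: frac_rel_def)
    \<comment> \<open>Transitivity cancels the middle denominator \<open>d\<close>; here the absence
      of zero divisors enters.\<close>
    have "d \<otimes> (a \<otimes> f) = (a \<otimes> d) \<otimes> f" using c by (simp add: m_ac)
    also have "\<dots> = (c \<otimes> f) \<otimes> b" unfolding e1 using c by (simp add: m_ac)
    also have "\<dots> = d \<otimes> (e \<otimes> b)" unfolding e2 using c by (simp add: m_ac)
    finally have "a \<otimes> f = e \<otimes> b" using c m_lcancel[of d "a \<otimes> f" "e \<otimes> b"] by auto
    then show "(p, r) \<in> frac_rel R" using c p by (auto simp: frac_rel_def)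
  qed
qed

lemma mk_frac_eq:
  assumes "a \<in> carrier R" "b \<in> carrier R" "b \<noteq> \<zero>" "c \<in> carrier R" "d \<in> carrier R" "d \<noteq> \<zero>"
  shows "mk_frac R a b = mk_frac R c d \<longleftrightarrow> a \<otimes> d = c \<otimes> b"
proof -
  have "mk_frac R a b = mk_frac R c d \<longleftrightarrow> ((a, b), (c, d)) \<in> frac_rel R"
    unfolding mk_frac_def using assms by (intro eq_equiv_class_iff[OF frac_equiv]) auto
  also have "\<dots> \<longleftrightarrow> a \<otimes> d = c \<otimes> b" using assms by (auto simp: frac_rel_def)
  finally show ?thesis .
qed

lemma mk_frac_self: "a \<in> carrier R \<Longrightarrow> b \<in> carrier R \<Longrightarrow> b \<noteq> \<zero> \<Longrightarrow> (a, b) \<in> mk_frac R a b"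
  by (auto simp: mk_frac_def frac_rel_def)

lemma mk_frac_mem:
  assumes "(c, d) \<in> mk_frac R a b"
  shows "a \<in> carrier R" "b \<in> carrier R" "b \<noteq> \<zero>" "c \<in> carrier R" "d \<in> carrier R" "d \<noteq> \<zero>" "a \<otimes> d = c \<otimes> b"
proof -
  have "((a, b), (c, d)) \<in> frac_rel R" using assms by (simp add: mk_frac_def)
  then show "a \<in> carrier R" "b \<in> carrier R" "b \<noteq> \<zero>" "c \<in> carrier R" "d \<in> carrier R" "d \<noteq> \<zero>" "a \<otimes> d = c \<otimes> b"
    unfolding frac_rel_def by blast+
qed

lemma frac_carrier:
  "u \<in> carrier (quotient_field R) \<longleftrightarrow> (\<exists>a\<in>carrier R. \<exists>b\<in>carrier R - {\<zero>}. u = mk_frac R a b)"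
  by (auto simp: quotient_field_def quotient_def mk_frac_def)

lemma fracE:
  assumes "u \<in> carrier (quotient_field R)"
  obtains a b where "u = mk_frac R a b" "a \<in> carrier R" "b \<in> carrier R" "b \<noteq> \<zero>"
  using assms unfolding frac_carrier by blast

lemma frac_closed: "a \<in> carrier R \<Longrightarrow> b \<in> carrier R \<Longrightarrow> b \<noteq> \<zero> \<Longrightarrow> mk_frac R a b \<in> carrier (quotient_field R)"
  unfolding frac_carrier by blast

text \<open>The operations of \<open>quotient_field\<close> are unions over all representatives.
  Such a union is a single class once the class is shown to be independent of the
  representatives.\<close>

lemma UN_pair_const:
  assumes "p \<in> u" "q \<in> v" "\<And>a b c d. (a, b) \<in> u \<Longrightarrow> (c, d) \<in> v \<Longrightarrow> g a b c d = c0"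
  shows "(\<Union>(a, b)\<in>u. \<Union>(c, d)\<in>v. g a b c d) = c0"
  using assms by (cases p; cases q; fastforce)

lemma frac_mult:
  assumes "a \<in> carrier R" "b \<in> carrier R" "b \<noteq> \<zero>" "c \<in> carrier R" "d \<in> carrier R" "d \<noteq> \<zero>"
  shows "mk_frac R a b \<otimes>\<^bsub>quotient_field R\<^esub> mk_frac R c d = mk_frac R (a \<otimes> c) (b \<otimes> d)"
proof -
  have "(\<Union>(a', b')\<in>mk_frac R a b. \<Union>(c', d')\<in>mk_frac R c d. mk_frac R (a' \<otimes> c') (b' \<otimes> d')) = mk_frac R (a \<otimes> c) (b \<otimes> d)"
  proof (rule UN_pair_const)
    fix a' b' c' d' assume "(a', b') \<in> mk_frac R a b" "(c', d') \<in> mk_frac R c d"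
    note m = mk_frac_mem[OF this(1)] mk_frac_mem[OF this(2)]
    have "(a' \<otimes> c') \<otimes> (b \<otimes> d) = (a' \<otimes> b) \<otimes> (c' \<otimes> d)" using m by (simp add: m_ac)
    also have "\<dots> = (a \<otimes> c) \<otimes> (b' \<otimes> d')" unfolding m(7)[symmetric] m(14)[symmetric] using m(1-6,8-13) by (simp add: m_ac)
    finally show "mk_frac R (a' \<otimes> c') (b' \<otimes> d') = mk_frac R (a \<otimes> c) (b \<otimes> d)"
      using m(1-6,8-13) integral by (subst mk_frac_eq) blast+
  qed (use assms mk_frac_self in blast)+
  then show ?thesis by (simp add: quotient_field_def)
qed

lemma frac_add:
  assumes "a \<in> carrier R" "b \<in> carrier R" "b \<noteq> \<zero>" "c \<in> carrier R" "d \<in> carrier R" "d \<noteq> \<zero>"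
  shows "mk_frac R a b \<oplus>\<^bsub>quotient_field R\<^esub> mk_frac R c d = mk_frac R (a \<otimes> d \<oplus> c \<otimes> b) (b \<otimes> d)"
proof -
  have "(\<Union>(a', b')\<in>mk_frac R a b. \<Union>(c', d')\<in>mk_frac R c d. mk_frac R (a' \<otimes> d' \<oplus> c' \<otimes> b') (b' \<otimes> d')) =
    mk_frac R (a \<otimes> d \<oplus> c \<otimes> b) (b \<otimes> d)"
  proof (rule UN_pair_const)
    fix a' b' c' d' assume "(a', b') \<in> mk_frac R a b" "(c', d') \<in> mk_frac R c d"
    note m = mk_frac_mem[OF this(1)] mk_frac_mem[OF this(2)]
    have "(a' \<otimes> d' \<oplus> c' \<otimes> b') \<otimes> (b \<otimes> d) = (a' \<otimes> b) \<otimes> (d \<otimes> d') \<oplus> (c' \<otimes> d) \<otimes> (b \<otimes> b')"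
      using m(1-6,8-13) by algebra
    also have "\<dots> = (a \<otimes> d \<oplus> c \<otimes> b) \<otimes> (b' \<otimes> d')"
      unfolding m(7)[symmetric] m(14)[symmetric] using m(1-6,8-13) by algebra
    finally show "mk_frac R (a' \<otimes> d' \<oplus> c' \<otimes> b') (b' \<otimes> d') = mk_frac R (a \<otimes> d \<oplus> c \<otimes> b) (b \<otimes> d)"
      using m(1-6,8-13) integral by (subst mk_frac_eq) blast+
  qed (use assms mk_frac_self in blast)+
  then show ?thesis by (simp add: quotient_field_def)
qed

lemma frac_one_zero: "\<one>\<^bsub>quotient_field R\<^esub> = mk_frac R \<one> \<one>" "\<zero>\<^bsub>quotient_field R\<^esub> = mk_frac R \<zero> \<one>"
  by (simp_all add: quotient_field_def)

lemma quotient_field_field: "field (quotient_field R)"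
proof -
  let ?K = "quotient_field R"
  have nz: "\<And>b d. b \<in> carrier R \<Longrightarrow> b \<noteq> \<zero> \<Longrightarrow> d \<in> carrier R \<Longrightarrow> d \<noteq> \<zero> \<Longrightarrow> b \<otimes> d \<noteq> \<zero>"
    using integral by blast
  have cr: "cring ?K"
  proof (rule cringI)
    show "abelian_group ?K"
    proof (rule abelian_groupI)
      fix u v w assume uC: "u \<in> carrier ?K" "v \<in> carrier ?K" "w \<in> carrier ?K"
      obtain a b where u1: "u = mk_frac R a b" "a \<in> carrier R" "b \<in> carrier R" "b \<noteq> \<zero>" by (rule fracE[OF uC(1)])
      obtain c d where u2: "v = mk_frac R c d" "c \<in> carrier R" "d \<in> carrier R" "d \<noteq> \<zero>" by (rule fracE[OF uC(2)])
      obtain e f where u3: "w = mk_frac R e f" "e \<in> carrier R" "f \<in> carrier R" "f \<noteq> \<zero>" by (rule fracE[OF uC(3)])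
      note u = u1(1) u2(1) u3(1) and m = u1(2-4) u2(2-4) u3(2-4)
      show "u \<oplus>\<^bsub>?K\<^esub> v \<in> carrier ?K" unfolding u using m nz by (subst frac_add) (auto intro: frac_closed)
      have "u \<oplus>\<^bsub>?K\<^esub> v \<oplus>\<^bsub>?K\<^esub> w = mk_frac R ((a \<otimes> d \<oplus> c \<otimes> b) \<otimes> f \<oplus> e \<otimes> (b \<otimes> d)) (b \<otimes> d \<otimes> f)"
        unfolding u using m nz by (simp add: frac_add)
      moreover have "u \<oplus>\<^bsub>?K\<^esub> (v \<oplus>\<^bsub>?K\<^esub> w) = mk_frac R (a \<otimes> (d \<otimes> f) \<oplus> (c \<otimes> f \<oplus> e \<otimes> d) \<otimes> b) (b \<otimes> (d \<otimes> f))"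
        unfolding u using m nz by (simp add: frac_add)
      moreover have "(a \<otimes> d \<oplus> c \<otimes> b) \<otimes> f \<oplus> e \<otimes> (b \<otimes> d) = a \<otimes> (d \<otimes> f) \<oplus> (c \<otimes> f \<oplus> e \<otimes> d) \<otimes> b"
        using m by algebra
      ultimately show "u \<oplus>\<^bsub>?K\<^esub> v \<oplus>\<^bsub>?K\<^esub> w = u \<oplus>\<^bsub>?K\<^esub> (v \<oplus>\<^bsub>?K\<^esub> w)" using m by (simp add: m_assoc)
      show "u \<oplus>\<^bsub>?K\<^esub> v = v \<oplus>\<^bsub>?K\<^esub> u"
        unfolding u using m by (simp add: frac_add a_comm m_comm)
      show "\<zero>\<^bsub>?K\<^esub> \<oplus>\<^bsub>?K\<^esub> u = u" unfolding u frac_one_zero using m by (simp add: frac_add)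
      show "\<exists>y\<in>carrier ?K. y \<oplus>\<^bsub>?K\<^esub> u = \<zero>\<^bsub>?K\<^esub>"
      proof (intro bexI[of _ "mk_frac R (\<ominus> a) b"])
        have "mk_frac R (\<ominus> a) b \<oplus>\<^bsub>?K\<^esub> u = mk_frac R (\<ominus> a \<otimes> b \<oplus> a \<otimes> b) (b \<otimes> b)"
          unfolding u using m by (simp add: frac_add)
        also have "\<ominus> a \<otimes> b \<oplus> a \<otimes> b = \<zero>" using m by (simp add: l_minus l_neg)
        also have "mk_frac R \<zero> (b \<otimes> b) = \<zero>\<^bsub>?K\<^esub>"
          unfolding frac_one_zero using m nz by (subst mk_frac_eq) auto
        finally show "mk_frac R (\<ominus> a) b \<oplus>\<^bsub>?K\<^esub> u = \<zero>\<^bsub>?K\<^esub>" .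
      qed (use m in \<open>auto intro: frac_closed\<close>)
    qed (auto simp: frac_one_zero intro: frac_closed)
    show "comm_monoid ?K"
    proof (rule comm_monoidI)
      fix u v w assume uC: "u \<in> carrier ?K" "v \<in> carrier ?K" "w \<in> carrier ?K"
      obtain a b where u1: "u = mk_frac R a b" "a \<in> carrier R" "b \<in> carrier R" "b \<noteq> \<zero>" by (rule fracE[OF uC(1)])
      obtain c d where u2: "v = mk_frac R c d" "c \<in> carrier R" "d \<in> carrier R" "d \<noteq> \<zero>" by (rule fracE[OF uC(2)])
      obtain e f where u3: "w = mk_frac R e f" "e \<in> carrier R" "f \<in> carrier R" "f \<noteq> \<zero>" by (rule fracE[OF uC(3)])
      note u = u1(1) u2(1) u3(1) and m = u1(2-4) u2(2-4) u3(2-4)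
      show "u \<otimes>\<^bsub>?K\<^esub> v \<in> carrier ?K" unfolding u using m nz by (subst frac_mult) (auto intro: frac_closed)
      show "u \<otimes>\<^bsub>?K\<^esub> v \<otimes>\<^bsub>?K\<^esub> w = u \<otimes>\<^bsub>?K\<^esub> (v \<otimes>\<^bsub>?K\<^esub> w)"
        unfolding u using m nz by (simp add: frac_mult m_assoc)
      show "u \<otimes>\<^bsub>?K\<^esub> v = v \<otimes>\<^bsub>?K\<^esub> u" unfolding u using m by (simp add: frac_mult m_comm)
      show "\<one>\<^bsub>?K\<^esub> \<otimes>\<^bsub>?K\<^esub> u = u" unfolding u frac_one_zero using m by (simp add: frac_mult)
    qed (auto simp: frac_one_zero intro: frac_closed)
    fix u v w assume uC: "u \<in> carrier ?K" "v \<in> carrier ?K" "w \<in> carrier ?K"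
    obtain a b where u1: "u = mk_frac R a b" "a \<in> carrier R" "b \<in> carrier R" "b \<noteq> \<zero>" by (rule fracE[OF uC(1)])
    obtain c d where u2: "v = mk_frac R c d" "c \<in> carrier R" "d \<in> carrier R" "d \<noteq> \<zero>" by (rule fracE[OF uC(2)])
    obtain e f where u3: "w = mk_frac R e f" "e \<in> carrier R" "f \<in> carrier R" "f \<noteq> \<zero>" by (rule fracE[OF uC(3)])
    note u = u1(1) u2(1) u3(1) and m = u1(2-4) u2(2-4) u3(2-4)
    have "(u \<oplus>\<^bsub>?K\<^esub> v) \<otimes>\<^bsub>?K\<^esub> w = mk_frac R ((a \<otimes> d \<oplus> c \<otimes> b) \<otimes> e) (b \<otimes> d \<otimes> f)"
      unfolding u using m nz by (simp add: frac_add frac_mult)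
    moreover have "u \<otimes>\<^bsub>?K\<^esub> w \<oplus>\<^bsub>?K\<^esub> v \<otimes>\<^bsub>?K\<^esub> w = mk_frac R (a \<otimes> e \<otimes> (d \<otimes> f) \<oplus> c \<otimes> e \<otimes> (b \<otimes> f)) (b \<otimes> f \<otimes> (d \<otimes> f))"
      unfolding u using m nz by (simp add: frac_add frac_mult)
    moreover have "mk_frac R ((a \<otimes> d \<oplus> c \<otimes> b) \<otimes> e) (b \<otimes> d \<otimes> f) =
      mk_frac R (a \<otimes> e \<otimes> (d \<otimes> f) \<oplus> c \<otimes> e \<otimes> (b \<otimes> f)) (b \<otimes> f \<otimes> (d \<otimes> f))"
    proof -
      have "b \<otimes> d \<otimes> f \<noteq> \<zero>" "b \<otimes> f \<otimes> (d \<otimes> f) \<noteq> \<zero>" using m nz by auto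
      moreover have "((a \<otimes> d \<oplus> c \<otimes> b) \<otimes> e) \<otimes> (b \<otimes> f \<otimes> (d \<otimes> f)) =
        (a \<otimes> e \<otimes> (d \<otimes> f) \<oplus> c \<otimes> e \<otimes> (b \<otimes> f)) \<otimes> (b \<otimes> d \<otimes> f)"
        using m(1,2,4,5,7,8) by algebra
      ultimately show ?thesis using m by (subst mk_frac_eq) auto
    qed
    ultimately show "(u \<oplus>\<^bsub>?K\<^esub> v) \<otimes>\<^bsub>?K\<^esub> w = u \<otimes>\<^bsub>?K\<^esub> w \<oplus>\<^bsub>?K\<^esub> v \<otimes>\<^bsub>?K\<^esub> w" by simp
  qed
  show ?thesis
  proof (rule cring.cring_fieldI2[OF cr])
    show "\<zero>\<^bsub>?K\<^esub> \<noteq> \<one>\<^bsub>?K\<^esub>" unfolding frac_one_zero by (subst mk_frac_eq) auto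
    fix u assume u: "u \<in> carrier ?K" "u \<noteq> \<zero>\<^bsub>?K\<^esub>"
    then obtain a b where ab: "u = mk_frac R a b" "a \<in> carrier R" "b \<in> carrier R" "b \<noteq> \<zero>"
      unfolding frac_carrier by auto
    have a: "a \<noteq> \<zero>"
    proof
      assume "a = \<zero>"
      then have "u = \<zero>\<^bsub>?K\<^esub>" unfolding ab(1) frac_one_zero using ab by (subst mk_frac_eq) auto
      then show False using u by simp
    qed
    have "u \<otimes>\<^bsub>?K\<^esub> mk_frac R b a = mk_frac R (a \<otimes> b) (b \<otimes> a)" unfolding ab(1) using ab a by (simp add: frac_mult)
    also have "\<dots> = \<one>\<^bsub>?K\<^esub>" unfolding frac_one_zero using ab a nz by (subst mk_frac_eq) (auto simp: m_comm)
    finally show "\<exists>v\<in>carrier ?K. u \<otimes>\<^bsub>?K\<^esub> v = \<one>\<^bsub>?K\<^esub>" using ab a frac_closed by blast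
  qed
qed

lemma frac_hom: "(\<lambda>a. mk_frac R a \<one>) \<in> Ring.ring_hom R (quotient_field R)"
  by (rule ring_hom_memI) (auto simp: frac_mult frac_add frac_one_zero intro: frac_closed)

lemma frac_embed_zero: "a \<in> carrier R \<Longrightarrow> mk_frac R a \<one> = \<zero>\<^bsub>quotient_field R\<^esub> \<longleftrightarrow> a = \<zero>"
  unfolding frac_one_zero by (subst mk_frac_eq) auto

lemma frac_denominator:
  assumes "u \<in> carrier (quotient_field R)"
  shows "\<exists>a\<in>carrier R. \<exists>b\<in>carrier R - {\<zero>}. u \<otimes>\<^bsub>quotient_field R\<^esub> mk_frac R b \<one> = mk_frac R a \<one>"
proof -
  obtain a b where ab: "u = mk_frac R a b" "a \<in> carrier R" "b \<in> carrier R" "b \<noteq> \<zero>"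
    using assms unfolding frac_carrier by auto
  have "u \<otimes>\<^bsub>quotient_field R\<^esub> mk_frac R b \<one> = mk_frac R (a \<otimes> b) b" unfolding ab(1) using ab by (simp add: frac_mult)
  also have "\<dots> = mk_frac R a \<one>" using ab by (subst mk_frac_eq) auto
  finally show ?thesis using ab by blast
qed

end

section \<open>The coordinate ring of an anisotropic form\<close>

context cring
begin

text \<open>\<open>Q\<close> is the quadratic polynomial v x^2 + 2bx + r in x, and \<open>u\<close>
  inverts its leading coefficient. The first identity is used to divide by \<open>Q\<close>; the
  second serves to conclude that \<open>Q\<close> vanishes at a point whose first coordinate
  satisfies the monic equation.\<close>

lemma conic_reduce:
  assumes c: "x \<in> carrier R" "b \<in> carrier R" "r \<in> carrier R" "u \<in> carrier R" "v \<in> carrier R"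
    and uv: "u \<otimes> v = \<one>" and Q: "Q = v \<otimes> (x \<otimes> x) \<oplus> (r \<oplus> (x \<otimes> b \<oplus> x \<otimes> b))"
  defines "\<sigma> \<equiv> \<ominus> (u \<otimes> (b \<oplus> b))" and "\<beta> \<equiv> \<ominus> (u \<otimes> r)"
  shows "x \<otimes> x = \<sigma> \<otimes> x \<oplus> \<beta> \<oplus> u \<otimes> Q" "Q \<oplus> v \<otimes> (\<sigma> \<otimes> x \<oplus> \<beta>) = v \<otimes> (x \<otimes> x)"
proof -
  have "u \<otimes> Q = (u \<otimes> v) \<otimes> (x \<otimes> x) \<oplus> (u \<otimes> r \<oplus> u \<otimes> (b \<oplus> b) \<otimes> x)"
    unfolding Q using c by algebra
  then have e: "u \<otimes> Q = x \<otimes> x \<oplus> (u \<otimes> r \<oplus> u \<otimes> (b \<oplus> b) \<otimes> x)" unfolding uv using c by simp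
  show "x \<otimes> x = \<sigma> \<otimes> x \<oplus> \<beta> \<oplus> u \<otimes> Q" unfolding e \<sigma>_def \<beta>_def using c by algebra
  have "v \<otimes> (\<sigma> \<otimes> x \<oplus> \<beta>) = \<ominus> ((u \<otimes> v) \<otimes> ((b \<oplus> b) \<otimes> x \<oplus> r))"
    unfolding \<sigma>_def \<beta>_def using c by algebra
  then have "v \<otimes> (\<sigma> \<otimes> x \<oplus> \<beta>) = \<ominus> ((b \<oplus> b) \<otimes> x \<oplus> r)" unfolding uv using c by simp
  then show "Q \<oplus> v \<otimes> (\<sigma> \<otimes> x \<oplus> \<beta>) = v \<otimes> (x \<otimes> x)" unfolding Q using c by algebra
qed

lemma conic_mult_var:
  assumes c: "x \<in> carrier R" "a \<in> carrier R" "b \<in> carrier R" "k \<in> carrier R" "Q \<in> carrier R"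
      "\<sigma> \<in> carrier R" "\<beta> \<in> carrier R" "u \<in> carrier R"
    and x: "x \<otimes> x = \<sigma> \<otimes> x \<oplus> \<beta> \<oplus> u \<otimes> Q"
  shows "(a \<oplus> x \<otimes> b \<oplus> k \<otimes> Q) \<otimes> x = b \<otimes> \<beta> \<oplus> x \<otimes> (a \<oplus> b \<otimes> \<sigma>) \<oplus> (k \<otimes> x \<oplus> b \<otimes> u) \<otimes> Q"
proof -
  have "(a \<oplus> x \<otimes> b \<oplus> k \<otimes> Q) \<otimes> x = a \<otimes> x \<oplus> b \<otimes> (x \<otimes> x) \<oplus> k \<otimes> Q \<otimes> x" using c by algebra
  also have "\<dots> = b \<otimes> \<beta> \<oplus> x \<otimes> (a \<oplus> b \<otimes> \<sigma>) \<oplus> (k \<otimes> x \<oplus> b \<otimes> u) \<otimes> Q" unfolding x using c by algebra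
  finally show ?thesis .
qed

lemma conic_mult_const:
  assumes "x \<in> carrier R" "a \<in> carrier R" "b \<in> carrier R" "k \<in> carrier R" "Q \<in> carrier R" "y \<in> carrier R"
  shows "(a \<oplus> x \<otimes> b \<oplus> k \<otimes> Q) \<otimes> y = a \<otimes> y \<oplus> x \<otimes> (b \<otimes> y) \<oplus> (k \<otimes> y) \<otimes> Q"
  using assms by algebra

lemma conic_add:
  assumes "x \<in> carrier R" "a \<in> carrier R" "b \<in> carrier R" "k \<in> carrier R" "Q \<in> carrier R"
    "a' \<in> carrier R" "b' \<in> carrier R" "k' \<in> carrier R"
  shows "(a \<oplus> x \<otimes> b \<oplus> k \<otimes> Q) \<oplus> (a' \<oplus> x \<otimes> b' \<oplus> k' \<otimes> Q) =
    (a \<oplus> a') \<oplus> x \<otimes> (b \<oplus> b') \<oplus> (k \<oplus> k') \<otimes> Q"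
  using assms by algebra

end

lemma ring_hom_cring_comp:
  assumes "ring_hom_cring R S h" "ring_hom_cring S U g"
  shows "ring_hom_cring R U (\<lambda>a. g (h a))"
proof -
  interpret h: ring_hom_cring R S h by fact
  interpret g: ring_hom_cring S U g by fact
  show ?thesis
    by (rule ring_hom_cring.intro[OF h.R.is_cring g.S.is_cring], rule ring_hom_cring_axioms.intro, rule ring_hom_memI) simp_all
qed

context
  fixes R (structure) and S (structure) and h
  assumes hom: "ring_hom_cring R S h"
begin

interpretation ring_hom_cring R S h by (rule hom)

lemma rhc_closed: "x \<in> carrier R \<Longrightarrow> h x \<in> carrier S"
  and rhc_one: "h \<one> = \<one>\<^bsub>S\<^esub>"
  and rhc_zero: "h \<zero> = \<zero>\<^bsub>S\<^esub>"
  and rhc_mult: "x \<in> carrier R \<Longrightarrow> y \<in> carrier R \<Longrightarrow> h (x \<otimes> y) = h x \<otimes>\<^bsub>S\<^esub> h y"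
  and rhc_add: "x \<in> carrier R \<Longrightarrow> y \<in> carrier R \<Longrightarrow> h (x \<oplus> y) = h x \<oplus>\<^bsub>S\<^esub> h y"
  and rhc_a_inv: "x \<in> carrier R \<Longrightarrow> h (\<ominus> x) = \<ominus>\<^bsub>S\<^esub> h x"
  by simp_all

end

context ring_hom_cring
begin

lemma pev_ring_hom: "range x \<subseteq> carrier S \<Longrightarrow> ring_hom_cring (mpoly_ring R I) S (pev R S h x)"
  by (intro ring_hom_cring.intro ring_hom_cring_axioms.intro R.mpoly_cring S.is_cring pev_hom)

lemma const_ring_hom: "ring_hom_cring R (mpoly_ring R I) R.indexed_const"
  by (intro ring_hom_cring.intro ring_hom_cring_axioms.intro R.mpoly_cring R.is_cring R.const_hom)

lemma pev_form_poly:
  assumes A: "A \<in> mats R (qdim A) (qdim A)" and x: "range x \<subseteq> carrier S"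
  shows "pev R S h x (form_poly R A) = qeval S (map_mat h A) (vec (qdim A) x)"
proof -
  let ?n = "qdim A" let ?MP = "mpoly_ring R {..<?n}"
  have C: "map_mat R.indexed_const A \<in> mats ?MP ?n ?n"
    by (rule ring_hom_cring.map_mat_mats[OF const_ring_hom A])
  have V: "vec ?n R.indexed_var \<in> vecs ?MP ?n"
    by (rule vecs_vecI) (simp add: R.mpoly_simps R.var_pset)
  have e: "pev R S h x (qeval ?MP (map_mat R.indexed_const A) (vec ?n R.indexed_var)) =
    qeval S (map_mat (pev R S h x) (map_mat R.indexed_const A)) (map_vec (pev R S h x) (vec ?n R.indexed_var))"
    by (rule ring_hom_cring.hom_qeval[OF pev_ring_hom[OF x] C V])
  have m: "map_mat (pev R S h x) (map_mat R.indexed_const A) = map_mat h A"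
  proof (rule eq_matI)
    fix i j assume "i < dim_row (map_mat h A)" "j < dim_col (map_mat h A)"
    then have ij: "i < ?n" "j < dim_col A" by simp_all
    then have "A $$ (i, j) \<in> carrier R" using mats_index[OF A, of i j] mats_dim(2)[OF A] by simp
    then show "map_mat (pev R S h x) (map_mat R.indexed_const A) $$ (i, j) = map_mat h A $$ (i, j)"
      using ij pev_const[OF _ x] by simp
  qed simp_all
  have v: "map_vec (pev R S h x) (vec ?n R.indexed_var) = vec ?n x"
    by (rule eq_vecI) (simp_all add: pev_var[OF x])
  show ?thesis unfolding form_poly_def e m v ..
qed

lemma pev_comp:
  assumes g: "ring_hom_cring S U g" and x: "range x \<subseteq> carrier S" and f: "f \<in> R.indexed_pset I (carrier R)"
  shows "pev R U (\<lambda>a. g (h a)) (\<lambda>i. g (x i)) f = g (pev R S h x f)"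
proof -
  note gh = ring_hom_cring_comp[OF ring_hom_cring_axioms g]
  have gx: "range (\<lambda>i. g (x i)) \<subseteq> carrier U"
    by (rule image_subsetI, rule rhc_closed[OF g], rule subsetD[OF x rangeI])
  show ?thesis using f
  proof (induction rule: R.indexed_pset.induct)
  case (indexed_const k)
  show ?case using ring_hom_cring.pev_const[OF gh indexed_const gx] pev_const[OF indexed_const x] by simp
next
  case (indexed_padd P Q)
  show ?case
    unfolding ring_hom_cring.pev_padd[OF gh indexed_padd(1,2) gx] pev_padd[OF indexed_padd(1,2) x] indexed_padd(3,4)
    by (rule rhc_add[OF g pev_closed[OF indexed_padd(1) x] pev_closed[OF indexed_padd(2) x], symmetric])
next
  case (indexed_pmult P i)
  have xi: "x i \<in> carrier S" using x by blast
  show ?case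
    unfolding ring_hom_cring.pev_pmult[OF gh indexed_pmult(1) gx indexed_pmult(2)] pev_pmult[OF indexed_pmult(1) x indexed_pmult(2)] indexed_pmult(3)
    by (rule rhc_mult[OF g pev_closed[OF indexed_pmult(1) x] xi, symmetric])
  qed
qed

end

lemma (in inf_field_hom) hom_inj:
  assumes "a \<in> carrier R" "b \<in> carrier R" "h a = h b" shows "a = b"
proof -
  have "h (a \<ominus> b) = \<zero>\<^bsub>S\<^esub>" using assms by (simp add: a_minus_def S.r_neg)
  then show ?thesis using hom_zero_iff[of "a \<ominus> b"] assms by simp
qed

lemma (in inf_field) inf_field_id: "inf_field_hom R R (\<lambda>x. x)"
  by (rule inf_field_homI[OF inf_field_axioms field_axioms], rule ring_hom_memI) simp_all

lemma (in inf_field) mpoly_sub_hom: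
  assumes "I \<subseteq> K"
  shows "ring_hom_cring (mpoly_ring R I) (mpoly_ring R K) (\<lambda>f. f)"
proof (rule ring_hom_cring.intro[OF mpoly_cring mpoly_cring], rule ring_hom_cring_axioms.intro, rule ring_hom_memI)
  fix f assume "f \<in> carrier (mpoly_ring R I)"
  then show "f \<in> carrier (mpoly_ring R K)" unfolding mpoly_simps by (rule pset_mono[OF _ assms])
qed (simp_all add: mpoly_simps)

text \<open>The point over the affine point \<open>y\<close> with first coordinate \<open>T\<close>.
  The value \<open>y 0\<close> is ignored.\<close>

definition pt :: "('r \<Rightarrow> 's) \<Rightarrow> 's \<Rightarrow> (nat \<Rightarrow> 'r) \<Rightarrow> nat \<Rightarrow> 's" where
  "pt h T y i = (if i = 0 then T else h (y i))"

locale aform = inf_field R for R (structure) +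
  fixes A
  assumes sym: "sym_mat R A" and an: "anisotropic R A" and dim: "2 \<le> qdim A"
begin

abbreviation "n \<equiv> qdim A"
abbreviation "MP \<equiv> mpoly_ring R {..<qdim A}"
abbreviation "PY \<equiv> indexed_pset {1..<qdim A} (carrier R)"
abbreviation "Q \<equiv> form_poly R A"
abbreviation "X0 \<equiv> indexed_var 0 :: nat multiset \<Rightarrow> 'a"
abbreviation "J \<equiv> Idl\<^bsub>MP\<^esub> {Q}"
abbreviation "cst \<equiv> indexed_const :: 'a \<Rightarrow> nat multiset \<Rightarrow> 'a"

lemma mats: "A \<in> mats R n n"
  by (rule sym_mat_mats[OF sym])

lemma PY_MP: "f \<in> PY \<Longrightarrow> f \<in> carrier MP"
  unfolding mpoly_simps by (erule pset_mono) auto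

lemma cst_hom: "ring_hom_cring R MP cst"
  by (intro ring_hom_cring.intro ring_hom_cring_axioms.intro mpoly_cring is_cring const_hom)

lemma var_MP: "i < n \<Longrightarrow> indexed_var i \<in> carrier MP"
  unfolding mpoly_simps by (rule var_pset) simp

lemma X0_MP: "X0 \<in> carrier MP"
  using var_MP[of 0] dim by simp

lemma CA: "map_mat cst A \<in> mats MP n n" "sym_mat MP (map_mat cst A)"
  by (rule ring_hom_cring.map_mat_mats[OF cst_hom mats], rule ring_hom_cring.hom_sym_mat[OF cst_hom sym])

lemma var_vec: "vec n indexed_var \<in> vecs MP n"
  by (rule vecs_vecI) (rule var_MP)

lemma Q_MP: "Q \<in> carrier MP"
  unfolding form_poly_def by (rule cring.qeval_closed[OF mpoly_cring CA(1) var_vec])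

lemma qeval_e0: "qeval R A (uvec R n 0) = A $$ (0, 0)"
proof -
  have u: "uvec R n 0 $ i = (if i = 0 then \<one> else \<zero>)" if "i < n" for i using that by simp
  have s: "(\<Oplus>k\<in>{..<n}. uvec R n 0 $ k \<otimes> A $$ (j, k)) = A $$ (j, 0)" if j: "j < n" for j
  proof -
    have "(\<Oplus>k\<in>{..<n}. uvec R n 0 $ k \<otimes> A $$ (j, k)) = (\<Oplus>k\<in>{..<n}. if k = 0 then A $$ (j, k) else \<zero>)"
      by (rule finsum_cong') (use mats_index[OF mats j] in \<open>auto simp: Pi_def\<close>)
    also have "\<dots> = A $$ (j, 0)" using finsum_delta[of "{..<n}" "\<lambda>k. A $$ (j, k)" 0] mats_index[OF mats j] dim by auto
    finally show ?thesis .
  qed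
  have "bform R A (uvec R n 0) (uvec R n 0) = (\<Oplus>j\<in>{..<n}. uvec R n 0 $ j \<otimes> A $$ (j, 0))"
    unfolding bform_sum[OF mats uvec_vecs uvec_vecs]
    by (rule finsum_cong') (use s mats_index[OF mats] dim in \<open>auto simp: Pi_def\<close>)
  also have "\<dots> = (\<Oplus>j\<in>{..<n}. if j = 0 then A $$ (j, 0) else \<zero>)"
    by (rule finsum_cong') (use mats_index[OF mats _, of _ 0] dim in \<open>auto simp: Pi_def\<close>)
  also have "\<dots> = A $$ (0, 0)" using finsum_delta[of "{..<n}" "\<lambda>k. A $$ (k, 0)" 0] mats_index[OF mats _, of _ 0] dim by auto
  finally show ?thesis unfolding qeval_def .
qed

lemma A00: "A $$ (0, 0) \<in> carrier R - {\<zero>}"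
proof -
  have c: "A $$ (0, 0) \<in> carrier R" using mats_index[OF mats, of 0 0] dim by simp
  have "uvec R n 0 $ 0 \<noteq> zvec R n $ 0" using dim by simp
  then have "uvec R n 0 \<noteq> zvec R n" by metis
  then have "qeval R A (uvec R n 0) \<noteq> \<zero>" using an uvec_vecs unfolding anisotropic_def by blast
  then show ?thesis using c qeval_e0 by simp
qed

lemma inv_A00: "inv (A $$ (0, 0)) \<in> carrier R" "inv (A $$ (0, 0)) \<otimes> A $$ (0, 0) = \<one>"
  using A00 by (auto simp: field_Units)

text \<open>Modulo \<open>Q\<close>, the variable \<open>X0\<close> satisfies a monic quadratic
  equation with coefficients in the other variables (\<open>PY\<close>). The two equations are the
  two conclusions of \<open>conic_reduce\<close>.\<close>

definition reduces :: "(nat multiset \<Rightarrow> 'a) \<Rightarrow> (nat multiset \<Rightarrow> 'a) \<Rightarrow> bool" where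
  "reduces \<sigma> \<beta> \<longleftrightarrow> \<sigma> \<in> PY \<and> \<beta> \<in> PY \<and>
     X0 \<otimes>\<^bsub>MP\<^esub> X0 = \<sigma> \<otimes>\<^bsub>MP\<^esub> X0 \<oplus>\<^bsub>MP\<^esub> \<beta> \<oplus>\<^bsub>MP\<^esub> cst (inv (A $$ (0, 0))) \<otimes>\<^bsub>MP\<^esub> Q \<and>
     Q \<oplus>\<^bsub>MP\<^esub> cst (A $$ (0, 0)) \<otimes>\<^bsub>MP\<^esub> (\<sigma> \<otimes>\<^bsub>MP\<^esub> X0 \<oplus>\<^bsub>MP\<^esub> \<beta>) = cst (A $$ (0, 0)) \<otimes>\<^bsub>MP\<^esub> (X0 \<otimes>\<^bsub>MP\<^esub> X0)"

text \<open>Split the generic vector as X0 e + w, where e is the first unit vector and w does not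
  involve X0. Then Q = a X0^2 + 2 X0 b(e, w) + q(w), where the leading coefficient a = q(e) is
  invertible by anisotropy.\<close>

lemma ex_reduces: "\<exists>\<sigma> \<beta>. reduces \<sigma> \<beta>"
proof -
  let ?P1 = "mpoly_ring R {1..<n}"
  interpret M: cring MP by (rule mpoly_cring)
  interpret M1: cring ?P1 by (rule mpoly_cring)
  have sub: "ring_hom_cring ?P1 MP (\<lambda>f. f)" by (rule mpoly_sub_hom) auto
  have c1: "ring_hom_cring R ?P1 cst"
    by (intro ring_hom_cring.intro ring_hom_cring_axioms.intro mpoly_cring is_cring const_hom)
  let ?C = "map_mat cst A"
  let ?e = "uvec MP n 0"
  define w where "w = vec n (\<lambda>i. if i = 0 then indexed_const \<zero> else indexed_var i :: nat multiset \<Rightarrow> 'a)"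
  have w1: "w \<in> vecs ?P1 n" unfolding w_def
    by (rule vecs_vecI) (auto simp: mpoly_simps pset_zero intro: var_pset)
  have w: "w \<in> vecs MP n" using w1 PY_MP unfolding vecs_def mpoly_simps by auto
  have C1: "?C \<in> mats ?P1 n n" by (rule ring_hom_cring.map_mat_mats[OF c1 mats])
  have e1: "uvec ?P1 n 0 = ?e" unfolding uvec_def mpoly_simps ..
  have id: "map_mat (\<lambda>f. f) ?C = ?C" "map_vec (\<lambda>f. f) w = w" "map_vec (\<lambda>f. f) ?e = ?e"
    by (auto intro!: eq_matI eq_vecI)
  \<comment> \<open>The coefficients are computed in the polynomial ring without \<open>X0\<close>
    and carried along the inclusion, which shows that they do not involve \<open>X0\<close>.\<close>
  have r: "qeval MP ?C w \<in> PY"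
    using ring_hom_cring.hom_qeval[OF sub C1 w1] M1.qeval_closed[OF C1 w1] unfolding id mpoly_simps by simp
  have b: "bform MP ?C ?e w \<in> PY"
    using ring_hom_cring.hom_bform[OF sub C1 M1.uvec_vecs w1, of 0] M1.bform_closed[OF C1 M1.uvec_vecs w1, of 0]
    unfolding e1 id mpoly_simps by simp
  have V: "vec n indexed_var = vadd MP (vscale MP X0 ?e) w"
  proof (rule eq_vecI)
    fix i assume "i < dim_vec (vadd MP (vscale MP X0 ?e) w)"
    then have i: "i < n" by simp
    then have v: "vadd MP (vscale MP X0 ?e) w $ i = X0 \<otimes>\<^bsub>MP\<^esub> (if i = 0 then \<one>\<^bsub>MP\<^esub> else \<zero>\<^bsub>MP\<^esub>) \<oplus>\<^bsub>MP\<^esub> w $ i" by simp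
    have wi: "w $ i = (if i = 0 then \<zero>\<^bsub>MP\<^esub> else indexed_var i)" using i by (simp add: w_def mpoly_simps)
    show "vec n indexed_var $ i = vadd MP (vscale MP X0 ?e) w $ i"
      unfolding v wi using i X0_MP var_MP[OF i] by simp
  qed simp
  have q: "dim_row ?C = n" by simp
  have e: "vscale MP X0 ?e \<in> vecs MP n" by (rule M.vscale_vecs[OF X0_MP M.uvec_vecs])
  have qe: "qeval MP ?C ?e = cst (A $$ (0, 0))"
  proof -
    have "cst (qeval R A (uvec R n 0)) = qeval MP ?C (map_vec cst (uvec R n 0))"
      by (rule ring_hom_cring.hom_qeval[OF cst_hom mats uvec_vecs])
    moreover have "map_vec cst (uvec R n 0) = ?e"
      by (rule eq_vecI) (simp_all add: mpoly_simps)
    moreover have "qeval R A (uvec R n 0) = A $$ (0, 0)" by (rule qeval_e0)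
    ultimately show ?thesis by simp
  qed
  have Q: "Q = cst (A $$ (0, 0)) \<otimes>\<^bsub>MP\<^esub> (X0 \<otimes>\<^bsub>MP\<^esub> X0) \<oplus>\<^bsub>MP\<^esub>
    (qeval MP ?C w \<oplus>\<^bsub>MP\<^esub> (X0 \<otimes>\<^bsub>MP\<^esub> bform MP ?C ?e w \<oplus>\<^bsub>MP\<^esub> X0 \<otimes>\<^bsub>MP\<^esub> bform MP ?C ?e w))"
  proof -
    have "Q = qeval MP ?C (vscale MP X0 ?e) \<oplus>\<^bsub>MP\<^esub> qeval MP ?C w \<oplus>\<^bsub>MP\<^esub>
      (bform MP ?C (vscale MP X0 ?e) w \<oplus>\<^bsub>MP\<^esub> bform MP ?C (vscale MP X0 ?e) w)"
      unfolding form_poly_def V by (rule M.qeval_add[OF CA(2)]) (use e w in simp_all)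
    also have "qeval MP ?C (vscale MP X0 ?e) = X0 \<otimes>\<^bsub>MP\<^esub> X0 \<otimes>\<^bsub>MP\<^esub> cst (A $$ (0, 0))"
      unfolding M.qeval_scale[OF CA(1) X0_MP M.uvec_vecs] qe ..
    also have "bform MP ?C (vscale MP X0 ?e) w = X0 \<otimes>\<^bsub>MP\<^esub> bform MP ?C ?e w"
      by (rule M.bform_scale_left[OF CA(1) X0_MP M.uvec_vecs w])
    finally show ?thesis
      using X0_MP PY_MP[OF r] PY_MP[OF b] rhc_closed[OF cst_hom, of "A $$ (0, 0)"] A00
      by (simp add: M.m_comm M.a_assoc)
  qed
  let ?u = "cst (inv (A $$ (0, 0)))"
  note iu = inv_A00 and a0 = A00[THEN DiffD1]
  have u: "?u \<in> carrier MP" "cst (A $$ (0, 0)) \<in> carrier MP" "?u \<otimes>\<^bsub>MP\<^esub> cst (A $$ (0, 0)) = \<one>\<^bsub>MP\<^esub>"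
    using rhc_closed[OF cst_hom iu(1)] rhc_closed[OF cst_hom a0]
      rhc_mult[OF cst_hom iu(1) a0] rhc_one[OF cst_hom] iu(2) by simp_all
  have u1: "?u \<in> carrier ?P1" by (rule rhc_closed[OF c1 iu(1)])
  note cr = M.conic_reduce[OF X0_MP PY_MP[OF b] PY_MP[OF r] u Q]
  \<comment> \<open>Sums and products agree in the two rings by definition, but the negative is
    determined by the ring; that it agrees follows because the inclusion is a homomorphism.\<close>
  have neg: "\<ominus>\<^bsub>MP\<^esub> f = \<ominus>\<^bsub>?P1\<^esub> f" if "f \<in> carrier ?P1" for f
    using rhc_a_inv[OF sub that] by simp
  have op: "f \<otimes>\<^bsub>MP\<^esub> g = f \<otimes>\<^bsub>?P1\<^esub> g" "f \<oplus>\<^bsub>MP\<^esub> g = f \<oplus>\<^bsub>?P1\<^esub> g" for f g by (simp_all add: mpoly_simps)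
  have r': "qeval MP ?C w \<in> carrier ?P1" "bform MP ?C ?e w \<in> carrier ?P1" using r b by (simp_all add: mpoly_simps)
  have s1: "\<ominus>\<^bsub>MP\<^esub> (?u \<otimes>\<^bsub>MP\<^esub> qeval MP ?C w) \<in> carrier ?P1"
    unfolding op using neg[OF M1.m_closed[OF u1 r'(1)]] M1.a_inv_closed[OF M1.m_closed[OF u1 r'(1)]] by simp
  have s2: "\<ominus>\<^bsub>MP\<^esub> (?u \<otimes>\<^bsub>MP\<^esub> (bform MP ?C ?e w \<oplus>\<^bsub>MP\<^esub> bform MP ?C ?e w)) \<in> carrier ?P1"
    unfolding op using neg[OF M1.m_closed[OF u1 M1.a_closed[OF r'(2) r'(2)]]]
      M1.a_inv_closed[OF M1.m_closed[OF u1 M1.a_closed[OF r'(2) r'(2)]]] by simp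
  have "reduces (\<ominus>\<^bsub>MP\<^esub> (?u \<otimes>\<^bsub>MP\<^esub> (bform MP ?C ?e w \<oplus>\<^bsub>MP\<^esub> bform MP ?C ?e w))) (\<ominus>\<^bsub>MP\<^esub> (?u \<otimes>\<^bsub>MP\<^esub> qeval MP ?C w))"
    unfolding reduces_def using cr s1[unfolded mpoly_simps(1)] s2[unfolded mpoly_simps(1)] by (intro conjI)
  then show ?thesis by blast
qed

text \<open>Division with remainder by \<open>Q\<close> as a polynomial in \<open>X0\<close>: the
  normal form a + X0 b is kept under multiplication by \<open>X0\<close> by rewriting the square of
  \<open>X0\<close> with \<open>reduces\<close>.\<close>

lemma division:
  assumes red: "reduces \<sigma> \<beta>" and f: "f \<in> indexed_pset {..<n} (carrier R)"
  shows "\<exists>a\<in>PY. \<exists>b\<in>PY. \<exists>k\<in>carrier MP. f = a \<oplus>\<^bsub>MP\<^esub> X0 \<otimes>\<^bsub>MP\<^esub> b \<oplus>\<^bsub>MP\<^esub> k \<otimes>\<^bsub>MP\<^esub> Q"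
  using f
proof (induction rule: indexed_pset.induct)
  case (indexed_const k)
  interpret M: cring MP by (rule mpoly_cring)
  have k: "cst k \<in> PY" using indexed_const by (rule indexed_pset.indexed_const)
  have z: "\<zero>\<^bsub>MP\<^esub> \<in> PY" unfolding mpoly_simps by (rule pset_zero)
  have "cst k = cst k \<oplus>\<^bsub>MP\<^esub> X0 \<otimes>\<^bsub>MP\<^esub> \<zero>\<^bsub>MP\<^esub> \<oplus>\<^bsub>MP\<^esub> \<zero>\<^bsub>MP\<^esub> \<otimes>\<^bsub>MP\<^esub> Q"
    using PY_MP[OF k] X0_MP Q_MP by simp
  then show ?case using k z M.zero_closed by blast
next
  case (indexed_padd f g)
  interpret M: cring MP by (rule mpoly_cring)
  obtain a b k where f: "a \<in> PY" "b \<in> PY" "k \<in> carrier MP" "f = a \<oplus>\<^bsub>MP\<^esub> X0 \<otimes>\<^bsub>MP\<^esub> b \<oplus>\<^bsub>MP\<^esub> k \<otimes>\<^bsub>MP\<^esub> Q"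
    using indexed_padd(3) by blast
  obtain a' b' k' where g: "a' \<in> PY" "b' \<in> PY" "k' \<in> carrier MP" "g = a' \<oplus>\<^bsub>MP\<^esub> X0 \<otimes>\<^bsub>MP\<^esub> b' \<oplus>\<^bsub>MP\<^esub> k' \<otimes>\<^bsub>MP\<^esub> Q"
    using indexed_padd(4) by blast
  have "indexed_padd f g = f \<oplus>\<^bsub>MP\<^esub> g" unfolding mpoly_simps ..
  also have "\<dots> = (a \<oplus>\<^bsub>MP\<^esub> a') \<oplus>\<^bsub>MP\<^esub> X0 \<otimes>\<^bsub>MP\<^esub> (b \<oplus>\<^bsub>MP\<^esub> b') \<oplus>\<^bsub>MP\<^esub> (k \<oplus>\<^bsub>MP\<^esub> k') \<otimes>\<^bsub>MP\<^esub> Q"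
    unfolding f(4) g(4) by (rule M.conic_add[OF X0_MP PY_MP[OF f(1)] PY_MP[OF f(2)] f(3) Q_MP PY_MP[OF g(1)] PY_MP[OF g(2)] g(3)])
  finally have e: "indexed_padd f g = (a \<oplus>\<^bsub>MP\<^esub> a') \<oplus>\<^bsub>MP\<^esub> X0 \<otimes>\<^bsub>MP\<^esub> (b \<oplus>\<^bsub>MP\<^esub> b') \<oplus>\<^bsub>MP\<^esub> (k \<oplus>\<^bsub>MP\<^esub> k') \<otimes>\<^bsub>MP\<^esub> Q" .
  have "a \<oplus>\<^bsub>MP\<^esub> a' \<in> PY" "b \<oplus>\<^bsub>MP\<^esub> b' \<in> PY"
    unfolding mpoly_simps using f(1,2) g(1,2) indexed_pset.indexed_padd by blast+
  then show ?case using e M.a_closed[OF f(3) g(3)] by blast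
next
  case (indexed_pmult f i)
  interpret M: cring MP by (rule mpoly_cring)
  have s: "\<sigma> \<in> PY" "\<beta> \<in> PY"
    and xx: "X0 \<otimes>\<^bsub>MP\<^esub> X0 = \<sigma> \<otimes>\<^bsub>MP\<^esub> X0 \<oplus>\<^bsub>MP\<^esub> \<beta> \<oplus>\<^bsub>MP\<^esub> cst (inv (A $$ (0, 0))) \<otimes>\<^bsub>MP\<^esub> Q"
    using red unfolding reduces_def by (auto simp only:)
  obtain a b k where f: "a \<in> PY" "b \<in> PY" "k \<in> carrier MP" "f = a \<oplus>\<^bsub>MP\<^esub> X0 \<otimes>\<^bsub>MP\<^esub> b \<oplus>\<^bsub>MP\<^esub> k \<otimes>\<^bsub>MP\<^esub> Q"
    using indexed_pmult(3) by blast
  have i: "i < n" using indexed_pmult(2) by simp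
  have "indexed_pmult f i = indexed_var i \<otimes>\<^bsub>MP\<^esub> f" unfolding mpoly_simps var_mult[OF pset_cc[OF indexed_pmult(1)]] ..
  also have "\<dots> = f \<otimes>\<^bsub>MP\<^esub> indexed_var i"
    using M.m_comm var_MP[OF i] indexed_pmult(1)[folded mpoly_simps(1)] by blast
  finally have e0: "indexed_pmult f i = f \<otimes>\<^bsub>MP\<^esub> indexed_var i" .
  have PYm: "g \<otimes>\<^bsub>MP\<^esub> g' \<in> PY" if "g \<in> PY" "g' \<in> PY" for g g' unfolding mpoly_simps by (rule pm_pset[OF that])
  show ?case
  proof (cases "i = 0")
    case True
    have iv: "cst (inv (A $$ (0, 0))) \<in> carrier MP"
      by (rule rhc_closed[OF cst_hom inv_A00(1)])
    have e: "indexed_pmult f i = b \<otimes>\<^bsub>MP\<^esub> \<beta> \<oplus>\<^bsub>MP\<^esub> X0 \<otimes>\<^bsub>MP\<^esub> (a \<oplus>\<^bsub>MP\<^esub> b \<otimes>\<^bsub>MP\<^esub> \<sigma>) \<oplus>\<^bsub>MP\<^esub>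
        (k \<otimes>\<^bsub>MP\<^esub> X0 \<oplus>\<^bsub>MP\<^esub> b \<otimes>\<^bsub>MP\<^esub> cst (inv (A $$ (0, 0)))) \<otimes>\<^bsub>MP\<^esub> Q"
      unfolding e0 unfolding True f(4)
      by (rule M.conic_mult_var[OF X0_MP PY_MP[OF f(1)] PY_MP[OF f(2)] f(3) Q_MP PY_MP[OF s(1)] PY_MP[OF s(2)] iv xx])
    have "a \<oplus>\<^bsub>MP\<^esub> b \<otimes>\<^bsub>MP\<^esub> \<sigma> \<in> PY" using indexed_pset.indexed_padd[OF f(1) PYm[OF f(2) s(1)]] unfolding mpoly_simps .
    then show ?thesis using e PYm[OF f(2) s(2)] M.a_closed[OF M.m_closed[OF f(3) X0_MP] M.m_closed[OF PY_MP[OF f(2)] iv]] by blast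
  next
    case False
    have v: "indexed_var i \<in> PY" by (rule var_pset) (use False i in auto)
    have "indexed_pmult f i = a \<otimes>\<^bsub>MP\<^esub> indexed_var i \<oplus>\<^bsub>MP\<^esub> X0 \<otimes>\<^bsub>MP\<^esub> (b \<otimes>\<^bsub>MP\<^esub> indexed_var i) \<oplus>\<^bsub>MP\<^esub> (k \<otimes>\<^bsub>MP\<^esub> indexed_var i) \<otimes>\<^bsub>MP\<^esub> Q"
      unfolding e0 unfolding f(4) by (rule M.conic_mult_const[OF X0_MP PY_MP[OF f(1)] PY_MP[OF f(2)] f(3) Q_MP var_MP[OF i]])
    then show ?thesis using PYm[OF f(1) v] PYm[OF f(2) v] M.m_closed[OF f(3) var_MP[OF i]] by blast
  qed
qed

end

section \<open>Points of the quadric over affine points, and primality of the form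
  polynomial\<close>

lemma pt_closed:
  assumes h: "ring_hom_cring R S h" and T: "T \<in> carrier S" and y: "range y \<subseteq> carrier R"
  shows "range (pt h T y) \<subseteq> carrier S"
proof (rule image_subsetI)
  fix i
  have "y i \<in> carrier R" using y by blast
  then show "pt h T y i \<in> carrier S" unfolding pt_def using T rhc_closed[OF h] by simp
qed

lemma (in field) mult_nonzero:
  "a \<in> carrier R \<Longrightarrow> b \<in> carrier R \<Longrightarrow> a \<noteq> \<zero> \<Longrightarrow> b \<noteq> \<zero> \<Longrightarrow> a \<otimes> b \<noteq> \<zero>"
  using integral by blast

lemma (in inf_field) root_qc:
  assumes "\<sigma> \<in> carrier R" "\<beta> \<in> carrier R" and E: "E = quad_ext R \<sigma> \<beta>"
  shows "qc \<zero> \<one> \<in> carrier E" "qc \<zero> \<one> \<otimes>\<^bsub>E\<^esub> qc \<zero> \<one> = qemb R \<sigma> \<otimes>\<^bsub>E\<^esub> qc \<zero> \<one> \<oplus>\<^bsub>E\<^esub> qemb R \<beta>"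
proof -
  note e = E_mult[OF assms] E_add[OF assms] qemb_simps[OF assms]
  show "qc \<zero> \<one> \<in> carrier E" by (simp add: E_carrier[OF assms])
  show "qc \<zero> \<one> \<otimes>\<^bsub>E\<^esub> qc \<zero> \<one> = qemb R \<sigma> \<otimes>\<^bsub>E\<^esub> qc \<zero> \<one> \<oplus>\<^bsub>E\<^esub> qemb R \<beta>"
    by (rule qc_eqI; simp add: e assms(1,2))
qed

context aform
begin

lemma J_mem: "f \<in> J \<longleftrightarrow> (\<exists>k\<in>carrier MP. f = k \<otimes>\<^bsub>MP\<^esub> Q)"
  unfolding cring.cgenideal_eq_genideal[OF mpoly_cring Q_MP, symmetric] cgenideal_def by blast

lemma J_eval:
  assumes h: "ring_hom_cring R S h" and x: "range x \<subseteq> carrier S" and Q0: "pev R S h x Q = \<zero>\<^bsub>S\<^esub>" and f: "f \<in> J"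
  shows "pev R S h x f = \<zero>\<^bsub>S\<^esub>"
proof -
  interpret h: ring_hom_cring R S h by fact
  note P = h.pev_ring_hom[OF x, of "{..<n}"]
  obtain k where k: "k \<in> carrier MP" "f = k \<otimes>\<^bsub>MP\<^esub> Q" using f J_mem by blast
  show ?thesis unfolding k(2) rhc_mult[OF P k(1) Q_MP] Q0 using rhc_closed[OF P k(1)] by simp
qed

lemma eval_Q_zero:
  assumes red: "reduces \<sigma> \<beta>" and h: "ring_hom_cring R S h" and x: "range x \<subseteq> carrier S"
    and e: "x 0 \<otimes>\<^bsub>S\<^esub> x 0 = pev R S h x \<sigma> \<otimes>\<^bsub>S\<^esub> x 0 \<oplus>\<^bsub>S\<^esub> pev R S h x \<beta>"
  shows "pev R S h x Q = \<zero>\<^bsub>S\<^esub>"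
proof -
  interpret h: ring_hom_cring R S h by fact
  interpret M: cring MP by (rule mpoly_cring)
  note P = h.pev_ring_hom[OF x, of "{..<n}"]
  let ?e = "pev R S h x" and ?a = "cst (A $$ (0, 0))"
  have s: "\<sigma> \<in> carrier MP" "\<beta> \<in> carrier MP"
    and eq: "Q \<oplus>\<^bsub>MP\<^esub> ?a \<otimes>\<^bsub>MP\<^esub> (\<sigma> \<otimes>\<^bsub>MP\<^esub> X0 \<oplus>\<^bsub>MP\<^esub> \<beta>) = ?a \<otimes>\<^bsub>MP\<^esub> (X0 \<otimes>\<^bsub>MP\<^esub> X0)"
    using red PY_MP unfolding reduces_def by (auto simp only:)
  have a: "?a \<in> carrier MP" by (rule rhc_closed[OF cst_hom A00[THEN DiffD1]])
  note m = M.m_closed M.a_closed and c = X0_MP s a Q_MP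
  have ex: "?e X0 = x 0" by (rule h.pev_var[OF x])
  let ?w = "?e ?a \<otimes>\<^bsub>S\<^esub> (?e \<sigma> \<otimes>\<^bsub>S\<^esub> x 0 \<oplus>\<^bsub>S\<^esub> ?e \<beta>)"
  have x0: "x 0 \<in> carrier S" using x by blast
  have w: "?w \<in> carrier S" using rhc_closed[OF P] c x0 by simp
  have "?e (Q \<oplus>\<^bsub>MP\<^esub> ?a \<otimes>\<^bsub>MP\<^esub> (\<sigma> \<otimes>\<^bsub>MP\<^esub> X0 \<oplus>\<^bsub>MP\<^esub> \<beta>)) = ?e Q \<oplus>\<^bsub>S\<^esub> ?w"
    using c by (simp add: rhc_add[OF P] rhc_mult[OF P] ex)
  moreover have "?e (?a \<otimes>\<^bsub>MP\<^esub> (X0 \<otimes>\<^bsub>MP\<^esub> X0)) = ?w"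
    using c by (simp add: rhc_mult[OF P] ex e)
  ultimately have z: "?e Q \<oplus>\<^bsub>S\<^esub> ?w = ?w" unfolding eq by simp
  have q: "?e Q \<in> carrier S" by (rule rhc_closed[OF P Q_MP])
  have "?e Q = (?e Q \<oplus>\<^bsub>S\<^esub> ?w) \<ominus>\<^bsub>S\<^esub> ?w"
    using q w by (simp add: a_minus_def h.S.a_assoc h.S.r_neg)
  also have "\<dots> = \<zero>\<^bsub>S\<^esub>" unfolding z using w by (simp add: a_minus_def h.S.r_neg)
  finally show ?thesis .
qed

lemma pev_pt:
  assumes h: "ring_hom_cring R S h" and T: "T \<in> carrier S" and y: "range y \<subseteq> carrier R" and f: "f \<in> PY"
  shows "pev R S h (pt h T y) f = h (pev R R (\<lambda>x. x) y f)"
proof -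
  have hy: "range (\<lambda>i. h (y i)) \<subseteq> carrier S"
    by (rule image_subsetI, rule rhc_closed[OF h], rule subsetD[OF y rangeI])
  have "pev R S h (pt h T y) f = pev R S h (\<lambda>i. h (y i)) f"
    by (rule ring_hom_cring.pev_cong[OF h f pt_closed[OF h T y] hy]) (simp add: pt_def)
  also have "\<dots> = h (pev R R (\<lambda>x. x) y f)" by (rule ring_hom_cring.pev_comp[OF id_hom h y f])
  finally show ?thesis .
qed

abbreviation "ev \<equiv> pev R R (\<lambda>x. x)"

text \<open>A root t would make (t, y_1, ..., y_(n-1)) a zero of the form over \<open>R\<close>. It
  is a nonzero vector because of \<open>y j\<close>, which contradicts anisotropy.\<close>

lemma irred_y:
  assumes red: "reduces \<sigma> \<beta>" and y: "range y \<subseteq> carrier R" and j: "1 \<le> j" "j < n" "y j \<noteq> \<zero>"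
  shows "irred R (ev y \<sigma>) (ev y \<beta>)"
  unfolding irred_def
proof (intro ballI notI)
  fix t assume t: "t \<in> carrier R" and e: "t \<otimes> t = ev y \<sigma> \<otimes> t \<oplus> ev y \<beta>"
  let ?x = "pt (\<lambda>x. x) t y"
  have s: "\<sigma> \<in> PY" "\<beta> \<in> PY" using red unfolding reduces_def by simp_all
  note x = pt_closed[OF id_hom t y]
  have "ev ?x Q = \<zero>"
    by (rule eval_Q_zero[OF red id_hom x]) (use e in \<open>simp add: pev_pt[OF id_hom t y s(1)] pev_pt[OF id_hom t y s(2)]; simp add: pt_def\<close>)
  moreover have "map_mat (\<lambda>x. x) A = A" by (rule eq_matI) simp_all
  ultimately have "qeval R A (vec n ?x) = \<zero>"
    using ring_hom_cring.pev_form_poly[OF id_hom mats x] by simp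
  moreover have "vec n ?x \<in> vecs R n" by (rule vecs_vecI) (use x in blast)
  ultimately have "vec n ?x = zvec R n" using an unfolding anisotropic_def by blast
  then have "vec n ?x $ j = zvec R n $ j" by simp
  then show False using j by (simp add: pt_def)
qed

text \<open>The equation for \<open>T\<close> puts the point on the quadric, so only the remainder a
  + X0 b contributes, with value a(y) + T b(y). If this were zero with b(y) nonzero,
  \<open>T\<close> would be the image of -a(y)/b(y), and by injectivity the quadratic equation would
  have a root in \<open>R\<close>, against \<open>irred_y\<close>.\<close>

lemma pt_value:
  assumes red: "reduces \<sigma> \<beta>" and H: "inf_field_hom R S h" and T: "T \<in> carrier S"
    and y: "range y \<subseteq> carrier R" and j: "1 \<le> j" "j < n" "y j \<noteq> \<zero>"
    and TT: "T \<otimes>\<^bsub>S\<^esub> T = h (ev y \<sigma>) \<otimes>\<^bsub>S\<^esub> T \<oplus>\<^bsub>S\<^esub> h (ev y \<beta>)"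
  shows "pev R S h (pt h T y) Q = \<zero>\<^bsub>S\<^esub>"
    and "a \<in> PY \<Longrightarrow> b \<in> PY \<Longrightarrow> k \<in> carrier MP \<Longrightarrow> ev y a \<noteq> \<zero> \<or> ev y b \<noteq> \<zero> \<Longrightarrow>
      pev R S h (pt h T y) (a \<oplus>\<^bsub>MP\<^esub> X0 \<otimes>\<^bsub>MP\<^esub> b \<oplus>\<^bsub>MP\<^esub> k \<otimes>\<^bsub>MP\<^esub> Q) \<noteq> \<zero>\<^bsub>S\<^esub>"
proof -
  interpret H: inf_field_hom R S h by fact
  interpret M: cring MP by (rule mpoly_cring)
  note h = H.ring_hom_cring_axioms
  note x = pt_closed[OF h T y]
  let ?e = "pev R S h (pt h T y)"
  have s: "\<sigma> \<in> PY" "\<beta> \<in> PY" using red unfolding reduces_def by simp_all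
  have p0: "pt h T y 0 = T" by (simp add: pt_def)
  show Q0: "?e Q = \<zero>\<^bsub>S\<^esub>"
    by (rule eval_Q_zero[OF red h x]) (unfold pev_pt[OF h T y s(1)] pev_pt[OF h T y s(2)] p0, rule TT)
  assume a: "a \<in> PY" and b: "b \<in> PY" and k: "k \<in> carrier MP" and nz: "ev y a \<noteq> \<zero> \<or> ev y b \<noteq> \<zero>"
  note P = H.pev_ring_hom[OF x, of "{..<n}"]
  have evc: "ev y f \<in> carrier R" if "f \<in> PY" for f by (rule ring_hom_cring.pev_closed[OF id_hom that y])
  have hc: "h (ev y f) \<in> carrier S" if "f \<in> PY" for f by (rule rhc_closed[OF h evc[OF that]])
  have val: "?e (a \<oplus>\<^bsub>MP\<^esub> X0 \<otimes>\<^bsub>MP\<^esub> b \<oplus>\<^bsub>MP\<^esub> k \<otimes>\<^bsub>MP\<^esub> Q) = h (ev y a) \<oplus>\<^bsub>S\<^esub> T \<otimes>\<^bsub>S\<^esub> h (ev y b)"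
    using PY_MP[OF a] PY_MP[OF b] k X0_MP Q_MP hc[OF a] hc[OF b] T rhc_closed[OF P k]
    by (simp add: rhc_add[OF P] rhc_mult[OF P] Q0 H.pev_var[OF x] p0 pev_pt[OF h T y a] pev_pt[OF h T y b])
  show "?e (a \<oplus>\<^bsub>MP\<^esub> X0 \<otimes>\<^bsub>MP\<^esub> b \<oplus>\<^bsub>MP\<^esub> k \<otimes>\<^bsub>MP\<^esub> Q) \<noteq> \<zero>\<^bsub>S\<^esub>"
    unfolding val
  proof
    assume z: "h (ev y a) \<oplus>\<^bsub>S\<^esub> T \<otimes>\<^bsub>S\<^esub> h (ev y b) = \<zero>\<^bsub>S\<^esub>"
    show False
    proof (cases "ev y b = \<zero>")
      case True
      have "h (ev y b) = \<zero>\<^bsub>S\<^esub>" unfolding True by (rule rhc_zero[OF h])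
      then have "h (ev y a) = \<zero>\<^bsub>S\<^esub>" using z T hc[OF a] by simp
      then show False using H.hom_zero_iff[OF evc[OF a]] nz True by simp
    next
      case False
      define i where "i = inv (ev y b)"
      have i: "i \<in> carrier R" "ev y b \<otimes> i = \<one>" unfolding i_def using False evc[OF b] by (auto simp: field_Units)
      have hi: "h i \<in> carrier S" "h (ev y b) \<otimes>\<^bsub>S\<^esub> h i = \<one>\<^bsub>S\<^esub>"
        using rhc_closed[OF h i(1)] rhc_mult[OF h evc[OF b] i(1)] i(2) rhc_one[OF h] by simp_all
      have t: "\<ominus> (ev y a \<otimes> i) \<in> carrier R" using evc[OF a] i by simp
      have ht: "h (\<ominus> (ev y a \<otimes> i)) = \<ominus>\<^bsub>S\<^esub> (h (ev y a) \<otimes>\<^bsub>S\<^esub> h i)"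
        using rhc_a_inv[OF h] rhc_mult[OF h] evc[OF a] i(1) by simp
      have c: "h (ev y a) \<in> carrier S" "h (ev y b) \<in> carrier S" using hc a b by simp_all
      have "T = T \<otimes>\<^bsub>S\<^esub> (h (ev y b) \<otimes>\<^bsub>S\<^esub> h i)" unfolding hi(2) using T by simp
      also have "\<dots> = (h (ev y a) \<oplus>\<^bsub>S\<^esub> T \<otimes>\<^bsub>S\<^esub> h (ev y b)) \<otimes>\<^bsub>S\<^esub> h i \<oplus>\<^bsub>S\<^esub> \<ominus>\<^bsub>S\<^esub> (h (ev y a) \<otimes>\<^bsub>S\<^esub> h i)"
        using T c hi(1) by (simp add: H.S.l_distr H.S.m_assoc H.S.a_ac H.S.r_neg H.S.r_neg1 H.S.r_neg2)
      also have "\<dots> = h (\<ominus> (ev y a \<otimes> i))" unfolding z ht using c hi(1) by simp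
      finally have T: "T = h (\<ominus> (ev y a \<otimes> i))" .
      let ?t = "\<ominus> (ev y a \<otimes> i)"
      have "h (?t \<otimes> ?t) = h (ev y \<sigma> \<otimes> ?t \<oplus> ev y \<beta>)"
        using TT unfolding T using t evc[OF s(1)] evc[OF s(2)] rhc_mult[OF h] rhc_add[OF h] by simp
      then have "?t \<otimes> ?t = ev y \<sigma> \<otimes> ?t \<oplus> ev y \<beta>"
        using t evc[OF s(1)] evc[OF s(2)] by (intro H.hom_inj) simp_all
      then show False using irred_y[OF red y j] t unfolding irred_def by blast
    qed
  qed
qed

text \<open>The component \<open>p\<close> of the remainder is a witness in the variables other than
  \<open>X0\<close>: wherever it is nonzero, \<open>pt_value\<close> makes \<open>f\<close> nonzero
  on the quadric above.\<close>

lemma not_J: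
  assumes red: "reduces \<sigma> \<beta>" and f: "f \<in> carrier MP" "f \<notin> J"
  shows "\<exists>a b k p u. a \<in> PY \<and> b \<in> PY \<and> k \<in> carrier MP \<and> f = a \<oplus>\<^bsub>MP\<^esub> X0 \<otimes>\<^bsub>MP\<^esub> b \<oplus>\<^bsub>MP\<^esub> k \<otimes>\<^bsub>MP\<^esub> Q \<and>
    (p = a \<or> p = b) \<and> range u \<subseteq> carrier R \<and> ev u p \<noteq> \<zero>"
proof -
  interpret M: cring MP by (rule mpoly_cring)
  obtain a b k where d: "a \<in> PY" "b \<in> PY" "k \<in> carrier MP" "f = a \<oplus>\<^bsub>MP\<^esub> X0 \<otimes>\<^bsub>MP\<^esub> b \<oplus>\<^bsub>MP\<^esub> k \<otimes>\<^bsub>MP\<^esub> Q"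
    using division[OF red f(1)[unfolded mpoly_simps]] by blast
  have "\<not> (a = \<zero>\<^bsub>MP\<^esub> \<and> b = \<zero>\<^bsub>MP\<^esub>)"
  proof
    assume z: "a = \<zero>\<^bsub>MP\<^esub> \<and> b = \<zero>\<^bsub>MP\<^esub>"
    have "f = k \<otimes>\<^bsub>MP\<^esub> Q" unfolding d(4) z[THEN conjunct1] z[THEN conjunct2] using d(3) X0_MP Q_MP by simp
    then show False using f(2) J_mem d(3) by blast
  qed
  then obtain p where p: "p = a \<or> p = b" "p \<noteq> \<zero>\<^bsub>MP\<^esub>" by blast
  have pP: "p \<in> PY" using p(1) d by blast
  have "\<exists>u. range u \<subseteq> carrier R \<and> ev u p \<noteq> \<zero>"
    using poly_vanish[OF _ pP] p(2) unfolding mpoly_simps by blast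
  then show ?thesis using d p(1) by blast
qed

text \<open>Choose an affine point \<open>y\<close> at which the witnesses of both factors are
  nonzero. Over the quadratic extension belonging to \<open>y\<close> there is a point of the
  quadric at which both factors, hence their product, are nonzero, while all of \<open>J\<close>
  vanishes there.\<close>

lemma prime_value:
  assumes red: "reduces \<sigma> \<beta>" and f: "f \<in> carrier MP" "f \<notin> J" and g: "g \<in> carrier MP" "g \<notin> J"
  shows "f \<otimes>\<^bsub>MP\<^esub> g \<notin> J"
proof -
  obtain a b k p u where F: "a \<in> PY" "b \<in> PY" "k \<in> carrier MP" "f = a \<oplus>\<^bsub>MP\<^esub> X0 \<otimes>\<^bsub>MP\<^esub> b \<oplus>\<^bsub>MP\<^esub> k \<otimes>\<^bsub>MP\<^esub> Q"
    "p = a \<or> p = b" "range u \<subseteq> carrier R" "ev u p \<noteq> \<zero>" using not_J[OF red f] by (elim exE conjE)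
  obtain a' b' k' p' u' where G: "a' \<in> PY" "b' \<in> PY" "k' \<in> carrier MP" "g = a' \<oplus>\<^bsub>MP\<^esub> X0 \<otimes>\<^bsub>MP\<^esub> b' \<oplus>\<^bsub>MP\<^esub> k' \<otimes>\<^bsub>MP\<^esub> Q"
    "p' = a' \<or> p' = b'" "range u' \<subseteq> carrier R" "ev u' p' \<noteq> \<zero>" using not_J[OF red g] by (elim exE conjE)
  have pP: "p \<in> PY" "p' \<in> PY" using F(1,2,5) G(1,2,5) by auto
  note lp = inf_field_hom.linepoly_pev[OF inf_field_id pP(1)] and lp' = inf_field_hom.linepoly_pev[OF inf_field_id pP(2)]
  obtain y1 where y1: "range y1 \<subseteq> carrier R" "ev y1 p \<noteq> \<zero>" "ev y1 p' \<noteq> \<zero>"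
    using inf_field_hom.linepoly_common[OF inf_field_id lp lp', OF F(6,7) G(6,7)] by (elim exE conjE)
  note evc = ring_hom_cring.pev_closed[OF id_hom pP(1)] ring_hom_cring.pev_closed[OF id_hom pP(2)]
  have nz1: "ev y1 p \<otimes> ev y1 p' \<noteq> \<zero>"
    by (rule mult_nonzero[OF evc(1)[OF y1(1)] evc(2)[OF y1(1)] y1(2,3)])
  \<comment> \<open>In addition \<open>y 1\<close> has to be nonzero, so that \<open>irred_y\<close>
    provides the quadratic extension.\<close>
  have on: "range (\<lambda>_::nat. \<one>) \<subseteq> carrier R" by (rule image_subsetI) simp
  note lc = inf_field_hom.linepoly_common[OF inf_field_id inf_field_hom.linepoly_mult[OF inf_field_id lp lp']
      inf_field_hom.linepoly_coord[OF inf_field_id, of 1], OF y1(1) nz1 on one_not_zero]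
  obtain y where y: "range y \<subseteq> carrier R" "ev y p \<otimes> ev y p' \<noteq> \<zero>" "y 1 \<noteq> \<zero>"
    using lc by (elim exE conjE)
  have "ev y p \<noteq> \<zero>"
  proof
    assume z: "ev y p = \<zero>"
    show False using y(2) evc(2)[OF y(1)] unfolding z by simp
  qed
  then have nz: "ev y a \<noteq> \<zero> \<or> ev y b \<noteq> \<zero>" using F(5) by auto
  have "ev y p' \<noteq> \<zero>"
  proof
    assume z: "ev y p' = \<zero>"
    show False using y(2) evc(1)[OF y(1)] unfolding z by simp
  qed
  then have nz': "ev y a' \<noteq> \<zero> \<or> ev y b' \<noteq> \<zero>" using G(5) by auto
  have j: "1 \<le> (1::nat)" "1 < n" using dim by simp_all
  have s: "\<sigma> \<in> PY" "\<beta> \<in> PY" using red unfolding reduces_def by simp_all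
  have sc: "ev y \<sigma> \<in> carrier R" "ev y \<beta> \<in> carrier R" by (rule ring_hom_cring.pev_closed[OF id_hom _ y(1)], rule s)+
  define E where "E = quad_ext R (ev y \<sigma>) (ev y \<beta>)"
  have H: "inf_field_hom R E (qemb R)" by (rule E_inf_field_hom[OF sc E_def irred_y[OF red y(1) j y(3)]])
  interpret H: inf_field_hom R E "qemb R" by (rule H)
  note r = root_qc[OF sc E_def]
  note v = pt_value[OF red H r(1) y(1) j y(3) r(2)]
  let ?e = "pev R E (qemb R) (pt (qemb R) (qc \<zero> \<one>) y)"
  have x: "range (pt (qemb R) (qc \<zero> \<one>) y) \<subseteq> carrier E" by (rule pt_closed[OF H.ring_hom_cring_axioms r(1) y(1)])
  note P = H.pev_ring_hom[OF x, of "{..<n}"]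
  have nf: "?e f \<noteq> \<zero>\<^bsub>E\<^esub>" unfolding F(4) by (rule v(2)[OF F(1-3) nz])
  have ng: "?e g \<noteq> \<zero>\<^bsub>E\<^esub>" unfolding G(4) by (rule v(2)[OF G(1-3) nz'])
  have "?e (f \<otimes>\<^bsub>MP\<^esub> g) = ?e f \<otimes>\<^bsub>E\<^esub> ?e g" by (rule rhc_mult[OF P f(1) g(1)])
  then have "?e (f \<otimes>\<^bsub>MP\<^esub> g) \<noteq> \<zero>\<^bsub>E\<^esub>"
    using H.S.mult_nonzero[OF rhc_closed[OF P f(1)] rhc_closed[OF P g(1)] nf ng] by simp
  then show ?thesis using J_eval[OF H.ring_hom_cring_axioms x v(1)] by metis
qed

text \<open>The point over the affine point (1, ..., 1) lies on the quadric and has second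
  coordinate 1. Thus \<open>J\<close> is proper, and the generic point in \<open>K_isotropic\<close>
  is nonzero.\<close>

lemma X1_notin: "indexed_var 1 \<notin> J"
proof -
  obtain \<sigma> \<beta> where red: "reduces \<sigma> \<beta>" using ex_reduces by blast
  let ?y = "\<lambda>_::nat. \<one>"
  have y: "range ?y \<subseteq> carrier R" "?y 1 \<noteq> \<zero>" by auto
  have j: "1 \<le> (1::nat)" "1 < n" using dim by simp_all
  have s: "\<sigma> \<in> PY" "\<beta> \<in> PY" using red unfolding reduces_def by simp_all
  have sc: "ev ?y \<sigma> \<in> carrier R" "ev ?y \<beta> \<in> carrier R" by (rule ring_hom_cring.pev_closed[OF id_hom _ y(1)], rule s)+
  define E where "E = quad_ext R (ev ?y \<sigma>) (ev ?y \<beta>)"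
  have H: "inf_field_hom R E (qemb R)" by (rule E_inf_field_hom[OF sc E_def irred_y[OF red y(1) j y(2)]])
  interpret H: inf_field_hom R E "qemb R" by (rule H)
  note r = root_qc[OF sc E_def]
  note v = pt_value(1)[OF red H r(1) y(1) j y(2) r(2)]
  have x: "range (pt (qemb R) (qc \<zero> \<one>) ?y) \<subseteq> carrier E" by (rule pt_closed[OF H.ring_hom_cring_axioms r(1) y(1)])
  have "pev R E (qemb R) (pt (qemb R) (qc \<zero> \<one>) ?y) (indexed_var 1) = \<one>\<^bsub>E\<^esub>"
    unfolding H.pev_var[OF x] using rhc_one[OF H.ring_hom_cring_axioms] by (simp add: pt_def)
  then show ?thesis using J_eval[OF H.ring_hom_cring_axioms x v] H.S.one_not_zero by metis
qed

lemma prime_J: "primeideal J MP"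
proof (rule primeidealI)
  obtain \<sigma> \<beta> where red: "reduces \<sigma> \<beta>" using ex_reduces by blast
  interpret M: cring MP by (rule mpoly_cring)
  show "ideal J MP" by (rule M.genideal_ideal) (use Q_MP in simp)
  show "cring MP" by (rule mpoly_cring)
  show "carrier MP \<noteq> J" using X1_notin var_MP[of 1] dim by auto
  show "a \<in> J \<or> b \<in> J" if "a \<in> carrier MP" "b \<in> carrier MP" "a \<otimes>\<^bsub>MP\<^esub> b \<in> J" for a b
    using prime_value[OF red] that by blast
qed

section \<open>The function field, its denominators and its generic point\<close>

abbreviation "D \<equiv> form_coord_ring R A"
abbreviation "K \<equiv> function_field R A"

text \<open>The canonical map from polynomials to the function field; its kernel is \<open>J\<close>
  (see \<open>phi_zero\<close>).\<close>

definition phi where "phi f = mk_frac D (J +>\<^bsub>MP\<^esub> f) \<one>\<^bsub>D\<^esub>"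

lemma D_domain: "domain D"
  unfolding form_coord_ring_def by (rule primeideal.quotient_is_domain[OF prime_J])

lemma K_field: "field K"
  unfolding function_field_def by (rule domain.quotient_field_field[OF D_domain])

lemma coset_hom: "ring_hom_cring MP D ((+>\<^bsub>MP\<^esub>) J)"
proof -
  have "(+>\<^bsub>MP\<^esub>) J \<in> Ring.ring_hom MP D"
    unfolding form_coord_ring_def by (rule ideal.rcos_ring_hom[OF primeideal.axioms(1)[OF prime_J]])
  then show ?thesis
    by (intro ring_hom_cring.intro ring_hom_cring_axioms.intro mpoly_cring domain.axioms(1)[OF D_domain])
qed

lemma phi_hom: "ring_hom_cring MP K phi"
proof -
  have "ring_hom_cring D K (\<lambda>a. mk_frac D a \<one>\<^bsub>D\<^esub>)"
    unfolding function_field_def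
    by (intro ring_hom_cring.intro ring_hom_cring_axioms.intro domain.axioms(1)[OF D_domain] domain.frac_hom[OF D_domain]
        K_field[unfolded function_field_def, THEN field.axioms(1), THEN domain.axioms(1)])
  from ring_hom_cring_comp[OF coset_hom this] show ?thesis unfolding phi_def[abs_def] .
qed

lemma coset_zero:
  assumes f: "f \<in> carrier MP" shows "J +>\<^bsub>MP\<^esub> f = \<zero>\<^bsub>D\<^esub> \<longleftrightarrow> f \<in> J"
proof -
  interpret M: cring MP by (rule mpoly_cring)
  have I: "ideal J MP" by (rule primeideal.axioms(1)[OF prime_J])
  have z: "J +>\<^bsub>MP\<^esub> \<zero>\<^bsub>MP\<^esub> = \<zero>\<^bsub>D\<^esub>" by (rule rhc_zero[OF coset_hom])
  have "f \<ominus>\<^bsub>MP\<^esub> \<zero>\<^bsub>MP\<^esub> = f" using f by (simp add: a_minus_def)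
  then show ?thesis using M.quotient_eq_iff_same_a_r_cos[OF I f M.zero_closed] unfolding z by simp
qed

lemma phi_zero: "f \<in> carrier MP \<Longrightarrow> phi f = \<zero>\<^bsub>K\<^esub> \<longleftrightarrow> f \<in> J"
  unfolding phi_def function_field_def
  using domain.frac_embed_zero[OF D_domain rhc_closed[OF coset_hom]] coset_zero by blast

lemma embed_eq: "function_field_embed R A = (\<lambda>a. phi (cst a))"
  unfolding phi_def function_field_embed_def[abs_def] ..

lemma K_hom: "inf_field_hom R K (function_field_embed R A)"
proof (rule inf_field_homI[OF inf_field_axioms K_field])
  interpret p: ring_hom_cring R K "\<lambda>a. phi (cst a)" by (rule ring_hom_cring_comp[OF cst_hom phi_hom])
  show "function_field_embed R A \<in> Ring.ring_hom R K" unfolding embed_eq by (rule p.homh)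
qed

lemma coset_surj: "u \<in> carrier D \<Longrightarrow> \<exists>f\<in>carrier MP. u = J +>\<^bsub>MP\<^esub> f"
  unfolding form_coord_ring_def FactRing_def A_RCOSETS_defs by (auto simp: a_r_coset_def r_coset_def)

lemma denominator:
  assumes "u \<in> carrier K"
  shows "\<exists>c\<in>carrier MP. c \<notin> J \<and> (\<exists>a\<in>carrier MP. u \<otimes>\<^bsub>K\<^esub> phi c = phi a)"
proof -
  obtain a b where ab: "a \<in> carrier D" "b \<in> carrier D" "b \<noteq> \<zero>\<^bsub>D\<^esub>"
    "u \<otimes>\<^bsub>K\<^esub> mk_frac D b \<one>\<^bsub>D\<^esub> = mk_frac D a \<one>\<^bsub>D\<^esub>"
    using domain.frac_denominator[OF D_domain assms[unfolded function_field_def]] unfolding function_field_def by blast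
  obtain c where c: "c \<in> carrier MP" "b = J +>\<^bsub>MP\<^esub> c" using coset_surj[OF ab(2)] by blast
  obtain a' where a: "a' \<in> carrier MP" "a = J +>\<^bsub>MP\<^esub> a'" using coset_surj[OF ab(1)] by blast
  have "c \<notin> J" using ab(3) coset_zero[OF c(1)] unfolding c(2) by blast
  moreover have "u \<otimes>\<^bsub>K\<^esub> phi c = phi a'" using ab(4) unfolding phi_def c(2) a(2) .
  ultimately show ?thesis using c(1) a(1) by blast
qed

lemma common_denominator:
  assumes "finite U" "U \<subseteq> carrier K"
  shows "\<exists>c\<in>carrier MP. c \<notin> J \<and> (\<forall>u\<in>U. \<exists>a\<in>carrier MP. u \<otimes>\<^bsub>K\<^esub> phi c = phi a)"
  using assms
proof (induction U rule: finite_induct)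
  case empty
  have "indexed_var 1 \<in> carrier MP" by (rule var_MP) (use dim in simp)
  then show ?case using X1_notin by blast
next
  case (insert u U)
  interpret K: field K by (rule K_field)
  interpret M: cring MP by (rule mpoly_cring)
  obtain \<sigma> \<beta> where red: "reduces \<sigma> \<beta>" using ex_reduces by blast
  have uK: "u \<in> carrier K" "U \<subseteq> carrier K" using insert.prems by simp_all
  obtain c where c: "c \<in> carrier MP" "c \<notin> J" "\<forall>u\<in>U. \<exists>a\<in>carrier MP. u \<otimes>\<^bsub>K\<^esub> phi c = phi a"
    using insert.IH[OF uK(2)] by blast
  obtain e a where e: "e \<in> carrier MP" "e \<notin> J" "a \<in> carrier MP" "u \<otimes>\<^bsub>K\<^esub> phi e = phi a"
    using denominator[OF uK(1)] by blast
  note pc = rhc_closed[OF phi_hom] and pm = rhc_mult[OF phi_hom]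
  have "\<exists>b\<in>carrier MP. v \<otimes>\<^bsub>K\<^esub> phi (c \<otimes>\<^bsub>MP\<^esub> e) = phi b" if v: "v \<in> insert u U" for v
  proof (cases "v = u")
    case True
    have "u \<otimes>\<^bsub>K\<^esub> phi (c \<otimes>\<^bsub>MP\<^esub> e) = phi c \<otimes>\<^bsub>K\<^esub> (u \<otimes>\<^bsub>K\<^esub> phi e)"
      unfolding pm[OF c(1) e(1)] using uK(1) pc[OF c(1)] pc[OF e(1)] by (simp add: K.m_ac)
    also have "\<dots> = phi (c \<otimes>\<^bsub>MP\<^esub> a)" unfolding e(4) pm[OF c(1) e(3)] ..
    finally show ?thesis using True M.m_closed[OF c(1) e(3)] by blast
  next
    case False
    then have vU: "v \<in> U" using v by blast
    then obtain b where b: "b \<in> carrier MP" "v \<otimes>\<^bsub>K\<^esub> phi c = phi b" using c(3) by blast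
    have vK: "v \<in> carrier K" using vU uK(2) by blast
    have "v \<otimes>\<^bsub>K\<^esub> phi (c \<otimes>\<^bsub>MP\<^esub> e) = (v \<otimes>\<^bsub>K\<^esub> phi c) \<otimes>\<^bsub>K\<^esub> phi e"
      unfolding pm[OF c(1) e(1)] using vK pc[OF c(1)] pc[OF e(1)] by (simp add: K.m_assoc)
    also have "\<dots> = phi (b \<otimes>\<^bsub>MP\<^esub> e)" unfolding b(2) pm[OF b(1) e(1)] ..
    finally show ?thesis using M.m_closed[OF b(1) e(1)] by blast
  qed
  then show ?case using prime_value[OF red c(1,2) e(1,2)] M.m_closed[OF c(1) e(1)] by blast
qed

text \<open>The generic point, whose coordinates are the classes of the variables, is a zero of the
  form because its value is the class of \<open>Q\<close>.\<close>

lemma K_isotropic: "\<not> anisotropic K (map_mat (function_field_embed R A) A)"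
proof -
  let ?v = "map_vec phi (vec n indexed_var)"
  have v: "?v \<in> vecs K n" by (rule ring_hom_cring.map_vec_vecs[OF phi_hom var_vec])
  have m: "map_mat phi (map_mat cst A) = map_mat (function_field_embed R A) A"
    unfolding embed_eq by (rule eq_matI) simp_all
  have "qeval K (map_mat (function_field_embed R A) A) ?v = phi Q"
    unfolding form_poly_def m[symmetric] by (rule ring_hom_cring.hom_qeval[OF phi_hom CA(1) var_vec, symmetric])
  also have "\<dots> = \<zero>\<^bsub>K\<^esub>"
  proof -
    interpret M: cring MP by (rule mpoly_cring)
    have "Q \<in> J" unfolding J_mem by (rule bexI[of _ "\<one>\<^bsub>MP\<^esub>"]) (use Q_MP in simp_all)
    then show ?thesis using phi_zero[OF Q_MP] by blast
  qed
  finally have q: "qeval K (map_mat (function_field_embed R A) A) ?v = \<zero>\<^bsub>K\<^esub>" .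
  have "?v $ 1 \<noteq> \<zero>\<^bsub>K\<^esub>" using phi_zero[OF var_MP[of 1]] X1_notin dim by simp
  moreover have "zvec K n $ 1 = \<zero>\<^bsub>K\<^esub>" using dim by simp
  ultimately have "?v \<noteq> zvec K n" by metis
  then show ?thesis using q v unfolding anisotropic_def by auto
qed

end

section \<open>Specialisation of totally isotropic subspaces\<close>

lemma (in cring) bform_zero_mat:
  assumes G: "G \<in> mats R d d" and z: "\<And>j k. j < d \<Longrightarrow> k < d \<Longrightarrow> G $$ (j, k) = \<zero>"
    and v: "v \<in> vecs R d" and w: "w \<in> vecs R d"
  shows "bform R G v w = \<zero>"
proof -
  have "(\<Oplus>k\<in>{..<d}. w $ k \<otimes> G $$ (j, k)) = \<zero>" if "j < d" for j
    by (rule add.finprod_one_eqI) (use z that vecs_index[OF w] in simp)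
  then show ?thesis unfolding bform_sum[OF G v w]
    by (intro add.finprod_one_eqI) (use vecs_index[OF v] in simp)
qed

text \<open>The specialisation \<open>e\<close> is requested only for the finite set
  \<open>U\<close> of entries of an echelon basis over \<open>K\<close>. After multiplication by the
  denominator \<open>c\<close> the entries lift to \<open>D\<close>. The vanishing of bilinear
  products in \<open>K\<close> is transferred by \<open>e\<close>, which kills the kernel of
  \<open>\<phi>\<close>, and the pivot block becomes e(c) times the identity, so the specialised
  vectors stay independent.\<close>

lemma ti_specialize:
  assumes K: "inf_field K" and M: "field M" and \<phi>: "ring_hom_cring D K \<phi>" and B: "B \<in> mats D (qdim B) (qdim B)"
    and S: "sym_mat K (map_mat \<phi> B)" and t: "ti K (map_mat \<phi> B) d"
    and pts: "\<And>U. finite U \<Longrightarrow> U \<subseteq> carrier K \<Longrightarrow> \<exists>e c. ring_hom_cring D M e \<and>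
      (\<forall>a\<in>carrier D. \<phi> a = \<zero>\<^bsub>K\<^esub> \<longrightarrow> e a = \<zero>\<^bsub>M\<^esub>) \<and> c \<in> carrier D \<and> e c \<noteq> \<zero>\<^bsub>M\<^esub> \<and>
      (\<forall>u\<in>U. \<exists>a\<in>carrier D. u \<otimes>\<^bsub>K\<^esub> \<phi> c = \<phi> a) \<and> map_mat e B = C"
  shows "ti M C d"
proof -
  interpret K: inf_field K by fact
  interpret M: field M by fact
  interpret p: ring_hom_cring D K \<phi> by fact
  let ?n = "qdim B" let ?B = "map_mat \<phi> B"
  have BK: "?B \<in> mats K ?n ?n" by (rule p.map_mat_mats[OF B])
  obtain f where f: "linemb K d ?n f" "\<forall>v\<in>vecs K d. qeval K ?B (f v) = \<zero>\<^bsub>K\<^esub>" using t unfolding ti_def by auto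
  obtain g p where g: "linmap K d d g" "\<forall>j<d. p j < ?n" "\<forall>v\<in>vecs K d. \<forall>j<d. f (g v) $ p j = v $ j"
    using K.linemb_echelon[OF f(1)] by blast
  have F: "linmap K d ?n (\<lambda>v. f (g v))" by (rule linmap_comp[OF linemb_linmap[OF f(1)] g(1)])
  have q: "qeval K ?B (f (g v)) = \<zero>\<^bsub>K\<^esub>" if "v \<in> vecs K d" for v using f(2) linmap_closed[OF g(1) that] by blast
  define T where "T k = f (g (uvec K d k))" for k
  have T: "T k \<in> vecs K ?n" for k unfolding T_def by (rule linmap_closed[OF F K.uvec_vecs])
  have Tp: "T k $ p j = (if j = k then \<one>\<^bsub>K\<^esub> else \<zero>\<^bsub>K\<^esub>)" if "j < d" for j k
    unfolding T_def using g(3) K.uvec_vecs that by simp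
  have bT: "bform K ?B (T j) (T k) = \<zero>\<^bsub>K\<^esub>" for j k
  proof (rule K.bform_polar[OF S])
    show "qeval K ?B (T j) = \<zero>\<^bsub>K\<^esub>" "qeval K ?B (T k) = \<zero>\<^bsub>K\<^esub>" unfolding T_def by (rule q[OF K.uvec_vecs])+
    show "qeval K ?B (vadd K (T j) (T k)) = \<zero>\<^bsub>K\<^esub>"
      unfolding T_def linmap_add[OF F K.uvec_vecs K.uvec_vecs, symmetric] by (rule q[OF K.vadd_vecs[OF K.uvec_vecs K.uvec_vecs]])
  qed (use T in simp_all)
  let ?U = "(\<lambda>(k, i). T k $ i) ` ({..<d} \<times> {..<?n})"
  have "finite ?U" by simp
  moreover have "?U \<subseteq> carrier K" by (rule image_subsetI) (use vecs_index[OF T] in auto)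
  ultimately obtain e c where e: "ring_hom_cring D M e" "\<forall>a\<in>carrier D. \<phi> a = \<zero>\<^bsub>K\<^esub> \<longrightarrow> e a = \<zero>\<^bsub>M\<^esub>"
    "c \<in> carrier D" "e c \<noteq> \<zero>\<^bsub>M\<^esub>" "\<forall>u\<in>?U. \<exists>a\<in>carrier D. u \<otimes>\<^bsub>K\<^esub> \<phi> c = \<phi> a" "map_mat e B = C"
    using pts[of ?U] by blast
  interpret e: ring_hom_cring D M e by (rule e(1))
  have "\<forall>k i. \<exists>a. k < d \<longrightarrow> i < ?n \<longrightarrow> a \<in> carrier D \<and> T k $ i \<otimes>\<^bsub>K\<^esub> \<phi> c = \<phi> a"
  proof (intro allI)
    fix k i
    show "\<exists>a. k < d \<longrightarrow> i < ?n \<longrightarrow> a \<in> carrier D \<and> T k $ i \<otimes>\<^bsub>K\<^esub> \<phi> c = \<phi> a"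
    proof (cases "k < d \<and> i < ?n")
      case True
      then have "T k $ i \<in> ?U" by (intro image_eqI[of _ _ "(k, i)"]) auto
      then show ?thesis using e(5) by blast
    qed blast
  qed
  then obtain w where w: "\<And>k i. k < d \<Longrightarrow> i < ?n \<Longrightarrow> w k i \<in> carrier D \<and> T k $ i \<otimes>\<^bsub>K\<^esub> \<phi> c = \<phi> (w k i)"
    by metis
  have pc: "\<phi> c \<in> carrier K" by (rule rhc_closed[OF \<phi> e(3)])
  define W where "W k = vec ?n (w k)" for k
  have W: "W k \<in> vecs D ?n" if "k < d" for k unfolding W_def by (rule vecs_vecI) (use w[OF that] in blast)
  \<comment> \<open>A lift is determined only modulo the kernel of \<open>\<phi>\<close>, on which
    \<open>e\<close> vanishes; hence the specialised pivot entries do not depend on the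
    lift.\<close>
  have piv: "e (w k (p j)) = (if j = k then e c else \<zero>\<^bsub>M\<^esub>)" if j: "j < d" and k: "k < d" for j k
  proof -
    have pj: "p j < ?n" using g(2) j by blast
    note wk = w[OF k pj]
    show ?thesis
    proof (cases "j = k")
      case True
      then have "\<phi> (w k (p j)) = \<phi> c" using wk Tp[OF j, of k] pc by simp
      then have "\<phi> (w k (p j) \<ominus>\<^bsub>D\<^esub> c) = \<zero>\<^bsub>K\<^esub>" using wk e(3) pc by (simp add: a_minus_def K.r_neg)
      then have "e (w k (p j) \<ominus>\<^bsub>D\<^esub> c) = \<zero>\<^bsub>M\<^esub>" using e(2) wk e(3) by simp
      then have "e (w k (p j)) \<ominus>\<^bsub>M\<^esub> e c = \<zero>\<^bsub>M\<^esub>" using wk e(3) by (simp add: a_minus_def)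
      then show ?thesis using True M.r_right_minus_eq[of "e (w k (p j))" "e c"] wk e(3) by simp
    next
      case False
      then have "\<phi> (w k (p j)) = \<zero>\<^bsub>K\<^esub>" using wk Tp[OF j, of k] pc by simp
      then show ?thesis using e(2) wk False by simp
    qed
  qed
  have pW: "map_vec \<phi> (W k) = vscale K (\<phi> c) (T k)" if k: "k < d" for k
  proof (rule eq_vecI)
    fix i assume "i < dim_vec (vscale K (\<phi> c) (T k))"
    then have i: "i < ?n" using vecs_dim[OF T] by simp
    have "T k $ i \<in> carrier K" by (rule vecs_index[OF T i])
    then show "map_vec \<phi> (W k) $ i = vscale K (\<phi> c) (T k) $ i"
      using w[OF k i] i pc vscale_index[OF T i, of "\<phi> c"] K.m_comm[of "T k $ i" "\<phi> c"] by (simp add: W_def)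
  qed (simp add: W_def vecs_dim[OF T])
  have eb: "bform M C (map_vec e (W j)) (map_vec e (W k)) = \<zero>\<^bsub>M\<^esub>" if j: "j < d" and k: "k < d" for j k
  proof -
    have "\<phi> (bform D B (W j) (W k)) = bform K ?B (vscale K (\<phi> c) (T j)) (vscale K (\<phi> c) (T k))"
      unfolding p.hom_bform[OF B W[OF j] W[OF k]] pW[OF j] pW[OF k] ..
    also have "\<dots> = \<phi> c \<otimes>\<^bsub>K\<^esub> (\<phi> c \<otimes>\<^bsub>K\<^esub> bform K ?B (T j) (T k))"
      unfolding K.bform_scale_left[OF BK pc T K.vscale_vecs[OF pc T]] K.bform_scale_right[OF BK pc T T] ..
    also have "\<dots> = \<zero>\<^bsub>K\<^esub>" unfolding bT using pc by simp
    finally have "e (bform D B (W j) (W k)) = \<zero>\<^bsub>M\<^esub>" using e(2) p.R.bform_closed[OF B W[OF j] W[OF k]] by blast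
    then show ?thesis using e.hom_bform[OF B W[OF j] W[OF k]] unfolding e(6) by simp
  qed
  define Y where "Y = mat ?n d (\<lambda>(i, k). e (w k i))"
  have ew: "e (w k i) \<in> carrier M" if "k < d" "i < ?n" for k i using w[OF that] by simp
  have Y: "Y \<in> mats M ?n d" unfolding Y_def by (rule mats_matI) (use ew in simp)
  have cY: "col Y k = map_vec e (W k)" if "k < d" for k
    by (rule eq_vecI) (use that in \<open>simp_all add: Y_def W_def\<close>)
  have CM: "C \<in> mats M ?n ?n" using e.map_mat_mats[OF B] unfolding e(6) .
  have qC: "qdim C = ?n" using e(6) by auto
  have G: "gram M C Y \<in> mats M d d" by (rule M.gram_mats[OF CM Y])
  have Gz: "gram M C Y $$ (j, k) = \<zero>\<^bsub>M\<^esub>" if "j < d" "k < d" for j k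
    using eb that cY mats_dim(2)[OF Y] by (simp add: gram_def)
  have q0: "qeval M C (apply_mat M Y v) = \<zero>\<^bsub>M\<^esub>" if v: "v \<in> vecs M d" for v
    unfolding qeval_def M.bform_gram[OF CM Y v v] by (rule M.bform_zero_mat[OF G Gz v v])
  have inj: "v = zvec M d" if v: "v \<in> vecs M d" and z: "apply_mat M Y v = zvec M ?n" for v
  proof (rule vecs_eqI[OF v M.zvec_vecs])
    fix j assume j: "j < d"
    have pj: "p j < ?n" using g(2) j by blast
    have vk: "v $ k \<in> carrier M" if "k < d" for k by (rule vecs_index[OF v that])
    have ec: "e c \<in> carrier M" by (rule rhc_closed[OF e(1) e(3)])
    have "\<zero>\<^bsub>M\<^esub> = apply_mat M Y v $ p j" unfolding z using pj by simp
    also have "\<dots> = (\<Oplus>\<^bsub>M\<^esub>k\<in>{..<d}. Y $$ (p j, k) \<otimes>\<^bsub>M\<^esub> v $ k)" by (rule apply_mat_index[OF Y pj])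
    also have "\<dots> = (\<Oplus>\<^bsub>M\<^esub>k\<in>{..<d}. if k = j then e c \<otimes>\<^bsub>M\<^esub> v $ k else \<zero>\<^bsub>M\<^esub>)"
      by (rule M.finsum_cong') (use pj vk piv[OF j] ec in \<open>auto simp: Y_def Pi_def\<close>)
    also have "\<dots> = e c \<otimes>\<^bsub>M\<^esub> v $ j"
      using M.finsum_delta[of "{..<d}" "\<lambda>k. e c \<otimes>\<^bsub>M\<^esub> v $ k" j] vk ec j by simp
    finally have "e c \<otimes>\<^bsub>M\<^esub> v $ j = \<zero>\<^bsub>M\<^esub>" by simp
    then show "v $ j = zvec M d $ j" using M.integral[OF _ ec vk[OF j]] e(4) j by simp
  qed
  have "linemb M d ?n (apply_mat M Y)" unfolding linemb_def using M.linmap_apply_mat[OF Y] inj by blast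
  then show ?thesis unfolding ti_def qC using q0 by blast
qed

section \<open>Points of an isotropic quadric\<close>

text \<open>The second intersection with the quadric of the line through the isotropic vector \<open>V\<close> in the
  direction \<open>d\<close>, up to the factor \<open>l\<close>.\<close>

definition secant :: "('a, 'b) ring_scheme \<Rightarrow> 'a mat \<Rightarrow> 'a vec \<Rightarrow> 'a \<Rightarrow> 'a vec \<Rightarrow> 'a vec" where
  "secant R C V l d = vscale R l (vadd R (vscale R (qeval R C d) V)
     (vscale R (\<ominus>\<^bsub>R\<^esub> \<one>\<^bsub>R\<^esub> \<otimes>\<^bsub>R\<^esub> (bform R C d V \<oplus>\<^bsub>R\<^esub> bform R C d V)) d))"

context cring
begin

lemma secant_vecs:
  assumes C: "C \<in> mats R n n" and V: "V \<in> vecs R n" and d: "d \<in> vecs R n" and l: "l \<in> carrier R"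
  shows "secant R C V l d \<in> vecs R n"
  unfolding secant_def
  using qeval_closed[OF C d] bform_closed[OF C d V] V d l by (intro vscale_vecs vadd_vecs) simp_all

lemma secant_index:
  assumes C: "C \<in> mats R n n" and V: "V \<in> vecs R n" and d: "d \<in> vecs R n" and i: "i < n"
  shows "secant R C V l d $ i =
    l \<otimes> (qeval R C d \<otimes> V $ i \<oplus> (\<ominus> \<one> \<otimes> (bform R C d V \<oplus> bform R C d V)) \<otimes> d $ i)"
  unfolding secant_def using i vecs_dim[OF V] vecs_dim[OF d] by simp

text \<open>With a = q(d), b = b(d, V) and c = -2b, the value at aV + cd is c^2 a + 2acb = 4ab^2 -
  4ab^2.\<close>

lemma secant_isotropic:
  assumes C: "sym_mat R C" and V: "V \<in> vecs R (qdim C)" "qeval R C V = \<zero>" and d: "d \<in> vecs R (qdim C)" and l: "l \<in> carrier R"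
  shows "qeval R C (secant R C V l d) = \<zero>"
proof -
  note M = sym_mat_mats[OF C]
  define a where "a = qeval R C d"
  define b where "b = bform R C d V"
  define c where "c = \<ominus> \<one> \<otimes> (b \<oplus> b)"
  have ab: "a \<in> carrier R" "b \<in> carrier R" unfolding a_def b_def using qeval_closed[OF M d] bform_closed[OF M d V(1)] by simp_all
  then have c: "c \<in> carrier R" unfolding c_def by simp
  have vV: "vscale R a V \<in> vecs R (qdim C)" "vscale R c d \<in> vecs R (qdim C)" using ab c V d by simp_all
  have "bform R C (vscale R a V) (vscale R c d) = a \<otimes> (c \<otimes> b)"
    unfolding bform_scale_left[OF M ab(1) V(1) vV(2)] bform_scale_right[OF M c d V(1)] b_def bform_commute[OF C V(1) d] ..
  then have "qeval R C (vadd R (vscale R a V) (vscale R c d)) = a \<otimes> a \<otimes> \<zero> \<oplus> c \<otimes> c \<otimes> a \<oplus> (a \<otimes> (c \<otimes> b) \<oplus> a \<otimes> (c \<otimes> b))"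
    unfolding qeval_add[OF C vV] qeval_scale[OF M ab(1) V(1)] qeval_scale[OF M c d] V(2) by (simp add: a_def)
  also have "\<dots> = \<zero>" unfolding c_def using ab by algebra
  finally have z: "qeval R C (vadd R (vscale R a V) (vscale R c d)) = \<zero>" .
  show ?thesis
    unfolding secant_def a_def[symmetric] b_def[symmetric] c_def[symmetric] qeval_scale[OF M l vadd_vecs[OF vV]] z using l by simp
qed

text \<open>The line through \<open>V\<close> and \<open>z\<close> meets the quadric again in
  \<open>z\<close>. For d = z - V both q(d) and -2 b(d, V) equal -2 b(z, V), so the unscaled point
  is -2 b(z, V) z, and \<open>l\<close> removes the factor. Every isotropic vector that is not
  orthogonal to \<open>V\<close> is reached in this way.\<close>

lemma secant_hits:
  assumes C: "sym_mat R C" and V: "V \<in> vecs R (qdim C)" "qeval R C V = \<zero>" and z: "z \<in> vecs R (qdim C)" "qeval R C z = \<zero>"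
    and l: "l \<in> carrier R" "l \<otimes> (\<ominus> \<one> \<otimes> (bform R C z V \<oplus> bform R C z V)) = \<one>"
  shows "secant R C V l (vadd R z (vscale R (\<ominus> \<one>) V)) = z"
proof -
  note M = sym_mat_mats[OF C]
  let ?d = "vadd R z (vscale R (\<ominus> \<one>) V)" let ?b = "bform R C z V"
  have m: "\<ominus> \<one> \<in> carrier R" by simp
  have mV: "vscale R (\<ominus> \<one>) V \<in> vecs R (qdim C)" using V by simp
  have d: "?d \<in> vecs R (qdim C)" using z mV by simp
  have b: "?b \<in> carrier R" by (rule bform_closed[OF M z(1) V(1)])
  have qd: "qeval R C ?d = \<ominus> \<one> \<otimes> (?b \<oplus> ?b)"
    unfolding qeval_add[OF C z(1) mV] qeval_scale[OF M m V(1)] V(2) z(2) bform_scale_right[OF M m V(1) z(1)]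
    using b by algebra
  have bd: "bform R C ?d V = ?b"
    unfolding bform_add_left[OF M z(1) mV V(1)] bform_scale_left[OF M m V(1) V(1)]
    using V(2)[unfolded qeval_def] b by simp
  show ?thesis
  proof (rule vecs_eqI[OF secant_vecs[OF M V(1) d l(1)] z(1)])
    fix i assume i: "i < qdim C"
    have c: "V $ i \<in> carrier R" "z $ i \<in> carrier R" using vecs_index V(1) z(1) i by blast+
    have di: "?d $ i = z $ i \<oplus> \<ominus> \<one> \<otimes> V $ i"
      using i vecs_dim[OF z(1)] vecs_dim[OF V(1)] by simp
    define k where "k = \<ominus> \<one> \<otimes> (?b \<oplus> ?b)"
    have k: "k \<in> carrier R" "l \<otimes> k = \<one>" unfolding k_def using b l(2) by simp_all
    have "secant R C V l ?d $ i = l \<otimes> (k \<otimes> V $ i \<oplus> k \<otimes> (z $ i \<oplus> \<ominus> \<one> \<otimes> V $ i))"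
      unfolding secant_index[OF M V(1) d i] qd bd di k_def ..
    also have "\<dots> = (l \<otimes> k) \<otimes> z $ i" using c l(1) k(1) by algebra
    finally show "secant R C V l ?d $ i = z $ i" unfolding k(2) using c by simp
  qed
qed

text \<open>When the direction and the scale move along lines, the secant points form a polynomial
  curve on the quadric; \<open>curve_point\<close> uses it to leave the quadratic extension.\<close>

lemma secant_upfun:
  assumes C: "sym_mat R C" and V: "V \<in> vecs R (qdim C)" and d: "d1 \<in> vecs R (qdim C)" "d2 \<in> vecs R (qdim C)"
    and l: "l1 \<in> carrier R" "l2 \<in> carrier R" and i: "i < qdim C"
  shows "upfun R (\<lambda>s. secant R C V (l1 \<oplus> s \<otimes> l2) (vadd R d1 (vscale R s d2)) $ i)"
proof -
  note M = sym_mat_mats[OF C]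
  have Vi: "V $ i \<in> carrier R" "d1 $ i \<in> carrier R" "d2 $ i \<in> carrier R" using vecs_index V d i by blast+
  note U = upfun_add upfun_const upfun_mult upfun_id
  have sd: "vscale R s d2 \<in> vecs R (qdim C)" if "s \<in> carrier R" for s using d(2) that by simp
  have lin: "upfun R (\<lambda>s. a \<oplus> s \<otimes> b)" if "a \<in> carrier R" "b \<in> carrier R" for a b
    by (rule upfun_add[OF upfun_const[OF that(1)] upfun_mult[OF upfun_id upfun_const[OF that(2)]]])
  have qc: "qeval R C d1 \<in> carrier R" "qeval R C d2 \<in> carrier R" "bform R C d1 d2 \<in> carrier R"
    "bform R C d1 V \<in> carrier R" "bform R C d2 V \<in> carrier R"
    using qeval_closed[OF M] bform_closed[OF M] d V by simp_all
  have q: "upfun R (\<lambda>s. qeval R C (vadd R d1 (vscale R s d2)))"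
  proof (rule upfun_cong)
    show "upfun R (\<lambda>s. qeval R C d1 \<oplus> s \<otimes> s \<otimes> qeval R C d2 \<oplus> (s \<otimes> bform R C d1 d2 \<oplus> s \<otimes> bform R C d1 d2))"
      by (rule upfun_add[OF upfun_add[OF upfun_const[OF qc(1)] upfun_mult[OF upfun_mult[OF upfun_id upfun_id] upfun_const[OF qc(2)]]]
            upfun_add[OF upfun_mult[OF upfun_id upfun_const[OF qc(3)]] upfun_mult[OF upfun_id upfun_const[OF qc(3)]]]])
    fix s assume s: "s \<in> carrier R"
    show "qeval R C d1 \<oplus> s \<otimes> s \<otimes> qeval R C d2 \<oplus> (s \<otimes> bform R C d1 d2 \<oplus> s \<otimes> bform R C d1 d2) = qeval R C (vadd R d1 (vscale R s d2))"
      unfolding qeval_add[OF C d(1) sd[OF s]] qeval_scale[OF M s d(2)] bform_scale_right[OF M s d(2) d(1)] ..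
  qed
  have b: "upfun R (\<lambda>s. bform R C (vadd R d1 (vscale R s d2)) V)"
  proof (rule upfun_cong[OF lin[OF qc(4,5)]])
    fix s assume s: "s \<in> carrier R"
    show "bform R C d1 V \<oplus> s \<otimes> bform R C d2 V = bform R C (vadd R d1 (vscale R s d2)) V"
      unfolding bform_add_left[OF M d(1) sd[OF s] V] bform_scale_left[OF M s d(2) V] ..
  qed
  have m: "\<ominus> \<one> \<in> carrier R" by simp
  show ?thesis
  proof (rule upfun_cong)
    show "upfun R (\<lambda>s. (l1 \<oplus> s \<otimes> l2) \<otimes> (qeval R C (vadd R d1 (vscale R s d2)) \<otimes> V $ i \<oplus>
      (\<ominus> \<one> \<otimes> (bform R C (vadd R d1 (vscale R s d2)) V \<oplus> bform R C (vadd R d1 (vscale R s d2)) V)) \<otimes> (d1 $ i \<oplus> s \<otimes> d2 $ i)))"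
      by (rule upfun_mult[OF lin[OF l] upfun_add[OF upfun_mult[OF q upfun_const[OF Vi(1)]]
            upfun_mult[OF upfun_scale[OF m upfun_add[OF b b]] lin[OF Vi(2,3)]]]])
    fix s assume s: "s \<in> carrier R"
    have "vadd R d1 (vscale R s d2) $ i = d1 $ i \<oplus> s \<otimes> d2 $ i"
      using i vecs_dim[OF d(1)] vecs_dim[OF d(2)] by simp
    then show "(l1 \<oplus> s \<otimes> l2) \<otimes> (qeval R C (vadd R d1 (vscale R s d2)) \<otimes> V $ i \<oplus>
      (\<ominus> \<one> \<otimes> (bform R C (vadd R d1 (vscale R s d2)) V \<oplus> bform R C (vadd R d1 (vscale R s d2)) V)) \<otimes> (d1 $ i \<oplus> s \<otimes> d2 $ i)) =
      secant R C V (l1 \<oplus> s \<otimes> l2) (vadd R d1 (vscale R s d2)) $ i"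
      unfolding secant_index[OF M V vadd_vecs[OF d(1) sd[OF s]] i] by simp
  qed
qed

end

context ring_hom_cring
begin

lemma hom_secant:
  assumes C: "C \<in> mats R n n" and V: "V \<in> vecs R n" and d: "d \<in> vecs R n" and l: "l \<in> carrier R"
  shows "map_vec h (secant R C V l d) = secant S (map_mat h C) (map_vec h V) (h l) (map_vec h d)"
proof (rule eq_vecI)
  note C' = map_mat_mats[OF C] and V' = map_vec_vecs[OF V] and d' = map_vec_vecs[OF d]
  note dm = vecs_dim[OF R.secant_vecs[OF C V d l]] vecs_dim[OF S.secant_vecs[OF C' V' d' hom_closed[OF l]]]
  show "dim_vec (map_vec h (secant R C V l d)) = dim_vec (secant S (map_mat h C) (map_vec h V) (h l) (map_vec h d))"
    using dm by simp
  fix i assume "i < dim_vec (secant S (map_mat h C) (map_vec h V) (h l) (map_vec h d))"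
  then have i: "i < n" using dm by simp
  have c: "V $ i \<in> carrier R" "d $ i \<in> carrier R" using vecs_index V d i by blast+
  have ix: "map_vec h V $ i = h (V $ i)" "map_vec h d $ i = h (d $ i)" using i vecs_dim[OF V] vecs_dim[OF d] by simp_all
  have "map_vec h (secant R C V l d) $ i = h (secant R C V l d $ i)" using i dm by simp
  also have "\<dots> = secant S (map_mat h C) (map_vec h V) (h l) (map_vec h d) $ i"
    unfolding R.secant_index[OF C V d i] S.secant_index[OF C' V' d' i] ix
      hom_qeval[OF C d, symmetric] hom_bform[OF C d V, symmetric]
    using c l R.qeval_closed[OF C d] R.bform_closed[OF C d V] by simp
  finally show "map_vec h (secant R C V l d) $ i = secant S (map_mat h C) (map_vec h V) (h l) (map_vec h d) $ i" .
qed

lemma pev_upfun: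
  assumes f: "f \<in> R.indexed_pset I (carrier R)" and Xs: "\<And>i. i \<in> I \<Longrightarrow> upfun S (\<lambda>s. Xs s i)"
    and r: "\<And>s. s \<in> carrier S \<Longrightarrow> range (Xs s) \<subseteq> carrier S"
  shows "upfun S (\<lambda>s. pev R S h (Xs s) f)"
  using f
proof (induction rule: R.indexed_pset.induct)
  case (indexed_const k)
  show ?case
    by (rule S.upfun_cong[OF S.upfun_const[OF hom_closed[OF indexed_const]]], rule pev_const[OF indexed_const r, symmetric])
next
  case (indexed_padd P Q)
  show ?case
    by (rule S.upfun_cong[OF S.upfun_add[OF indexed_padd(3,4)]], rule pev_padd[OF indexed_padd(1,2) r, symmetric])
next
  case (indexed_pmult P i)
  show ?case
    by (rule S.upfun_cong[OF S.upfun_mult[OF indexed_pmult(3) Xs[OF indexed_pmult(2)]]],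
      rule pev_pmult[OF indexed_pmult(1) r indexed_pmult(2), symmetric])
qed

end

lemma (in inf_field) E_decomp:
  assumes "\<sigma> \<in> carrier R" "\<beta> \<in> carrier R" and E: "E = quad_ext R \<sigma> \<beta>" and z: "z \<in> carrier E"
  shows "qemb R (qre z) \<oplus>\<^bsub>E\<^esub> qc \<zero> \<one> \<otimes>\<^bsub>E\<^esub> qemb R (qim z) = z"
proof -
  note e = E_mult[OF assms(1,2) E] E_add[OF assms(1,2) E] qemb_simps[OF assms(1,2) E]
  note c = conjunct1[OF iffD1[OF E_carrier[OF assms(1,2) E] z]] conjunct2[OF iffD1[OF E_carrier[OF assms(1,2) E] z]]
  show ?thesis by (rule qc_eqI; simp add: e assms(1,2) c)
qed

context inf_field_hom
begin

text \<open>Descent of a point from the quadratic extension \<open>E\<close> to \<open>S\<close>. By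
  \<open>secant_hits\<close> the point \<open>z\<close> is the secant point for a direction d1 + T
  d2 and a scale l1 + T l2 with components over \<open>S\<close>. Replacing the element T by a
  variable t gives a polynomial curve on the quadric. Along it \<open>f\<close> is nonzero at t = T,
  so it has finitely many zeros, and the infinite field \<open>S\<close> contains a parameter that
  avoids them; its point has coordinates in \<open>S\<close>.\<close>

lemma curve_point:
  assumes C: "sym_mat S C" and V: "V \<in> vecs S (qdim C)" "qeval S C V = \<zero>\<^bsub>S\<^esub>"
    and s: "\<sigma> \<in> carrier S" "\<beta> \<in> carrier S" and E: "E = quad_ext S \<sigma> \<beta>" and irr: "irred S \<sigma> \<beta>"
    and z: "range z \<subseteq> carrier E" "qeval E (map_mat (qemb S) C) (vec (qdim C) z) = \<zero>\<^bsub>E\<^esub>"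
    and nz: "bform E (map_mat (qemb S) C) (vec (qdim C) z) (map_vec (qemb S) V) \<noteq> \<zero>\<^bsub>E\<^esub>"
    and f: "f \<in> R.indexed_pset {..<qdim C} (carrier R)" "pev R E (\<lambda>a. qemb S (h a)) z f \<noteq> \<zero>\<^bsub>E\<^esub>"
  shows "\<exists>x. range x \<subseteq> carrier S \<and> qeval S C (vec (qdim C) x) = \<zero>\<^bsub>S\<^esub> \<and> pev R S h x f \<noteq> \<zero>\<^bsub>S\<^esub>"
proof -
  have EH: "inf_field_hom S E (qemb S)" by (rule S.E_inf_field_hom[OF s E irr])
  interpret E: inf_field_hom S E "qemb S" by (rule EH)
  let ?g = "qemb S" let ?n = "qdim C" let ?C = "map_mat ?g C" let ?V = "map_vec ?g V" let ?z = "vec ?n z"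
  have CS: "C \<in> mats S ?n ?n" by (rule sym_mat_mats[OF C])
  have CE: "sym_mat E ?C" by (rule E.hom_sym_mat[OF C])
  have qn: "qdim ?C = ?n" by simp
  have CE': "?C \<in> mats E ?n ?n" using sym_mat_mats[OF CE] unfolding qn .
  have V': "?V \<in> vecs E ?n" by (rule E.map_vec_vecs[OF V(1)])
  have qV: "qeval E ?C ?V = \<zero>\<^bsub>E\<^esub>"
    unfolding E.hom_qeval[OF CS V(1), symmetric] V(2) by (rule rhc_zero[OF E.ring_hom_cring_axioms])
  have zv: "?z \<in> vecs E ?n" by (rule vecs_vecI) (use z(1) in blast)
  define \<kappa> where "\<kappa> = bform E ?C ?z ?V"
  have \<kappa>: "\<kappa> \<in> carrier E" unfolding \<kappa>_def by (rule E.S.bform_closed[OF CE' zv V'])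
  \<comment> \<open>The unscaled secant point is \<open>k\<close> times \<open>z\<close>; the scale
    \<open>l\<close> below is the inverse of this factor.\<close>
  define k where "k = \<ominus>\<^bsub>E\<^esub> \<one>\<^bsub>E\<^esub> \<otimes>\<^bsub>E\<^esub> (\<kappa> \<oplus>\<^bsub>E\<^esub> \<kappa>)"
  have k: "k \<in> carrier E" "k \<noteq> \<zero>\<^bsub>E\<^esub>"
  proof -
    show "k \<in> carrier E" unfolding k_def using \<kappa> by simp
    have "\<kappa> \<oplus>\<^bsub>E\<^esub> \<kappa> \<noteq> \<zero>\<^bsub>E\<^esub>" using E.S.double_zero[OF \<kappa>] nz unfolding \<kappa>_def by metis
    moreover have "\<ominus>\<^bsub>E\<^esub> \<one>\<^bsub>E\<^esub> \<noteq> \<zero>\<^bsub>E\<^esub>"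
    proof
      assume m: "\<ominus>\<^bsub>E\<^esub> \<one>\<^bsub>E\<^esub> = \<zero>\<^bsub>E\<^esub>"
      have "\<one>\<^bsub>E\<^esub> = \<ominus>\<^bsub>E\<^esub> (\<ominus>\<^bsub>E\<^esub> \<one>\<^bsub>E\<^esub>)" by simp
      also have "\<dots> = \<zero>\<^bsub>E\<^esub>" unfolding m by simp
      finally show False using E.S.one_not_zero by simp
    qed
    ultimately show "k \<noteq> \<zero>\<^bsub>E\<^esub>" unfolding k_def using \<kappa> by (intro E.S.mult_nonzero) simp_all
  qed
  define l where "l = inv\<^bsub>E\<^esub> k"
  have l: "l \<in> carrier E" "l \<otimes>\<^bsub>E\<^esub> k = \<one>\<^bsub>E\<^esub>" unfolding l_def using k by (auto simp: E.S.field_Units)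
  define d where "d = vadd E ?z (vscale E (\<ominus>\<^bsub>E\<^esub> \<one>\<^bsub>E\<^esub>) ?V)"
  have d: "d \<in> vecs E ?n" unfolding d_def by (rule E.S.vadd_vecs[OF zv E.S.vscale_vecs[OF _ V']]) simp
  have hit: "secant E ?C ?V l d = ?z"
    unfolding d_def
    by (rule E.S.secant_hits[OF CE, unfolded qn, OF V' qV zv z(2) l(1)]) (use l(2) in \<open>simp add: k_def \<kappa>_def\<close>)
  define T where "T = qc \<zero>\<^bsub>S\<^esub> \<one>\<^bsub>S\<^esub>"
  note ec = S.E_carrier[OF s E]
  have T: "T \<in> carrier E" unfolding T_def ec by simp
  note l12 = conjunct1[OF iffD1[OF ec l(1)]] conjunct2[OF iffD1[OF ec l(1)]]
  have di: "qre (d $ i) \<in> carrier S" "qim (d $ i) \<in> carrier S" if "i < ?n" for i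
    using iffD1[OF ec vecs_index[OF d that]] by simp_all
  define d1 where "d1 = vec ?n (\<lambda>i. qre (d $ i))"
  define d2 where "d2 = vec ?n (\<lambda>i. qim (d $ i))"
  have d12: "d1 \<in> vecs S ?n" "d2 \<in> vecs S ?n" unfolding d1_def d2_def by (rule vecs_vecI, rule di, assumption)+
  have gd: "map_vec ?g d1 \<in> vecs E ?n" "map_vec ?g d2 \<in> vecs E ?n" by (rule E.map_vec_vecs, rule d12)+
  have gl: "?g (qre l) \<in> carrier E" "?g (qim l) \<in> carrier E" by (rule rhc_closed[OF E.ring_hom_cring_axioms], rule l12)+
  define Dv where "Dv t = vadd E (map_vec ?g d1) (vscale E t (map_vec ?g d2))" for t
  define L where "L t = ?g (qre l) \<oplus>\<^bsub>E\<^esub> t \<otimes>\<^bsub>E\<^esub> ?g (qim l)" for t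
  have Dv: "Dv t \<in> vecs E ?n" if "t \<in> carrier E" for t
    unfolding Dv_def by (rule E.S.vadd_vecs[OF gd(1) E.S.vscale_vecs[OF that gd(2)]])
  have L: "L t \<in> carrier E" if "t \<in> carrier E" for t unfolding L_def using gl that by simp
  have LT: "L T = l" unfolding L_def T_def by (rule S.E_decomp[OF s E l(1)])
  have DT: "Dv T = d"
  proof (rule vecs_eqI[OF Dv[OF T] d])
    fix i assume i: "i < ?n"
    have "Dv T $ i = ?g (qre (d $ i)) \<oplus>\<^bsub>E\<^esub> T \<otimes>\<^bsub>E\<^esub> ?g (qim (d $ i))"
      unfolding Dv_def using i by (simp add: d1_def d2_def)
    also have "\<dots> = d $ i" unfolding T_def by (rule S.E_decomp[OF s E vecs_index[OF d i]])
    finally show "Dv T $ i = d $ i" .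
  qed
  define Xs where "Xs t i = (if i < ?n then secant E ?C ?V (L t) (Dv t) $ i else \<zero>\<^bsub>E\<^esub>)" for t i
  have Xs: "range (Xs t) \<subseteq> carrier E" if t: "t \<in> carrier E" for t
  proof (rule image_subsetI)
    fix i
    show "Xs t i \<in> carrier E" unfolding Xs_def using vecs_index[OF E.S.secant_vecs[OF CE' V' Dv[OF t] L[OF t]]] by simp
  qed
  note gh = ring_hom_cring_comp[OF ring_hom_cring_axioms E.ring_hom_cring_axioms]
  let ?gh = "\<lambda>a. ?g (h a)"
  have XT: "pev R E ?gh (Xs T) f = pev R E ?gh z f"
    by (rule ring_hom_cring.pev_cong[OF gh f(1) Xs[OF T] z(1)]) (simp add: Xs_def LT DT hit)
  have up: "upfun E (\<lambda>t. Xs t i)" if i: "i < ?n" for i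
    unfolding Xs_def L_def Dv_def
    using E.S.secant_upfun[OF CE, unfolded qn, OF V' gd gl i] i by simp
  have U: "upfun E (\<lambda>t. pev R E ?gh (Xs t) f)"
    by (rule ring_hom_cring.pev_upfun[OF gh f(1) up Xs]) simp_all
  have fin: "finite {t \<in> carrier E. pev R E ?gh (Xs t) f = \<zero>\<^bsub>E\<^esub>}"
    by (rule E.S.upfun_zeros_finite[OF U T]) (use f(2) XT in simp)
  have "inj_on ?g (carrier S)" by (rule inj_onI) (rule E.hom_inj)
  then have "infinite (?g ` carrier S)" using S.infinite_carrier finite_imageD by blast
  then have "infinite (?g ` carrier S - {t \<in> carrier E. pev R E ?gh (Xs t) f = \<zero>\<^bsub>E\<^esub>})" using fin by (rule Diff_infinite_finite[rotated])
  then obtain t where "t \<in> ?g ` carrier S - {t \<in> carrier E. pev R E ?gh (Xs t) f = \<zero>\<^bsub>E\<^esub>}"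
    using infinite_imp_nonempty by blast
  then obtain m where m: "m \<in> carrier S" "?g m \<in> ?g ` carrier S - {t \<in> carrier E. pev R E ?gh (Xs t) f = \<zero>\<^bsub>E\<^esub>}" by blast
  have gm: "?g m \<in> carrier E" by (rule rhc_closed[OF E.ring_hom_cring_axioms m(1)])
  then have mz: "pev R E ?gh (Xs (?g m)) f \<noteq> \<zero>\<^bsub>E\<^esub>" using m(2) by simp
  define ds where "ds = vadd S d1 (vscale S m d2)"
  define ls where "ls = qre l \<oplus>\<^bsub>S\<^esub> m \<otimes>\<^bsub>S\<^esub> qim l"
  have ds: "ds \<in> vecs S ?n" unfolding ds_def by (rule S.vadd_vecs[OF d12(1) S.vscale_vecs[OF m(1) d12(2)]])
  have ls: "ls \<in> carrier S" unfolding ls_def using l12 m(1) by simp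
  have sv: "secant S C V ls ds \<in> vecs S ?n" by (rule S.secant_vecs[OF CS V(1) ds ls])
  define x where "x i = (if i < ?n then secant S C V ls ds $ i else \<zero>\<^bsub>S\<^esub>)" for i
  have xr: "range x \<subseteq> carrier S"
  proof (rule image_subsetI)
    fix i show "x i \<in> carrier S" unfolding x_def using vecs_index[OF sv] by simp
  qed
  have gds: "map_vec ?g ds = Dv (?g m)"
  proof (rule vecs_eqI[OF E.map_vec_vecs[OF ds] Dv[OF gm]])
    fix i assume i: "i < ?n"
    have c: "d1 $ i \<in> carrier S" "d2 $ i \<in> carrier S" using vecs_index d12 i by blast+
    have "map_vec ?g ds $ i = ?g (ds $ i)" using i vecs_dim[OF ds] by simp
    also have "ds $ i = d1 $ i \<oplus>\<^bsub>S\<^esub> m \<otimes>\<^bsub>S\<^esub> d2 $ i" unfolding ds_def using i vecs_dim[OF d12(1)] vecs_dim[OF d12(2)] by simp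
    also have "?g \<dots> = Dv (?g m) $ i"
      unfolding Dv_def using c m(1) i vecs_dim[OF d12(1)] vecs_dim[OF d12(2)] by simp
    finally show "map_vec ?g ds $ i = Dv (?g m) $ i" .
  qed
  have gls: "?g ls = L (?g m)" unfolding ls_def L_def using l12 m(1) by simp
  have gx: "Xs (?g m) = (\<lambda>i. ?g (x i))"
  proof (rule ext)
    fix i
    have "?g (secant S C V ls ds $ i) = secant E ?C ?V (L (?g m)) (Dv (?g m)) $ i" if i: "i < ?n"
      using arg_cong[OF E.hom_secant[OF CS V(1) ds ls], of "\<lambda>v. v $ i"] i vecs_dim[OF sv] unfolding gls gds by simp
    then show "Xs (?g m) i = ?g (x i)" unfolding Xs_def x_def using rhc_zero[OF E.ring_hom_cring_axioms] by simp
  qed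
  have "pev R E ?gh (Xs (?g m)) f = ?g (pev R S h x f)"
    unfolding gx by (rule pev_comp[OF E.ring_hom_cring_axioms xr f(1)])
  then have "pev R S h x f \<noteq> \<zero>\<^bsub>S\<^esub>" using mz rhc_zero[OF E.ring_hom_cring_axioms] by metis
  moreover have "vec ?n x = secant S C V ls ds" by (rule eq_vecI) (use vecs_dim[OF sv] in \<open>simp_all add: x_def\<close>)
  then have "qeval S C (vec ?n x) = \<zero>\<^bsub>S\<^esub>" using S.secant_isotropic[OF C V ds ls] by simp
  ultimately show ?thesis using xr by blast
qed

end

context aform
begin

lemma K_quad_form:
  assumes "inf_field_hom R S h" shows "quad_form S (map_mat h A)"
proof -
  obtain vs where "orthl R A vs" "length vs = qdim A"
    using diagonalisation[OF anisotropic_quad_form[OF sym an]] by blast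
  then show ?thesis using inf_field_hom.hom_wiso(2)[OF assms sym] by blast
qed

text \<open>Take the points over an affine point \<open>y\<close> over \<open>R\<close> at which the
  witness \<open>p\<close> of \<open>f\<close> is nonzero. If the quadratic equation for the first
  coordinate has a root in \<open>S\<close>, this already is a point over \<open>S\<close>;
  otherwise it is a point over a quadratic extension and \<open>curve_point\<close> descends it by
  secants through \<open>v\<close>. The descent requires that the point is not orthogonal to
  \<open>v\<close>, and this restricts the choice of \<open>y\<close>.\<close>

lemma point:
  assumes H: "inf_field_hom R S h" and f: "f \<in> carrier MP" "f \<notin> J"
    and v: "v \<in> vecs S n" "v \<noteq> zvec S n" "qeval S (map_mat h A) v = \<zero>\<^bsub>S\<^esub>"
  shows "\<exists>x. range x \<subseteq> carrier S \<and> pev R S h x Q = \<zero>\<^bsub>S\<^esub> \<and> pev R S h x f \<noteq> \<zero>\<^bsub>S\<^esub>"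
proof -
  interpret H: inf_field_hom R S h by fact
  note h = H.ring_hom_cring_axioms
  let ?C = "map_mat h A"
  have C: "sym_mat S ?C" by (rule H.hom_sym_mat[OF sym])
  have qC: "qdim ?C = n" by simp
  have CS: "?C \<in> mats S n n" using sym_mat_mats[OF C] unfolding qC .
  obtain w where w: "w \<in> vecs S n" "bform S ?C v w \<noteq> \<zero>\<^bsub>S\<^esub>"
    using K_quad_form[OF H] v(1,2) unfolding quad_form_def qC by blast
  have lf: "linfun S n (\<lambda>w. bform S ?C w v)" by (rule H.S.linfun_bform_left[OF CS v(1)])
  have "\<exists>i<n. bform S ?C (uvec S n i) v \<noteq> \<zero>\<^bsub>S\<^esub>"
  proof (rule ccontr)
    assume "\<not> ?thesis"
    then have z: "bform S ?C (uvec S n i) v = \<zero>\<^bsub>S\<^esub>" if "i < n" for i using that by blast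
    have "bform S ?C w v = (\<Oplus>\<^bsub>S\<^esub>j\<in>{..<n}. w $ j \<otimes>\<^bsub>S\<^esub> bform S ?C (uvec S n j) v)"
      by (rule H.S.linfun_expand[OF lf w(1)])
    also have "\<dots> = \<zero>\<^bsub>S\<^esub>" by (rule H.S.add.finprod_one_eqI) (use z vecs_index[OF w(1)] in simp)
    finally show False using w(2) H.S.bform_commute[OF C, unfolded qC, OF v(1) w(1)] by simp
  qed
  then obtain i where i: "i < n" "bform S ?C (uvec S n i) v \<noteq> \<zero>\<^bsub>S\<^esub>" by blast
  obtain \<sigma> \<beta> where red: "reduces \<sigma> \<beta>" using ex_reduces by blast
  have s: "\<sigma> \<in> PY" "\<beta> \<in> PY" using red unfolding reduces_def by simp_all
  obtain a b k p u where F: "a \<in> PY" "b \<in> PY" "k \<in> carrier MP" "f = a \<oplus>\<^bsub>MP\<^esub> X0 \<otimes>\<^bsub>MP\<^esub> b \<oplus>\<^bsub>MP\<^esub> k \<otimes>\<^bsub>MP\<^esub> Q"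
    "p = a \<or> p = b" "range u \<subseteq> carrier R" "ev u p \<noteq> \<zero>" using not_J[OF red f] by (elim exE conjE)
  have pP: "p \<in> PY" using F(1,2,5) by auto
  note evc = ring_hom_cring.pev_closed[OF id_hom]
  note lp = inf_field_hom.linepoly_pev[OF H pP]
  have nzu: "h (ev u p) \<noteq> \<zero>\<^bsub>S\<^esub>" using H.hom_zero_iff[OF evc[OF pP F(6)]] F(7) by simp
  \<comment> \<open>The point over \<open>y\<close> is T times the first unit vector plus
    \<open>y0 y\<close>. Its product with \<open>v\<close> is therefore \<open>bl y\<close> plus T
    times \<open>?bz\<close>.\<close>
  define y0 where "y0 y = vec n (\<lambda>i. if i = 0 then \<zero>\<^bsub>S\<^esub> else h (y i))" for y
  have y0: "y0 y \<in> vecs S n" if y: "range y \<subseteq> carrier R" for y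
    unfolding y0_def
  proof (rule vecs_vecI)
    fix i show "(if i = 0 then \<zero>\<^bsub>S\<^esub> else h (y i)) \<in> carrier S" using rhc_closed[OF h subsetD[OF y rangeI]] by simp
  qed
  define bl where "bl y = bform S ?C (y0 y) v" for y
  have blc: "bl y \<in> carrier S" if "range y \<subseteq> carrier R" for y
    unfolding bl_def by (rule linfun_closed[OF lf y0[OF that]])
  let ?bz = "bform S ?C (uvec S n 0) v"
  have b0: "?bz \<in> carrier S" by (rule linfun_closed[OF lf H.S.uvec_vecs])
  \<comment> \<open>If \<open>?bz\<close> is nonzero, non-orthogonality holds for every
    \<open>y\<close>, and \<open>y 1\<close> is made nonzero for \<open>irred_y\<close>. Otherwise a
    later unit vector is not orthogonal to \<open>v\<close>, so the linear function
    \<open>bl\<close> is not identically zero; where it is nonzero, some coordinate of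
    \<open>y\<close> after the first is nonzero as well.\<close>
  have "\<exists>y. range y \<subseteq> carrier R \<and> h (ev y p) \<noteq> \<zero>\<^bsub>S\<^esub> \<and> (\<exists>j. 1 \<le> j \<and> j < n \<and> y j \<noteq> \<zero>) \<and> (?bz \<noteq> \<zero>\<^bsub>S\<^esub> \<or> bl y \<noteq> \<zero>\<^bsub>S\<^esub>)"
  proof (cases "?bz = \<zero>\<^bsub>S\<^esub>")
    case False
    have on: "range (\<lambda>_::nat. \<one>) \<subseteq> carrier R" by (rule image_subsetI) simp
    have h1: "h \<one> \<noteq> \<zero>\<^bsub>S\<^esub>" using rhc_one[OF h] H.S.one_not_zero by simp
    obtain y where y: "range y \<subseteq> carrier R" "h (ev y p) \<noteq> \<zero>\<^bsub>S\<^esub>" "h (y 1) \<noteq> \<zero>\<^bsub>S\<^esub>"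
      using inf_field_hom.linepoly_common[OF H lp inf_field_hom.linepoly_coord[OF H, of 1], OF F(6) nzu on h1]
      by (elim exE conjE)
    have "y 1 \<noteq> \<zero>" using y(3) rhc_zero[OF h] by metis
    then show ?thesis using y(1,2) False dim by (intro exI[of _ y] conjI exI[of _ 1]) simp_all
  next
    case True
    have i0: "i \<noteq> 0" using i True by metis
    have lpl: "linepoly R S h bl"
    proof (rule H.linepolyI)
      fix a b :: "nat \<Rightarrow> 'a" assume a: "range a \<subseteq> carrier R" and b: "range b \<subseteq> carrier R"
      have ab: "range (\<lambda>i. b i \<ominus> a i) \<subseteq> carrier R"
        by (rule image_subsetI) (use subsetD[OF a rangeI] subsetD[OF b rangeI] in simp)
      have U: "upfun S (\<lambda>t. bl a \<oplus>\<^bsub>S\<^esub> t \<otimes>\<^bsub>S\<^esub> bl (\<lambda>i. b i \<ominus> a i))"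
        by (rule H.S.upfun_add[OF H.S.upfun_const[OF blc[OF a]] H.S.upfun_mult[OF H.S.upfun_id H.S.upfun_const[OF blc[OF ab]]]])
      show "\<exists>cs. set cs \<subseteq> carrier S \<and> (\<forall>t\<in>carrier R. bl (\<lambda>i. a i \<oplus> t \<otimes> (b i \<ominus> a i)) = hor S cs (h t))"
      proof (rule H.upfun_list[OF U])
        fix t assume t: "t \<in> carrier R"
        have ht: "h t \<in> carrier S" by (rule rhc_closed[OF h t])
        have "y0 (\<lambda>i. a i \<oplus> t \<otimes> (b i \<ominus> a i)) = vadd S (y0 a) (vscale S (h t) (y0 (\<lambda>i. b i \<ominus> a i)))"
        proof (rule eq_vecI)
          fix j assume "j < dim_vec (vadd S (y0 a) (vscale S (h t) (y0 (\<lambda>i. b i \<ominus> a i))))"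
          then have j: "j < n" by (simp add: y0_def)
          have c: "a j \<in> carrier R" "b j \<ominus> a j \<in> carrier R" using a ab by blast+
          show "y0 (\<lambda>i. a i \<oplus> t \<otimes> (b i \<ominus> a i)) $ j = vadd S (y0 a) (vscale S (h t) (y0 (\<lambda>i. b i \<ominus> a i))) $ j"
            using j c t ht by (simp add: y0_def rhc_add[OF h] rhc_mult[OF h])
        qed (simp add: y0_def)
        then show "bl (\<lambda>i. a i \<oplus> t \<otimes> (b i \<ominus> a i)) = bl a \<oplus>\<^bsub>S\<^esub> h t \<otimes>\<^bsub>S\<^esub> bl (\<lambda>i. b i \<ominus> a i)"
          unfolding bl_def using linfun_add[OF lf y0[OF a] H.S.vscale_vecs[OF ht y0[OF ab]]] linfun_scale[OF lf ht y0[OF ab]] by simp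
      qed
    qed
    let ?u = "\<lambda>j::nat. if j = i then \<one> else \<zero>"
    have ur: "range ?u \<subseteq> carrier R" by (rule image_subsetI) simp
    have "y0 ?u = uvec S n i"
    proof (rule eq_vecI)
      fix j assume "j < dim_vec (uvec S n i)"
      then show "y0 ?u $ j = uvec S n i $ j" using i0 rhc_one[OF h] rhc_zero[OF h] by (simp add: y0_def)
    qed (simp add: y0_def)
    then have lu: "bl ?u \<noteq> \<zero>\<^bsub>S\<^esub>" unfolding bl_def using i(2) by simp
    obtain y where y: "range y \<subseteq> carrier R" "h (ev y p) \<noteq> \<zero>\<^bsub>S\<^esub>" "bl y \<noteq> \<zero>\<^bsub>S\<^esub>"
      using inf_field_hom.linepoly_common[OF H lp lpl, OF F(6) nzu ur lu] by (elim exE conjE)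
    have "\<exists>j. 1 \<le> j \<and> j < n \<and> y j \<noteq> \<zero>"
    proof (rule ccontr)
      assume "\<not> ?thesis"
      then have z: "y j = \<zero>" if "j \<noteq> 0" "j < n" for j using that by (metis One_nat_def Suc_leI neq0_conv)
      have "y0 y = zvec S n"
      proof (rule eq_vecI)
        fix j assume "j < dim_vec (zvec S n)"
        then show "y0 y $ j = zvec S n $ j" using z rhc_zero[OF h] by (simp add: y0_def)
      qed (simp add: y0_def)
      then show False using y(3) H.S.linfun_zero[OF lf] unfolding bl_def by simp
    qed
    then show ?thesis using y by blast
  qed
  then obtain y j where y: "range y \<subseteq> carrier R" "h (ev y p) \<noteq> \<zero>\<^bsub>S\<^esub>" "1 \<le> j" "j < n" "y j \<noteq> \<zero>"
    "?bz \<noteq> \<zero>\<^bsub>S\<^esub> \<or> bl y \<noteq> \<zero>\<^bsub>S\<^esub>" by (elim exE conjE)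
  have "ev y p \<noteq> \<zero>" using y(2) rhc_zero[OF h] by metis
  then have nz: "ev y a \<noteq> \<zero> \<or> ev y b \<noteq> \<zero>" using F(5) by auto
  let ?s = "h (ev y \<sigma>)" let ?b = "h (ev y \<beta>)"
  have sc: "?s \<in> carrier S" "?b \<in> carrier S" using rhc_closed[OF h evc[OF s(1) y(1)]] rhc_closed[OF h evc[OF s(2) y(1)]] by simp_all
  show ?thesis
  proof (cases "irred S ?s ?b")
    case False
    then obtain T where T: "T \<in> carrier S" "T \<otimes>\<^bsub>S\<^esub> T = ?s \<otimes>\<^bsub>S\<^esub> T \<oplus>\<^bsub>S\<^esub> ?b" unfolding irred_def by blast
    note pv = pt_value[OF red H T(1) y(1,3-5) T(2)]
    show ?thesis using pt_closed[OF h T(1) y(1)] pv(1) pv(2)[OF F(1-3) nz] unfolding F(4)[symmetric] by blast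
  next
    case True
    define E where "E = quad_ext S ?s ?b"
    have EH: "inf_field_hom S E (qemb S)" by (rule H.S.E_inf_field_hom[OF sc E_def True])
    interpret E: inf_field_hom S E "qemb S" by (rule EH)
    let ?g = "qemb S" let ?gh = "\<lambda>a. ?g (h a)" let ?T = "qc \<zero>\<^bsub>S\<^esub> \<one>\<^bsub>S\<^esub>"
    note g = E.ring_hom_cring_axioms
    note gh = ring_hom_cring_comp[OF h g]
    interpret gh: ring_hom_cring R E ?gh by (rule gh)
    have GH: "inf_field_hom R E ?gh" by (rule inf_field_homI[OF inf_field_axioms E.S.field_axioms gh.homh])
    note r = H.S.root_qc[OF sc E_def]
    note pv = pt_value[OF red GH r(1) y(1,3-5) r(2)]
    let ?z = "pt ?gh ?T y"
    have zr: "range ?z \<subseteq> carrier E" by (rule pt_closed[OF gh r(1) y(1)])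
    have mm: "map_mat ?gh A = map_mat ?g ?C" by (rule eq_matI) simp_all
    have q0: "qeval E (map_mat ?g ?C) (vec (qdim ?C) ?z) = \<zero>\<^bsub>E\<^esub>"
      using pv(1) gh.pev_form_poly[OF mats zr] unfolding mm qC by simp
    have fz: "pev R E ?gh ?z f \<noteq> \<zero>\<^bsub>E\<^esub>" unfolding F(4) by (rule pv(2)[OF F(1-3) nz])
    have zd: "vec n ?z = vadd E (vscale E ?T (map_vec ?g (uvec S n 0))) (map_vec ?g (y0 y))"
    proof (rule eq_vecI)
      fix i assume "i < dim_vec (vadd E (vscale E ?T (map_vec ?g (uvec S n 0))) (map_vec ?g (y0 y)))"
      then have i: "i < n" by simp
      have yi: "?gh (y i) \<in> carrier E" by (rule rhc_closed[OF gh subsetD[OF y(1) rangeI]])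
      have e: "vadd E (vscale E ?T (map_vec ?g (uvec S n 0))) (map_vec ?g (y0 y)) $ i =
        ?T \<otimes>\<^bsub>E\<^esub> ?g (if i = 0 then \<one>\<^bsub>S\<^esub> else \<zero>\<^bsub>S\<^esub>) \<oplus>\<^bsub>E\<^esub> ?g (if i = 0 then \<zero>\<^bsub>S\<^esub> else h (y i))"
        using i by (simp add: y0_def)
      show "vec n ?z $ i = vadd E (vscale E ?T (map_vec ?g (uvec S n 0))) (map_vec ?g (y0 y)) $ i"
        unfolding e using i r(1) yi rhc_one[OF g] rhc_zero[OF g] by (simp add: pt_def)
    qed (simp add: y0_def)
    have C': "map_mat ?g ?C \<in> mats E n n" by (rule E.map_mat_mats[OF CS])
    have u0: "map_vec ?g (uvec S n 0) \<in> vecs E n" by (rule E.map_vec_vecs[OF H.S.uvec_vecs])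
    have yv: "map_vec ?g (y0 y) \<in> vecs E n" by (rule E.map_vec_vecs[OF y0[OF y(1)]])
    have gv: "map_vec ?g v \<in> vecs E n" by (rule E.map_vec_vecs[OF v(1)])
    have bz: "bform E (map_mat ?g ?C) (vec n ?z) (map_vec ?g v) = ?g (bl y) \<oplus>\<^bsub>E\<^esub> ?T \<otimes>\<^bsub>E\<^esub> ?g ?bz"
    proof -
      have "bform E (map_mat ?g ?C) (vec n ?z) (map_vec ?g v) = ?T \<otimes>\<^bsub>E\<^esub> ?g ?bz \<oplus>\<^bsub>E\<^esub> ?g (bl y)"
        unfolding zd E.S.bform_add_left[OF C' E.S.vscale_vecs[OF r(1) u0] yv gv] E.S.bform_scale_left[OF C' r(1) u0 gv]
          E.hom_bform[OF CS H.S.uvec_vecs v(1), symmetric] E.hom_bform[OF CS y0[OF y(1)] v(1), symmetric] bl_def ..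
      then show ?thesis using r(1) rhc_closed[OF g b0] rhc_closed[OF g blc[OF y(1)]] by (simp add: E.S.a_comm)
    qed
    note ee = H.S.E_mult[OF sc E_def] H.S.E_add[OF sc E_def] H.S.qemb_simps[OF sc E_def]
    \<comment> \<open>The elements 1 and T are independent over \<open>S\<close>, so it is enough
      that one of the two components is nonzero.\<close>
    have "qre (?g (bl y) \<oplus>\<^bsub>E\<^esub> ?T \<otimes>\<^bsub>E\<^esub> ?g ?bz) = bl y" "qim (?g (bl y) \<oplus>\<^bsub>E\<^esub> ?T \<otimes>\<^bsub>E\<^esub> ?g ?bz) = ?bz"
      using sc b0 blc[OF y(1)] by (simp_all add: ee)
    then have bnz: "bform E (map_mat ?g ?C) (vec (qdim ?C) ?z) (map_vec ?g v) \<noteq> \<zero>\<^bsub>E\<^esub>"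
      unfolding qC bz using y(6) H.S.E_zero[OF sc E_def] by metis
    have v': "v \<in> vecs S (qdim ?C)" using v(1) by simp
    have f': "f \<in> indexed_pset {..<qdim ?C} (carrier R)" using f(1) unfolding mpoly_simps qC .
    obtain x where x: "range x \<subseteq> carrier S" "qeval S ?C (vec (qdim ?C) x) = \<zero>\<^bsub>S\<^esub>" "pev R S h x f \<noteq> \<zero>\<^bsub>S\<^esub>"
      using H.curve_point[OF C v' v(3) sc E_def True zr q0 bnz f' fz] by (elim exE conjE)
    have "pev R S h x Q = \<zero>\<^bsub>S\<^esub>" using H.pev_form_poly[OF mats x(1)] x(2) unfolding qC by simp
    then show ?thesis using x by blast
  qed
qed

lemma first_witt_index_ti:
  "ti K (map_mat (function_field_embed R A) A) d \<longleftrightarrow> d \<le> first_witt_index R A"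
  "2 * first_witt_index R A \<le> n"
proof -
  interpret K: inf_field_hom R K "function_field_embed R A" by (rule K_hom)
  note w = K.S.witt_index_props[OF K_quad_form[OF K_hom], folded first_witt_index_def]
  show "ti K (map_mat (function_field_embed R A) A) d \<longleftrightarrow> d \<le> first_witt_index R A" by (rule w(1))
  show "2 * first_witt_index R A \<le> n" using w(2) by simp
qed

lemma specialize:
  assumes H: "inf_field_hom R S h" and iso: "\<not> anisotropic S (map_mat h A)"
  shows "ti S (map_mat h A) (first_witt_index R A)"
proof -
  interpret H: inf_field_hom R S h by fact
  interpret K: inf_field_hom R K "function_field_embed R A" by (rule K_hom)
  note h = H.ring_hom_cring_axioms
  have m: "map_mat phi (map_mat cst A) = map_mat (function_field_embed R A) A"
    unfolding embed_eq by (rule eq_matI) simp_all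
  obtain v where v: "v \<in> vecs S n" "v \<noteq> zvec S n" "qeval S (map_mat h A) v = \<zero>\<^bsub>S\<^esub>"
    using iso unfolding anisotropic_def by auto
  show ?thesis
  proof (rule ti_specialize[OF K.S.inf_field_axioms H.S.field_axioms phi_hom])
    show "map_mat cst A \<in> mats MP (qdim (map_mat cst A)) (qdim (map_mat cst A))" using CA(1) by simp
    show "sym_mat K (map_mat phi (map_mat cst A))" by (rule ring_hom_cring.hom_sym_mat[OF phi_hom CA(2)])
    show "ti K (map_mat phi (map_mat cst A)) (first_witt_index R A)" unfolding m first_witt_index_ti(1) by simp
    fix U assume U: "finite U" "U \<subseteq> carrier K"
    obtain c where c: "c \<in> carrier MP" "c \<notin> J" "\<forall>u\<in>U. \<exists>a\<in>carrier MP. u \<otimes>\<^bsub>K\<^esub> phi c = phi a"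
      using common_denominator[OF U] by blast
    obtain x where x: "range x \<subseteq> carrier S" "pev R S h x Q = \<zero>\<^bsub>S\<^esub>" "pev R S h x c \<noteq> \<zero>\<^bsub>S\<^esub>"
      using point[OF H c(1,2) v] by (elim exE conjE)
    let ?e = "pev R S h x"
    have e1: "ring_hom_cring MP S ?e" by (rule H.pev_ring_hom[OF x(1)])
    have e2: "\<forall>a\<in>carrier MP. phi a = \<zero>\<^bsub>K\<^esub> \<longrightarrow> ?e a = \<zero>\<^bsub>S\<^esub>"
      using J_eval[OF h x(1,2)] phi_zero by simp
    have e3: "map_mat ?e (map_mat cst A) = map_mat h A"
    proof (rule eq_matI)
      fix i j assume "i < dim_row (map_mat h A)" "j < dim_col (map_mat h A)"
      then have ij: "i < n" "j < dim_col A" by simp_all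
      then have "A $$ (i, j) \<in> carrier R" using mats_index[OF mats, of i j] mats_dim(2)[OF mats] by simp
      then show "map_mat ?e (map_mat cst A) $$ (i, j) = map_mat h A $$ (i, j)"
        using ij H.pev_const[OF _ x(1)] by simp
    qed simp_all
    show "\<exists>e c. ring_hom_cring MP S e \<and> (\<forall>a\<in>carrier MP. phi a = \<zero>\<^bsub>K\<^esub> \<longrightarrow> e a = \<zero>\<^bsub>S\<^esub>) \<and> c \<in> carrier MP \<and>
      e c \<noteq> \<zero>\<^bsub>S\<^esub> \<and> (\<forall>u\<in>U. \<exists>a\<in>carrier MP. u \<otimes>\<^bsub>K\<^esub> phi c = phi a) \<and> map_mat e (map_mat cst A) = map_mat h A"
      using e1 e2 c(1) x(3) c(3) e3 by blast
  qed
qed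

end

section \<open>Diagonal Pfister forms\<close>

context inf_field
begin

text \<open>The images of the unit vectors form the basis. An isometry in the sense of
  \<open>wiso\<close> is only known to preserve values, so orthogonality is recovered by comparing
  values on sums and cancelling 2.\<close>

lemma wiso_orthl:
  assumes A: "sym_mat R A" and r: "set r \<subseteq> carrier R - {\<zero>}" and W: "wiso R (diag_form R r) A"
  shows "\<exists>ss. orthl R A ss \<and> length ss = qdim A \<and> map (qeval R A) ss = r"
proof -
  let ?n = "length r" let ?D = "diag_form R r"
  have rc: "set r \<subseteq> carrier R" using r by blast
  have D: "?D \<in> mats R ?n ?n" by (rule diag_mats[OF rc])
  have SD: "sym_mat R ?D" by (rule diag_sym[OF rc])
  have n: "qdim A = ?n" using wiso_dim[OF W] by simp
  obtain f where f: "linemb R ?n ?n f" "\<forall>v\<in>vecs R ?n. qeval R A (f v) = qeval R ?D v"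
    using W unfolding wiso_def diag_dim by blast
  note lm = linemb_linmap[OF f(1)]
  let ?e = "uvec R ?n"
  have fe: "f (?e i) \<in> vecs R (qdim A)" for i unfolding n by (rule linmap_closed[OF lm uvec_vecs])
  have b: "bform R ?D (?e i) (?e j) = (if i = j then r ! j else \<zero>)" if "i < ?n" "j < ?n" for i j
    using bform_diag_uvec[OF rc uvec_vecs that(2), of i] that nth_mem[OF that(2)] rc by (auto simp del: nth_mem)
  have q: "qeval R A (f (?e i)) = r ! i" if "i < ?n" for i
    using f(2) uvec_vecs b[OF that that] unfolding qeval_def by simp
  have o: "bform R A (f (?e i)) (f (?e j)) = \<zero>" if i: "i < ?n" and j: "j < ?n" and ij: "i \<noteq> j" for i j
  proof -
    have MA: "A \<in> mats R (qdim A) (qdim A)" by (rule sym_mat_mats[OF A])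
    have c: "bform R A (f (?e i)) (f (?e j)) \<in> carrier R" by (rule bform_closed[OF MA fe fe])
    note ri = subsetD[OF rc nth_mem[OF i]] subsetD[OF rc nth_mem[OF j]]
    have "qeval R A (vadd R (f (?e i)) (f (?e j))) = qeval R ?D (vadd R (?e i) (?e j))"
      unfolding linmap_add[OF lm uvec_vecs uvec_vecs, symmetric] using f(2) vadd_vecs[OF uvec_vecs uvec_vecs] by blast
    also have "\<dots> = r ! i \<oplus> r ! j"
      unfolding qeval_add[OF SD, unfolded diag_dim, OF uvec_vecs uvec_vecs] using b[OF i j] b[OF i i] b[OF j j] ij ri by (simp add: qeval_def)
    finally have "r ! i \<oplus> r ! j \<oplus> (bform R A (f (?e i)) (f (?e j)) \<oplus> bform R A (f (?e i)) (f (?e j))) = r ! i \<oplus> r ! j"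
      unfolding qeval_add[OF A fe fe] q[OF i] q[OF j] .
    then have "bform R A (f (?e i)) (f (?e j)) \<oplus> bform R A (f (?e i)) (f (?e j)) = \<zero>"
      using c ri add.r_cancel_one[of "bform R A (f (?e i)) (f (?e j)) \<oplus> bform R A (f (?e i)) (f (?e j))" "r ! i \<oplus> r ! j"] by (simp add: a_ac)
    then show ?thesis by (rule double_zero[OF c])
  qed
  let ?ss = "map (\<lambda>i. f (?e i)) [0..<?n]"
  have m: "map (qeval R A) ?ss = r" by (rule nth_equalityI) (simp_all add: q)
  have "orthl R A ?ss"
    unfolding orthl_def
  proof (intro conjI ballI)
    show "sorted_wrt (\<lambda>u v. bform R A u v = \<zero>) ?ss" unfolding sorted_wrt_iff_nth_less using o by simp
    fix v assume "v \<in> set ?ss"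
    then obtain i where i: "i < ?n" "v = f (?e i)" by auto
    show "v \<in> vecs R (qdim A)" unfolding i(2) by (rule fe)
    show "qeval R A v \<noteq> \<zero>" unfolding i(2) q[OF i(1)] using r nth_mem[OF i(1)] by blast
  qed
  then show ?thesis using m n by (intro exI[of _ ?ss]) simp
qed

lemma tensor_diag:
  assumes as: "set as \<subseteq> carrier R" and bs: "set bs \<subseteq> carrier R"
  shows "tensor_form R (diag_form R as) (diag_form R bs) = diag_form R (tens R as bs)"
proof (rule eq_matI)
  let ?m = "length as" let ?n = "length bs"
  have nth: "tens R xs bs ! i = xs ! (i div ?n) \<otimes> bs ! (i mod ?n)" if "i < length xs * ?n" for xs i
    using that
  proof (induction xs arbitrary: i)
    case (Cons x xs)
    show ?case
    proof (cases "i < ?n")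
      case True
      then show ?thesis by (simp add: nth_append)
    next
      case False
      have n0: "?n \<noteq> 0" using Cons.prems by auto
      have "i div ?n = Suc ((i - ?n) div ?n)" "i mod ?n = (i - ?n) mod ?n"
        using False n0 by (simp_all add: le_div_geq le_mod_geq)
      then show ?thesis using False Cons.IH[of "i - ?n"] Cons.prems by (simp add: nth_append)
    qed
  qed simp
  fix i j assume "i < dim_row (diag_form R (tens R as bs))" "j < dim_col (diag_form R (tens R as bs))"
  then have ij: "i < ?m * ?n" "j < ?m * ?n" by (simp_all add: diag_form_def)
  note d = index_div_mod[OF ij(1)] index_div_mod[OF ij(2)]
  have c: "as ! (i div ?n) \<in> carrier R" "bs ! (i mod ?n) \<in> carrier R" using d as bs nth_mem by blast+
  have e: "i = j \<longleftrightarrow> i div ?n = j div ?n \<and> i mod ?n = j mod ?n" by (metis div_mult_mod_eq)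
  show "tensor_form R (diag_form R as) (diag_form R bs) $$ (i, j) = diag_form R (tens R as bs) $$ (i, j)"
    using ij d c nth[OF ij(1)] e by (auto simp: tensor_form_def diag_form_def)
qed (simp_all add: tensor_form_def diag_form_def)

lemma foldr_pfister:
  "set as \<subseteq> carrier R \<Longrightarrow>
   foldr (\<lambda>a B. tensor_form R (diag_form R [\<one>, a]) B) as (diag_form R [\<one>]) = diag_form R (pf R as [\<one>])"
proof (induction as)
  case (Cons a as)
  have p: "set as \<subseteq> carrier R" "a \<in> carrier R" "set [\<one>] \<subseteq> carrier R" using Cons.prems by simp_all
  note c = pf_carrier[OF p(1,3)] p(2)
  have "map (\<lambda>b. \<one> \<otimes> b) (pf R as [\<one>]) = pf R as [\<one>]" by (rule map_idI) (use c in auto)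
  then have t: "tens R [\<one>, a] (pf R as [\<one>]) = pf R (a # as) [\<one>]" by simp
  have 1: "set [\<one>, a] \<subseteq> carrier R" using c by simp
  show ?case using Cons tensor_diag[OF 1 c(1)] unfolding t by simp
qed simp

lemma wiso_scale:
  assumes a: "a \<in> carrier R" and r: "set r \<subseteq> carrier R" and A: "A \<in> mats R (qdim A) (qdim A)" and W: "wiso R A (diag_form R r)"
  shows "wiso R (scale_form R a A) (diag_form R (map (\<lambda>x. a \<otimes> x) r))"
proof -
  have n: "qdim A = length r" using wiso_dim[OF W] by simp
  obtain f where f: "linemb R (length r) (length r) f" "\<forall>v\<in>vecs R (length r). qeval R (diag_form R r) (f v) = qeval R A v"
    using W unfolding wiso_def n by blast
  have s: "qeval R (scale_form R a A) v = a \<otimes> qeval R A v" if v: "v \<in> vecs R (qdim A)" for v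
  proof -
    have S: "scale_form R a A \<in> mats R (qdim A) (qdim A)"
      unfolding scale_form_def by (rule mat_map_mats[OF A]) (use a in simp)
    note vi = vecs_index[OF v] and Ai = mats_index[OF A]
    have A1: "v $ k \<otimes> scale_form R a A $$ (j, k) = a \<otimes> (v $ k \<otimes> A $$ (j, k))" if "j < qdim A" "k < qdim A" for j k
      using that mats_dim(2)[OF A] a vi[OF that(2)] Ai[OF that] by (simp add: scale_form_def m_ac)
    have in1: "(\<Oplus>k\<in>{..<qdim A}. v $ k \<otimes> A $$ (j, k)) \<in> carrier R" if "j < qdim A" for j
      by (rule finsum_closed) (use vi Ai that in auto)
    have A2: "(\<Oplus>k\<in>{..<qdim A}. v $ k \<otimes> scale_form R a A $$ (j, k)) = a \<otimes> (\<Oplus>k\<in>{..<qdim A}. v $ k \<otimes> A $$ (j, k))" if j: "j < qdim A" for j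
    proof -
      have "(\<Oplus>k\<in>{..<qdim A}. v $ k \<otimes> scale_form R a A $$ (j, k)) = (\<Oplus>k\<in>{..<qdim A}. a \<otimes> (v $ k \<otimes> A $$ (j, k)))"
        by (rule finsum_cong') (use A1[OF j] a vi Ai[OF j] in auto)
      also have "\<dots> = a \<otimes> (\<Oplus>k\<in>{..<qdim A}. v $ k \<otimes> A $$ (j, k))"
        by (rule finsum_rdistr[symmetric]) (use a vi Ai[OF j] in auto)
      finally show ?thesis .
    qed
    have "qeval R (scale_form R a A) v = (\<Oplus>j\<in>{..<qdim A}. a \<otimes> (v $ j \<otimes> (\<Oplus>k\<in>{..<qdim A}. v $ k \<otimes> A $$ (j, k))))"
      unfolding qeval_def bform_sum[OF S v v] by (rule finsum_cong') (use A2 a vi in1 in \<open>auto simp: m_ac\<close>)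
    also have "\<dots> = a \<otimes> (\<Oplus>j\<in>{..<qdim A}. v $ j \<otimes> (\<Oplus>k\<in>{..<qdim A}. v $ k \<otimes> A $$ (j, k)))"
      by (rule finsum_rdistr[symmetric]) (use a vi in1 in auto)
    finally show ?thesis unfolding qeval_def bform_sum[OF A v v] .
  qed
  have q: "qeval R (diag_form R (map (\<lambda>x. a \<otimes> x) r)) (f v) = qeval R (scale_form R a A) v" if v: "v \<in> vecs R (length r)" for v
    unfolding qeval_diag_scale[OF r a linmap_closed[OF linemb_linmap[OF f(1)] v]] s[unfolded n, OF v] using f(2) v by simp
  have "qdim (scale_form R a A) = length r" using n by (simp add: scale_form_def)
  then show ?thesis unfolding wiso_def using f(1) q by auto
qed

lemma tens_map_scale:
  assumes "set l \<subseteq> carrier R" "set ds \<subseteq> carrier R" "a \<in> carrier R" "b \<in> carrier R"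
  shows "tens R (map (\<lambda>x. a \<otimes> x) (map (\<lambda>x. b \<otimes> x) l)) ds = map (\<lambda>x. b \<otimes> x) (tens R (map (\<lambda>x. a \<otimes> x) l) ds)"
  using assms(1)
proof (induction l)
  case (Cons x l)
  have "map (\<lambda>d. a \<otimes> (b \<otimes> x) \<otimes> d) ds = map (\<lambda>d. b \<otimes> (a \<otimes> x \<otimes> d)) ds"
    by (rule map_cong[OF refl]) (use assms Cons.prems in \<open>auto simp: m_ac\<close>)
  then show ?case using Cons by (simp add: comp_def)
qed simp

text \<open>A form similar to a Pfister form carries a scalar \<open>a\<close>. Moving it onto the
  other factor leaves an honest Pfister multiple, to which \<open>pfister_ti\<close>
  applies.\<close>

lemma tens_pf:
  assumes ds: "set ds \<subseteq> carrier R" and a: "a \<in> carrier R"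
  shows "set bs \<subseteq> carrier R \<Longrightarrow> tens R (map (\<lambda>x. a \<otimes> x) (pf R bs [\<one>])) ds = pf R bs (map (\<lambda>x. a \<otimes> x) ds)"
proof (induction bs)
  case Nil
  then show ?case using a by simp
next
  case (Cons b bs)
  have p: "set bs \<subseteq> carrier R" "b \<in> carrier R" "set [\<one>] \<subseteq> carrier R" using Cons.prems by simp_all
  note c = pf_carrier[OF p(1,3)] p(2)
  have "tens R (map (\<lambda>x. a \<otimes> x) (pf R (b # bs) [\<one>])) ds =
    tens R (map (\<lambda>x. a \<otimes> x) (pf R bs [\<one>])) ds @ tens R (map (\<lambda>x. a \<otimes> x) (map (\<lambda>x. b \<otimes> x) (pf R bs [\<one>]))) ds"
    by (simp only: pf.simps map_append tens_append)
  also have "\<dots> = pf R (b # bs) (map (\<lambda>x. a \<otimes> x) ds)"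
    unfolding tens_map_scale[OF c(1) ds a c(2)] using Cons by simp
  finally show ?case .
qed

lemma pf_nonzero:
  assumes "set ds \<subseteq> carrier R - {\<zero>}"
  shows "set bs \<subseteq> carrier R - {\<zero>} \<Longrightarrow> set (pf R bs ds) \<subseteq> carrier R - {\<zero>}"
proof (induction bs)
  case (Cons b bs)
  have b: "b \<in> carrier R" "b \<noteq> \<zero>" and p: "set (pf R bs ds) \<subseteq> carrier R - {\<zero>}" using Cons by auto
  have "b \<otimes> x \<in> carrier R - {\<zero>}" if "x \<in> set (pf R bs ds)" for x
    using p that mult_nonzero[OF b(1) _ b(2), of x] b(1) by auto
  then show ?case using p by auto
qed (use assms in simp)

lemma ordering_mult_iff:
  assumes P: "field_ordering R P" and p: "p \<in> carrier R - {\<zero>}" and a: "a \<in> carrier R - {\<zero>}"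
  shows "p \<otimes> a \<in> P \<longleftrightarrow> (p \<in> P \<longleftrightarrow> a \<in> P)"
proof -
  have cp: "cone_pair R P {x \<in> carrier R. \<ominus> x \<in> P}" by (rule field_ordering_facts(1)[OF P])
  have m: "x \<otimes> y \<in> P" if "x \<in> P" "y \<in> P" for x y using P that unfolding field_ordering_def by blast
  have neg: "\<ominus> x \<in> P \<longleftrightarrow> x \<notin> P" if "x \<in> carrier R - {\<zero>}" for x
    using cp that unfolding cone_pair_def by blast
  have pa: "p \<otimes> a \<in> carrier R - {\<zero>}" using p a mult_nonzero by auto
  have c: "p \<in> carrier R" "a \<in> carrier R" using p a by auto
  show ?thesis
    using m[of p a] m[of "\<ominus> p" a] m[of p "\<ominus> a"] m[of "\<ominus> p" "\<ominus> a"] neg[OF p] neg[OF a] neg[OF pa] c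
    by (auto simp: l_minus r_minus)
qed

text \<open>Used when all entries of \<open>r\<close> have one sign: multiplication by them keeps
  the sign of every entry of \<open>ds\<close> or reverses all of them.\<close>

lemma filter_tens:
  assumes "\<And>p a. p \<in> set r \<Longrightarrow> a \<in> set ds \<Longrightarrow> G (p \<otimes> a) \<longleftrightarrow> H a"
  shows "length (filter G (tens R r ds)) = length r * length (filter H ds)"
  using assms
proof (induction r)
  case (Cons p r)
  have "length (filter G (map (\<lambda>a. p \<otimes> a) ds)) = length (filter (\<lambda>a. G (p \<otimes> a)) ds)" by (simp add: filter_map comp_def)
  also have "filter (\<lambda>a. G (p \<otimes> a)) ds = filter H ds" by (rule filter_cong[OF refl]) (use Cons.prems in simp)
  finally show ?case using Cons by simp
qed simp

lemma diag_scale_isotropic: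
  assumes l: "set l \<subseteq> carrier R" and b: "b \<in> carrier R" "b \<noteq> \<zero>"
  shows "\<not> anisotropic R (diag_form R (map (\<lambda>a. b \<otimes> a) l)) \<Longrightarrow> \<not> anisotropic R (diag_form R l)"
    and "ti R (diag_form R l) d \<Longrightarrow> ti R (diag_form R (map (\<lambda>a. b \<otimes> a) l)) d"
proof -
  have c: "qeval R (diag_form R l) v \<in> carrier R" if "v \<in> vecs R (length l)" for v
    by (rule qeval_closed[OF diag_mats[OF l] that])
  assume "\<not> anisotropic R (diag_form R (map (\<lambda>a. b \<otimes> a) l))"
  then obtain v where v: "v \<in> vecs R (length l)" "v \<noteq> zvec R (length l)" "b \<otimes> qeval R (diag_form R l) v = \<zero>"
    unfolding anisotropic_def using qeval_diag_scale[OF l b(1)] by auto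
  then have "qeval R (diag_form R l) v = \<zero>" using integral[OF v(3) b(1) c[OF v(1)]] b(2) by blast
  then show "\<not> anisotropic R (diag_form R l)" using v unfolding anisotropic_def by auto
next
  assume "ti R (diag_form R l) d"
  then obtain f where f: "linemb R d (length l) f" "\<forall>v\<in>vecs R d. qeval R (diag_form R l) (f v) = \<zero>" unfolding ti_def by auto
  have "qeval R (diag_form R (map (\<lambda>a. b \<otimes> a) l)) (f v) = \<zero>" if "v \<in> vecs R d" for v
    unfolding qeval_diag_scale[OF l b(1) linmap_closed[OF linemb_linmap[OF f(1)] that]] using f(2) that b(1) by simp
  then show "ti R (diag_form R (map (\<lambda>a. b \<otimes> a) l)) d" unfolding ti_def using f(1) by auto
qed

end

section \<open>The inequality for indefinite forms\<close>

context aform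
begin

lemma specialize_diag:
  assumes vs: "orthl R A vs" "length vs = n" and H: "inf_field_hom R S h"
    and iso: "\<not> anisotropic S (diag_form S (map h (map (qeval R A) vs)))"
  shows "ti S (diag_form S (map h (map (qeval R A) vs))) (first_witt_index R A)"
proof -
  interpret H: inf_field_hom R S h by fact
  note W = H.hom_wiso(1)[OF sym vs]
  have "\<not> anisotropic S (map_mat h A)" using H.S.wiso_anisotropic[OF W] iso by blast
  then show ?thesis by (rule ti_wiso[OF specialize[OF H] H.S.wiso_sym[OF W]])
qed

text \<open>The base case of \<open>pfister_ti\<close> after the similarity factor of
  \<open>\<pi>\<close> has been moved onto \<open>q\<close>.\<close>

lemma specialize_scaled:
  assumes vs: "orthl R A vs" "length vs = n" and c: "c \<in> carrier R" "c \<noteq> \<zero>" and H: "inf_field_hom R S h"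
    and iso: "\<not> anisotropic S (diag_form S (map h (map (\<lambda>a. c \<otimes> a) (map (qeval R A) vs))))"
  shows "ti S (diag_form S (map h (map (\<lambda>a. c \<otimes> a) (map (qeval R A) vs)))) (first_witt_index R A)"
proof -
  interpret H: inf_field_hom R S h by fact
  let ?ds = "map (qeval R A) vs"
  have ds: "set ?ds \<subseteq> carrier R" using orthl_diag_carrier[OF sym vs(1)] by blast
  have e: "map h (map (\<lambda>a. c \<otimes> a) ?ds) = map (\<lambda>a. h c \<otimes>\<^bsub>S\<^esub> a) (map h ?ds)"
    unfolding map_map comp_def by (rule map_cong[OF refl]) (use ds c in auto)
  have hd: "set (map h ?ds) \<subseteq> carrier S" unfolding set_map using ds by (intro image_subsetI H.hom_closed) auto
  have hc: "h c \<in> carrier S" "h c \<noteq> \<zero>\<^bsub>S\<^esub>" using c H.hom_zero_iff[OF c(1)] by simp_all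
  have "\<not> anisotropic S (diag_form S (map h ?ds))"
    by (rule H.S.diag_scale_isotropic(1)[OF hd hc iso[unfolded e]])
  from specialize_diag[OF vs H this] show ?thesis unfolding e by (rule H.S.diag_scale_isotropic(2)[OF hd hc])
qed

text \<open>Used for \<open>q\<close> and again for the tensor product with \<open>\<pi>\<close>.
  Indefiniteness enters as one entry of each sign, at the indices \<open>i\<close> and
  \<open>j\<close>.\<close>

lemma first_witt_index_le:
  assumes P: "field_ordering R P" and vs: "orthl R A vs" "length vs = n"
  defines "ds \<equiv> map (qeval R A) vs"
  assumes i: "i < n" "ds ! i \<in> P" and j: "j < n" "ds ! j \<notin> P"
  shows "first_witt_index R A \<le> length (filter (\<lambda>a. a \<in> P) ds)" "first_witt_index R A \<le> length (filter (\<lambda>a. a \<notin> P) ds)"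
proof -
  let ?N = "{x \<in> carrier R. \<ominus> x \<in> P}"
  have cp: "cone_pair R P ?N" by (rule field_ordering_facts(1)[OF P])
  then have cone: "cone R P" "cone R ?N" and un: "P \<union> ?N = carrier R - {\<zero>}" and dj: "P \<inter> ?N = {}"
    unfolding cone_pair_def by (simp_all only: HOL.simp_thms)
  have ds0: "set ds \<subseteq> carrier R - {\<zero>}" unfolding ds_def by (rule orthl_diag_carrier[OF sym vs(1)])
  then have ds: "set ds \<subseteq> carrier R" by blast
  have ln: "length ds = n" unfolding ds_def using vs(2) by simp
  have dij: "ds ! i \<in> set ds" "ds ! j \<in> set ds" using i j ln by simp_all
  have c1: "ds ! i \<in> carrier R" "ds ! j \<in> carrier R" using dij ds by blast+
  define c where "c = ds ! i \<otimes> (\<ominus> (ds ! j))"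
  have "\<ominus> (ds ! j) \<in> P" using j(2) dij ds0 un by blast
  then have cP: "c \<in> P" unfolding c_def using i(2) P unfolding field_ordering_def by blast
  have c: "c \<in> carrier R" unfolding c_def using c1 by simp
  have c0: "c \<noteq> \<zero>" using cP P unfolding field_ordering_def by blast
  let ?l = "ds @ map (\<lambda>a. c \<otimes> a) ds"
  have iso: "\<not> anisotropic R (diag_form R ?l)"
  proof -
    \<comment> \<open>With c = -d_i d_j, the vector with entry d_j at d_i in the first copy and 1 at
      d_j in the second has the value d_j^2 d_i + c d_j = 0.\<close>
    let ?u = "vscale R (ds ! j) (uvec R n i)" and ?w = "uvec R n j"
    define v where "v = vec (n + n) (\<lambda>k. if k < n then ?u $ k else ?w $ (k - n))"
    have u: "?u \<in> vecs R n" by (rule vscale_vecs[OF c1(2) uvec_vecs])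
    have v: "v \<in> vecs R (length ds + length ds)" unfolding v_def ln
      by (rule vecs_vecI) (use vecs_index[OF u] vecs_index[OF uvec_vecs] in simp)
    have h1: "vec n (($) v) = ?u" by (rule eq_vecI) (simp_all add: v_def)
    have h2: "vdrop n n v = ?w" by (rule eq_vecI) (simp_all add: v_def vdrop_def)
    have qe: "qeval R (diag_form R ds) (uvec R n k) = ds ! k" if k: "k < n" for k
    proof -
      have "ds ! k \<in> carrier R" by (rule subsetD[OF ds nth_mem]) (use k ln in simp)
      then show ?thesis
        unfolding qeval_def using bform_diag_uvec[OF ds, unfolded ln, OF uvec_vecs k, of k] k by simp
    qed
    have "qeval R (diag_form R ?l) v = ds ! j \<otimes> ds ! j \<otimes> ds ! i \<oplus> c \<otimes> ds ! j"
      unfolding qeval_diag_double[OF ds c v] unfolding ln h1 h2 qe[OF j(1)]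
        qeval_scale[OF diag_mats[OF ds, unfolded ln] c1(2) uvec_vecs] qe[OF i(1)] ..
    also have "\<dots> = \<zero>" unfolding c_def using c1 by algebra
    finally have q: "qeval R (diag_form R ?l) v = \<zero>" .
    have "v $ (n + j) \<noteq> zvec R (n + n) $ (n + j)" using j(1) by (simp add: v_def)
    then have "v \<noteq> zvec R (n + n)" by metis
    then show ?thesis using q v ln unfolding anisotropic_def by auto
  qed
  have base: "ti S (diag_form S (map h ds)) (first_witt_index R A)"
    if "inf_field_hom R S h" "\<not> anisotropic S (diag_form S (map h ds))" for S :: "('a, 'b) ring_scheme" and h
    using specialize_diag[OF vs that(1)] that(2) unfolding ds_def by blast
  have i2: "2 * first_witt_index R A \<le> length ds" unfolding ln by (rule first_witt_index_ti(2))
  have pl: "pf R [c] (map (\<lambda>x. x) ds) = ?l" by simp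
  have "set [c] \<subseteq> carrier R" using c by simp
  from pfister_ti[OF inf_field_axioms ds i2 base inf_field_id this, unfolded pl] iso
  have t: "ti R (diag_form R ?l) (2 * first_witt_index R A)" by simp
  have l0: "set ?l \<subseteq> carrier R - {\<zero>}"
  proof
    fix x assume "x \<in> set ?l"
    then consider "x \<in> set ds" | y where "y \<in> set ds" "x = c \<otimes> y" by auto
    then show "x \<in> carrier R - {\<zero>}"
    proof cases
      case 1
      then show ?thesis using ds0 by blast
    next
      case 2
      have "y \<in> carrier R" "y \<noteq> \<zero>" using 2(1) ds0 by blast+
      then show ?thesis unfolding 2(2) using mult_nonzero[OF c _ c0] c by simp
    qed
  qed
  \<comment> \<open>Since \<open>c\<close> is positive, the second copy has the same signs as the
    first, so both counts double, as the isotropic dimension does.\<close>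
  have sgn: "c \<otimes> a \<in> P \<longleftrightarrow> a \<in> P" if a: "a \<in> set ds" for a
  proof -
    have "a \<in> carrier R - {\<zero>}" "c \<in> carrier R - {\<zero>}" using a ds0 c c0 by auto
    from ordering_mult_iff[OF P this(2,1)] show ?thesis using cP by simp
  qed
  have f1: "length (filter (\<lambda>a. a \<notin> P) ?l) = 2 * length (filter (\<lambda>a. a \<notin> P) ds)"
    using sgn by (simp add: filter_map comp_def cong: filter_cong)
  have f2: "length (filter (\<lambda>a. a \<notin> ?N) ?l) = 2 * length (filter (\<lambda>a. a \<in> P) ds)"
  proof -
    have "filter (\<lambda>a. a \<notin> ?N) ?l = filter (\<lambda>a. a \<in> P) ?l"
      by (rule filter_cong[OF refl]) (use l0 un dj in blast)
    then show ?thesis using sgn by (simp add: filter_map comp_def cong: filter_cong)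
  qed
  show "first_witt_index R A \<le> length (filter (\<lambda>a. a \<notin> P) ds)" using ti_inertia[OF cone(1) l0 t] unfolding f1 by simp
  show "first_witt_index R A \<le> length (filter (\<lambda>a. a \<in> P) ds)" using ti_inertia[OF cone(2) l0 t] unfolding f2 by simp
qed

end

section \<open>Upper and lower bounds for the tensor product\<close>

lemma filter_index_ex: "0 < length (filter G xs) \<Longrightarrow> \<exists>i<length xs. G (xs ! i)"
  by (metis length_greater_0_conv filter_False in_set_conv_nth)

text \<open>The pure tensor of \<open>s\<close> with an isotropic vector \<open>v\<close> is
  isotropic, and it vanishes only if \<open>v\<close> does, because \<open>s\<close> has a nonzero
  coordinate.\<close>

lemma (in inf_field) tensor_anisotropic:
  assumes A: "sym_mat R A" and B: "sym_mat R B" and an: "anisotropic R (tensor_form R A B)"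
    and s: "s \<in> vecs R (qdim A)" "qeval R A s \<noteq> \<zero>"
  shows "anisotropic R B"
  unfolding anisotropic_def
proof (intro ballI impI)
  fix v assume v: "v \<in> vecs R (qdim B)" and q: "qeval R B v = \<zero>"
  note MA = sym_mat_mats[OF A] and MB = sym_mat_mats[OF B]
  have tv: "tv R s v \<in> vecs R (qdim A * qdim B)" by (rule tv_vecs[OF s(1) v])
  have "qeval R (tensor_form R A B) (tv R s v) = qeval R A s \<otimes> qeval R B v"
    unfolding qeval_def by (rule bform_tensor[OF MA MB s(1) s(1) v v])
  also have "\<dots> = \<zero>" unfolding q using qeval_closed[OF MA s(1)] by simp
  finally have z: "tv R s v = zvec R (qdim A * qdim B)" using an tv unfolding anisotropic_def tensor_dim by blast
  have "s \<noteq> zvec R (qdim A)" using s(2) qeval_zvec[OF MA] by metis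
  then obtain i where i: "i < qdim A" "s $ i \<noteq> \<zero>" using vec_nonzero_index[OF s(1)] by blast
  show "v = zvec R (qdim B)"
  proof (rule vecs_eqI[OF v zvec_vecs])
    fix j assume j: "j < qdim B"
    have k: "i * qdim B + j < qdim A * qdim B"
    proof -
      have "i * qdim B + j < Suc i * qdim B" using j by simp
      also have "\<dots> \<le> qdim A * qdim B" using i(1) by (intro mult_le_mono1) simp
      finally show ?thesis .
    qed
    have "tv R s v $ (i * qdim B + j) = s $ i \<otimes> v $ j"
      using k j unfolding tv_def vecs_dim[OF s(1)] vecs_dim[OF v] by simp
    then have "s $ i \<otimes> v $ j = \<zero>" using k unfolding z by simp
    then have "v $ j = \<zero>" using integral vecs_index[OF s(1) i(1)] vecs_index[OF v j] i(2) by blast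
    then show "v $ j = zvec R (qdim B) $ j" using j by simp
  qed
qed

theorem proposition2p10:
  fixes F :: "('a, 'b) ring_scheme"
    and q \<pi> :: "'a mat"
    and P :: "'a set"
  assumes "real_field F"
    and "quad_form F q" and "qdim q \<ge> 2"
    and "quad_form F \<pi>" and "\<exists>n \<rho>. pfister_form F n \<rho> \<and> similar_form F \<pi> \<rho>"
    and "anisotropic F (tensor_form F \<pi> q)"
    and "field_ordering F P"
    and "definite_at F P \<pi>"
    and "indefinite_at F P q"
  shows "\<bar>signature F P q\<bar> \<le> int (qdim q) - 2 * int (first_witt_index F q) \<and>
    (\<bar>signature F P q\<bar> = int (qdim q) - 2 * int (first_witt_index F q) \<longrightarrow>
      first_witt_index F (tensor_form F \<pi> q) = qdim \<pi> * first_witt_index F q)"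
proof -
  let ?T = "tensor_form F \<pi> q"
  note P = assms(7)
  have "field F" using assms(1) unfolding real_field_def by blast
  then interpret F: inf_field F using field.real_inf_field[OF _ P] by blast
  have Sq: "sym_mat F q" and Sp: "sym_mat F \<pi>" using quad_form_sym assms(2,4) by blast+
  have ST: "sym_mat F ?T" by (rule F.tensor_sym[OF Sp Sq])
  obtain \<rho> a as where a: "a \<in> carrier F" "a \<noteq> \<zero>\<^bsub>F\<^esub>" "isometric F \<pi> (scale_form F a \<rho>)"
    and as0: "set as \<subseteq> carrier F - {\<zero>\<^bsub>F\<^esub>}" and \<rho>: "quad_form F \<rho>"
      "isometric F \<rho> (foldr (\<lambda>a B. tensor_form F (diag_form F [\<one>\<^bsub>F\<^esub>, a]) B) as (diag_form F [\<one>\<^bsub>F\<^esub>]))"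
    using assms(5) unfolding pfister_form_def similar_form_def by blast
  have as: "set as \<subseteq> carrier F" using as0 by blast
  define l where "l = pf F as [\<one>\<^bsub>F\<^esub>]"
  define r where "r = map (\<lambda>x. a \<otimes>\<^bsub>F\<^esub> x) l"
  have l0: "set l \<subseteq> carrier F - {\<zero>\<^bsub>F\<^esub>}" unfolding l_def by (rule F.pf_nonzero[OF _ as0]) simp
  then have lc: "set l \<subseteq> carrier F" by blast
  have r0: "set r \<subseteq> carrier F - {\<zero>\<^bsub>F\<^esub>}"
  proof
    fix y assume "y \<in> set r"
    then obtain x where x: "x \<in> set l" "y = a \<otimes>\<^bsub>F\<^esub> x" unfolding r_def by auto
    have "x \<in> carrier F" "x \<noteq> \<zero>\<^bsub>F\<^esub>" using x(1) l0 by blast+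
    then show "y \<in> carrier F - {\<zero>\<^bsub>F\<^esub>}" unfolding x(2) using F.mult_nonzero[OF a(1) _ a(2)] a(1) by simp
  qed
  have W\<rho>: "wiso F \<rho> (diag_form F l)"
    using F.isometric_wiso[OF \<rho>(2)] unfolding F.foldr_pfister[OF as] l_def .
  have W\<pi>: "wiso F \<pi> (diag_form F r)" unfolding r_def
    by (rule wiso_trans[OF F.isometric_wiso[OF a(3)] F.wiso_scale[OF a(1) lc sym_mat_mats[OF quad_form_sym[OF \<rho>(1)]] W\<rho>]])
  obtain ss where ss: "orthl F \<pi> ss" "length ss = qdim \<pi>" "map (qeval F \<pi>) ss = r"
    using F.wiso_orthl[OF Sp r0 F.wiso_sym[OF W\<pi>]] by blast
  have lr: "length r = qdim \<pi>" "qdim \<pi> = 2 ^ length as" "0 < qdim \<pi>"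
  proof -
    show 1: "length r = qdim \<pi>" using ss(2,3) by auto
    show "qdim \<pi> = 2 ^ length as" unfolding 1[symmetric] r_def l_def by simp
    then show "0 < qdim \<pi>" by simp
  qed
  obtain s ss' where s: "ss = s # ss'" using ss(2) lr(3) by (cases ss) auto
  have sv: "s \<in> vecs F (qdim \<pi>)" "qeval F \<pi> s \<noteq> \<zero>\<^bsub>F\<^esub>" using ss(1) unfolding s orthl_def by simp_all
  have anq: "anisotropic F q" by (rule F.tensor_anisotropic[OF Sp Sq assms(6) sv])
  interpret Q: aform F q by unfold_locales (use Sq anq assms(3) in simp_all)
  have dT: "2 \<le> qdim ?T" unfolding tensor_dim using lr(3) assms(3) mult_le_mono[of 1 "qdim \<pi>" 2 "qdim q"] by simp
  interpret T: aform F ?T by unfold_locales (use ST assms(6) dT in simp_all)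
  obtain vs where vs: "orthl F q vs" "length vs = qdim q" using F.diagonalisation[OF assms(2)] by blast
  define ds where "ds = map (qeval F q) vs"
  have ds0: "set ds \<subseteq> carrier F - {\<zero>\<^bsub>F\<^esub>}" unfolding ds_def by (rule F.orthl_diag_carrier[OF Sq vs(1)])
  then have ds: "set ds \<subseteq> carrier F" by blast
  have ln: "length ds = qdim q" unfolding ds_def using vs(2) by simp
  \<comment> \<open>Pure tensors of orthogonal bases of \<open>\<pi>\<close> and \<open>q\<close>.
    This choice makes the diagonal of the tensor product equal to \<open>tens F r ds\<close>, in
    which signs can be counted.\<close>
  define os where "os = concat (map (\<lambda>s. map (tv F s) vs) ss)"
  have os: "orthl F ?T os" "map (qeval F ?T) os = tens F r ds"
    using F.orthl_tensor[OF Sp Sq ss(1) vs(1)] unfolding ss(3) os_def ds_def by blast+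
  have lo: "length os = qdim ?T"
    using arg_cong[OF os(2), of length] unfolding length_map length_tens lr(1) ln tensor_dim .
  define np where "np = length (filter (\<lambda>a. a \<in> P) ds)"
  define nn where "nn = length (filter (\<lambda>a. a \<notin> P) ds)"
  define i where "i = first_witt_index F q"
  have n: "qdim q = np + nn" unfolding np_def nn_def ln[symmetric] by (simp add: sum_length_filter_compl)
  have sq: "signature F P q = int np - int nn"
    unfolding np_def nn_def
    by (rule F.signature_diag[OF P ds0 F.wiso_sym[OF F.orthl_wiso[OF Sq vs, folded ds_def]]])
  have "0 < np" "0 < nn" using assms(9) unfolding indefinite_at_def sq n by (auto simp: abs_if split: if_splits)
  then obtain j j' where j: "j < length ds" "ds ! j \<in> P" "j' < length ds" "ds ! j' \<notin> P"
    using filter_index_ex[of "\<lambda>a. a \<in> P" ds] filter_index_ex[of "\<lambda>a. a \<notin> P" ds] unfolding np_def nn_def by blast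
  have i: "i \<le> np" "i \<le> nn"
    using Q.first_witt_index_le[OF P vs, folded ds_def, of j j'] j unfolding ln i_def np_def nn_def by blast+
  have part1: "\<bar>signature F P q\<bar> \<le> int (qdim q) - 2 * int i" unfolding sq n using i by (simp add: abs_if)
  have sp: "signature F P \<pi> = int (length (filter (\<lambda>a. a \<in> P) r)) - int (length (filter (\<lambda>a. a \<notin> P) r))"
    by (rule F.signature_diag[OF P r0 W\<pi>])
  have lrs: "length (filter (\<lambda>a. a \<in> P) r) + length (filter (\<lambda>a. a \<notin> P) r) = qdim \<pi>"
    unfolding lr(1)[symmetric] by (rule sum_length_filter_compl)
  have "length (filter (\<lambda>a. a \<notin> P) r) = 0 \<or> length (filter (\<lambda>a. a \<in> P) r) = 0"
    using assms(8)[unfolded definite_at_def sp] lrs by linarith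
  then have dfn: "(\<forall>p\<in>set r. p \<in> P) \<or> (\<forall>p\<in>set r. p \<notin> P)" by (auto simp: filter_empty_conv)
  have mult: "p \<otimes>\<^bsub>F\<^esub> x \<in> P \<longleftrightarrow> (p \<in> P \<longleftrightarrow> x \<in> P)" if "p \<in> set r" "x \<in> set ds" for p x
    by (rule F.ordering_mult_iff[OF P]) (use that r0 ds0 in blast)+
  let ?m = "qdim \<pi>" and ?t = "tens F r ds"
  let ?tp = "length (filter (\<lambda>a. a \<in> P) ?t)" and ?tn = "length (filter (\<lambda>a. a \<notin> P) ?t)"
  \<comment> \<open>By definiteness all entries of \<open>\<pi>\<close> have the same sign. The two
    sign counts of \<open>q\<close> are therefore multiplied by the dimension of
    \<open>\<pi>\<close>, and interchanged if that sign is negative.\<close>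
  have cnt: "?tp = ?m * np \<and> ?tn = ?m * nn \<or> ?tp = ?m * nn \<and> ?tn = ?m * np"
    using dfn
  proof
    assume p: "\<forall>p\<in>set r. p \<in> P"
    have "?tp = length r * np" "?tn = length r * nn"
      unfolding np_def nn_def by (rule F.filter_tens; use mult p in blast)+
    then show ?thesis unfolding lr(1) by blast
  next
    assume p: "\<forall>p\<in>set r. p \<notin> P"
    have "?tp = length r * nn" "?tn = length r * np"
      unfolding np_def nn_def by (rule F.filter_tens; use mult p in blast)+
    then show ?thesis unfolding lr(1) by blast
  qed
  then have "0 < ?tp" "0 < ?tn" using \<open>0 < np\<close> \<open>0 < nn\<close> lr(3) by auto
  then obtain k k' where k: "k < length ?t" "?t ! k \<in> P" "k' < length ?t" "?t ! k' \<notin> P"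
    using filter_index_ex[of "\<lambda>a. a \<in> P" ?t] filter_index_ex[of "\<lambda>a. a \<notin> P" ?t] by blast
  have lt: "length ?t = qdim ?T" unfolding length_tens lr(1) ln tensor_dim ..
  have "first_witt_index F ?T \<le> ?tp" "first_witt_index F ?T \<le> ?tn"
    using T.first_witt_index_le[OF P os(1) lo, unfolded os(2), of k k'] k unfolding lt by blast+
  then have upper: "first_witt_index F ?T \<le> ?m * np" "first_witt_index F ?T \<le> ?m * nn" using cnt by auto
  \<comment> \<open>Over its own function field the tensor product is isotropic and is a Pfister
    multiple of the scaled form \<open>q\<close>; \<open>pfister_ti\<close> then provides a totally
    isotropic subspace of dimension \<open>qdim \<pi> * i\<close>.\<close>
  have lower: "?m * i \<le> first_witt_index F ?T"
  proof -
    let ?K = "function_field F ?T" and ?e = "function_field_embed F ?T"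
    interpret K: inf_field_hom F ?K ?e by (rule T.K_hom)
    define ds' where "ds' = map (\<lambda>x. a \<otimes>\<^bsub>F\<^esub> x) ds"
    have ds': "set ds' \<subseteq> carrier F" unfolding ds'_def using ds a(1) by auto
    have t: "?t = pf F as ds'" unfolding r_def l_def ds'_def by (rule F.tens_pf[OF ds a(1) as])
    have et: "map ?e ?t = pf ?K (map ?e as) (map ?e ds')" unfolding t by (rule K.map_pf[OF as ds'])
    have WK: "wiso ?K (diag_form ?K (pf ?K (map ?e as) (map ?e ds'))) (map_mat ?e ?T)"
      using K.hom_wiso(1)[OF ST os(1) lo] unfolding os(2) et .
    have iso: "\<not> anisotropic ?K (diag_form ?K (pf ?K (map ?e as) (map ?e ds')))"
      using T.K_isotropic K.S.wiso_anisotropic[OF K.S.wiso_sym[OF WK]] by blast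
    have i2: "2 * i \<le> length ds'" unfolding ds'_def length_map ln i_def by (rule Q.first_witt_index_ti(2))
    have eas: "set (map ?e as) \<subseteq> carrier ?K" unfolding set_map by (rule image_subsetI) (use as in auto)
    have "ti ?K (diag_form ?K (pf ?K (map ?e as) (map ?e ds'))) (2 ^ length (map ?e as) * i)"
    proof (rule pfister_ti[OF F.inf_field_axioms ds' i2 _ T.K_hom eas iso])
      fix L :: "(((nat multiset \<Rightarrow> 'a) set \<times> (nat multiset \<Rightarrow> 'a) set) set, unit) ring_scheme" and h
      assume H: "inf_field_hom F L h" and an: "\<not> anisotropic L (diag_form L (map h ds'))"
      show "ti L (diag_form L (map h ds')) i"
        using Q.specialize_scaled[OF vs a(1,2) H] an unfolding ds'_def ds_def i_def by blast
    qed
    from ti_wiso[OF this WK] have "2 ^ length (map ?e as) * i \<le> first_witt_index F ?T"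
      unfolding T.first_witt_index_ti(1) .
    then show ?thesis unfolding lr(2) by simp
  qed
  \<comment> \<open>Equality in the first claim says that \<open>i\<close> is the smaller of
    \<open>np\<close> and \<open>nn\<close>, so the matching upper bound coincides with the lower
    one.\<close>
  have part2: "first_witt_index F ?T = ?m * i" if eq: "\<bar>signature F P q\<bar> = int (qdim q) - 2 * int i"
  proof (cases "np \<le> nn")
    case True
    then have "i = np" using eq unfolding sq n by (simp add: abs_if split: if_splits)
    then show ?thesis using upper(1) lower by simp
  next
    case False
    then have "i = nn" using eq unfolding sq n by (simp add: abs_if split: if_splits)
    then show ?thesis using upper(2) lower by simp
  qed
  show ?thesis using part1 part2 unfolding i_def by blast
qed

end
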